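(* Let $\Sigma$ be the set of all $\lambda\in\mathbb{R}$ for which the problem $$ \begin{cases} -\mathrm{div}(a(x,\nabla u)) = \lambda \rho(x) |u|^{p-2}u & \text{in } \Omega,\\ u=0 & \text{on } \partial\Omega \end{cases} $$ has a nontrivial weak solution $u\in W^{1,p}_0(\Omega)$, and let $\lambda_1$ be the first eigenvalue. Then $\lambda_1$ is isolated: there exists $\delta>0$ such that $(\lambda_1,\lambda_1+\delta)\cap\Sigma=\emptyset$.
   Context: Standing assumptions. $1<p<\infty$; $\Omega\subset\mathbb{R}^N$, $N\ge 1$, is a bounded domain; $\rho$ is measurable with $0<\rho^-\le\rho(x)\le\rho^+<\infty$ for a.e. $x\in\Omega$, for constants $\rho^\pm$. A weak solution of the problem is $u\in W^{1,p}_0(\Omega)$ with $\int_\Omega a(x,\nabla u)\cdot\nabla v\,dx=\lambda\int_\Omega\rho|u|^{p-2}uv\,dx$ for all $v\in W^{1,p}_0(\Omega)$. The function $a:\Omega\times\mathbb{R}^N\to\mathbb{R}^N$ satisfies, with positive constants $\alpha,\beta,c$, for all $\xi,\xi_1,\xi_2,\dots\in\mathbb{R}^N$ and a.e. $x\in\Omega$: (H0) $a(x,\cdot)$ is continuous for a.e. $x$ and $a(\cdot,\xi)$ is measurable for every $\xi$; (H1) $0\le (a(x,\xi_1)-a(x,\xi_2))\cdot(\xi_1-\xi_2)$; (H2) $\alpha|\xi|^p\le a(x,\xi)\cdot\xi$; (H3) $|a(x,\xi)|\le\beta|\xi|^{p-1}$; (H4) $a(x,t\xi)=t^{p-1}a(x,\xi)$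 for every $t>0$; (H5) $a(x,-\xi)=-a(x,\xi)$; (H6) with $\Psi(x,\xi_1,\xi_2)=a(x,\xi_1)\cdot\xi_1+a(x,\xi_2)\cdot\xi_2$ and $\delta_p=\min\{p/2,p-1\}$, $|a(x,\xi_1)-a(x,\xi_2)|\le c\,\Psi(x,\xi_1,\xi_2)^{(p-1-\delta_p)/p}\big[(a(x,\xi_1)-a(x,\xi_2))\cdot(\xi_1-\xi_2)\big]^{\delta_p/p}$; (H7) $\sum_{i=1}^k a(x,\xi_i)\cdot(\xi_{i+1}-\xi_i)\le 0$ for all $k\ge1$ and $\xi_1,\dots,\xi_{k+1}$ with $\xi_{k+1}=\xi_1$; (H8) with $\gamma=\max(2,p)$, $\alpha|\xi_1-\xi_2|^{\gamma}\Psi(x,\xi_1,\xi_2)^{1-\gamma/p}\le(a(x,\xi_1)-a(x,\xi_2))\cdot(\xi_1-\xi_2)$ (for $(\xi_1,\xi_2)\neq(0,0)$). Potential and first eigenvalue. Under these hypotheses there is a unique Carathéodory function $\Phi:\Omega\times\mathbb{R}^N\to\mathbb{R}$ which in the variable $\xi$ is even, $p$-homogeneous, strictly convex and differentiable, with $\nabla_\xi\Phi(x,\xi)=p\,a(x,\xi)$, $\Phi(x,0)=0$ and $\alpha|\xi|^p\le\Phi(x,\xi)\le\beta|\xi|^p$. The first eigenvalue is $$\lambda_1=\inf_{v\in W^{1,p}_0(\Omega),\,v\ne0}\frac{\int_\Omega\Phi(x,\nabla v)\,dx}{\int_\Omega\rho|v|^p\,dx},$$ which is the smallest element of $\Sigma$.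 *)

theory Defs
  imports "HOL-Analysis.Analysis"
begin

section \<open>Test functions\<close>

definition grad :: "('a::euclidean_space \<Rightarrow> real) \<Rightarrow> 'a \<Rightarrow> 'a" where
  "grad f x = (THE D. GDERIV f x :> D)"

primrec C_k :: "nat \<Rightarrow> ('a::euclidean_space \<Rightarrow> real) \<Rightarrow> bool" where
  "C_k 0 f \<longleftrightarrow> continuous_on UNIV f"
| "C_k (Suc k) f \<longleftrightarrow> f differentiable_on UNIV \<and> (\<forall>b\<in>Basis. C_k k (\<lambda>x. grad f x \<bullet> b))"

text \<open>The space \<open>C\<^sub>c\<^sup>\<infinity>(\<Omega>)\<close>; its elements are functions on the whole space, extended by zero.\<close>

definition test_functions :: "'a::euclidean_space set \<Rightarrow> ('a \<Rightarrow> real) set" where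
  "test_functions \<Omega> =
     {\<phi>. (\<forall>k. C_k k \<phi>) \<and> compact (closure {x. \<phi> x \<noteq> 0}) \<and> closure {x. \<phi> x \<noteq> 0} \<subseteq> \<Omega>}"


section \<open>Sobolev spaces\<close>

text \<open>Elements of \<open>L\<^sup>p\<close> and of the Sobolev spaces are represented by functions, not by
  equivalence classes modulo almost everywhere equality.\<close>

definition Lp :: "'a::euclidean_space set \<Rightarrow> real \<Rightarrow> ('a \<Rightarrow> 'b::euclidean_space) set" where
  "Lp \<Omega> p = {f. f \<in> borel_measurable (lebesgue_on \<Omega>) \<and>
                 integrable (lebesgue_on \<Omega>) (\<lambda>x. norm (f x) powr p)}"

definition locally_integrable ::
    "'a::euclidean_space set \<Rightarrow> ('a \<Rightarrow> 'b::euclidean_space) \<Rightarrow> bool" where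
  "locally_integrable \<Omega> f \<longleftrightarrow> (\<forall>K. compact K \<and> K \<subseteq> \<Omega> \<longrightarrow> f absolutely_integrable_on K)"

definition has_weak_grad ::
    "'a::euclidean_space set \<Rightarrow> ('a \<Rightarrow> real) \<Rightarrow> ('a \<Rightarrow> 'a) \<Rightarrow> bool" where
  "has_weak_grad \<Omega> u G \<longleftrightarrow>
     locally_integrable \<Omega> u \<and> locally_integrable \<Omega> G \<and>
     (\<forall>\<phi>\<in>test_functions \<Omega>.
        (\<integral>x. u x *\<^sub>R grad \<phi> x \<partial>lebesgue_on \<Omega>) = - (\<integral>x. \<phi> x *\<^sub>R G x \<partial>lebesgue_on \<Omega>))"

text \<open>The weak gradient is unique almost everywhere, so the choice of representative is
  immaterial below.\<close>

definition wgrad :: "'a::euclidean_space set \<Rightarrow> ('a \<Rightarrow> real) \<Rightarrow> 'a \<Rightarrow> 'a" where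
  "wgrad \<Omega> u = (SOME G. has_weak_grad \<Omega> u G)"

definition W1p :: "'a::euclidean_space set \<Rightarrow> real \<Rightarrow> ('a \<Rightarrow> real) set" where
  "W1p \<Omega> p = {u \<in> Lp \<Omega> p. \<exists>G. has_weak_grad \<Omega> u G \<and> G \<in> Lp \<Omega> p}"

definition W1p_norm :: "'a::euclidean_space set \<Rightarrow> real \<Rightarrow> ('a \<Rightarrow> real) \<Rightarrow> real" where
  "W1p_norm \<Omega> p u =
     ((\<integral>x. \<bar>u x\<bar> powr p \<partial>lebesgue_on \<Omega>) +
      (\<integral>x. norm (wgrad \<Omega> u x) powr p \<partial>lebesgue_on \<Omega>)) powr (1 / p)"

text \<open>\<open>W\<^sub>0\<^sup>1\<^sup>,\<^sup>p(\<Omega>)\<close> is the closure of the test functions in \<open>W\<^sup>1\<^sup>,\<^sup>p(\<Omega>)\<close>.\<close>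

definition W1p0 :: "'a::euclidean_space set \<Rightarrow> real \<Rightarrow> ('a \<Rightarrow> real) set" where
  "W1p0 \<Omega> p =
     {u \<in> W1p \<Omega> p. \<forall>\<epsilon>>0. \<exists>\<phi>\<in>test_functions \<Omega>. W1p_norm \<Omega> p (\<lambda>x. u x - \<phi> x) < \<epsilon>}"

definition nontrivial_on :: "'a::euclidean_space set \<Rightarrow> ('a \<Rightarrow> real) \<Rightarrow> bool" where
  "nontrivial_on \<Omega> u \<longleftrightarrow> \<not> (AE x in lebesgue_on \<Omega>. u x = 0)"


section \<open>The eigenvalue problem\<close>

text \<open>At points where \<open>u\<close> vanishes, \<open>\<bar>u\<bar> powr (p - 2) * u\<close> is \<open>0\<close>, which is the value of
  \<open>\<bar>u\<bar>\<^sup>p\<^sup>-\<^sup>2 u\<close> for every \<open>p > 1\<close>.\<close>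

definition weak_solution ::
    "'a::euclidean_space set \<Rightarrow> real \<Rightarrow> ('a \<Rightarrow> 'a \<Rightarrow> 'a) \<Rightarrow> ('a \<Rightarrow> real) \<Rightarrow> real \<Rightarrow> ('a \<Rightarrow> real) \<Rightarrow> bool"
  where
  "weak_solution \<Omega> p a \<rho> \<mu> u \<longleftrightarrow>
     u \<in> W1p0 \<Omega> p \<and>
     (\<forall>v\<in>W1p0 \<Omega> p.
        (\<integral>x. a x (wgrad \<Omega> u x) \<bullet> wgrad \<Omega> v x \<partial>lebesgue_on \<Omega>) =
        \<mu> * (\<integral>x. \<rho> x * (\<bar>u x\<bar> powr (p - 2) * u x) * v x \<partial>lebesgue_on \<Omega>))"

definition Spectrum ::
    "'a::euclidean_space set \<Rightarrow> real \<Rightarrow> ('a \<Rightarrow> 'a \<Rightarrow> 'a) \<Rightarrow> ('a \<Rightarrow> real) \<Rightarrow> real set" where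
  "Spectrum \<Omega> p a \<rho> = {\<mu>. \<exists>u. nontrivial_on \<Omega> u \<and> weak_solution \<Omega> p a \<rho> \<mu> u}"

definition Psi :: "('a::euclidean_space \<Rightarrow> 'a \<Rightarrow> 'a) \<Rightarrow> 'a \<Rightarrow> 'a \<Rightarrow> 'a \<Rightarrow> real" where
  "Psi a x \<xi>\<^sub>1 \<xi>\<^sub>2 = a x \<xi>\<^sub>1 \<bullet> \<xi>\<^sub>1 + a x \<xi>\<^sub>2 \<bullet> \<xi>\<^sub>2"


section \<open>Potential and first eigenvalue\<close>

definition strictly_convex :: "('a::real_vector \<Rightarrow> real) \<Rightarrow> bool" where
  "strictly_convex f \<longleftrightarrow>
     (\<forall>\<xi> \<eta> t. \<xi> \<noteq> \<eta> \<and> 0 < t \<and> t < 1 \<longrightarrow>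
        f ((1 - t) *\<^sub>R \<xi> + t *\<^sub>R \<eta>) < (1 - t) * f \<xi> + t * f \<eta>)"

definition is_potential ::
    "'a::euclidean_space set \<Rightarrow> real \<Rightarrow> real \<Rightarrow> real \<Rightarrow> ('a \<Rightarrow> 'a \<Rightarrow> 'a) \<Rightarrow> ('a \<Rightarrow> 'a \<Rightarrow> real) \<Rightarrow> bool"
  where
  "is_potential \<Omega> p \<alpha> \<beta> a \<Phi> \<longleftrightarrow>
     (\<forall>\<xi>. (\<lambda>x. \<Phi> x \<xi>) \<in> borel_measurable (lebesgue_on \<Omega>)) \<and>
     (AE x in lebesgue_on \<Omega>.
        continuous_on UNIV (\<Phi> x) \<and>
        (\<forall>\<xi>. \<Phi> x (- \<xi>) = \<Phi> x \<xi>) \<and>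
        (\<forall>t>0. \<forall>\<xi>. \<Phi> x (t *\<^sub>R \<xi>) = t powr p * \<Phi> x \<xi>) \<and>
        strictly_convex (\<Phi> x) \<and>
        (\<forall>\<xi>. GDERIV (\<Phi> x) \<xi> :> p *\<^sub>R a x \<xi>) \<and>
        \<Phi> x 0 = 0 \<and>
        (\<forall>\<xi>. \<alpha> * norm \<xi> powr p \<le> \<Phi> x \<xi> \<and> \<Phi> x \<xi> \<le> \<beta> * norm \<xi> powr p))"

text \<open>Under the structure conditions on \<open>a\<close> a potential exists, and two potentials agree for
  almost every \<open>x\<close> (for all \<open>\<xi>\<close>), so the first eigenvalue does not depend on the choice.\<close>

definition potential ::
    "'a::euclidean_space set \<Rightarrow> real \<Rightarrow> real \<Rightarrow> real \<Rightarrow> ('a \<Rightarrow> 'a \<Rightarrow> 'a) \<Rightarrow> 'a \<Rightarrow> 'a \<Rightarrow> real" where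
  "potential \<Omega> p \<alpha> \<beta> a = (SOME \<Phi>. is_potential \<Omega> p \<alpha> \<beta> a \<Phi>)"

definition first_eigenvalue ::
    "'a::euclidean_space set \<Rightarrow> real \<Rightarrow> ('a \<Rightarrow> 'a \<Rightarrow> real) \<Rightarrow> ('a \<Rightarrow> real) \<Rightarrow> real" where
  "first_eigenvalue \<Omega> p \<Phi> \<rho> =
     Inf {(\<integral>x. \<Phi> x (wgrad \<Omega> v x) \<partial>lebesgue_on \<Omega>) / (\<integral>x. \<rho> x * \<bar>v x\<bar> powr p \<partial>lebesgue_on \<Omega>) | v.
            v \<in> W1p0 \<Omega> p \<and> nontrivial_on \<Omega> v}"

end

theory Submission
  imports Defs "HOL-Complex_Analysis.Great_Picard"
begin

text \<open>
  Suppose that \<open>\<lambda>\<^sub>1\<close> is a limit of eigenvalues \<open>\<lambda>\<^sub>n > \<lambda>\<^sub>1\<close> with eigenfunctions \<open>u\<^sub>n\<close>. Write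
  \<open>E\<close> for the energy \<open>\<integral> \<Phi>(x, \<nabla>u)\<close> and \<open>B\<close> for the weighted mass \<open>\<integral> \<rho> \<bar>u\<bar>\<^sup>p\<close>. The contradiction
  comes from the signs of the \<open>u\<^sub>n\<close>.

  A nonnegative eigenfunction \<open>v\<close> can only belong to an eigenvalue \<open>\<mu> \<le> \<lambda>\<^sub>1\<close>. The strong maximum
  principle gives \<open>v > 0\<close>, and Picone's inequality, which is the equation for \<open>v\<close> tested with
  \<open>\<bar>\<phi>\<bar>\<^sup>p v\<^sup>1\<^sup>-\<^sup>p\<close>, yields \<open>\<mu> B \<phi> \<le> E \<phi>\<close> for every test function \<open>\<phi>\<close>; by density \<open>\<mu>\<close> is a lower bound
  of all Rayleigh quotients (theorem \<open>nonneg_eigenfunction\<close>). Hence every \<open>u\<^sub>n\<close> changes sign.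
  Testing the equation with the positive and with the negative part of \<open>u\<^sub>n\<close> shows that both parts
  have Rayleigh quotient \<open>\<lambda>\<^sub>n\<close>. After normalisation they form two minimising sequences, and by the
  Rellich theorem they converge in \<open>L\<^sup>p\<close>, along a common subsequence, to limits \<open>V\<close> and \<open>W\<close> of mass
  one. If \<open>V > 0\<close> and \<open>W > 0\<close> almost everywhere, this is absurd, because the two parts of \<open>u\<^sub>n\<close> have
  product zero, so that \<open>V W = 0\<close>.

  The positivity of \<open>V\<close> and \<open>W\<close> does not need convergence of the gradients. The strong maximum
  principle is proved for limits of almost minimisers: nonnegative functions whose energy can be
  lowered by at most \<open>e\<^sub>n\<close>, where \<open>e\<^sub>n \<rightarrow> 0\<close>, when a nonnegative function is added (\<open>near_min\<close>).
  Both nonnegative eigenfunctions and normalised functions with Rayleigh quotient close to \<open>\<lambda>\<^sub>1\<close> are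
  of this kind. Convexity of \<open>\<Phi>\<close> turns almost minimality into a bound on the energy of
  \<open>log (v + \<tau>)\<close> (\<open>log_energy\<close>). The Poincare inequality bounds the oscillation of \<open>log (v + \<tau>)\<close> on
  a box, Fatou's lemma passes to the limit, and the result is uniform in \<open>\<tau>\<close>. As \<open>\<tau> \<rightarrow> 0\<close> the
  logarithm separates \<open>0\<close> from positive values by an unbounded gap, so on each box the limit either
  vanishes or is positive almost everywhere; connectedness makes this alternative global.

  The potential is \<open>\<Phi>(x, \<xi>) = a(x, \<xi>) \<bullet> \<xi>\<close>. Its gradient inequality follows from cyclic monotonicity
  along rays together with homogeneity (\<open>\<Phi>_gradient_ineq\<close>), and Euler's identity shows that there is
  no other potential. Functions in \<open>W\<^sub>0\<^sup>1\<^sup>,\<^sup>p\<close> are handled as almost everywhere limits of test functions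
  under an \<open>L\<^sup>p\<close> majorant, for the function and for its gradient (\<open>sob0\<close>); chain rules and continuity of
  the functionals then reduce to pointwise limits and dominated convergence.\<close>

section \<open>Smooth functions\<close>

lemma grad_eqI: "GDERIV f x :> D \<Longrightarrow> grad f x = D"
  unfolding grad_def
proof (rule the_equality)
  fix D' assume a: "GDERIV f x :> D" and b: "GDERIV f x :> D'"
  have "(\<lambda>h. inner h D) = (\<lambda>h. inner h D')"
    using a b has_derivative_unique unfolding gderiv_def by blast
  then show "D' = D"
    by (metis inner_commute vector_eq_rdot)
qed

lemma differentiable_imp_GDERIV:
  fixes f :: "'a::euclidean_space \<Rightarrow> real"
  assumes "f differentiable at x" shows "GDERIV f x :> grad f x"
proof -
  obtain f' where f': "(f has_derivative f') (at x)"
    using assms differentiable_def by blast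
  then interpret linear f' by (rule has_derivative_linear)
  have "f' = (\<lambda>h. inner h (\<Sum>b\<in>Basis. f' b *\<^sub>R b))"
  proof
    fix h :: 'a
    have "f' h = f' (\<Sum>b\<in>Basis. (h \<bullet> b) *\<^sub>R b)" by (simp add: euclidean_representation)
    also have "\<dots> = (\<Sum>b\<in>Basis. (h \<bullet> b) * f' b)" by (simp add: sum scaleR)
    finally show "f' h = inner h (\<Sum>b\<in>Basis. f' b *\<^sub>R b)"
      by (simp add: inner_sum_right mult.commute)
  qed
  then have "GDERIV f x :> (\<Sum>b\<in>Basis. f' b *\<^sub>R b)"
    using f' unfolding gderiv_def by simp
  then show ?thesis using grad_eqI by metis
qed

lemma GDERIV_imp_differentiable: "GDERIV f x :> D \<Longrightarrow> f differentiable at x"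
  unfolding gderiv_def differentiable_def by blast

lemma C_k_SucI:
  assumes "\<And>x. GDERIV f x :> g x" "\<And>b. b \<in> Basis \<Longrightarrow> C_k k (\<lambda>x. g x \<bullet> b)"
  shows "C_k (Suc k) f"
proof -
  have "grad f = g" using assms(1) grad_eqI by blast
  then show ?thesis using assms
    by (auto simp: differentiable_on_def intro: GDERIV_imp_differentiable differentiable_at_withinI)
qed

lemma C_k_Suc_GDERIV: "C_k (Suc k) f \<Longrightarrow> GDERIV f x :> grad f x"
  by (auto simp: differentiable_on_def intro: differentiable_imp_GDERIV)

lemma C_k_Suc_imp: "C_k (Suc k) f \<Longrightarrow> C_k k f"
proof (induction k arbitrary: f)
  case 0 then show ?case by (auto intro: differentiable_imp_continuous_on)
next
  case (Suc k) then show ?case by (meson C_k.simps(2))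
qed

lemma C_k_const: "C_k k (\<lambda>x. c)"
proof (induction k arbitrary: c)
  case (Suc k) show ?case
    by (rule C_k_SucI[where g = "\<lambda>_. 0"]) (use Suc in \<open>auto intro: GDERIV_const\<close>)
qed auto

lemma C_k_add: "C_k k f \<Longrightarrow> C_k k g \<Longrightarrow> C_k k (\<lambda>x. f x + g x)"
proof (induction k arbitrary: f g)
  case 0 then show ?case by (auto intro: continuous_on_add)
next
  case (Suc k)
  show ?case
    by (rule C_k_SucI[where g = "\<lambda>x. grad f x + grad g x"])
      (use Suc in \<open>auto intro!: GDERIV_add C_k_Suc_GDERIV Suc.IH simp: inner_add_left\<close>)
qed

lemma C_k_mult: "C_k k f \<Longrightarrow> C_k k g \<Longrightarrow> C_k k (\<lambda>x. f x * g x)"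
proof (induction k arbitrary: f g)
  case 0 then show ?case by (auto intro: continuous_on_mult)
next
  case (Suc k)
  have "C_k k f" "C_k k g" using Suc.prems C_k_Suc_imp by blast+
  then have "C_k k (\<lambda>x. f x * (grad g x \<bullet> b) + g x * (grad f x \<bullet> b))" if "b \<in> Basis" for b
    by (intro C_k_add Suc.IH) (use Suc.prems that in auto)
  then show ?case
    by (intro C_k_SucI[where g = "\<lambda>x. f x *\<^sub>R grad g x + g x *\<^sub>R grad f x"] GDERIV_mult)
       (use C_k_Suc_GDERIV[OF Suc.prems(1)] C_k_Suc_GDERIV[OF Suc.prems(2)] in \<open>auto simp: inner_add_left\<close>)
qed

lemma C_k_inner: "C_k k (\<lambda>x. x \<bullet> b)"
proof (cases k)
  case 0 then show ?thesis by (auto intro!: continuous_intros)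
next
  case (Suc l) 
  have "GDERIV (\<lambda>x. x \<bullet> b) x :> b" for x
    unfolding gderiv_def by (auto intro!: derivative_eq_intros)
  then show ?thesis unfolding Suc by (rule C_k_SucI) (rule C_k_const)
qed

text \<open>The chain rule replaces the outer function by its derivative. If the outer functions range over a
  family that is closed under differentiation, induction on the order therefore goes through with
  the outer function kept arbitrary in the family.\<close>

lemma C_k_compose:
  fixes S :: "(real \<Rightarrow> real) set"
  assumes S: "\<And>f. f \<in> S \<Longrightarrow> \<exists>f'\<in>S. \<forall>s. (f has_real_derivative f' s) (at s)"
    and f: "f \<in> S" and \<phi>: "C_k k \<phi>"
  shows "C_k k (\<lambda>x. f (\<phi> x))"
  using f \<phi>
proof (induction k arbitrary: f)
  case 0
  then obtain f' where "\<forall>s. (f has_real_derivative f' s) (at s)" using S by blast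
  then have "continuous_on UNIV f" by (meson DERIV_continuous_on has_field_derivative_at_within)
  then show ?case using 0 by (auto intro: continuous_on_compose2)
next
  case (Suc k)
  then obtain f' where f': "f' \<in> S" "\<And>s. (f has_real_derivative f' s) (at s)" using S by blast
  have "C_k k (\<lambda>x. f' (\<phi> x))" using Suc f' C_k_Suc_imp by blast
  then have "C_k k (\<lambda>x. f' (\<phi> x) * (grad \<phi> x \<bullet> b))" if "b \<in> Basis" for b
    by (rule C_k_mult) (use Suc.prems that in auto)
  then show ?case
    by (intro C_k_SucI[where g = "\<lambda>x. f' (\<phi> x) *\<^sub>R grad \<phi> x"])
       (use GDERIV_DERIV_compose[OF C_k_Suc_GDERIV[OF Suc.prems(2)] f'(2)] in auto)
qed

definition smooth :: "('a::euclidean_space \<Rightarrow> real) \<Rightarrow> bool" where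
  "smooth f \<longleftrightarrow> (\<forall>k. C_k k f)"

lemma smooth_GDERIV: "smooth f \<Longrightarrow> GDERIV f x :> grad f x"
  unfolding smooth_def using C_k_Suc_GDERIV by blast

lemma smooth_continuous: "smooth f \<Longrightarrow> continuous_on UNIV f"
  unfolding smooth_def using C_k.simps(1) by blast

lemma smooth_grad_component: "smooth f \<Longrightarrow> b \<in> Basis \<Longrightarrow> smooth (\<lambda>x. grad f x \<bullet> b)"
  unfolding smooth_def using C_k.simps(2) by blast

lemma smooth_continuous_grad: "smooth f \<Longrightarrow> continuous_on UNIV (grad f)"
  by (subst continuous_on_componentwise)
    (simp add: smooth_grad_component smooth_continuous)

lemma smooth_add: "smooth f \<Longrightarrow> smooth g \<Longrightarrow> smooth (\<lambda>x. f x + g x)"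
  and smooth_mult: "smooth f \<Longrightarrow> smooth g \<Longrightarrow> smooth (\<lambda>x. f x * g x)"
  and smooth_const: "smooth (\<lambda>x. c)"
  and smooth_inner: "smooth (\<lambda>x. x \<bullet> b)"
  unfolding smooth_def by (auto intro: C_k_add C_k_mult C_k_const C_k_inner)

lemma smooth_prod: "finite I \<Longrightarrow> (\<And>i. i \<in> I \<Longrightarrow> smooth (f i)) \<Longrightarrow> smooth (\<lambda>x. \<Prod>i\<in>I. f i x)"
  by (induction I rule: finite_induct) (auto intro: smooth_mult smooth_const)

subsection \<open>Powers of positive polynomials\<close>

lemma poly_powr_has_derivative:
  assumes q: "\<And>s. 0 < poly q (s::real)"
  shows "((\<lambda>s. poly P s * poly q s powr r) has_real_derivative
     poly (pderiv P * q + smult r (P * pderiv q)) s * poly q s powr (r - 1)) (at s)"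
proof -
  have e: "poly q s powr r = poly q s * poly q s powr (r - 1)"
    using q[of s] by (simp add: powr_diff)
  show ?thesis
    using DERIV_mult[OF poly_DERIV[of P s] DERIV_fun_powr[OF poly_DERIV[of q s] q, of r]]
    by (rule DERIV_cong) (simp add: algebra_simps e)
qed

text \<open>The family \<open>P q\<^sup>r\<close>, with \<open>q\<close> fixed and \<open>P\<close> and \<open>r\<close> arbitrary, is closed under differentiation.\<close>

lemma smooth_poly_powr:
  assumes q: "\<And>s. 0 < poly q (s::real)" and "smooth \<phi>"
  shows "smooth (\<lambda>x. poly P (\<phi> x) * poly q (\<phi> x) powr r)"
proof -
  let ?S = "{\<lambda>s. poly P s * poly q s powr r | P r. True}"
  have "C_k k (\<lambda>x. poly P (\<phi> x) * poly q (\<phi> x) powr r)" for k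
  proof (rule C_k_compose[where S = ?S and f = "\<lambda>s. poly P s * poly q s powr r"])
    fix f assume "f \<in> ?S"
    then obtain P r where f: "f = (\<lambda>s. poly P s * poly q s powr r)" by auto
    show "\<exists>f'\<in>?S. \<forall>s. (f has_real_derivative f' s) (at s)"
      unfolding f
      by (intro bexI[where x = "\<lambda>s. poly (pderiv P * q + smult r (P * pderiv q)) s * poly q s powr (r - 1)"])
         (use poly_powr_has_derivative[OF q] in blast)+
  qed (use assms in \<open>auto simp: smooth_def\<close>)
  then show ?thesis by (simp add: smooth_def)
qed

subsection \<open>Smooth bump functions\<close>

lemma poly_exp_tendsto_0: "((\<lambda>z::real. poly P z * exp (- z)) \<longlongrightarrow> 0) at_top"
proof -
  have *: "poly P z * exp (- z) = (\<Sum>i\<le>degree P. coeff P i * (z ^ i / exp z))" for z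
    by (simp add: poly_altdef sum_distrib_right exp_minus divide_inverse mult.assoc)
  have "((\<lambda>z::real. \<Sum>i\<le>degree P. coeff P i * (z ^ i / exp z)) \<longlongrightarrow> (\<Sum>i\<le>degree P. coeff P i * 0)) at_top"
    by (intro tendsto_intros tendsto_power_div_exp_0)
  then show ?thesis unfolding * by simp
qed

text \<open>The family \<open>P (1/s) e\<^sup>-\<^sup>1\<^sup>/\<^sup>s\<close>, continued by zero, is closed under differentiation. The polynomial
  factor is carried along for this reason; the bump functions use \<open>P = 1\<close>.\<close>

definition flat_exp :: "real poly \<Rightarrow> real \<Rightarrow> real" where
  "flat_exp P s = (if s > 0 then poly P (1 / s) * exp (- (1 / s)) else 0)"

lemma flat_exp_tendsto_0: "(flat_exp P \<longlongrightarrow> 0) (at_right 0)"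
proof -
  have "((\<lambda>s. poly P (1 / s) * exp (- (1 / s))) \<longlongrightarrow> 0) (at_right (0::real))"
    by (rule filterlim_compose[OF poly_exp_tendsto_0])
       (use filterlim_inverse_at_top_right in \<open>simp add: divide_inverse\<close>)
  then show ?thesis
    by (rule Lim_transform_eventually) (auto simp: flat_exp_def intro!: eventually_mono[OF eventually_at_right_less])
qed

lemma flat_exp_has_derivative:
  "(flat_exp P has_real_derivative flat_exp (monom 1 2 * (P - pderiv P)) s) (at s)"
proof -
  consider "s > 0" | "s < 0" | "s = 0" by linarith
  then show ?thesis
  proof cases
    case 1
    have "((\<lambda>s. poly P (1 / s) * exp (- (1 / s))) has_real_derivative
        (poly (pderiv P) (1 / s) * (- 1 / s\<^sup>2)) * exp (- (1 / s)) + (exp (- (1 / s)) * (1 / s\<^sup>2)) * poly P (1 / s)) (at s)"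
      using 1 by (intro DERIV_mult DERIV_chain2[OF poly_DERIV] DERIV_chain2[OF DERIV_exp])
        (auto intro!: derivative_eq_intros simp: power2_eq_square)
    also have "(poly (pderiv P) (1 / s) * (- 1 / s\<^sup>2)) * exp (- (1 / s)) + (exp (- (1 / s)) * (1 / s\<^sup>2)) * poly P (1 / s)
        = flat_exp (monom 1 2 * (P - pderiv P)) s"
      using 1 by (simp add: flat_exp_def poly_monom algebra_simps power_divide)
    finally show ?thesis
      by (rule has_field_derivative_transform_within_open[where S = "{0<..}"])
         (use 1 in \<open>auto simp: flat_exp_def\<close>)
  next
    case 2
    have "((\<lambda>s. 0) has_real_derivative flat_exp (monom 1 2 * (P - pderiv P)) s) (at s)"
      using 2 by (simp add: flat_exp_def)
    then show ?thesis
      by (rule has_field_derivative_transform_within_open[where S = "{..<0}"])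
         (use 2 in \<open>auto simp: flat_exp_def\<close>)
  next
    \<comment> \<open>division by \<open>s\<close> multiplies \<open>P\<close> by its variable, so the difference quotient at \<open>0\<close> belongs to
      the same family and tends to \<open>0\<close>\<close>
    case 3
    have r: "((\<lambda>h. flat_exp P h / h) \<longlongrightarrow> 0) (at_right 0)"
      by (rule Lim_transform_eventually[OF flat_exp_tendsto_0[of "pCons 0 P"]])
         (auto simp: flat_exp_def intro!: eventually_mono[OF eventually_at_right_less])
    have l: "((\<lambda>h. flat_exp P h / h) \<longlongrightarrow> 0) (at_left 0)"
      by (rule Lim_transform_eventually[OF tendsto_const])
         (auto simp: flat_exp_def eventually_at_filter)
    show ?thesis unfolding 3 DERIV_def
      using filterlim_at_split[THEN iffD2, OF conjI[OF l r]] by (simp add: flat_exp_def)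
  qed
qed

lemma smooth_flat_exp:
  assumes "smooth \<phi>" shows "smooth (\<lambda>x. flat_exp P (\<phi> x))"
proof -
  have "C_k k (\<lambda>x. flat_exp P (\<phi> x))" for k
  proof (rule C_k_compose[where S = "range flat_exp" and f = "flat_exp P"])
    fix f assume "f \<in> range flat_exp"
    then obtain P where f: "f = flat_exp P" by blast
    show "\<exists>f'\<in>range flat_exp. \<forall>s. (f has_real_derivative f' s) (at s)"
      unfolding f by (intro bexI[where x = "flat_exp (monom 1 2 * (P - pderiv P))"] allI flat_exp_has_derivative rangeI)
  qed (use assms in \<open>auto simp: smooth_def\<close>)
  then show ?thesis by (simp add: smooth_def)
qed

section \<open>Test functions and the fundamental lemma\<close>

lemma test_functions_iff:
  "\<phi> \<in> test_functions \<Omega> \<longleftrightarrow>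
    smooth \<phi> \<and> compact (closure {x. \<phi> x \<noteq> 0}) \<and> closure {x. \<phi> x \<noteq> 0} \<subseteq> \<Omega>"
  by (auto simp: test_functions_def smooth_def)

lemma test_functions_smooth: "\<phi> \<in> test_functions \<Omega> \<Longrightarrow> smooth \<phi>"
  by (simp add: test_functions_iff)

lemma test_functions_support:
  assumes "\<phi> \<in> test_functions \<Omega>" "smooth f" "\<And>x. \<phi> x = 0 \<Longrightarrow> f x = 0"
  shows "f \<in> test_functions \<Omega>"
proof -
  have "closure {x. f x \<noteq> 0} \<subseteq> closure {x. \<phi> x \<noteq> 0}"
    by (rule closure_mono) (use assms in auto)
  moreover from this have "compact (closure {x. f x \<noteq> 0})"
    using assms(1) by (metis test_functions_iff closed_Int_compact closed_closure inf.absorb1)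
  ultimately show ?thesis using assms by (auto simp: test_functions_iff)
qed

text \<open>As \<open>n\<close> grows, these functions tend to the indicator of the open box, if it is nonempty, and they stay
  below \<open>1\<close>.\<close>

definition bump :: "nat \<Rightarrow> 'a::euclidean_space \<Rightarrow> 'a \<Rightarrow> 'a \<Rightarrow> real" where
  "bump n a b x = (\<Prod>i\<in>Basis. flat_exp 1 (real (Suc n) * ((x \<bullet> i - a \<bullet> i) * (b \<bullet> i - x \<bullet> i))))"

lemma flat_exp_1: "flat_exp 1 s = (if s > 0 then exp (- (1 / s)) else 0)"
  by (simp add: flat_exp_def)

lemma smooth_bump: "smooth (bump n a b)"
proof -
  have *: "(\<lambda>x. real (Suc n) * ((x \<bullet> i - a \<bullet> i) * (b \<bullet> i - x \<bullet> i))) =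
    (\<lambda>x. real (Suc n) * ((x \<bullet> i + (- (a \<bullet> i))) * (b \<bullet> i + (-1) * (x \<bullet> i))))" for i :: 'a
    by (simp add: algebra_simps)
  show ?thesis unfolding bump_def[abs_def]
    by (intro smooth_prod smooth_flat_exp finite_Basis)
       (unfold *, intro smooth_mult smooth_add smooth_const smooth_inner)
qed

lemma bump_nonneg: "0 \<le> bump n a b x"
  and bump_le_1: "bump n a b x \<le> 1"
  unfolding bump_def by (auto intro!: prod_nonneg prod_le_1 simp: flat_exp_1)

text \<open>In a nonempty box the two factors cannot both be negative, so a positive product means that the
  coordinate lies strictly between the bounds.\<close>

lemma factors_pos_iff:
  assumes "box a b \<noteq> {}" "i \<in> Basis"
  shows "0 < (x \<bullet> i - a \<bullet> i) * (b \<bullet> i - x \<bullet> i) \<longleftrightarrow> a \<bullet> i < x \<bullet> i \<and> x \<bullet> i < b \<bullet> i"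
  using assms by (auto simp: box_ne_empty zero_less_mult_iff)

lemma bump_pos_iff: "box a b \<noteq> {} \<Longrightarrow> 0 < bump n a b x \<longleftrightarrow> x \<in> box a b"
proof -
  assume ne: "box a b \<noteq> {}"
  have "0 < bump n a b x \<longleftrightarrow> bump n a b x \<noteq> 0" using bump_nonneg[of n a b x] by linarith
  also have "\<dots> \<longleftrightarrow> (\<forall>i\<in>Basis. 0 < (x \<bullet> i - a \<bullet> i) * (b \<bullet> i - x \<bullet> i))"
    by (simp add: bump_def flat_exp_1 zero_less_mult_iff)
  also have "\<dots> \<longleftrightarrow> x \<in> box a b" using factors_pos_iff[OF ne] by (auto simp: mem_box)
  finally show ?thesis .
qed

lemma bump_tendsto:
  assumes ne: "box a b \<noteq> {}"
  shows "(\<lambda>n. bump n a b x) \<longlonglongrightarrow> indicator (box a b) x"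
proof (cases "x \<in> box a b")
  case True
  have "(\<lambda>n. flat_exp 1 (real (Suc n) * ((x \<bullet> i - a \<bullet> i) * (b \<bullet> i - x \<bullet> i)))) \<longlonglongrightarrow> 1"
    if i: "i \<in> Basis" for i
  proof -
    let ?c = "(x \<bullet> i - a \<bullet> i) * (b \<bullet> i - x \<bullet> i)"
    have c: "0 < ?c" using factors_pos_iff[OF ne i] True i by (auto simp: mem_box)
    have "(\<lambda>n. exp (- (1 / ?c * inverse (real (Suc n))))) \<longlonglongrightarrow> exp (- (1 / ?c * 0))"
      by (intro tendsto_intros LIMSEQ_inverse_real_of_nat)
    moreover have "(\<lambda>n. exp (- (1 / ?c * inverse (real (Suc n))))) = (\<lambda>n. flat_exp 1 (real (Suc n) * ?c))"
      using c by (auto simp: flat_exp_1 fun_eq_iff divide_inverse mult_ac)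
    ultimately show ?thesis by simp
  qed
  then have "(\<lambda>n. bump n a b x) \<longlonglongrightarrow> (\<Prod>i\<in>(Basis::'a set). 1)"
    unfolding bump_def by (intro tendsto_prod)
  then show ?thesis using True by simp
next
  case False
  then have "bump n a b x = 0" for n
    using bump_pos_iff[OF ne, of n x] bump_nonneg[of n a b x] by linarith
  then show ?thesis using False by simp
qed

lemma bump_test_function:
  assumes "box a b \<noteq> {}" "cbox a b \<subseteq> \<Omega>"
  shows "bump n a b \<in> test_functions \<Omega>"
proof -
  have "{x. bump n a b x \<noteq> 0} = box a b"
    using bump_pos_iff[OF assms(1), of n] bump_nonneg[of n a b]
    by (auto simp: less_le)
  then show ?thesis
    using assms by (simp add: test_functions_iff smooth_bump)
qed

text \<open>Open boxes generate the Borel sets and are stable under intersection. By Dynkin's argument the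
  integral of \<open>f\<close> vanishes over every Borel, hence over every Lebesgue measurable, subset of the box.\<close>

lemma AE_zero_of_box_integrals:
  fixes f :: "'a::euclidean_space \<Rightarrow> 'b::euclidean_space"
  assumes f: "set_integrable lebesgue (box c d) f"
    and z: "\<And>a b. box a b \<subseteq> box c d \<Longrightarrow> (LINT x:box a b|lebesgue. f x) = 0"
  shows "AE x in lebesgue. x \<in> box c d \<longrightarrow> f x = 0"
proof -
  let ?C = "box c d"
  have sub: "set_integrable lebesgue (A \<inter> ?C) f" if "A \<in> sets lebesgue" for A
    by (rule set_integrable_subset[OF f]) (use that in auto)
  have P: "(LINT x:A \<inter> ?C|lebesgue. f x) = 0" if A: "A \<in> sets borel" for A
  proof -
    have "Int_stable (range (\<lambda>(a::'a, b). box a b))"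
      by (auto simp: Int_stable_def box_Int_box)
    moreover have "range (\<lambda>(a::'a, b). box a b) \<subseteq> Pow UNIV" by simp
    moreover have "A \<in> sigma_sets UNIV (range (\<lambda>(a::'a, b). box a b))"
      using A unfolding borel_eq_box by simp
    ultimately show ?thesis
    proof (induction rule: sigma_sets_induct_disjoint)
      case (basic A)
      then obtain a b where "A = box a b" by auto
      then show ?case
        using z[of "\<Sum>i\<in>Basis. max (a \<bullet> i) (c \<bullet> i) *\<^sub>R i" "\<Sum>i\<in>Basis. min (b \<bullet> i) (d \<bullet> i) *\<^sub>R i"]
        by (simp add: box_Int_box[symmetric])
    next
      case empty then show ?case by (simp add: set_lebesgue_integral_def)
    next
      case (compl A)
      then have A: "A \<in> sets borel" by (simp add: borel_eq_box)
      have "(LINT x:(A \<inter> ?C) \<union> ((UNIV - A) \<inter> ?C)|lebesgue. f x) =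
         (LINT x:A \<inter> ?C|lebesgue. f x) + (LINT x:(UNIV - A) \<inter> ?C|lebesgue. f x)"
        by (rule set_integral_Un) (use A in \<open>auto intro!: sub\<close>)
      moreover have "(A \<inter> ?C) \<union> ((UNIV - A) \<inter> ?C) = ?C" by auto
      ultimately show ?case using compl.IH z[of c d] by simp
    next
      case (union F)
      then have F: "F i \<in> sets borel" for i by (auto simp: borel_eq_box subset_eq)
      have "(LINT x:(\<Union>i. F i \<inter> ?C)|lebesgue. f x) = (\<Sum>i. (LINT x:(F i \<inter> ?C)|lebesgue. f x))"
      proof (rule lebesgue_integral_countable_add)
        show "F i \<inter> ?C \<in> sets lebesgue" for i using F[of i] by auto
        show "F i \<inter> ?C \<inter> (F j \<inter> ?C) = {}" if "i \<noteq> j" for i j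
          using union(1) that by (auto simp: disjoint_family_on_def)
        have "(\<Union>i. F i) \<in> sets lebesgue" using F by auto
        from sub[OF this] show "set_integrable lebesgue (\<Union>i. F i \<inter> ?C) f" by simp
      qed
      then show ?case using union.IH by simp
    qed
  qed
  have Pl: "(LINT x:A \<inter> ?C|lebesgue. f x) = 0" if A: "A \<in> sets lebesgue" for A
  proof -
    obtain S N N' where S: "A = S \<union> N" "N \<subseteq> N'" "N' \<in> null_sets lborel" "S \<in> sets lborel"
      using A by (rule sets_completionE)
    have "N' \<in> null_sets lebesgue" using S(3) by (rule null_sets_completionI)
    then have "AE x in lebesgue. x \<notin> N'" by (rule AE_not_in)
    then have "AE x in lebesgue. (x \<in> A \<inter> ?C) = (x \<in> S \<inter> ?C)"
      by eventually_elim (use S in auto)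
    then have "(LINT x:A \<inter> ?C|lebesgue. f x) = (LINT x:S \<inter> ?C|lebesgue. f x)"
      by (intro set_integral_cong_set)
         (use sub[of A] sub[of S] A S in \<open>auto simp: set_integrable_def set_borel_measurable_def\<close>)
    then show ?thesis using P S by simp
  qed
  interpret finite_measure "lebesgue_on ?C" by (rule finite_measure_lebesgue_on) simp
  have "AE x in lebesgue_on ?C. f x = 0"
  proof (rule density_zero)
    show "integrable (lebesgue_on ?C) f"
      using f by (simp add: integrable_restrict_space set_integrable_def)
    fix A assume "A \<in> sets (lebesgue_on ?C)"
    then have A: "A \<in> sets lebesgue" "A \<subseteq> ?C"
      by (auto simp: sets_restrict_space_iff)
    have "(LINT x:A|lebesgue_on ?C. f x) = (LINT x:A \<inter> ?C|lebesgue. f x)"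
      unfolding set_lebesgue_integral_def
      by (subst integral_restrict_space) (auto simp: indicator_def intro!: Bochner_Integration.integral_cong)
    then show "(LINT x:A|lebesgue_on ?C. f x) = 0" using Pl[OF A(1)] by simp
  qed
  then show ?thesis by (simp add: AE_restrict_space_iff)
qed

text \<open>The bump functions of a box converge boundedly to its indicator, so \<open>f\<close> integrates to zero over
  every box with closure in \<open>\<Omega>\<close>, and countably many such boxes exhaust \<open>\<Omega>\<close>.\<close>

lemma fundamental_lemma:
  fixes f :: "'a::euclidean_space \<Rightarrow> 'b::euclidean_space"
  assumes \<Omega>: "open \<Omega>" and f: "locally_integrable \<Omega> f"
    and z: "\<And>\<phi>. \<phi> \<in> test_functions \<Omega> \<Longrightarrow> (\<integral>x. \<phi> x *\<^sub>R f x \<partial>lebesgue_on \<Omega>) = 0"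
  shows "AE x in lebesgue_on \<Omega>. f x = 0"
proof -
  have box: "AE x in lebesgue. x \<in> cbox c d \<longrightarrow> f x = 0" if cd: "cbox c d \<subseteq> \<Omega>" for c d
  proof -
    have fi: "set_integrable lebesgue (cbox c d) f"
      using f cd by (auto simp: locally_integrable_def)
    then have fm: "(\<lambda>x. indicat_real (cbox c d) x *\<^sub>R f x) \<in> borel_measurable lebesgue"
      by (auto simp: set_integrable_def)
    have "AE x in lebesgue. x \<in> box c d \<longrightarrow> f x = 0"
    proof (rule AE_zero_of_box_integrals)
      show "set_integrable lebesgue (box c d) f"
        by (rule set_integrable_subset[OF fi]) (auto simp: box_subset_cbox)
      fix a b :: 'a assume ab: "box a b \<subseteq> box c d"
      show "(LINT x:box a b|lebesgue. f x) = 0"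
      proof (cases "box a b = {}")
        case True then show ?thesis by (simp add: set_lebesgue_integral_def)
      next
        case ne: False
        have "cbox a b \<subseteq> cbox c d"
          using ab ne by (metis closure_box closure_mono box_eq_empty(1) subset_empty)
        then have cab: "cbox a b \<subseteq> \<Omega>" using cd by blast
        \<comment> \<open>the factor of the large box makes \<open>f\<close>, which is only locally integrable, an integrable function
          on the whole space\<close>
        have "(\<lambda>n. \<integral>x. bump n a b x *\<^sub>R (indicat_real (cbox c d) x *\<^sub>R f x) \<partial>lebesgue)
           \<longlonglongrightarrow> (\<integral>x. indicat_real (box a b) x *\<^sub>R (indicat_real (cbox c d) x *\<^sub>R f x) \<partial>lebesgue)"
        proof (rule integral_dominated_convergence[where w = "\<lambda>x. norm (indicat_real (cbox c d) x *\<^sub>R f x)"])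
          show "(\<lambda>x. indicat_real (box a b) x *\<^sub>R indicat_real (cbox c d) x *\<^sub>R f x) \<in> borel_measurable lebesgue"
            by (intro borel_measurable_scaleR fm borel_measurable_indicator) auto
          show "(\<lambda>x. bump n a b x *\<^sub>R indicat_real (cbox c d) x *\<^sub>R f x) \<in> borel_measurable lebesgue" for n
            by (intro borel_measurable_scaleR fm measurable_completion)
               (simp add: borel_measurable_continuous_onI smooth_bump smooth_continuous)
          show "integrable lebesgue (\<lambda>x. norm (indicat_real (cbox c d) x *\<^sub>R f x))"
            using fi by (simp only: set_integrable_def integrable_norm)
          show "AE x in lebesgue. norm (bump n a b x *\<^sub>R indicat_real (cbox c d) x *\<^sub>R f x)
              \<le> norm (indicat_real (cbox c d) x *\<^sub>R f x)" for n
            using bump_nonneg[of n a b] bump_le_1[of n a b]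
            by (auto intro!: AE_I2 simp: indicator_def mult_left_le_one_le)
          show "AE x in lebesgue. (\<lambda>n. bump n a b x *\<^sub>R indicat_real (cbox c d) x *\<^sub>R f x)
              \<longlonglongrightarrow> indicat_real (box a b) x *\<^sub>R indicat_real (cbox c d) x *\<^sub>R f x"
            by (intro AE_I2 tendsto_scaleR bump_tendsto[OF ne] tendsto_const)
        qed
        moreover have "(\<integral>x. bump n a b x *\<^sub>R (indicat_real (cbox c d) x *\<^sub>R f x) \<partial>lebesgue) = 0" for n
        proof -
          have out: "bump n a b x = 0" if "x \<notin> box a b" for x
            using bump_pos_iff[OF ne, of n x] bump_nonneg[of n a b x] that by linarith
          have in_eq: "indicat_real \<Omega> x *\<^sub>R bump n a b x *\<^sub>R f x =
                bump n a b x *\<^sub>R (indicat_real (cbox c d) x *\<^sub>R f x)" for x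
          proof (cases "x \<in> box a b")
            case True
            then have "x \<in> \<Omega>" "x \<in> cbox c d"
              using cab ab box_subset_cbox by blast+
            then show ?thesis by simp
          qed (simp add: out)
          have "(\<integral>x. bump n a b x *\<^sub>R f x \<partial>lebesgue_on \<Omega>) = 0"
            by (intro z bump_test_function ne cab)
          moreover have "(\<integral>x. bump n a b x *\<^sub>R f x \<partial>lebesgue_on \<Omega>) =
             (\<integral>x. bump n a b x *\<^sub>R (indicat_real (cbox c d) x *\<^sub>R f x) \<partial>lebesgue)"
            by (subst integral_restrict_space) (use \<Omega> in \<open>simp_all only: in_eq, auto\<close>)
          ultimately show ?thesis by simp
        qed
        ultimately have "(\<integral>x. indicat_real (box a b) x *\<^sub>R (indicat_real (cbox c d) x *\<^sub>R f x) \<partial>lebesgue) = 0"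
          by (simp add: LIMSEQ_const_iff)
        also have "(\<integral>x. indicat_real (box a b) x *\<^sub>R (indicat_real (cbox c d) x *\<^sub>R f x) \<partial>lebesgue) =
           (LINT x:box a b|lebesgue. f x)"
          unfolding set_lebesgue_integral_def
          using ab box_subset_cbox[of c d]
          by (intro Bochner_Integration.integral_cong) (auto simp: indicator_def)
        finally show ?thesis .
      qed
    qed
    moreover have "AE x in lebesgue. x \<notin> cbox c d - box c d"
      using negligible_frontier_interval[of c d] by (intro AE_not_in) (simp add: negligible_iff_null_sets)
    ultimately show ?thesis by eventually_elim auto
  qed
  obtain \<D> where D: "countable \<D>" "\<And>X. X \<in> \<D> \<Longrightarrow> X \<subseteq> \<Omega> \<and> (\<exists>a b. X = cbox a b)" "\<Union>\<D> = \<Omega>"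
    using open_countable_Union_open_cbox[OF \<Omega>] by (metis Pow_iff subsetD)
  have "AE x in lebesgue. x \<in> X \<longrightarrow> f x = 0" if "X \<in> \<D>" for X
    using D(2)[OF that] box by auto
  then have "AE x in lebesgue. \<forall>X\<in>\<D>. x \<in> X \<longrightarrow> f x = 0"
    by (subst AE_ball_countable[OF D(1)]) blast
  then have "AE x in lebesgue. x \<in> \<Omega> \<longrightarrow> f x = 0"
    by eventually_elim (use D(3) in auto)
  then show ?thesis using \<Omega> by (simp add: AE_restrict_space_iff)
qed

section \<open>Calculus with test functions\<close>

lemma smooth_borel:
  assumes "smooth f"
  shows "f \<in> borel_measurable borel" "grad f \<in> borel_measurable borel"
  using assms by (auto intro: borel_measurable_continuous_onI smooth_continuous smooth_continuous_grad)

lemma test_function_zero_outside: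
  assumes "\<phi> \<in> test_functions \<Omega>" "x \<notin> closure {x. \<phi> x \<noteq> 0}"
  shows "\<phi> x = 0" "grad \<phi> x = 0"
proof -
  show "\<phi> x = 0" using assms(2) closure_subset[of "{x. \<phi> x \<noteq> 0}"] by auto
  have "GDERIV (\<lambda>_. 0) x :> (0::'a)" by (rule GDERIV_const)
  then have "GDERIV \<phi> x :> 0"
    unfolding gderiv_def
    by (rule has_derivative_transform_within_open[OF _ open_Compl[OF closed_closure[of "{x. \<phi> x \<noteq> 0}"]]])
       (use assms(2) closure_subset[of "{x. \<phi> x \<noteq> 0}"] in auto)
  then show "grad \<phi> x = 0" by (rule grad_eqI)
qed

lemma test_function_zero_off_domain:
  assumes "\<phi> \<in> test_functions \<Omega>" "x \<notin> \<Omega>"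
  shows "\<phi> x = 0" "grad \<phi> x = 0"
proof -
  have "x \<notin> closure {x. \<phi> x \<noteq> 0}" using assms by (auto simp: test_functions_iff)
  then show "\<phi> x = 0" "grad \<phi> x = 0" by (rule test_function_zero_outside[OF assms(1)])+
qed

lemma test_function_bounded:
  assumes "\<phi> \<in> test_functions \<Omega>"
  obtains B where "0 < B" "\<And>x. \<bar>\<phi> x\<bar> \<le> B" "\<And>x. norm (grad \<phi> x) \<le> B"
proof -
  let ?K = "closure {x. \<phi> x \<noteq> 0}"
  have K: "compact ?K" and s: "smooth \<phi>" using assms by (auto simp: test_functions_iff)
  have "bounded (\<phi> ` ?K)" "bounded (grad \<phi> ` ?K)"
    using K smooth_continuous[OF s] smooth_continuous_grad[OF s]
    by (auto intro!: compact_imp_bounded compact_continuous_image intro: continuous_on_subset)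
  then obtain B1 B2 where "\<And>x. x \<in> ?K \<Longrightarrow> norm (\<phi> x) \<le> B1" "\<And>x. x \<in> ?K \<Longrightarrow> norm (grad \<phi> x) \<le> B2"
    unfolding bounded_iff by (meson imageI)
  then have "\<bar>\<phi> x\<bar> \<le> \<bar>B1\<bar> + \<bar>B2\<bar> + 1" "norm (grad \<phi> x) \<le> \<bar>B1\<bar> + \<bar>B2\<bar> + 1" for x
    using test_function_zero_outside[OF assms, of x] by (cases "x \<in> ?K"; fastforce)+
  then show ?thesis by (rule that[rotated]) auto
qed

lemma smooth_add_grad:
  assumes "smooth f" "smooth g"
  shows "grad (\<lambda>x. f x + g x) x = grad f x + grad g x"
  by (intro grad_eqI GDERIV_add smooth_GDERIV assms)

lemma smooth_mult_grad:
  assumes "smooth f" "smooth g"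
  shows "grad (\<lambda>x. f x * g x) x = f x *\<^sub>R grad g x + g x *\<^sub>R grad f x"
  by (intro grad_eqI GDERIV_mult smooth_GDERIV assms)

lemma smooth_cmult_grad:
  assumes "smooth f"
  shows "grad (\<lambda>x. c * f x) x = c *\<^sub>R grad f x"
  using smooth_mult_grad[OF smooth_const assms, of c x] grad_eqI[OF GDERIV_const[of c x]] by simp

lemma test_functions_add:
  assumes "f \<in> test_functions \<Omega>" "g \<in> test_functions \<Omega>"
  shows "(\<lambda>x. f x + g x) \<in> test_functions \<Omega>"
proof -
  let ?F = "closure {x. f x \<noteq> 0}" and ?G = "closure {x. g x \<noteq> 0}" and ?H = "closure {x. f x + g x \<noteq> 0}"
  have f: "smooth f" "compact ?F" "?F \<subseteq> \<Omega>" and g: "smooth g" "compact ?G" "?G \<subseteq> \<Omega>"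
    using assms by (simp_all add: test_functions_iff)
  have "?H \<subseteq> closure ({x. f x \<noteq> 0} \<union> {x. g x \<noteq> 0})"
    by (intro closure_mono) auto
  then have sub: "?H \<subseteq> ?F \<union> ?G" by (simp add: closure_Un)
  have "compact (?H \<inter> (?F \<union> ?G))"
    by (intro closed_Int_compact closed_closure compact_Un f g)
  then have "compact ?H" using sub by (simp add: inf.absorb1)
  moreover have "?H \<subseteq> \<Omega>" by (rule order_trans[OF sub Un_least[OF f(3) g(3)]])
  ultimately show ?thesis unfolding test_functions_iff using smooth_add[OF f(1) g(1)] by simp
qed

lemma test_functions_cmult:
  "f \<in> test_functions \<Omega> \<Longrightarrow> (\<lambda>x. c * f x) \<in> test_functions \<Omega>"
  by (rule test_functions_support) (auto intro: smooth_mult smooth_const test_functions_smooth)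

lemma test_functions_mult:
  "f \<in> test_functions \<Omega> \<Longrightarrow> smooth g \<Longrightarrow> (\<lambda>x. f x * g x) \<in> test_functions \<Omega>"
  by (rule test_functions_support) (auto intro: smooth_mult test_functions_smooth)

lemma test_functions_diff:
  assumes "f \<in> test_functions \<Omega>" "g \<in> test_functions \<Omega>"
  shows "(\<lambda>x. f x - g x) \<in> test_functions \<Omega>"
    "grad (\<lambda>x. f x - g x) x = grad f x - grad g x"
proof -
  show "(\<lambda>x. f x - g x) \<in> test_functions \<Omega>"
    using test_functions_add[OF assms(1) test_functions_cmult[OF assms(2), of "-1"]] by simp
  show "grad (\<lambda>x. f x - g x) x = grad f x - grad g x"
    by (intro grad_eqI GDERIV_diff smooth_GDERIV test_functions_smooth[where \<Omega> = \<Omega>] assms)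
qed

lemma test_function_lipschitz:
  assumes "\<phi> \<in> test_functions \<Omega>"
  obtains B where "0 < B" "\<And>x y. \<bar>\<phi> x - \<phi> y\<bar> \<le> B * norm (x - y)"
proof -
  obtain B where B: "0 < B" "\<And>x. norm (grad \<phi> x) \<le> B" using test_function_bounded[OF assms] by metis
  have "norm (\<phi> x - \<phi> y) \<le> B * norm (x - y)" for x y
  proof (rule differentiable_bound[where S = UNIV and f' = "\<lambda>x h. h \<bullet> grad \<phi> x"])
    fix x show "(\<phi> has_derivative (\<lambda>h. h \<bullet> grad \<phi> x)) (at x within UNIV)"
      using smooth_GDERIV[OF test_functions_smooth[OF assms]] by (simp add: gderiv_def)
    show "onorm (\<lambda>h. h \<bullet> grad \<phi> x) \<le> B"
    proof (rule onorm_le)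
      fix h show "norm (h \<bullet> grad \<phi> x) \<le> B * norm h"
        using Cauchy_Schwarz_ineq2[of h "grad \<phi> x"] mult_left_mono[OF B(2)[of x], of "norm h"]
        by (simp add: mult.commute)
    qed
  qed auto
  then show ?thesis using that B(1) by auto
qed

text \<open>Translation invariance says that the difference quotients of a test function integrate
  to zero; dominated convergence transfers this to the derivative.\<close>

lemma integral_grad_test_function:
  fixes \<phi> :: "'a::euclidean_space \<Rightarrow> real"
  assumes "\<phi> \<in> test_functions \<Omega>"
  shows "(\<integral>x. grad \<phi> x \<bullet> b \<partial>lborel) = 0"
proof -
  let ?K = "closure {x. \<phi> x \<noteq> 0}"
  have s: "smooth \<phi>" and K: "compact ?K" using assms by (auto simp: test_functions_iff)
  note [measurable] = smooth_borel[OF s]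
  obtain R where R: "?K \<subseteq> cball 0 R" using compact_imp_bounded[OF K] by (metis bounded_iff mem_cball_0 subsetI)
  obtain B where B: "0 < B" "\<And>x y. \<bar>\<phi> x - \<phi> y\<bar> \<le> B * norm (x - y)"
    using test_function_lipschitz[OF assms] by metis
  obtain B' where B': "\<And>x. \<bar>\<phi> x\<bar> \<le> B'" using test_function_bounded[OF assms] by metis
  have cb: "integrable lborel (\<lambda>x. C * indicat_real (cball 0 r) x :: real)" for C and r and x :: 'a
    by (intro integrable_mult_right integrable_real_indicator emeasure_lborel_cball_finite) simp
  have int: "integrable lborel \<phi>"
  proof (rule Bochner_Integration.integrable_bound[OF cb[of B' R]])
    show "AE x in lborel. norm (\<phi> x) \<le> norm (B' * indicat_real (cball 0 R) x)"
    proof (rule AE_I2)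
      fix x show "norm (\<phi> x) \<le> norm (B' * indicat_real (cball 0 R) x)"
        using B'[of x] test_function_zero_outside[OF assms, of x] R by (cases "x \<in> ?K") (auto simp: subset_iff)
    qed
  qed simp
  define h where "h n = inverse (real (Suc n))" for n
  have h: "h n > 0" "h n \<le> 1" for n by (auto simp: h_def inverse_le_1_iff)
  have zero: "(\<integral>x. (\<phi> (x + h n *\<^sub>R b) - \<phi> x) / h n \<partial>lborel) = 0" for n
  proof -
    have i: "integrable lborel (\<lambda>x. \<phi> (h n *\<^sub>R b + x))"
      using int by (subst (asm) lborel_distr_plus[of "h n *\<^sub>R b", symmetric]) (simp add: integrable_distr_eq)
    have "(\<integral>x. \<phi> x \<partial>lborel) = (\<integral>x. \<phi> (h n *\<^sub>R b + x) \<partial>lborel)"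
      by (subst lborel_distr_plus[of "h n *\<^sub>R b", symmetric]) (simp add: integral_distr)
    then show ?thesis using i int by (simp add: add.commute)
  qed
  have "(\<lambda>n. \<integral>x. (\<phi> (x + h n *\<^sub>R b) - \<phi> x) / h n \<partial>lborel) \<longlonglongrightarrow> (\<integral>x. grad \<phi> x \<bullet> b \<partial>lborel)"
  proof (rule integral_dominated_convergence[where w = "\<lambda>x. (B * norm b) * indicat_real (cball 0 (R + norm b)) x"])
    show "AE x in lborel. (\<lambda>n. (\<phi> (x + h n *\<^sub>R b) - \<phi> x) / h n) \<longlonglongrightarrow> grad \<phi> x \<bullet> b"
    proof (rule AE_I2)
      fix x
      have "((\<lambda>t. \<phi> (x + t *\<^sub>R b)) has_derivative (\<lambda>t. (t *\<^sub>R b) \<bullet> grad \<phi> x)) (at 0)"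
        by (rule has_derivative_compose[of "\<lambda>t. x + t *\<^sub>R b" "\<lambda>t. t *\<^sub>R b"])
           (use smooth_GDERIV[OF s, of x] in \<open>auto intro!: derivative_eq_intros simp: gderiv_def\<close>)
      then have "((\<lambda>t. \<phi> (x + t *\<^sub>R b)) has_real_derivative (grad \<phi> x \<bullet> b)) (at 0)"
        by (simp add: has_field_derivative_def inner_commute mult.commute[of "grad \<phi> x \<bullet> b"] fun_eq_iff)
           (simp add: mult_commute_abs)
      then have *: "((\<lambda>t. (\<phi> (x + t *\<^sub>R b) - \<phi> x) / t) \<longlongrightarrow> grad \<phi> x \<bullet> b) (at 0)"
        by (simp add: DERIV_def)
      have "filterlim h (at 0) sequentially"
        using LIMSEQ_inverse_real_of_nat h(1) unfolding filterlim_at h_def by (auto simp: less_imp_neq)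
      from filterlim_compose[OF * this] show "(\<lambda>n. (\<phi> (x + h n *\<^sub>R b) - \<phi> x) / h n) \<longlonglongrightarrow> grad \<phi> x \<bullet> b" .
    qed
    show "AE x in lborel. norm ((\<phi> (x + h n *\<^sub>R b) - \<phi> x) / h n) \<le> (B * norm b) * indicat_real (cball 0 (R + norm b)) x" for n
    proof (rule AE_I2)
      fix x
      show "norm ((\<phi> (x + h n *\<^sub>R b) - \<phi> x) / h n) \<le> (B * norm b) * indicat_real (cball 0 (R + norm b)) x"
      proof (cases "norm x \<le> R + norm b")
        case True
        then show ?thesis using B(2)[of "x + h n *\<^sub>R b" x] h[of n]
          by (simp add: divide_simps mult_ac abs_if split: if_splits)
      next
        case False
        have "norm x \<le> norm (x + h n *\<^sub>R b) + norm (h n *\<^sub>R b)"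
          using norm_triangle_ineq4[of "x + h n *\<^sub>R b" "h n *\<^sub>R b"] by simp
        moreover have "norm (h n *\<^sub>R b) \<le> norm b" using h[of n] by (simp add: mult_left_le_one_le)
        ultimately have "x \<notin> cball 0 R" "x + h n *\<^sub>R b \<notin> cball 0 R"
          using False norm_ge_zero[of b] unfolding mem_cball_0 by linarith+
        then have "x \<notin> ?K" "x + h n *\<^sub>R b \<notin> ?K" using R by blast+
        then have "\<phi> x = 0" "\<phi> (x + h n *\<^sub>R b) = 0"
          using test_function_zero_outside(1)[OF assms] by metis+
        then show ?thesis using False by simp
      qed
    qed
    show "integrable lborel (\<lambda>x. (B * norm b) * indicat_real (cball 0 (R + norm b)) x)" by (rule cb)
  qed measurable
  then show ?thesis unfolding zero by (simp add: LIMSEQ_const_iff)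
qed

section \<open>Dominated convergence in Lebesgue spaces\<close>

lemma norm_add_powr_le:
  fixes x y :: "'a::real_normed_vector"
  assumes "0 \<le> p"
  shows "norm (x + y) powr p \<le> 2 powr p * (norm x powr p + norm y powr p)"
proof -
  have "norm (x + y) powr p \<le> (2 * max (norm x) (norm y)) powr p"
    using norm_triangle_ineq[of x y] assms by (intro powr_mono2) auto
  also have "\<dots> = 2 powr p * max (norm x) (norm y) powr p" by (simp add: powr_mult)
  also have "\<dots> \<le> 2 powr p * (norm x powr p + norm y powr p)"
    by (intro mult_left_mono) (auto simp: max_def)
  finally show ?thesis .
qed

lemma norm_diff_powr_le:
  fixes x y :: "'a::real_normed_vector"
  assumes "0 \<le> p"
  shows "norm (x - y) powr p \<le> 2 powr p * (norm x powr p + norm y powr p)"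
  using norm_add_powr_le[OF assms, of x "- y"] by simp

lemma tendsto_powr_zero_iff:
  assumes "0 < p" "\<And>n. 0 \<le> f n" and "f \<longlonglongrightarrow> (0::real)"
  shows "(\<lambda>n. f n powr p) \<longlonglongrightarrow> 0"
  using tendsto_powr'[OF assms(3) tendsto_const[of p]] assms(1,2) by simp

lemma le_one_add_powr:
  assumes "1 < p" "0 \<le> (t::real)" shows "t \<le> 1 + t powr p"
proof (cases "t \<le> 1")
  case False
  then have "t powr 1 \<le> t powr p" using assms by (intro powr_mono) auto
  then show ?thesis using False by simp
qed (simp add: add_increasing2)

locale bounded_domain =
  fixes \<Omega> :: "'a::euclidean_space set" and p :: real
  assumes open_dom: "open \<Omega>" and bounded_dom: "bounded \<Omega>" and p_gt_1: "1 < p"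
begin

abbreviation M where "M \<equiv> lebesgue_on \<Omega>"

lemma dom_lmeasurable: "\<Omega> \<in> lmeasurable"
  using open_dom bounded_dom by (simp add: lmeasurable_open)

lemma dom_sets [simp]: "\<Omega> \<in> sets lebesgue"
  using dom_lmeasurable by (rule fmeasurableD)

sublocale finite_measure M
  by (rule finite_measure_lebesgue_on[OF dom_lmeasurable])

lemma AE_M: "(AE x in M. P x) \<longleftrightarrow> (AE x in lebesgue. x \<in> \<Omega> \<longrightarrow> P x)"
  by (simp add: AE_restrict_space_iff)

lemma borel_measurable_M_iff:
  fixes f :: "'a \<Rightarrow> 'b::euclidean_space"
  shows "f \<in> borel_measurable M \<longleftrightarrow> (\<lambda>x. if x \<in> \<Omega> then f x else 0) \<in> borel_measurable lebesgue"
  by (rule borel_measurable_if[symmetric, OF dom_sets])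

lemma measurable_AE_eq:
  fixes f :: "'a \<Rightarrow> 'b::euclidean_space"
  assumes "f \<in> borel_measurable M" "AE x in M. f x = g x"
  shows "g \<in> borel_measurable M"
  unfolding borel_measurable_M_iff
  by (rule borel_measurable_AE[OF assms(1)[unfolded borel_measurable_M_iff]])
     (use assms(2) in \<open>auto simp: AE_M\<close>)

lemma measurable_AE_limit:
  fixes f :: "nat \<Rightarrow> 'a \<Rightarrow> 'b::euclidean_space"
  assumes "\<And>n. f n \<in> borel_measurable M" "AE x in M. (\<lambda>n. f n x) \<longlonglongrightarrow> g x"
  shows "g \<in> borel_measurable M"
proof -
  have "AE x in M. lim (\<lambda>n. f n x) = g x"
    using assms(2) by eventually_elim (rule limI)
  moreover have "(\<lambda>x. lim (\<lambda>n. f n x)) \<in> borel_measurable M"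
    by (rule borel_measurable_lim_metric) (rule assms)
  ultimately show ?thesis by (rule measurable_AE_eq[rotated])
qed

lemma smooth_measurable:
  assumes "smooth f"
  shows "f \<in> borel_measurable M" "grad f \<in> borel_measurable M"
  using smooth_borel[OF assms] by (auto intro!: measurable_restrict_space1 measurable_completion)

abbreviation Lpr :: "('a \<Rightarrow> real) set" where "Lpr \<equiv> Lp \<Omega> p"

lemma Lp_D:
  assumes "f \<in> Lp \<Omega> p"
  shows "f \<in> borel_measurable M" "integrable M (\<lambda>x. norm (f x) powr p)"
  using assms by (auto simp: Lp_def)

lemma Lp_bound:
  fixes f :: "'a \<Rightarrow> 'b::euclidean_space"
  assumes "f \<in> borel_measurable M" "g \<in> Lp \<Omega> p" "AE x in M. norm (f x) \<le> norm (g x)"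
  shows "f \<in> Lp \<Omega> p"
proof -
  note [measurable] = assms(1)
  have "integrable M (\<lambda>x. norm (f x) powr p)"
  proof (rule Bochner_Integration.integrable_bound[OF Lp_D(2)[OF assms(2)]])
    show "AE x in M. norm (norm (f x) powr p) \<le> norm (norm (g x) powr p)"
      using assms(3) by eventually_elim (use p_gt_1 in \<open>auto intro: powr_mono2\<close>)
  qed measurable
  then show ?thesis using assms(1) by (simp add: Lp_def)
qed

lemma Lp_add:
  fixes f g :: "'a \<Rightarrow> 'b::euclidean_space"
  assumes "f \<in> Lp \<Omega> p" "g \<in> Lp \<Omega> p"
  shows "(\<lambda>x. f x + g x) \<in> Lp \<Omega> p"
proof -
  note [measurable] = Lp_D(1)[OF assms(1)] Lp_D(1)[OF assms(2)]
  have i: "integrable M (\<lambda>x. 2 powr p * (norm (f x) powr p + norm (g x) powr p))"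
    using Lp_D(2)[OF assms(1)] Lp_D(2)[OF assms(2)] by simp
  have "integrable M (\<lambda>x. norm (f x + g x) powr p)"
  proof (rule Bochner_Integration.integrable_bound[OF i])
    show "AE x in M. norm (norm (f x + g x) powr p) \<le> norm (2 powr p * (norm (f x) powr p + norm (g x) powr p))"
    proof (rule AE_I2)
      fix x show "norm (norm (f x + g x) powr p) \<le> norm (2 powr p * (norm (f x) powr p + norm (g x) powr p))"
        using norm_add_powr_le[of p "f x" "g x"] p_gt_1 by (simp add: abs_mult)
    qed
  qed measurable
  then show ?thesis by (simp add: Lp_def)
qed

lemma Lp_cmult:
  fixes f :: "'a \<Rightarrow> 'b::euclidean_space"
  assumes "f \<in> Lp \<Omega> p" shows "(\<lambda>x. c *\<^sub>R f x) \<in> Lp \<Omega> p"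
  using assms by (auto simp: Lp_def powr_mult)

lemma Lp_diff:
  fixes f g :: "'a \<Rightarrow> 'b::euclidean_space"
  assumes "f \<in> Lp \<Omega> p" "g \<in> Lp \<Omega> p"
  shows "(\<lambda>x. f x - g x) \<in> Lp \<Omega> p"
  using Lp_add[OF assms(1) Lp_cmult[OF assms(2), of "-1"]] by simp

lemma Lp_norm:
  fixes f :: "'a \<Rightarrow> 'b::euclidean_space"
  assumes "f \<in> Lp \<Omega> p" shows "(\<lambda>x. norm (f x)) \<in> Lpr"
  using assms by (auto simp: Lp_def)

lemma Lp_const: "(\<lambda>x. c) \<in> Lp \<Omega> p"
  by (simp add: Lp_def)

lemma Lp_AE_eq:
  fixes f :: "'a \<Rightarrow> 'b::euclidean_space"
  assumes "f \<in> Lp \<Omega> p" "AE x in M. f x = g x" shows "g \<in> Lp \<Omega> p"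
  by (rule Lp_bound[OF measurable_AE_eq[OF Lp_D(1)[OF assms(1)] assms(2)] assms(1)])
     (use assms(2) in \<open>auto elim!: eventually_mono\<close>)

lemma Lp_integrable:
  fixes f :: "'a \<Rightarrow> 'b::euclidean_space"
  assumes "f \<in> Lp \<Omega> p" shows "integrable M f"
proof (rule Bochner_Integration.integrable_bound)
  show "integrable M (\<lambda>x. 1 + norm (f x) powr p)" using Lp_D(2)[OF assms] by simp
  show "AE x in M. norm (f x) \<le> norm (1 + norm (f x) powr p)"
    using le_one_add_powr[OF p_gt_1] by (simp add: add_nonneg_nonneg)
qed (rule Lp_D(1)[OF assms])

text \<open>Convergence almost everywhere under a common \<open>L\<^sup>p\<close> majorant. Working with this notion
  instead of convergence in norm makes every later limit a pointwise statement.\<close>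

definition dom_conv :: "(nat \<Rightarrow> 'a \<Rightarrow> 'b::euclidean_space) \<Rightarrow> ('a \<Rightarrow> 'b) \<Rightarrow> bool" where
  "dom_conv f u \<longleftrightarrow> (\<forall>n. f n \<in> borel_measurable M) \<and>
     (\<exists>g\<in>Lpr. \<forall>n. AE x in M. norm (f n x) \<le> g x) \<and> (AE x in M. (\<lambda>n. f n x) \<longlonglongrightarrow> u x)"

lemma dom_convI:
  assumes "\<And>n. f n \<in> borel_measurable M" "g \<in> Lpr" "\<And>n. AE x in M. norm (f n x) \<le> g x"
    "AE x in M. (\<lambda>n. f n x) \<longlonglongrightarrow> u x"
  shows "dom_conv f u"
  using assms unfolding dom_conv_def by blast

text \<open>The countably many majorisations hold simultaneously outside one null set and pass to the limit.\<close>

lemma dom_convE: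
  assumes "dom_conv f u"
  shows "\<exists>g\<in>Lpr. (\<forall>x. 0 \<le> g x) \<and> (AE x in M. \<forall>n. norm (f n x) \<le> g x) \<and>
    (AE x in M. norm (u x) \<le> g x) \<and> (AE x in M. (\<lambda>n. f n x) \<longlonglongrightarrow> u x)"
proof -
  obtain g where g: "g \<in> Lpr" "\<And>n. AE x in M. norm (f n x) \<le> g x" and l: "AE x in M. (\<lambda>n. f n x) \<longlonglongrightarrow> u x"
    using assms by (auto simp: dom_conv_def)
  have 1: "AE x in M. \<forall>n. norm (f n x) \<le> \<bar>g x\<bar>"
    unfolding AE_all_countable
  proof
    fix n show "AE x in M. norm (f n x) \<le> \<bar>g x\<bar>"
      using g(2)[of n] by eventually_elim simp
  qed
  have 2: "AE x in M. norm (u x) \<le> \<bar>g x\<bar>"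
    using 1 l
  proof eventually_elim
    case (elim x)
    then show ?case by (intro LIMSEQ_le_const2[OF tendsto_norm[OF elim(2)]]) auto
  qed
  show ?thesis
    by (rule bexI[where x = "\<lambda>x. \<bar>g x\<bar>"]) (use Lp_norm[OF g(1)] 1 2 l in auto)
qed

lemma dom_conv_measurable:
  assumes "dom_conv f u"
  shows "f n \<in> borel_measurable M" "u \<in> borel_measurable M"
  using assms measurable_AE_limit[of f u] by (auto simp: dom_conv_def)

lemma dom_conv_Lp:
  assumes "dom_conv f u" shows "f n \<in> Lp \<Omega> p" "u \<in> Lp \<Omega> p"
proof -
  obtain g where g: "g \<in> Lpr" "\<forall>x. 0 \<le> g x" "AE x in M. \<forall>n. norm (f n x) \<le> g x"
    "AE x in M. norm (u x) \<le> g x" and "AE x in M. (\<lambda>n. f n x) \<longlonglongrightarrow> u x"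
    using dom_convE[OF assms] by blast
  show "f n \<in> Lp \<Omega> p"
    by (rule Lp_bound[OF dom_conv_measurable(1)[OF assms] g(1)])
       (use g(2,3) in \<open>auto elim!: eventually_mono\<close>)
  show "u \<in> Lp \<Omega> p"
    by (rule Lp_bound[OF dom_conv_measurable(2)[OF assms] g(1)])
       (use g(2,4) in \<open>auto elim!: eventually_mono\<close>)
qed

lemma dom_conv_subseq:
  assumes "dom_conv f u" "strict_mono r" shows "dom_conv (\<lambda>n. f (r n)) u"
proof -
  obtain g where g: "g \<in> Lpr" "\<And>n. AE x in M. norm (f n x) \<le> g x" and l: "AE x in M. (\<lambda>n. f n x) \<longlonglongrightarrow> u x"
    using assms by (auto simp: dom_conv_def)
  have "AE x in M. (\<lambda>n. f (r n) x) \<longlonglongrightarrow> u x"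
    using l by eventually_elim (use LIMSEQ_subseq_LIMSEQ[OF _ assms(2)] in \<open>auto simp: o_def\<close>)
  then show ?thesis using g dom_conv_measurable(1)[OF assms(1)] by (auto simp: dom_conv_def)
qed

lemma dom_conv_add:
  assumes "dom_conv f u" "dom_conv g v" shows "dom_conv (\<lambda>n x. f n x + g n x) (\<lambda>x. u x + v x)"
proof -
  obtain a where a: "a \<in> Lpr" "\<And>n. AE x in M. norm (f n x) \<le> a x" and l: "AE x in M. (\<lambda>n. f n x) \<longlonglongrightarrow> u x"
    using assms by (auto simp: dom_conv_def)
  obtain b where b: "b \<in> Lpr" "\<And>n. AE x in M. norm (g n x) \<le> b x" and l': "AE x in M. (\<lambda>n. g n x) \<longlonglongrightarrow> v x"
    using assms by (auto simp: dom_conv_def)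
  show ?thesis
  proof (rule dom_convI[where g = "\<lambda>x. a x + b x"])
    show "AE x in M. norm (f n x + g n x) \<le> a x + b x" for n
      using a(2)[of n] b(2)[of n] by eventually_elim (rule norm_triangle_mono)
    show "AE x in M. (\<lambda>n. f n x + g n x) \<longlonglongrightarrow> u x + v x"
      using l l' by eventually_elim (rule tendsto_add)
  qed (use a b dom_conv_measurable[OF assms(1)] dom_conv_measurable[OF assms(2)] in \<open>auto intro: Lp_add borel_measurable_add\<close>)
qed

lemma dom_conv_cmult:
  assumes "dom_conv f u" shows "dom_conv (\<lambda>n x. c *\<^sub>R f n x) (\<lambda>x. c *\<^sub>R u x)"
proof -
  obtain a where a: "a \<in> Lpr" "\<And>n. AE x in M. norm (f n x) \<le> a x" and l: "AE x in M. (\<lambda>n. f n x) \<longlonglongrightarrow> u x"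
    using assms by (auto simp: dom_conv_def)
  show ?thesis
  proof (rule dom_convI[where g = "\<lambda>x. \<bar>c\<bar> * a x"])
    show "AE x in M. norm (c *\<^sub>R f n x) \<le> \<bar>c\<bar> * a x" for n
      using a(2)[of n] by eventually_elim (simp add: mult_left_mono)
    show "AE x in M. (\<lambda>n. c *\<^sub>R f n x) \<longlonglongrightarrow> c *\<^sub>R u x"
      using l by eventually_elim (intro tendsto_intros)
  qed (use Lp_cmult[OF a(1), of "\<bar>c\<bar>"] dom_conv_measurable[OF assms(1)] in \<open>auto intro: borel_measurable_scaleR\<close>)
qed

lemma integral_dom_conv:
  fixes h :: "nat \<Rightarrow> 'a \<Rightarrow> 'c::euclidean_space"
  assumes g: "g \<in> Lpr"
    and m: "\<And>n. h n \<in> borel_measurable M"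
    and b: "AE x in M. \<forall>n. norm (h n x) \<le> C * (1 + \<bar>g x\<bar> powr p)"
    and l: "AE x in M. (\<lambda>n. h n x) \<longlonglongrightarrow> k x"
  shows "(\<lambda>n. \<integral>x. h n x \<partial>M) \<longlonglongrightarrow> (\<integral>x. k x \<partial>M)" "integrable M k" "integrable M (h n)"
proof -
  have i: "integrable M (\<lambda>x. C * (1 + \<bar>g x\<bar> powr p))" using Lp_D(2)[OF g] by simp
  have mk: "k \<in> borel_measurable M" using m l by (rule measurable_AE_limit)
  have bn: "AE x in M. norm (h n x) \<le> C * (1 + \<bar>g x\<bar> powr p)" for n using b by (auto elim!: eventually_mono)
  show "(\<lambda>n. \<integral>x. h n x \<partial>M) \<longlonglongrightarrow> (\<integral>x. k x \<partial>M)" "integrable M k" "integrable M (h n)"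
    using integral_dominated_convergence[OF mk m i l bn] integrable_dominated_convergence[OF mk m i l bn]
      integrable_dominated_convergence2[OF mk m i l bn] by auto
qed

lemma dom_conv_norm:
  assumes "dom_conv f u"
  shows "(\<lambda>n. \<integral>x. norm (f n x - u x) powr p \<partial>M) \<longlonglongrightarrow> 0"
proof -
  obtain g where g: "g \<in> Lpr" "\<forall>x. 0 \<le> g x" "AE x in M. \<forall>n. norm (f n x) \<le> g x"
    "AE x in M. norm (u x) \<le> g x" and l: "AE x in M. (\<lambda>n. f n x) \<longlonglongrightarrow> u x"
    using dom_convE[OF assms] by blast
  note [measurable] = dom_conv_measurable[OF assms]
  have "(\<lambda>n. \<integral>x. norm (f n x - u x) powr p \<partial>M) \<longlonglongrightarrow> (\<integral>x. 0 \<partial>M)"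
  proof (rule integral_dom_conv[OF g(1), where C = "2 powr p * 2"])
    show "AE x in M. \<forall>n. norm (norm (f n x - u x) powr p) \<le> 2 powr p * 2 * (1 + \<bar>g x\<bar> powr p)"
      using g(3,4)
    proof eventually_elim
      case (elim x)
      show ?case
      proof
        fix n
        have "norm (f n x - u x) powr p \<le> 2 powr p * (norm (f n x) powr p + norm (u x) powr p)"
          using p_gt_1 by (intro norm_diff_powr_le) auto
        also have "\<dots> \<le> 2 powr p * (\<bar>g x\<bar> powr p + \<bar>g x\<bar> powr p)"
          using elim p_gt_1 g(2) by (intro mult_left_mono add_mono powr_mono2) auto
        also have "\<dots> \<le> 2 powr p * 2 * (1 + \<bar>g x\<bar> powr p)" by (simp add: algebra_simps)
        finally show "norm (norm (f n x - u x) powr p) \<le> 2 powr p * 2 * (1 + \<bar>g x\<bar> powr p)" by simp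
      qed
    qed
    show "AE x in M. (\<lambda>n. norm (f n x - u x) powr p) \<longlonglongrightarrow> 0"
      using l
    proof eventually_elim
      case (elim x)
      then have "(\<lambda>n. norm (f n x - u x)) \<longlonglongrightarrow> 0" by (simp add: LIM_zero tendsto_norm_zero)
      then show ?case using p_gt_1 by (intro tendsto_powr_zero_iff) auto
    qed
  qed measurable
  then show ?thesis by simp
qed

text \<open>The Riesz--Fischer argument: a sequence which is Cauchy fast enough converges almost
  everywhere, and the sum of its increments is a majorant.\<close>

lemma Lp_Cauchy_subseq:
  fixes f :: "nat \<Rightarrow> 'a \<Rightarrow> 'b::euclidean_space"
  assumes f: "\<And>n. f n \<in> Lp \<Omega> p"
    and cauchy: "\<And>e. e > 0 \<Longrightarrow> \<exists>N. \<forall>m\<ge>N. \<forall>n\<ge>N. (\<integral>x. norm (f m x - f n x) powr p \<partial>M) < e"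
  obtains r u where "strict_mono r" "dom_conv (\<lambda>n. f (r n)) u"
proof -
  define c where "c = (1/4::real) powr p"
  have c: "c > 0" by (simp add: c_def)
  have "\<exists>r::nat \<Rightarrow> nat. strict_mono r \<and> (\<forall>k. \<forall>m\<ge>r k. \<forall>n\<ge>r k. (\<integral>x. norm (f m x - f n x) powr p \<partial>M) < c ^ k)"
  proof -
    obtain N where N: "\<And>k m n. m \<ge> N k \<Longrightarrow> n \<ge> N k \<Longrightarrow> (\<integral>x. norm (f m x - f n x) powr p \<partial>M) < c ^ k"
      using cauchy[of "c ^ k" for k] c by (metis zero_less_power)
    define r where "r k = (\<Sum>i\<le>k. Suc (N i))" for k
    have "strict_mono r" by (rule strict_monoI_Suc) (simp add: r_def)
    moreover have "r k \<ge> N k" for k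
      unfolding r_def using member_le_sum[of k "{..k}" "\<lambda>i. Suc (N i)"] by simp
    ultimately show ?thesis using N by (meson order_trans)
  qed
  then obtain r where r: "strict_mono r"
    and rc: "\<And>k m n. m \<ge> r k \<Longrightarrow> n \<ge> r k \<Longrightarrow> (\<integral>x. norm (f m x - f n x) powr p \<partial>M) < c ^ k"
    by blast
  define d where "d k x = f (r (Suc k)) x - f (r k) x" for k x
  have dL: "d k \<in> Lp \<Omega> p" for k unfolding d_def[abs_def] by (intro Lp_diff f)
  note [measurable] = Lp_D(1)[OF dL] Lp_D(1)[OF f]
  \<comment> \<open>the \<open>p\<close>-th powers of the increments have integrals below \<open>4\<^sup>-\<^sup>k\<^sup>p\<close>; even after multiplication by
    \<open>2\<^sup>k\<^sup>p\<close> they are summable, whence \<open>\<bar>d k\<bar> \<le> 2\<^sup>-\<^sup>k T\<close> with \<open>T\<close> in \<open>L\<^sup>p\<close>\<close>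
  define w where "w k x = (2 powr p) ^ k * norm (d k x) powr p" for k x
  have wm [measurable]: "w k \<in> borel_measurable M" for k unfolding w_def[abs_def] by measurable
  have w0: "0 \<le> w k x" for k x by (simp add: w_def)
  have wi: "(\<integral>\<^sup>+ x. ennreal (w k x) \<partial>M) \<le> ennreal (((1/2) powr p) ^ k)" for k
  proof -
    have i: "integrable M (w k)" unfolding w_def[abs_def] using Lp_D(2)[OF dL] by simp
    have "(\<integral>\<^sup>+ x. ennreal (w k x) \<partial>M) = ennreal (\<integral>x. w k x \<partial>M)"
      using i w0 by (intro nn_integral_eq_integral) auto
    also have "(\<integral>x. w k x \<partial>M) = (2 powr p) ^ k * (\<integral>x. norm (d k x) powr p \<partial>M)" by (simp add: w_def)
    also have "\<dots> \<le> (2 powr p) ^ k * c ^ k"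
      using rc[of k "r (Suc k)" "r k"] r by (intro mult_left_mono) (auto simp: d_def strict_mono_less_eq)
    also have "\<dots> = ((1/2) powr p) ^ k"
      using powr_mult[of 2 "1/4" p] by (simp add: c_def flip: power_mult_distrib)
    finally show ?thesis by (simp add: ennreal_leI)
  qed
  have half: "(1/2::real) powr p < 1" using powr_less_mono2[of p "1/2" 1] p_gt_1 by simp
  have fin: "(\<integral>\<^sup>+ x. (\<Sum>k. ennreal (w k x)) \<partial>M) < \<infinity>"
  proof -
    have "(\<integral>\<^sup>+ x. (\<Sum>k. ennreal (w k x)) \<partial>M) = (\<Sum>k. \<integral>\<^sup>+ x. ennreal (w k x) \<partial>M)"
      by (intro nn_integral_suminf) measurable
    also have "\<dots> \<le> (\<Sum>k. ennreal (((1/2) powr p) ^ k))" by (intro suminf_le wi) auto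
    also have "\<dots> = ennreal (\<Sum>k. ((1/2) powr p) ^ k)"
      using half by (intro suminf_ennreal2 summable_geometric) auto
    finally show ?thesis by (rule order_le_less_trans) simp
  qed
  define S where "S x = enn2real (\<Sum>k. ennreal (w k x))" for x
  have Sm [measurable]: "S \<in> borel_measurable M" unfolding S_def[abs_def] by measurable
  have S0: "0 \<le> S x" for x by (simp add: S_def)
  have SAE: "AE x in M. (\<Sum>k. ennreal (w k x)) = ennreal (S x)"
  proof -
    have "AE x in M. (\<Sum>k. ennreal (w k x)) \<noteq> \<infinity>"
      using fin by (intro nn_integral_PInf_AE) (auto simp: less_top)
    then show ?thesis by eventually_elim (auto simp: S_def less_top)
  qed
  have Si: "integrable M S"
  proof (rule integrableI_nonneg)
    have "(\<integral>\<^sup>+ x. ennreal (S x) \<partial>M) = (\<integral>\<^sup>+ x. (\<Sum>k. ennreal (w k x)) \<partial>M)"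
      using SAE by (intro nn_integral_cong_AE) (auto elim!: eventually_mono)
    then show "(\<integral>\<^sup>+ x. ennreal (S x) \<partial>M) < \<infinity>" using fin by simp
  qed (use S0 in auto)
  define T where "T x = S x powr (1/p)" for x
  have dT: "AE x in M. \<forall>k. norm (d k x) \<le> (1/2) ^ k * T x"
    using SAE
  proof eventually_elim
    case (elim x)
    show ?case
    proof
      fix k
      have "ennreal (w k x) \<le> (\<Sum>k. ennreal (w k x))"
        using sum_le_suminf[of "\<lambda>k. ennreal (w k x)" "{k}"] by simp
      then have "w k x \<le> S x" using elim S0 by simp
      then have "w k x powr (1/p) \<le> T x" unfolding T_def using w0 p_gt_1 by (intro powr_mono2) auto
      moreover have "w k x powr (1/p) = 2 ^ k * norm (d k x)"
      proof -
        have "(2 powr p) ^ k = (2 ^ k) powr p" by (simp add: powr_powr mult.commute flip: powr_realpow)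
        then have "w k x = (2 ^ k * norm (d k x)) powr p" by (simp add: w_def powr_mult)
        then show ?thesis using p_gt_1 by (simp add: powr_powr)
      qed
      ultimately show "norm (d k x) \<le> (1/2) ^ k * T x" by (simp add: field_simps power_divide)
    qed
  qed
  define g where "g x = norm (f (r 0) x) + 2 * T x" for x
  have "T \<in> borel_measurable M" unfolding T_def[abs_def] by measurable
  then have TL: "T \<in> Lpr"
    using Si S0 p_gt_1 by (auto simp: Lp_def T_def powr_powr)
  have gL: "g \<in> Lpr"
    unfolding g_def[abs_def] using Lp_add[OF Lp_norm[OF f[of "r 0"]] Lp_cmult[OF TL, of 2]] by simp
  have fsum: "f (r n) x = f (r 0) x + (\<Sum>k<n. d k x)" for n x
    by (induction n) (auto simp: d_def)
  define u where "u x = f (r 0) x + (\<Sum>k. d k x)" for x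
  have geo: "summable (\<lambda>k. (1/2::real) ^ k * t)" for t by (intro summable_mult2 summable_geometric) auto
  have "dom_conv (\<lambda>n. f (r n)) u"
  proof (rule dom_convI[OF _ gL])
    show "AE x in M. norm (f (r n) x) \<le> g x" for n
      using dT
    proof eventually_elim
      case (elim x)
      have "norm (\<Sum>k<n. d k x) \<le> (\<Sum>k<n. (1/2) ^ k * T x)"
        using elim by (intro sum_norm_le) auto
      also have "\<dots> \<le> (\<Sum>k. (1/2) ^ k * T x)"
        by (intro sum_le_suminf geo) (auto simp: T_def)
      also have "\<dots> = 2 * T x"
        by (subst suminf_mult2[symmetric]) (auto simp: suminf_geometric intro: summable_geometric)
      finally show ?case unfolding fsum[of n] g_def
        using norm_triangle_ineq[of "f (r 0) x" "\<Sum>k<n. d k x"] by linarith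
    qed
    show "AE x in M. (\<lambda>n. f (r n) x) \<longlonglongrightarrow> u x"
      using dT
    proof eventually_elim
      case (elim x)
      have "summable (\<lambda>k. d k x)"
        by (rule summable_comparison_test'[OF geo[of "T x"]]) (use elim in auto)
      then have "(\<lambda>n. \<Sum>k<n. d k x) \<longlonglongrightarrow> (\<Sum>k. d k x)" by (rule summable_LIMSEQ)
      then have "(\<lambda>n. f (r 0) x + (\<Sum>k<n. d k x)) \<longlonglongrightarrow> u x" unfolding u_def by (intro tendsto_intros)
      then show ?case by (simp add: fsum[symmetric])
    qed
  qed measurable
  with r show ?thesis by (rule that)
qed

lemma integral_powr_zero_AE:
  assumes "f \<in> Lp \<Omega> p" "(\<integral>x. norm (f x) powr p \<partial>M) = 0"
  shows "AE x in M. f x = 0"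
  using integral_nonneg_eq_0_iff_AE[OF Lp_D(2)[OF assms(1)]] assms(2) by (auto elim!: eventually_mono)

lemma Lp_dist_triangle:
  fixes a b c :: "'a \<Rightarrow> 'b::euclidean_space"
  assumes "a \<in> Lp \<Omega> p" "b \<in> Lp \<Omega> p" "c \<in> Lp \<Omega> p"
  shows "(\<integral>x. norm (a x - c x) powr p \<partial>M) \<le> 2 powr p * ((\<integral>x. norm (a x - b x) powr p \<partial>M) + (\<integral>x. norm (b x - c x) powr p \<partial>M))"
proof -
  note i = Lp_D(2)[OF Lp_diff[OF assms(1,2)]] Lp_D(2)[OF Lp_diff[OF assms(1,3)]] Lp_D(2)[OF Lp_diff[OF assms(2,3)]]
  have "(\<integral>x. norm (a x - c x) powr p \<partial>M) \<le> (\<integral>x. 2 powr p * (norm (a x - b x) powr p + norm (b x - c x) powr p) \<partial>M)"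
  proof (rule integral_mono)
    fix x show "norm (a x - c x) powr p \<le> 2 powr p * (norm (a x - b x) powr p + norm (b x - c x) powr p)"
      using norm_add_powr_le[of p "a x - b x" "b x - c x"] p_gt_1 by simp
  qed (use i in auto)
  then show ?thesis using i by simp
qed

text \<open>A convergent sequence is Cauchy, and the dominated limit of a subsequence must agree almost
  everywhere with the limit in norm.\<close>

lemma Lp_conv_subseq:
  fixes f :: "nat \<Rightarrow> 'a \<Rightarrow> 'b::euclidean_space"
  assumes f: "\<And>n. f n \<in> Lp \<Omega> p" and u: "u \<in> Lp \<Omega> p"
    and lim: "(\<lambda>n. \<integral>x. norm (f n x - u x) powr p \<partial>M) \<longlonglongrightarrow> 0"
  obtains r where "strict_mono r" "dom_conv (\<lambda>n. f (r n)) u"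
proof -
  have tri: "(\<integral>x. norm (a x - b x) powr p \<partial>M) \<le> 2 powr p * ((\<integral>x. norm (a x - c x) powr p \<partial>M) + (\<integral>x. norm (b x - c x) powr p \<partial>M))"
    if "a \<in> Lp \<Omega> p" "b \<in> Lp \<Omega> p" "c \<in> Lp \<Omega> p" for a b c :: "'a \<Rightarrow> 'b"
    using Lp_dist_triangle[OF that(1,3,2)] by (simp add: norm_minus_commute)
  have "\<exists>N. \<forall>m\<ge>N. \<forall>n\<ge>N. (\<integral>x. norm (f m x - f n x) powr p \<partial>M) < e" if "e > 0" for e
  proof -
    let ?e = "e / (2 * 2 powr p)"
    have "?e > 0" using that by simp
    then obtain N where N: "\<And>n. n \<ge> N \<Longrightarrow> (\<integral>x. norm (f n x - u x) powr p \<partial>M) < ?e"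
      using order_tendstoD(2)[OF lim] by (auto simp: eventually_sequentially)
    have "(\<integral>x. norm (f m x - f n x) powr p \<partial>M) < e" if "m \<ge> N" "n \<ge> N" for m n
    proof -
      have "(\<integral>x. norm (f m x - f n x) powr p \<partial>M) < 2 powr p * (?e + ?e)"
        using tri[OF f f u, of m n] N[OF that(1)] N[OF that(2)]
        by (smt (verit) mult_less_cancel_left_pos powr_gt_zero)
      then show ?thesis by (simp add: field_simps)
    qed
    then show ?thesis by blast
  qed
  from Lp_Cauchy_subseq[OF f this] obtain r v where r: "strict_mono r" and v: "dom_conv (\<lambda>n. f (r n)) v"
    by metis
  note vL = dom_conv_Lp(2)[OF v]
  have "(\<lambda>n. 2 powr p * ((\<integral>x. norm (f (r n) x - u x) powr p \<partial>M) + (\<integral>x. norm (f (r n) x - v x) powr p \<partial>M))) \<longlonglongrightarrow> 2 powr p * (0 + 0)"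
    using LIMSEQ_subseq_LIMSEQ[OF lim r] dom_conv_norm[OF v] by (intro tendsto_intros) (auto simp: o_def)
  moreover have "(\<integral>x. norm (u x - v x) powr p \<partial>M) \<le> 2 powr p * ((\<integral>x. norm (f (r n) x - u x) powr p \<partial>M) + (\<integral>x. norm (f (r n) x - v x) powr p \<partial>M))" for n
    using tri[OF u vL f[of "r n"]] by (simp add: norm_minus_commute)
  ultimately have "(\<integral>x. norm (u x - v x) powr p \<partial>M) \<le> 2 powr p * (0 + 0)"
    by (intro LIMSEQ_le_const[where X = "\<lambda>n. 2 powr p * ((\<integral>x. norm (f (r n) x - u x) powr p \<partial>M) + (\<integral>x. norm (f (r n) x - v x) powr p \<partial>M))"]) blast+
  then have "(\<integral>x. norm (u x - v x) powr p \<partial>M) = 0"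
    by (intro antisym) auto
  then have "AE x in M. u x - v x = 0" by (rule integral_powr_zero_AE[OF Lp_diff[OF u vL]])
  then have "AE x in M. v x = u x" by eventually_elim auto
  then have "dom_conv (\<lambda>n. f (r n)) u"
    using v unfolding dom_conv_def by (auto elim: eventually_elim2)
  with r show ?thesis by (rule that)
qed

section \<open>The space \<open>W\<^sub>0\<^sup>1\<^sup>,\<^sup>p\<close> through dominated approximation\<close>

text \<open>Lebesgue measure is complete, so measurability, and with it integrability, is not affected by
  changes on a null set; neither side has to be assumed measurable.\<close>

lemma integral_eq_AE:
  fixes f g :: "'a \<Rightarrow> 'b::euclidean_space"
  assumes "AE x in M. f x = g x"
  shows "(\<integral>x. f x \<partial>M) = (\<integral>x. g x \<partial>M)" "integrable M f \<longleftrightarrow> integrable M g"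
proof -
  have a: "AE x in M. g x = f x" using assms by eventually_elim simp
  have m: "f \<in> borel_measurable M \<longleftrightarrow> g \<in> borel_measurable M"
    using measurable_AE_eq[OF _ assms] measurable_AE_eq[OF _ a] by metis
  show i: "integrable M f \<longleftrightarrow> integrable M g"
  proof
    assume "integrable M f"
    then show "integrable M g"
      by (rule integrable_cong_AE_imp[OF _ _ assms]) (use m \<open>integrable M f\<close> in \<open>simp add: borel_measurable_integrable flip: m\<close>)
  next
    assume "integrable M g"
    then show "integrable M f"
      by (rule integrable_cong_AE_imp[OF _ _ a]) (use \<open>integrable M g\<close> in \<open>simp add: borel_measurable_integrable m\<close>)
  qed
  show "(\<integral>x. f x \<partial>M) = (\<integral>x. g x \<partial>M)"
  proof (cases "integrable M f")
    case True
    then have "integrable M g" using i by simp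
    with True show ?thesis using assms by (intro integral_cong_AE borel_measurable_integrable)
  next
    case False
    then have "\<not> integrable M g" using i by simp
    with False show ?thesis by (simp add: not_integrable_integral_eq)
  qed
qed

lemma bounded_mult_integrable:
  fixes f :: "'a \<Rightarrow> 'b::euclidean_space"
  assumes "integrable M f" "g \<in> borel_measurable M" "\<And>x. \<bar>g x\<bar> \<le> B"
  shows "integrable M (\<lambda>x. g x *\<^sub>R f x)"
proof (rule Bochner_Integration.integrable_bound)
  show "integrable M (\<lambda>x. B *\<^sub>R f x)" using assms(1) by simp
  show "(\<lambda>x. g x *\<^sub>R f x) \<in> borel_measurable M"
    using assms by (intro borel_measurable_scaleR) auto
  show "AE x in M. norm (g x *\<^sub>R f x) \<le> norm (B *\<^sub>R f x)"
  proof (rule AE_I2)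
    fix x
    have "\<bar>g x\<bar> * norm (f x) \<le> B * norm (f x)" by (intro mult_right_mono assms(3)) auto
    moreover have "0 \<le> B" using assms(3)[of x] by linarith
    ultimately show "norm (g x *\<^sub>R f x) \<le> norm (B *\<^sub>R f x)" by simp
  qed
qed

lemma bounded_scaleR_integrable:
  fixes g :: "'a \<Rightarrow> 'b::euclidean_space"
  assumes "integrable M f" "g \<in> borel_measurable M" "\<And>x. norm (g x) \<le> B"
  shows "integrable M (\<lambda>x. f x *\<^sub>R g x)"
proof (rule Bochner_Integration.integrable_bound)
  show "integrable M (\<lambda>x. B * f x)" using assms(1) by simp
  show "(\<lambda>x. f x *\<^sub>R g x) \<in> borel_measurable M"
    using assms by (intro borel_measurable_scaleR) auto
  show "AE x in M. norm (f x *\<^sub>R g x) \<le> norm (B * f x)"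
  proof (rule AE_I2)
    fix x
    have "\<bar>f x\<bar> * norm (g x) \<le> \<bar>f x\<bar> * B" by (intro mult_left_mono assms(3)) auto
    moreover have "0 \<le> B" using assms(3)[of x] norm_ge_zero[of "g x"] by linarith
    ultimately show "norm (f x *\<^sub>R g x) \<le> norm (B * f x)" by (simp add: abs_mult mult.commute)
  qed
qed

lemma test_measurable:
  assumes "\<phi> \<in> test_functions \<Omega>"
  shows "\<phi> \<in> borel_measurable M" "grad \<phi> \<in> borel_measurable M"
  using smooth_measurable test_functions_smooth[OF assms] by auto

lemma bounded_Lp:
  fixes f :: "'a \<Rightarrow> 'b::euclidean_space"
  assumes "f \<in> borel_measurable M" "\<And>x. norm (f x) \<le> B"
  shows "f \<in> Lp \<Omega> p"
  by (rule Lp_bound[OF assms(1) Lp_const[of B]])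
     (use assms(2) in \<open>auto intro!: AE_I2 intro: order_trans abs_ge_self\<close>)

lemma test_Lp:
  assumes "\<phi> \<in> test_functions \<Omega>"
  shows "\<phi> \<in> Lp \<Omega> p" "grad \<phi> \<in> Lp \<Omega> p"
proof -
  obtain B where "\<And>x. \<bar>\<phi> x\<bar> \<le> B" "\<And>x. norm (grad \<phi> x) \<le> B" using test_function_bounded[OF assms] by metis
  then show "\<phi> \<in> Lp \<Omega> p" "grad \<phi> \<in> Lp \<Omega> p"
    using test_measurable[OF assms] bounded_Lp[of \<phi> B] bounded_Lp[of "grad \<phi>" B] by auto
qed

lemma integral_M_eq_lborel:
  fixes f :: "'a \<Rightarrow> 'b::euclidean_space"
  assumes "f \<in> borel_measurable borel" "\<And>x. x \<notin> \<Omega> \<Longrightarrow> f x = 0"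
  shows "(\<integral>x. f x \<partial>M) = (\<integral>x. f x \<partial>lborel)"
proof -
  have "(\<integral>x. f x \<partial>M) = (\<integral>x. indicat_real \<Omega> x *\<^sub>R f x \<partial>lebesgue)"
    by (subst integral_restrict_space) auto
  also have "\<dots> = (\<integral>x. f x \<partial>lebesgue)"
    by (rule Bochner_Integration.integral_cong) (use assms(2) in \<open>auto simp: indicator_def\<close>)
  also have "\<dots> = (\<integral>x. f x \<partial>lborel)" using assms(1) by (intro integral_completion) simp
  finally show ?thesis .
qed

text \<open>The gradient of the product \<open>\<phi> \<psi>\<close> integrates to zero.\<close>

lemma integral_by_parts:
  assumes \<phi>: "\<phi> \<in> test_functions \<Omega>" and \<psi>: "\<psi> \<in> test_functions \<Omega>"
  shows "(\<integral>x. \<psi> x *\<^sub>R grad \<phi> x \<partial>M) = - (\<integral>x. \<phi> x *\<^sub>R grad \<psi> x \<partial>M)"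
proof -
  have s: "smooth \<phi>" "smooth \<psi>" using assms by (auto intro: test_functions_smooth)
  have t: "(\<lambda>x. \<psi> x * \<phi> x) \<in> test_functions \<Omega>" by (rule test_functions_mult[OF \<psi> s(1)])
  obtain B1 where B1: "\<And>x. \<bar>\<phi> x\<bar> \<le> B1" using test_function_bounded[OF \<phi>] by metis
  obtain B2 where B2: "\<And>x. \<bar>\<psi> x\<bar> \<le> B2" using test_function_bounded[OF \<psi>] by metis
  have i: "integrable M (\<lambda>x. \<psi> x *\<^sub>R grad \<phi> x)" "integrable M (\<lambda>x. \<phi> x *\<^sub>R grad \<psi> x)"
    using bounded_mult_integrable[OF Lp_integrable[OF test_Lp(2)[OF \<phi>]] test_measurable(1)[OF \<psi>] B2]
      bounded_mult_integrable[OF Lp_integrable[OF test_Lp(2)[OF \<psi>]] test_measurable(1)[OF \<phi>] B1] by auto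
  have "(\<integral>x. \<psi> x *\<^sub>R grad \<phi> x + \<phi> x *\<^sub>R grad \<psi> x \<partial>M) = 0"
  proof (rule euclidean_eqI)
    fix b :: 'a assume "b \<in> Basis"
    have "(\<integral>x. \<psi> x *\<^sub>R grad \<phi> x + \<phi> x *\<^sub>R grad \<psi> x \<partial>M) \<bullet> b = (\<integral>x. (\<psi> x *\<^sub>R grad \<phi> x + \<phi> x *\<^sub>R grad \<psi> x) \<bullet> b \<partial>M)"
      using i by (intro integral_inner_left[symmetric]) auto
    also have "\<dots> = (\<integral>x. grad (\<lambda>x. \<psi> x * \<phi> x) x \<bullet> b \<partial>M)"
      by (simp add: smooth_mult_grad s)
    also have "\<dots> = (\<integral>x. grad (\<lambda>x. \<psi> x * \<phi> x) x \<bullet> b \<partial>lborel)"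
      by (rule integral_M_eq_lborel)
         (use test_function_zero_off_domain(2)[OF t] smooth_borel(2)[OF test_functions_smooth[OF t]] in \<open>auto\<close>)
    also have "\<dots> = 0" by (rule integral_grad_test_function[OF t])
    finally show "(\<integral>x. \<psi> x *\<^sub>R grad \<phi> x + \<phi> x *\<^sub>R grad \<psi> x \<partial>M) \<bullet> b = 0 \<bullet> b" by simp
  qed
  then show ?thesis using i by (simp add: eq_neg_iff_add_eq_0)
qed

lemma Lp_locally_integrable:
  fixes f :: "'a \<Rightarrow> 'b::euclidean_space"
  assumes "f \<in> Lp \<Omega> p" shows "locally_integrable \<Omega> f"
  unfolding locally_integrable_def
proof (intro allI impI)
  fix K assume K: "compact K \<and> K \<subseteq> \<Omega>"
  have "set_integrable lebesgue \<Omega> f"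
    using Lp_integrable[OF assms] by (simp add: integrable_restrict_space set_integrable_def)
  then show "set_integrable lebesgue K f"
    by (rule set_integrable_subset) (use K in \<open>auto intro: lmeasurable_compact fmeasurableD\<close>)
qed

lemma test_times_integrable:
  fixes f :: "'a \<Rightarrow> 'b::euclidean_space"
  assumes f: "locally_integrable \<Omega> f" and \<phi>: "\<phi> \<in> test_functions \<Omega>"
  shows "integrable M (\<lambda>x. \<phi> x *\<^sub>R f x)"
proof -
  let ?K = "closure {x. \<phi> x \<noteq> 0}"
  obtain B where B: "0 < B" "\<And>x. \<bar>\<phi> x\<bar> \<le> B" using test_function_bounded[OF \<phi>] by metis
  have i: "integrable lebesgue (\<lambda>x. indicat_real ?K x *\<^sub>R f x)"
    using f \<phi> by (auto simp: locally_integrable_def test_functions_iff set_integrable_def)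
  have "integrable lebesgue (\<lambda>x. \<phi> x *\<^sub>R (indicat_real ?K x *\<^sub>R f x))"
  proof (rule Bochner_Integration.integrable_bound)
    show "integrable lebesgue (\<lambda>x. B *\<^sub>R (indicat_real ?K x *\<^sub>R f x))" using i by (rule integrable_scaleR_right)
    show "(\<lambda>x. \<phi> x *\<^sub>R indicat_real ?K x *\<^sub>R f x) \<in> borel_measurable lebesgue"
      by (rule borel_measurable_scaleR[OF _ borel_measurable_integrable[OF i]])
         (use smooth_borel(1)[OF test_functions_smooth[OF \<phi>]] in \<open>auto intro: measurable_completion\<close>)
    show "AE x in lebesgue. norm (\<phi> x *\<^sub>R indicat_real ?K x *\<^sub>R f x) \<le> norm (B *\<^sub>R indicat_real ?K x *\<^sub>R f x)"
    proof (rule AE_I2)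
      fix x
      have "\<bar>\<phi> x\<bar> * norm (indicat_real ?K x *\<^sub>R f x) \<le> \<bar>B\<bar> * norm (indicat_real ?K x *\<^sub>R f x)"
        using B(2)[of x] by (intro mult_right_mono) auto
      then show "norm (\<phi> x *\<^sub>R indicat_real ?K x *\<^sub>R f x) \<le> norm (B *\<^sub>R indicat_real ?K x *\<^sub>R f x)"
        by (simp only: norm_scaleR)
    qed
  qed
  moreover have "(\<lambda>x. \<phi> x *\<^sub>R (indicat_real ?K x *\<^sub>R f x)) = (\<lambda>x. indicat_real \<Omega> x *\<^sub>R (\<phi> x *\<^sub>R f x))"
  proof
    fix x show "\<phi> x *\<^sub>R (indicat_real ?K x *\<^sub>R f x) = indicat_real \<Omega> x *\<^sub>R (\<phi> x *\<^sub>R f x)"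
  proof (cases "x \<in> ?K")
    case True
    then have "x \<in> \<Omega>" using \<phi> unfolding test_functions_iff by blast
    then show ?thesis using True by simp
  next
    case False
    then have "\<phi> x = 0" by (rule test_function_zero_outside(1)[OF \<phi>])
    then show ?thesis by simp
  qed
  qed
  ultimately have "integrable lebesgue (\<lambda>x. indicat_real \<Omega> x *\<^sub>R (\<phi> x *\<^sub>R f x))" by (simp only:)
  then show ?thesis by (subst integrable_restrict_space) auto
qed

lemma weak_grad_unique:
  assumes 1: "has_weak_grad \<Omega> u G" and 2: "has_weak_grad \<Omega> v H" and ae: "AE x in M. u x = v x"
  shows "AE x in M. G x = H x"
proof -
  have l: "locally_integrable \<Omega> G" "locally_integrable \<Omega> H" "locally_integrable \<Omega> u" "locally_integrable \<Omega> v"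
    using 1 2 by (auto simp: has_weak_grad_def)
  have "locally_integrable \<Omega> (\<lambda>x. G x - H x)"
    using l unfolding locally_integrable_def by (auto intro: set_integral_diff)
  then have "AE x in M. G x - H x = 0"
  proof (rule fundamental_lemma[OF open_dom])
    fix \<phi> assume \<phi>: "\<phi> \<in> test_functions \<Omega>"
    have "(\<integral>x. \<phi> x *\<^sub>R (G x - H x) \<partial>M) = (\<integral>x. \<phi> x *\<^sub>R G x \<partial>M) - (\<integral>x. \<phi> x *\<^sub>R H x \<partial>M)"
      using test_times_integrable[OF l(1) \<phi>] test_times_integrable[OF l(2) \<phi>]
      by (simp add: scaleR_diff_right)
    also have "\<dots> = (\<integral>x. v x *\<^sub>R grad \<phi> x \<partial>M) - (\<integral>x. u x *\<^sub>R grad \<phi> x \<partial>M)"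
      using 1 2 \<phi> by (auto simp: has_weak_grad_def)
    also have "(\<integral>x. v x *\<^sub>R grad \<phi> x \<partial>M) = (\<integral>x. u x *\<^sub>R grad \<phi> x \<partial>M)"
    proof (rule integral_eq_AE(1))
      show "AE x in M. v x *\<^sub>R grad \<phi> x = u x *\<^sub>R grad \<phi> x" using ae by eventually_elim simp
    qed
    finally show "(\<integral>x. \<phi> x *\<^sub>R (G x - H x) \<partial>M) = 0" by simp
  qed
  then show ?thesis by eventually_elim simp
qed

lemma has_weak_grad_diff:
  assumes 1: "has_weak_grad \<Omega> u G" and 2: "\<phi> \<in> test_functions \<Omega>" and u: "u \<in> Lp \<Omega> p"
  shows "has_weak_grad \<Omega> (\<lambda>x. u x - \<phi> x) (\<lambda>x. G x - grad \<phi> x)"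
proof -
  have l: "locally_integrable \<Omega> G" "locally_integrable \<Omega> (grad \<phi>)" "locally_integrable \<Omega> u" "locally_integrable \<Omega> \<phi>"
    using 1 Lp_locally_integrable[OF test_Lp(1)[OF 2]] Lp_locally_integrable[OF test_Lp(2)[OF 2]]
    by (auto simp: has_weak_grad_def)
  have "(\<integral>x. (u x - \<phi> x) *\<^sub>R grad \<psi> x \<partial>M) = - (\<integral>x. \<psi> x *\<^sub>R (G x - grad \<phi> x) \<partial>M)"
    if \<psi>: "\<psi> \<in> test_functions \<Omega>" for \<psi>
  proof -
    obtain B where B: "\<And>x. norm (grad \<psi> x) \<le> B" using test_function_bounded[OF \<psi>] by metis
    have "(\<integral>x. (u x - \<phi> x) *\<^sub>R grad \<psi> x \<partial>M) = (\<integral>x. u x *\<^sub>R grad \<psi> x \<partial>M) - (\<integral>x. \<phi> x *\<^sub>R grad \<psi> x \<partial>M)"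
      using bounded_scaleR_integrable[OF Lp_integrable[OF u] test_measurable(2)[OF \<psi>] B]
        bounded_scaleR_integrable[OF Lp_integrable[OF test_Lp(1)[OF 2]] test_measurable(2)[OF \<psi>] B]
      by (simp add: scaleR_diff_left)
    also have "\<dots> = - (\<integral>x. \<psi> x *\<^sub>R G x \<partial>M) + (\<integral>x. \<psi> x *\<^sub>R grad \<phi> x \<partial>M)"
      using 1 \<psi> integral_by_parts[OF \<psi> 2] by (simp add: has_weak_grad_def)
    also have "\<dots> = - (\<integral>x. \<psi> x *\<^sub>R (G x - grad \<phi> x) \<partial>M)"
      using test_times_integrable[OF l(1) \<psi>] test_times_integrable[OF l(2) \<psi>]
      by (simp add: scaleR_diff_right)
    finally show ?thesis .
  qed
  moreover have "locally_integrable \<Omega> (\<lambda>x. u x - \<phi> x)" "locally_integrable \<Omega> (\<lambda>x. G x - grad \<phi> x)"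
    using l unfolding locally_integrable_def by (auto intro: set_integral_diff)
  ultimately show ?thesis by (simp add: has_weak_grad_def)
qed

text \<open>\<open>u\<close> belongs to \<open>W\<^sub>0\<^sup>1\<^sup>,\<^sup>p(\<Omega>)\<close> and \<open>G\<close> is a representative of its gradient. Carrying the gradient as an
  argument frees the calculus from the choice made in \<^const>\<open>wgrad\<close>; the equivalence with \<^const>\<open>W1p0\<close>
  is shown below in \<open>sob0_imp_W1p0\<close> and \<open>W1p0_imp_sob0\<close>.\<close>

definition sob0 :: "('a \<Rightarrow> real) \<Rightarrow> ('a \<Rightarrow> 'a) \<Rightarrow> bool" where
  "sob0 u G \<longleftrightarrow> (\<exists>f. (\<forall>n. f n \<in> test_functions \<Omega>) \<and> dom_conv f u \<and> dom_conv (\<lambda>n. grad (f n)) G)"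

lemma sob0_Lp:
  assumes "sob0 u G" shows "u \<in> Lp \<Omega> p" "G \<in> Lp \<Omega> p"
  using assms dom_conv_Lp(2) unfolding sob0_def by blast+

lemma dom_conv_AE_eq:
  assumes "dom_conv f u" "AE x in M. u x = v x" shows "dom_conv f v"
proof -
  have "AE x in M. (\<lambda>n. f n x) \<longlonglongrightarrow> u x" using assms(1) by (simp add: dom_conv_def)
  then have "AE x in M. (\<lambda>n. f n x) \<longlonglongrightarrow> v x"
    using assms(2) by eventually_elim simp
  then show ?thesis using assms(1) by (simp add: dom_conv_def)
qed

lemma sob0_AE_eq:
  assumes "sob0 u G" "AE x in M. u x = v x" "AE x in M. G x = H x" shows "sob0 v H"
proof -
  obtain f where f: "\<And>n. f n \<in> test_functions \<Omega>" "dom_conv f u" "dom_conv (\<lambda>n. grad (f n)) G"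
    using assms(1) unfolding sob0_def by blast
  show ?thesis unfolding sob0_def
    by (intro exI[of _ f] conjI allI f(1) dom_conv_AE_eq[OF f(2) assms(2)] dom_conv_AE_eq[OF f(3) assms(3)])
qed

lemma sob0_add:
  assumes "sob0 u G" "sob0 v H" shows "sob0 (\<lambda>x. u x + v x) (\<lambda>x. G x + H x)"
proof -
  obtain f where f: "\<And>n. f n \<in> test_functions \<Omega>" "dom_conv f u" "dom_conv (\<lambda>n. grad (f n)) G"
    using assms(1) unfolding sob0_def by blast
  obtain g where g: "\<And>n. g n \<in> test_functions \<Omega>" "dom_conv g v" "dom_conv (\<lambda>n. grad (g n)) H"
    using assms(2) unfolding sob0_def by blast
  have "grad (\<lambda>x. f n x + g n x) = (\<lambda>x. grad (f n) x + grad (g n) x)" for n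
    by (intro ext smooth_add_grad test_functions_smooth[where \<Omega> = \<Omega>] f g)
  then show ?thesis unfolding sob0_def
    by (intro exI[of _ "\<lambda>n x. f n x + g n x"]) (simp add: f g test_functions_add dom_conv_add)
qed

lemma sob0_cmult:
  assumes "sob0 u G" shows "sob0 (\<lambda>x. c * u x) (\<lambda>x. c *\<^sub>R G x)"
proof -
  obtain f where f: "\<And>n. f n \<in> test_functions \<Omega>" "dom_conv f u" "dom_conv (\<lambda>n. grad (f n)) G"
    using assms(1) unfolding sob0_def by blast
  have "grad (\<lambda>x. c * f n x) = (\<lambda>x. c *\<^sub>R grad (f n) x)" for n
    by (intro ext smooth_cmult_grad test_functions_smooth[where \<Omega> = \<Omega>] f)
  then show ?thesis unfolding sob0_def
    using dom_conv_cmult[OF f(2), of c] dom_conv_cmult[OF f(3), of c]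
    by (intro exI[of _ "\<lambda>n x. c * f n x"]) (simp add: f test_functions_cmult)
qed

text \<open>Two successive subsequences give dominated convergence of the functions and of their gradients.\<close>

lemma sob0_by_norm:
  assumes f: "\<And>n. f n \<in> test_functions \<Omega>" and L: "u \<in> Lp \<Omega> p" "G \<in> Lp \<Omega> p"
    and lim: "(\<lambda>n. \<integral>x. \<bar>f n x - u x\<bar> powr p \<partial>M) \<longlonglongrightarrow> 0"
      "(\<lambda>n. \<integral>x. norm (grad (f n) x - G x) powr p \<partial>M) \<longlonglongrightarrow> 0"
  shows "sob0 u G"
proof -
  obtain r where r: "strict_mono r" "dom_conv (\<lambda>n. f (r n)) u"
    by (rule Lp_conv_subseq[of f u]) (use f L lim in \<open>auto intro: test_Lp\<close>)
  have "(\<lambda>n. \<integral>x. norm (grad (f (r n)) x - G x) powr p \<partial>M) \<longlonglongrightarrow> 0"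
    using LIMSEQ_subseq_LIMSEQ[OF lim(2) r(1)] by (simp add: o_def)
  then obtain s where s: "strict_mono s" "dom_conv (\<lambda>n. grad (f (r (s n)))) G"
    by (rule Lp_conv_subseq[of "\<lambda>n. grad (f (r n))" G, rotated 2]) (use f L in \<open>auto intro: test_Lp\<close>)
  show ?thesis unfolding sob0_def
    by (rule exI[of _ "\<lambda>n. f (r (s n))"]) (use f s dom_conv_subseq[OF r(2) s(1)] in auto)
qed

lemma sob0_approx:
  assumes "sob0 u G" "0 < e"
  shows "\<exists>\<phi>\<in>test_functions \<Omega>. (\<integral>x. norm (\<phi> x - u x) powr p \<partial>M) < e \<and> (\<integral>x. norm (grad \<phi> x - G x) powr p \<partial>M) < e"
proof -
  obtain f where f: "\<And>n. f n \<in> test_functions \<Omega>" "dom_conv f u" "dom_conv (\<lambda>n. grad (f n)) G"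
    using assms(1) unfolding sob0_def by blast
  have "\<forall>\<^sub>F n in sequentially. (\<integral>x. norm (f n x - u x) powr p \<partial>M) < e \<and> (\<integral>x. norm (grad (f n) x - G x) powr p \<partial>M) < e"
    using order_tendstoD(2)[OF dom_conv_norm[OF f(2)] assms(2)] order_tendstoD(2)[OF dom_conv_norm[OF f(3)] assms(2)]
    by eventually_elim simp
  from eventually_happens'[OF sequentially_bot this] show ?thesis using f(1) by blast
qed

text \<open>Integration by parts passes to the limit, since a fixed test function and its gradient are bounded.\<close>

lemma sob0_weak_grad:
  assumes "sob0 u G" shows "has_weak_grad \<Omega> u G"
  unfolding has_weak_grad_def
proof (intro conjI ballI)
  show "locally_integrable \<Omega> u" "locally_integrable \<Omega> G"
    using sob0_Lp[OF assms] by (auto intro: Lp_locally_integrable)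
  fix \<phi> assume \<phi>: "\<phi> \<in> test_functions \<Omega>"
  obtain f where f: "\<And>n. f n \<in> test_functions \<Omega>" "dom_conv f u" "dom_conv (\<lambda>n. grad (f n)) G"
    using assms(1) unfolding sob0_def by blast
  obtain B where B: "0 < B" "\<And>x. \<bar>\<phi> x\<bar> \<le> B" "\<And>x. norm (grad \<phi> x) \<le> B"
    using test_function_bounded[OF \<phi>] by metis
  have le: "t \<le> 1 + \<bar>s\<bar> powr p" if "t \<le> s" "0 \<le> t" for t s :: real
    using le_one_add_powr[OF p_gt_1, of s] that by simp
  obtain g where g: "g \<in> Lpr" "AE x in M. \<forall>n. norm (f n x) \<le> g x" "AE x in M. (\<lambda>n. f n x) \<longlonglongrightarrow> u x"
    using dom_convE[OF f(2)] by blast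
  obtain h where h: "h \<in> Lpr" "AE x in M. \<forall>n. norm (grad (f n) x) \<le> h x" "AE x in M. (\<lambda>n. grad (f n) x) \<longlonglongrightarrow> G x"
    using dom_convE[OF f(3)] by blast
  have 1: "(\<lambda>n. \<integral>x. f n x *\<^sub>R grad \<phi> x \<partial>M) \<longlonglongrightarrow> (\<integral>x. u x *\<^sub>R grad \<phi> x \<partial>M)"
  proof (rule integral_dom_conv(1)[OF g(1)])
    show "(\<lambda>x. f n x *\<^sub>R grad \<phi> x) \<in> borel_measurable M" for n
      by (intro borel_measurable_scaleR test_measurable f \<phi>)
    show "AE x in M. \<forall>n. norm (f n x *\<^sub>R grad \<phi> x) \<le> B * (1 + \<bar>g x\<bar> powr p)"
      using g(2)
    proof eventually_elim
      case (elim x)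
      have "norm (f n x) * norm (grad \<phi> x) \<le> (1 + \<bar>g x\<bar> powr p) * B" for n
        using elim by (intro mult_mono le B(3)) auto
      then show ?case by (simp add: mult.commute)
    qed
    show "AE x in M. (\<lambda>n. f n x *\<^sub>R grad \<phi> x) \<longlonglongrightarrow> u x *\<^sub>R grad \<phi> x"
      using g(3) by eventually_elim (intro tendsto_intros)
  qed
  have 2: "(\<lambda>n. \<integral>x. \<phi> x *\<^sub>R grad (f n) x \<partial>M) \<longlonglongrightarrow> (\<integral>x. \<phi> x *\<^sub>R G x \<partial>M)"
  proof (rule integral_dom_conv(1)[OF h(1)])
    show "(\<lambda>x. \<phi> x *\<^sub>R grad (f n) x) \<in> borel_measurable M" for n
      by (intro borel_measurable_scaleR test_measurable f \<phi>)
    show "AE x in M. \<forall>n. norm (\<phi> x *\<^sub>R grad (f n) x) \<le> B * (1 + \<bar>h x\<bar> powr p)"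
      using h(2)
    proof eventually_elim
      case (elim x)
      have "\<bar>\<phi> x\<bar> * norm (grad (f n) x) \<le> B * (1 + \<bar>h x\<bar> powr p)" for n
        using elim B(1) by (intro mult_mono le B(2)) auto
      then show ?case by simp
    qed
    show "AE x in M. (\<lambda>n. \<phi> x *\<^sub>R grad (f n) x) \<longlonglongrightarrow> \<phi> x *\<^sub>R G x"
      using h(3) by eventually_elim (intro tendsto_intros)
  qed
  have "(\<integral>x. f n x *\<^sub>R grad \<phi> x \<partial>M) = - (\<integral>x. \<phi> x *\<^sub>R grad (f n) x \<partial>M)" for n
    by (rule integral_by_parts[OF \<phi> f(1)])
  then have "(\<lambda>n. \<integral>x. f n x *\<^sub>R grad \<phi> x \<partial>M) \<longlonglongrightarrow> - (\<integral>x. \<phi> x *\<^sub>R G x \<partial>M)"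
    using tendsto_minus[OF 2] by simp
  with 1 show "(\<integral>x. u x *\<^sub>R grad \<phi> x \<partial>M) = - (\<integral>x. \<phi> x *\<^sub>R G x \<partial>M)"
    by (rule LIMSEQ_unique)
qed

lemma wgrad_AE_eq:
  assumes "has_weak_grad \<Omega> u G" shows "AE x in M. wgrad \<Omega> u x = G x"
proof -
  have "has_weak_grad \<Omega> u (wgrad \<Omega> u)" unfolding wgrad_def using assms by (rule someI[where P = "has_weak_grad \<Omega> u"])
  then show ?thesis using assms by (rule weak_grad_unique) simp
qed

lemma sob0_imp_W1p0:
  assumes "sob0 u G" shows "u \<in> W1p0 \<Omega> p" "AE x in M. wgrad \<Omega> u x = G x"
proof -
  show "AE x in M. wgrad \<Omega> u x = G x" by (rule wgrad_AE_eq[OF sob0_weak_grad[OF assms]])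
  obtain f where f: "\<And>n. f n \<in> test_functions \<Omega>" "dom_conv f u" "dom_conv (\<lambda>n. grad (f n)) G"
    using assms(1) unfolding sob0_def by blast
  have W: "W1p_norm \<Omega> p (\<lambda>x. u x - f n x) =
    ((\<integral>x. \<bar>f n x - u x\<bar> powr p \<partial>M) + (\<integral>x. norm (grad (f n) x - G x) powr p \<partial>M)) powr (1 / p)" for n
  proof -
    have "AE x in M. wgrad \<Omega> (\<lambda>x. u x - f n x) x = G x - grad (f n) x"
      by (intro wgrad_AE_eq has_weak_grad_diff sob0_weak_grad[OF assms] f sob0_Lp[OF assms])
    then have "AE x in M. norm (wgrad \<Omega> (\<lambda>x. u x - f n x) x) powr p = norm (grad (f n) x - G x) powr p"
      by eventually_elim (simp add: norm_minus_commute)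
    from integral_eq_AE(1)[OF this] show ?thesis by (simp add: W1p_norm_def abs_minus_commute)
  qed
  have "(\<lambda>n. (\<integral>x. \<bar>f n x - u x\<bar> powr p \<partial>M) + (\<integral>x. norm (grad (f n) x - G x) powr p \<partial>M)) \<longlonglongrightarrow> 0 + 0"
    using dom_conv_norm[OF f(2)] dom_conv_norm[OF f(3)] by (intro tendsto_add) auto
  then have "(\<lambda>n. W1p_norm \<Omega> p (\<lambda>x. u x - f n x)) \<longlonglongrightarrow> 0"
    unfolding W using p_gt_1 by (intro tendsto_powr_zero_iff) auto
  then have "\<exists>\<phi>\<in>test_functions \<Omega>. W1p_norm \<Omega> p (\<lambda>x. u x - \<phi> x) < \<epsilon>" if "\<epsilon> > 0" for \<epsilon>
    using order_tendstoD(2)[OF _ that] f(1) by (fastforce simp: eventually_sequentially)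
  then show "u \<in> W1p0 \<Omega> p"
    using sob0_Lp[OF assms] sob0_weak_grad[OF assms] by (auto simp: W1p0_def W1p_def)
qed

lemma W1p0_imp_sob0:
  assumes "u \<in> W1p0 \<Omega> p" shows "sob0 u (wgrad \<Omega> u)"
proof -
  obtain G where uL: "u \<in> Lp \<Omega> p" and G: "has_weak_grad \<Omega> u G" "G \<in> Lp \<Omega> p"
    using assms by (auto simp: W1p0_def W1p_def)
  have w: "has_weak_grad \<Omega> u (wgrad \<Omega> u)" unfolding wgrad_def using G(1) by (rule someI[where P = "has_weak_grad \<Omega> u"])
  have ae: "AE x in M. G x = wgrad \<Omega> u x" using weak_grad_unique[OF G(1) w] by simp
  have wL: "wgrad \<Omega> u \<in> Lp \<Omega> p" by (rule Lp_AE_eq[OF G(2) ae])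
  define e where "e n = inverse (real (Suc n))" for n
  have e: "e n > 0" for n by (simp add: e_def)
  have "\<forall>n. \<exists>\<phi>\<in>test_functions \<Omega>. W1p_norm \<Omega> p (\<lambda>x. u x - \<phi> x) < e n"
    using assms e by (auto simp: W1p0_def)
  then obtain f where f: "\<And>n. f n \<in> test_functions \<Omega>" and fe: "\<And>n. W1p_norm \<Omega> p (\<lambda>x. u x - f n x) < e n"
    by metis
  define A where "A n = (\<integral>x. \<bar>f n x - u x\<bar> powr p \<partial>M)" for n
  define B where "B n = (\<integral>x. norm (grad (f n) x - wgrad \<Omega> u x) powr p \<partial>M)" for n
  have AB0: "0 \<le> A n" "0 \<le> B n" for n by (auto simp: A_def B_def)
  have AB: "A n + B n \<le> e n powr p" for n
  proof -
    have "AE x in M. wgrad \<Omega> (\<lambda>x. u x - f n x) x = wgrad \<Omega> u x - grad (f n) x"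
      by (intro wgrad_AE_eq has_weak_grad_diff w f uL)
    then have "AE x in M. norm (wgrad \<Omega> (\<lambda>x. u x - f n x) x) powr p = norm (grad (f n) x - wgrad \<Omega> u x) powr p"
      by eventually_elim (simp add: norm_minus_commute)
    from integral_eq_AE(1)[OF this] have "W1p_norm \<Omega> p (\<lambda>x. u x - f n x) = (A n + B n) powr (1/p)"
      by (simp add: W1p_norm_def A_def B_def abs_minus_commute)
    then have "((A n + B n) powr (1/p)) powr p \<le> e n powr p"
      using fe[of n] p_gt_1 by (intro powr_mono2) auto
    then show ?thesis using AB0[of n] p_gt_1 by (simp add: powr_powr)
  qed
  have "e \<longlonglongrightarrow> 0" unfolding e_def[abs_def] by (rule LIMSEQ_inverse_real_of_nat)
  then have ep: "(\<lambda>n. e n powr p) \<longlonglongrightarrow> 0" using p_gt_1 e by (intro tendsto_powr_zero_iff) (auto intro: less_imp_le)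
  have "A n \<le> e n powr p" "B n \<le> e n powr p" for n using AB[of n] AB0[of n] by linarith+
  then have "A \<longlonglongrightarrow> 0" "B \<longlonglongrightarrow> 0"
    using AB0 tendsto_sandwich[OF _ _ tendsto_const ep, of A] tendsto_sandwich[OF _ _ tendsto_const ep, of B]
    by auto
  then show ?thesis
    unfolding A_def[abs_def] B_def[abs_def] by (intro sob0_by_norm[OF f uL wL])
qed

text \<open>A test function close to \<open>u k\<close> in norm is chosen for each \<open>k\<close>. These test functions converge
  in norm, and this suffices by \<open>sob0_by_norm\<close>.\<close>

lemma sob0_closed:
  assumes s: "\<And>k. sob0 (u k) (G k)" and u: "dom_conv u U" and G: "dom_conv G H"
  shows "sob0 U H"
proof -
  define e where "e n = inverse (real (Suc n))" for n
  have e: "e n > 0" for n by (simp add: e_def)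
  have e0: "e \<longlonglongrightarrow> 0" unfolding e_def[abs_def] by (rule LIMSEQ_inverse_real_of_nat)
  have "\<forall>k. \<exists>\<phi>. \<phi> \<in> test_functions \<Omega> \<and> (\<integral>x. norm (\<phi> x - u k x) powr p \<partial>M) < e k \<and> (\<integral>x. norm (grad \<phi> x - G k x) powr p \<partial>M) < e k"
    by (intro allI sob0_approx[unfolded Bex_def] s e)
  from choice[OF this] obtain f where f: "\<And>k. f k \<in> test_functions \<Omega>"
    and f1: "\<And>k. (\<integral>x. norm (f k x - u k x) powr p \<partial>M) < e k"
    and f2: "\<And>k. (\<integral>x. norm (grad (f k) x - G k x) powr p \<partial>M) < e k"
    by auto
  have tri: "(\<lambda>k. \<integral>x. norm (a k x - c x) powr p \<partial>M) \<longlonglongrightarrow> 0"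
    if a: "\<And>k. a k \<in> Lp \<Omega> p" and b: "dom_conv b c" and ab: "\<And>k. (\<integral>x. norm (a k x - b k x) powr p \<partial>M) < e k"
    for a b :: "nat \<Rightarrow> 'a \<Rightarrow> 'b::euclidean_space" and c
  proof (rule tendsto_sandwich[OF _ _ tendsto_const])
    let ?r = "\<lambda>k. 2 powr p * (e k + (\<integral>x. norm (b k x - c x) powr p \<partial>M))"
    have "?r \<longlonglongrightarrow> 2 powr p * (0 + 0)" by (intro tendsto_intros e0 dom_conv_norm[OF b])
    then show "?r \<longlonglongrightarrow> 0" by simp
    have "(\<integral>x. norm (a k x - c x) powr p \<partial>M) \<le> ?r k" for k
    proof -
      have "(\<integral>x. norm (a k x - c x) powr p \<partial>M) \<le>
          2 powr p * ((\<integral>x. norm (a k x - b k x) powr p \<partial>M) + (\<integral>x. norm (b k x - c x) powr p \<partial>M))"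
        by (rule Lp_dist_triangle[OF a dom_conv_Lp(1)[OF b] dom_conv_Lp(2)[OF b]])
      also have "\<dots> \<le> ?r k" using ab[of k] by (intro mult_left_mono add_right_mono) auto
      finally show ?thesis .
    qed
    then show "\<forall>\<^sub>F k in sequentially. (\<integral>x. norm (a k x - c x) powr p \<partial>M) \<le> ?r k" by simp
  qed simp
  show ?thesis
  proof (rule sob0_by_norm[OF f dom_conv_Lp(2)[OF u] dom_conv_Lp(2)[OF G]])
    show "(\<lambda>n. \<integral>x. \<bar>f n x - U x\<bar> powr p \<partial>M) \<longlonglongrightarrow> 0"
      using tri[of f u U] f1 u test_Lp(1)[OF f] by simp
    show "(\<lambda>n. \<integral>x. norm (grad (f n) x - H x) powr p \<partial>M) \<longlonglongrightarrow> 0"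
      using tri[of "\<lambda>n. grad (f n)" G H] f2 G test_Lp(2)[OF f] by simp
  qed
qed

end

section \<open>Chain rules\<close>

lemma smooth_quadratic_powr:
  fixes \<phi> :: "'a::euclidean_space \<Rightarrow> real"
  assumes "smooth \<phi>" "\<kappa> \<noteq> 0"
  shows "smooth (\<lambda>x. ((\<phi> x + \<sigma>)\<^sup>2 + \<kappa>\<^sup>2) powr r)"
proof -
  have "smooth (\<lambda>x. poly 1 (\<phi> x + \<sigma>) * poly [:\<kappa>\<^sup>2, 0, 1:] (\<phi> x + \<sigma>) powr r)"
    by (rule smooth_poly_powr[OF _ smooth_add[OF assms(1) smooth_const]])
       (use assms(2) in \<open>simp add: add_pos_nonneg\<close>)
  then show ?thesis by (simp add: power2_eq_square add.commute)
qed

lemma quadratic_pos: "\<kappa> \<noteq> 0 \<Longrightarrow> 0 < (s::real)\<^sup>2 + \<kappa>\<^sup>2"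
  by (simp add: add_nonneg_pos)

lemma quadratic_powr_has_derivative:
  fixes s :: real
  assumes "\<kappa> \<noteq> 0"
  shows "((\<lambda>s. ((s + \<sigma>)\<^sup>2 + \<kappa>\<^sup>2) powr r) has_real_derivative
     2 * r * (s + \<sigma>) * ((s + \<sigma>)\<^sup>2 + \<kappa>\<^sup>2) powr (r - 1)) (at s)"
proof -
  have "((\<lambda>s. (s + \<sigma>)\<^sup>2 + \<kappa>\<^sup>2) has_real_derivative 2 * (s + \<sigma>)) (at s)"
    by (auto intro!: derivative_eq_intros)
  from DERIV_fun_powr[OF this, of r] quadratic_pos[OF assms, of "s + \<sigma>"]
  show ?thesis by (simp add: mult_ac)
qed

context bounded_domain
begin

lemma dom_conv_compose_bounded:
  assumes f: "dom_conv f u" and F: "continuous_on UNIV (F :: real \<Rightarrow> real)"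
  shows "(\<lambda>x. F (u x)) \<in> borel_measurable M" "(\<lambda>x. F (f n x)) \<in> borel_measurable M"
    "AE x in M. (\<lambda>n. F (f n x)) \<longlonglongrightarrow> F (u x)"
proof -
  note [measurable] = borel_measurable_continuous_onI[OF F] dom_conv_measurable[OF f]
  show "(\<lambda>x. F (u x)) \<in> borel_measurable M" "(\<lambda>x. F (f n x)) \<in> borel_measurable M" by measurable
  have "AE x in M. (\<lambda>n. f n x) \<longlonglongrightarrow> u x" using f by (simp add: dom_conv_def)
  then show "AE x in M. (\<lambda>n. F (f n x)) \<longlonglongrightarrow> F (u x)"
    by eventually_elim (rule continuous_on_tendsto_compose[OF F], auto)
qed

text \<open>Because \<open>F 0 = 0\<close>, composition with \<open>F\<close> preserves test functions, and the bound on the derivative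
  supplies the majorants.\<close>

lemma sob0_chain:
  fixes F F' :: "real \<Rightarrow> real"
  assumes u: "sob0 u G"
    and d: "\<And>s. (F has_real_derivative F' s) (at s)" and c: "continuous_on UNIV F'"
    and b: "\<And>s. \<bar>F' s\<bar> \<le> C" and z: "F 0 = 0"
    and sm: "\<And>\<phi> :: 'a \<Rightarrow> real. smooth \<phi> \<Longrightarrow> smooth (\<lambda>x. F (\<phi> x))"
  shows "sob0 (\<lambda>x. F (u x)) (\<lambda>x. F' (u x) *\<^sub>R G x)"
proof -
  obtain f where f: "\<And>n. f n \<in> test_functions \<Omega>" "dom_conv f u" "dom_conv (\<lambda>n. grad (f n)) G"
    using assms(1) unfolding sob0_def by blast
  have C: "0 \<le> C" using b[of 0] by linarith
  have Fc: "continuous_on UNIV F"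
    using d by (intro continuous_at_imp_continuous_on) (auto intro: DERIV_isCont)
  have lip: "\<bar>F s\<bar> \<le> C * \<bar>s\<bar>" for s
    using field_differentiable_bound[of UNIV F F' C s 0] d b z by auto
  have t: "(\<lambda>x. F (f n x)) \<in> test_functions \<Omega>" for n
    by (rule test_functions_support[OF f(1)[of n]]) (use z sm test_functions_smooth[OF f(1)] in auto)
  have g: "grad (\<lambda>x. F (f n x)) = (\<lambda>x. F' (f n x) *\<^sub>R grad (f n) x)" for n
    by (intro ext grad_eqI GDERIV_DERIV_compose d smooth_GDERIV test_functions_smooth[OF f(1)])
  have AE1: "AE x in M. (\<lambda>n. F (f n x)) \<longlonglongrightarrow> F (u x)" by (rule dom_conv_compose_bounded[OF f(2) Fc])
  have AE2: "AE x in M. (\<lambda>n. F' (f n x)) \<longlonglongrightarrow> F' (u x)" by (rule dom_conv_compose_bounded[OF f(2) c])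
  obtain h where h: "h \<in> Lpr" "AE x in M. \<forall>n. norm (f n x) \<le> h x"
    using dom_convE[OF f(2)] by blast
  obtain k where k: "k \<in> Lpr" "AE x in M. \<forall>n. norm (grad (f n) x) \<le> k x" "AE x in M. (\<lambda>n. grad (f n) x) \<longlonglongrightarrow> G x"
    using dom_convE[OF f(3)] by blast
  have 1: "dom_conv (\<lambda>n x. F (f n x)) (\<lambda>x. F (u x))"
  proof (rule dom_convI[where g = "\<lambda>x. C *\<^sub>R h x", OF _ Lp_cmult[OF h(1)] _ AE1])
    show "(\<lambda>x. F (f n x)) \<in> borel_measurable M" for n by (rule dom_conv_compose_bounded[OF f(2) Fc])
    show "AE x in M. norm (F (f n x)) \<le> C *\<^sub>R h x" for n
      using h(2)
    proof eventually_elim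
      case (elim x)
      have "\<bar>F (f n x)\<bar> \<le> C * \<bar>f n x\<bar>" by (rule lip)
      also have "\<dots> \<le> C * h x" using elim C by (intro mult_left_mono) auto
      finally show ?case by simp
    qed
  qed
  have 2: "dom_conv (\<lambda>n x. F' (f n x) *\<^sub>R grad (f n) x) (\<lambda>x. F' (u x) *\<^sub>R G x)"
  proof (rule dom_convI[where g = "\<lambda>x. C *\<^sub>R k x", OF _ Lp_cmult[OF k(1)]])
    show "(\<lambda>x. F' (f n x) *\<^sub>R grad (f n) x) \<in> borel_measurable M" for n
      by (intro borel_measurable_scaleR dom_conv_compose_bounded[OF f(2) c] test_measurable f)
    show "AE x in M. norm (F' (f n x) *\<^sub>R grad (f n) x) \<le> C *\<^sub>R k x" for n
      using k(2)
    proof eventually_elim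
      case (elim x)
      have "\<bar>F' (f n x)\<bar> * norm (grad (f n) x) \<le> C * k x" using elim C by (intro mult_mono b) auto
      then show ?case by simp
    qed
    show "AE x in M. (\<lambda>n. F' (f n x) *\<^sub>R grad (f n) x) \<longlonglongrightarrow> F' (u x) *\<^sub>R G x"
      using AE2 k(3) by eventually_elim (rule tendsto_scaleR)
  qed
  show ?thesis unfolding sob0_def
    by (rule exI[of _ "\<lambda>n x. F (f n x)"]) (simp add: t g 1 2)
qed

text \<open>The factor \<open>\<phi>\<close> provides the compact support, so that \<open>F\<close> need not vanish at \<open>0\<close>.\<close>

lemma sob0_mult_chain:
  fixes F F' :: "real \<Rightarrow> real"
  assumes \<phi>: "\<phi> \<in> test_functions \<Omega>" and u: "sob0 u G"
    and d: "\<And>s. (F has_real_derivative F' s) (at s)" and c: "continuous_on UNIV F'"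
    and b: "\<And>s. \<bar>F s\<bar> \<le> C" "\<And>s. \<bar>F' s\<bar> \<le> C"
    and sm: "\<And>\<phi> :: 'a \<Rightarrow> real. smooth \<phi> \<Longrightarrow> smooth (\<lambda>x. F (\<phi> x))"
  shows "sob0 (\<lambda>x. \<phi> x * F (u x)) (\<lambda>x. F (u x) *\<^sub>R grad \<phi> x + (\<phi> x * F' (u x)) *\<^sub>R G x)"
proof -
  obtain f where f: "\<And>n. f n \<in> test_functions \<Omega>" "dom_conv f u" "dom_conv (\<lambda>n. grad (f n)) G"
    using u unfolding sob0_def by blast
  have C: "0 \<le> C" using b(1)[of 0] by linarith
  have Fc: "continuous_on UNIV F"
    using d by (intro continuous_at_imp_continuous_on) (auto intro: DERIV_isCont)
  obtain B where B: "0 < B" "\<And>x. \<bar>\<phi> x\<bar> \<le> B" "\<And>x. norm (grad \<phi> x) \<le> B"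
    using test_function_bounded[OF \<phi>] by metis
  have sf: "smooth (f n)" for n by (rule test_functions_smooth[OF f(1)])
  have t: "(\<lambda>x. \<phi> x * F (f n x)) \<in> test_functions \<Omega>" for n
    by (intro test_functions_mult \<phi> sm sf)
  have g: "grad (\<lambda>x. \<phi> x * F (f n x)) = (\<lambda>x. F (f n x) *\<^sub>R grad \<phi> x + (\<phi> x * F' (f n x)) *\<^sub>R grad (f n) x)" for n
  proof
    fix x
    have "GDERIV (\<lambda>x. F (f n x)) x :> F' (f n x) *\<^sub>R grad (f n) x"
      by (intro GDERIV_DERIV_compose d smooth_GDERIV sf)
    from GDERIV_mult[OF smooth_GDERIV[OF test_functions_smooth[OF \<phi>]] this]
    show "grad (\<lambda>x. \<phi> x * F (f n x)) x = F (f n x) *\<^sub>R grad \<phi> x + (\<phi> x * F' (f n x)) *\<^sub>R grad (f n) x"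
      by (intro grad_eqI) (simp add: add.commute)
  qed
  have AE1: "AE x in M. (\<lambda>n. F (f n x)) \<longlonglongrightarrow> F (u x)" by (rule dom_conv_compose_bounded[OF f(2) Fc])
  have AE2: "AE x in M. (\<lambda>n. F' (f n x)) \<longlonglongrightarrow> F' (u x)" by (rule dom_conv_compose_bounded[OF f(2) c])
  obtain k where k: "k \<in> Lpr" "AE x in M. \<forall>n. norm (grad (f n) x) \<le> k x" "AE x in M. (\<lambda>n. grad (f n) x) \<longlonglongrightarrow> G x"
    using dom_convE[OF f(3)] by blast
  have 1: "dom_conv (\<lambda>n x. \<phi> x * F (f n x)) (\<lambda>x. \<phi> x * F (u x))"
  proof (rule dom_convI[where g = "\<lambda>x. B * C", OF _ Lp_const])
    show "(\<lambda>x. \<phi> x * F (f n x)) \<in> borel_measurable M" for n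
      by (intro borel_measurable_times dom_conv_compose_bounded[OF f(2) Fc] test_measurable \<phi>)
    show "AE x in M. norm (\<phi> x * F (f n x)) \<le> B * C" for n
    proof (rule AE_I2)
      fix x
      have "\<bar>\<phi> x\<bar> * \<bar>F (f n x)\<bar> \<le> B * C" using B(1) by (intro mult_mono b B) auto
      then show "norm (\<phi> x * F (f n x)) \<le> B * C" by (simp add: abs_mult)
    qed
    show "AE x in M. (\<lambda>n. \<phi> x * F (f n x)) \<longlonglongrightarrow> \<phi> x * F (u x)"
      using AE1 by eventually_elim (intro tendsto_intros)
  qed
  have 2: "dom_conv (\<lambda>n x. F (f n x) *\<^sub>R grad \<phi> x + (\<phi> x * F' (f n x)) *\<^sub>R grad (f n) x)
    (\<lambda>x. F (u x) *\<^sub>R grad \<phi> x + (\<phi> x * F' (u x)) *\<^sub>R G x)"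
  proof (rule dom_convI[where g = "\<lambda>x. C * B + (B * C) *\<^sub>R k x", OF _ Lp_add[OF Lp_const Lp_cmult[OF k(1)]]])
    show "(\<lambda>x. F (f n x) *\<^sub>R grad \<phi> x + (\<phi> x * F' (f n x)) *\<^sub>R grad (f n) x) \<in> borel_measurable M" for n
      by (intro borel_measurable_scaleR borel_measurable_times borel_measurable_add
          dom_conv_compose_bounded[OF f(2) c] dom_conv_compose_bounded[OF f(2) Fc] test_measurable f \<phi>)
    show "AE x in M. norm (F (f n x) *\<^sub>R grad \<phi> x + (\<phi> x * F' (f n x)) *\<^sub>R grad (f n) x) \<le> C * B + (B * C) *\<^sub>R k x" for n
      using k(2)
    proof eventually_elim
      case (elim x)
      have "\<bar>F (f n x)\<bar> * norm (grad \<phi> x) \<le> C * B" using C by (intro mult_mono b B) auto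
      moreover have "(\<bar>\<phi> x\<bar> * \<bar>F' (f n x)\<bar>) * norm (grad (f n) x) \<le> (B * C) * k x"
        using elim C B(1) by (intro mult_mono b B) auto
      ultimately show ?case
        by (intro norm_triangle_mono) (auto simp: abs_mult)
    qed
    show "AE x in M. (\<lambda>n. F (f n x) *\<^sub>R grad \<phi> x + (\<phi> x * F' (f n x)) *\<^sub>R grad (f n) x)
        \<longlonglongrightarrow> F (u x) *\<^sub>R grad \<phi> x + (\<phi> x * F' (u x)) *\<^sub>R G x"
      using AE1 AE2 k(3) by eventually_elim (intro tendsto_intros)
  qed
  show ?thesis unfolding sob0_def
    by (rule exI[of _ "\<lambda>n x. \<phi> x * F (f n x)"]) (simp add: t g 1 2)
qed

text \<open>The positive part is approximated by \<open>(sqrt ((s - \<tau>)\<^sup>2 + \<tau>\<^sup>4) + s - const) / 2\<close>. With the shift by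
  \<open>\<tau>\<close> and the much smaller smoothing \<open>\<tau>\<^sup>4\<close> the derivatives tend to \<open>0\<close>, and not to \<open>1/2\<close>, at \<open>s = 0\<close>. The
  formula for the gradient is thus obtained without knowing that \<open>G\<close> vanishes where \<open>u\<close> does.\<close>

lemma sob0_pos_part:
  assumes u: "sob0 u G"
  shows "sob0 (\<lambda>x. max 0 (u x)) (\<lambda>x. if 0 < u x then G x else 0)"
proof -
  define \<tau> where "\<tau> n = inverse (real (Suc n))" for n
  have \<tau>: "\<tau> n > 0" for n by (simp add: \<tau>_def)
  have \<tau>0: "\<tau> \<longlonglongrightarrow> 0" unfolding \<tau>_def[abs_def] by (rule LIMSEQ_inverse_real_of_nat)
  define Q where "Q n s = (s + (- \<tau> n))\<^sup>2 + ((\<tau> n)\<^sup>2)\<^sup>2" for n and s :: real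
  have Qpos: "Q n s > 0" for n s unfolding Q_def using \<tau>[of n] by (intro quadratic_pos) simp
  \<comment> \<open>the subtracted value at \<open>0\<close> makes \<open>F n\<close> vanish there, as the chain rule requires\<close>
  define F where "F n s = (1/2) * (Q n s powr (1/2) + s - Q n 0 powr (1/2))" for n s
  define F' where "F' n s = (1/2) * ((s - \<tau> n) * Q n s powr (- 1/2) + 1)" for n s
  have d: "(F n has_real_derivative F' n s) (at s)" for n s
  proof -
    have "((\<lambda>s. Q n s powr (1/2)) has_real_derivative 2 * (1/2) * (s + (- \<tau> n)) * Q n s powr (1/2 - 1)) (at s)"
      unfolding Q_def using \<tau>[of n] by (intro quadratic_powr_has_derivative) simp
    then have "((\<lambda>s. (1/2) * (Q n s powr (1/2) + s - Q n 0 powr (1/2))) has_real_derivative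
       (1/2) * (2 * (1/2) * (s + (- \<tau> n)) * Q n s powr (1/2 - 1) + 1 - 0)) (at s)"
      by (intro DERIV_cmult DERIV_diff DERIV_add DERIV_ident DERIV_const)
    then show ?thesis unfolding F_def[abs_def] F'_def by simp
  qed
  have sq: "\<bar>s - \<tau> n\<bar> * Q n s powr (- 1/2) \<le> 1" for n s
  proof -
    have "\<bar>s - \<tau> n\<bar> = ((s - \<tau> n)\<^sup>2) powr (1/2)" by (simp add: powr_half_sqrt)
    also have "\<dots> \<le> Q n s powr (1/2)" by (intro powr_mono2) (auto simp: Q_def)
    finally have "\<bar>s - \<tau> n\<bar> * Q n s powr (- 1/2) \<le> Q n s powr (1/2) * Q n s powr (- 1/2)"
      by (intro mult_right_mono) auto
    also have "\<dots> = 1" using Qpos[of n s] by (simp flip: powr_add)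
    finally show ?thesis .
  qed
  have F'b: "\<bar>F' n s\<bar> \<le> 1" for n s
  proof -
    have "\<bar>(s - \<tau> n) * Q n s powr (- 1/2)\<bar> \<le> 1" using sq[of s n] by (simp add: abs_mult)
    moreover have "\<bar>y\<bar> \<le> 1 \<Longrightarrow> \<bar>1 / 2 * (y + 1)\<bar> \<le> 1" for y :: real by (auto simp: abs_le_iff)
    ultimately show ?thesis unfolding F'_def by blast
  qed
  have F'c: "continuous_on UNIV (F' n)" for n
  proof -
    have "continuous_on UNIV (Q n)" unfolding Q_def[abs_def] by (intro continuous_intros)
    moreover have "\<forall>s\<in>UNIV. Q n s \<noteq> 0" using Qpos[of n] by (metis less_irrefl)
    ultimately show ?thesis unfolding F'_def[abs_def] by (intro continuous_intros)
  qed
  have F0: "F n 0 = 0" for n by (simp add: F_def)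
  have sm: "smooth (\<lambda>x. F n (\<phi> x))" if "smooth \<phi>" for n and \<phi> :: "'a \<Rightarrow> real"
  proof -
    have "smooth (\<lambda>x. Q n (\<phi> x) powr (1/2))"
      unfolding Q_def using \<tau>[of n] by (intro smooth_quadratic_powr that) simp
    then have "smooth (\<lambda>x. (1/2) * (Q n (\<phi> x) powr (1/2) + (\<phi> x + (- (Q n 0 powr (1/2))))))"
      by (intro smooth_mult smooth_add smooth_const that)
    then show ?thesis by (simp add: F_def algebra_simps)
  qed
  have S: "sob0 (\<lambda>x. F n (u x)) (\<lambda>x. F' n (u x) *\<^sub>R G x)" for n
    by (rule sob0_chain[OF u d F'c F'b F0 sm])
  have Flim: "(\<lambda>n. F n s) \<longlonglongrightarrow> max 0 s" for s
  proof -
    have "(\<lambda>n. (1/2) * (Q n s powr (1/2) + s - Q n 0 powr (1/2))) \<longlonglongrightarrow>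
       (1/2) * (((s + (- 0))\<^sup>2 + (0\<^sup>2)\<^sup>2) powr (1/2) + s - ((0 + (- 0))\<^sup>2 + (0\<^sup>2)\<^sup>2) powr (1/2))"
      unfolding Q_def by (intro tendsto_intros \<tau>0 tendsto_powr'[OF _ tendsto_const]) auto
    then show ?thesis by (simp add: F_def powr_half_sqrt max_def abs_if split: if_splits)
  qed
  have F'lim: "(\<lambda>n. F' n s) \<longlonglongrightarrow> (if 0 < s then 1 else 0)" for s
  proof (cases "s = 0")
    case False
    have "(\<lambda>n. (1/2) * ((s - \<tau> n) * Q n s powr (- 1/2) + 1)) \<longlonglongrightarrow>
       (1/2) * ((s - 0) * ((s + (- 0))\<^sup>2 + (0\<^sup>2)\<^sup>2) powr (- 1/2) + 1)"
      unfolding Q_def by (intro tendsto_intros \<tau>0) (use False in auto)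
    moreover have "(s\<^sup>2) powr (- 1/2) = 1 / \<bar>s\<bar>"
      using False by (simp add: powr_minus_divide powr_half_sqrt)
    ultimately show ?thesis using False by (simp add: F'_def abs_if split: if_splits)
  next
    case True
    have "F' n 0 = (1/2) * (1 - (1 + (\<tau> n)\<^sup>2) powr (- 1/2))" for n
    proof -
      have "Q n 0 = (\<tau> n)\<^sup>2 * (1 + (\<tau> n)\<^sup>2)" by (simp add: Q_def algebra_simps power2_eq_square)
      then have "Q n 0 powr (- 1/2) = ((\<tau> n)\<^sup>2) powr (- 1/2) * (1 + (\<tau> n)\<^sup>2) powr (- 1/2)"
        by (simp add: powr_mult)
      moreover have "((\<tau> n)\<^sup>2) powr (- 1/2) = 1 / \<tau> n"
        using \<tau>[of n] by (simp add: powr_minus_divide powr_half_sqrt)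
      ultimately show ?thesis using \<tau>[of n] by (simp add: F'_def)
    qed
    moreover have "(\<lambda>n. (1/2) * (1 - (1 + (\<tau> n)\<^sup>2) powr (- 1/2))) \<longlonglongrightarrow> (1/2) * (1 - (1 + 0\<^sup>2) powr (- 1/2))"
      by (intro tendsto_intros \<tau>0) auto
    ultimately have "(\<lambda>n. F' n 0) \<longlonglongrightarrow> (1/2) * (1 - (1 + 0\<^sup>2) powr (- 1/2))" by (simp only:)
    then show ?thesis using True by simp
  qed
  have lip: "\<bar>F n s\<bar> \<le> \<bar>s\<bar>" for n s
    using field_differentiable_bound[of UNIV "F n" "F' n" 1 s 0] d[of n] F'b[of n] F0[of n] by auto
  note uL = sob0_Lp[OF u]
  note um = Lp_D(1)[OF uL(1)] and Gm = Lp_D(1)[OF uL(2)]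
  show ?thesis
  proof (rule sob0_closed[OF S])
    show "dom_conv (\<lambda>n x. F n (u x)) (\<lambda>x. max 0 (u x))"
    proof (rule dom_convI[where g = "\<lambda>x. norm (u x)", OF _ Lp_norm[OF uL(1)]])
      show "(\<lambda>x. F n (u x)) \<in> borel_measurable M" for n using sob0_Lp(1)[OF S] Lp_D(1) by blast
    qed (use lip Flim in auto)
    show "dom_conv (\<lambda>n x. F' n (u x) *\<^sub>R G x) (\<lambda>x. if 0 < u x then G x else 0)"
    proof (rule dom_convI[where g = "\<lambda>x. norm (G x)", OF _ Lp_norm[OF uL(2)]])
      show "(\<lambda>x. F' n (u x) *\<^sub>R G x) \<in> borel_measurable M" for n using sob0_Lp(2)[OF S] Lp_D(1) by blast
      show "AE x in M. norm (F' n (u x) *\<^sub>R G x) \<le> norm (G x)" for n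
        using F'b[of n] by (auto intro!: AE_I2 mult_left_le_one_le)
      show "AE x in M. (\<lambda>n. F' n (u x) *\<^sub>R G x) \<longlonglongrightarrow> (if 0 < u x then G x else 0)"
      proof (rule AE_I2)
        fix x
        have "(\<lambda>n. F' n (u x) *\<^sub>R G x) \<longlonglongrightarrow> (if 0 < u x then 1 else 0) *\<^sub>R G x"
          by (intro tendsto_intros F'lim)
        then show "(\<lambda>n. F' n (u x) *\<^sub>R G x) \<longlonglongrightarrow> (if 0 < u x then G x else 0)"
          by (simp split: if_splits)
      qed
    qed
  qed
qed

text \<open>The factor \<open>\<bar>\<phi>\<bar>\<^sup>p\<close> is in general not smooth. It is the limit of the test functions
  \<open>(\<phi>\<^sup>2 + \<kappa>\<^sup>2)\<^sup>p\<^sup>/\<^sup>2 - \<kappa>\<^sup>p\<close>, and closedness carries the product rule over.\<close>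

lemma sob0_abs_powr_mult_chain:
  fixes F F' :: "real \<Rightarrow> real"
  assumes \<phi>: "\<phi> \<in> test_functions \<Omega>" and u: "sob0 u G"
    and d: "\<And>s. (F has_real_derivative F' s) (at s)" and c: "continuous_on UNIV F'"
    and b: "\<And>s. \<bar>F s\<bar> \<le> C" "\<And>s. \<bar>F' s\<bar> \<le> C"
    and sm: "\<And>\<phi> :: 'a \<Rightarrow> real. smooth \<phi> \<Longrightarrow> smooth (\<lambda>x. F (\<phi> x))"
  shows "sob0 (\<lambda>x. \<bar>\<phi> x\<bar> powr p * F (u x))
    (\<lambda>x. (F (u x) * (p * sgn (\<phi> x) * \<bar>\<phi> x\<bar> powr (p - 1))) *\<^sub>R grad \<phi> x + (\<bar>\<phi> x\<bar> powr p * F' (u x)) *\<^sub>R G x)"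
proof -
  define \<kappa> where "\<kappa> n = inverse (real (Suc n))" for n
  have \<kappa>: "\<kappa> n > 0" "\<kappa> n \<le> 1" for n by (auto simp: \<kappa>_def inverse_le_1_iff)
  have \<kappa>0: "\<kappa> \<longlonglongrightarrow> 0" unfolding \<kappa>_def[abs_def] by (rule LIMSEQ_inverse_real_of_nat)
  define E where "E n s = (s\<^sup>2 + (\<kappa> n)\<^sup>2) powr (p/2) - ((\<kappa> n)\<^sup>2) powr (p/2)" for n and s :: real
  define E' where "E' n s = p * s * (s\<^sup>2 + (\<kappa> n)\<^sup>2) powr (p/2 - 1)" for n and s :: real
  have dE: "(E n has_real_derivative E' n s) (at s)" for n s
  proof -
    have "((\<lambda>s. ((s + 0)\<^sup>2 + (\<kappa> n)\<^sup>2) powr (p/2) - ((\<kappa> n)\<^sup>2) powr (p/2)) has_real_derivative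
       2 * (p/2) * (s + 0) * ((s + 0)\<^sup>2 + (\<kappa> n)\<^sup>2) powr (p/2 - 1) - 0) (at s)"
      using \<kappa>[of n] by (intro DERIV_diff DERIV_const quadratic_powr_has_derivative) simp
    then show ?thesis unfolding E_def[abs_def] E'_def by simp
  qed
  have smE: "smooth (\<lambda>x. E n (\<phi> x))" for n
  proof -
    have "smooth (\<lambda>x. ((\<phi> x + 0)\<^sup>2 + (\<kappa> n)\<^sup>2) powr (p/2) + (- (((\<kappa> n)\<^sup>2) powr (p/2))))"
      using \<kappa>[of n] by (intro smooth_add smooth_const smooth_quadratic_powr test_functions_smooth[OF \<phi>]) simp
    then show ?thesis by (simp add: E_def)
  qed
  have tE: "(\<lambda>x. E n (\<phi> x)) \<in> test_functions \<Omega>" for n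
    by (rule test_functions_support[OF \<phi> smE]) (simp add: E_def)
  have gE: "grad (\<lambda>x. E n (\<phi> x)) x = E' n (\<phi> x) *\<^sub>R grad \<phi> x" for n x
    by (intro grad_eqI GDERIV_DERIV_compose dE smooth_GDERIV test_functions_smooth[OF \<phi>])
  have S: "sob0 (\<lambda>x. E n (\<phi> x) * F (u x)) (\<lambda>x. F (u x) *\<^sub>R (E' n (\<phi> x) *\<^sub>R grad \<phi> x) + (E n (\<phi> x) * F' (u x)) *\<^sub>R G x)" for n
    using sob0_mult_chain[OF tE u d c b sm, of n] by (simp only: gE)
  have Elim: "(\<lambda>n. E n s) \<longlonglongrightarrow> \<bar>s\<bar> powr p" for s
  proof -
    have "(\<lambda>n. E n s) \<longlonglongrightarrow> (s\<^sup>2 + 0\<^sup>2) powr (p/2) - (0\<^sup>2) powr (p/2)"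
      unfolding E_def using p_gt_1 by (intro tendsto_intros \<kappa>0 tendsto_powr'[OF _ tendsto_const]) auto
    moreover have "(s\<^sup>2) powr (p/2) = \<bar>s\<bar> powr p"
      by (metis powr_powr powr_half_sqrt real_sqrt_abs zero_le_power2 mult.commute times_divide_eq_right mult_1_right)
    ultimately show ?thesis by simp
  qed
  have E'lim: "(\<lambda>n. E' n s) \<longlonglongrightarrow> p * sgn s * \<bar>s\<bar> powr (p - 1)" for s
  proof (cases "s = 0")
    case True then show ?thesis by (simp add: E'_def)
  next
    case False
    have "(\<lambda>n. E' n s) \<longlonglongrightarrow> p * s * (s\<^sup>2 + 0\<^sup>2) powr (p/2 - 1)"
      unfolding E'_def using False by (intro tendsto_intros \<kappa>0) auto
    moreover have "(s\<^sup>2) powr (p/2 - 1) = \<bar>s\<bar> powr (p - 2)"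
    proof -
      have "(\<bar>s\<bar> powr 2) powr (p/2 - 1) = \<bar>s\<bar> powr (2 * (p/2 - 1))" by (rule powr_powr)
      moreover have "\<bar>s\<bar> powr 2 = s\<^sup>2" using False by simp
      ultimately show ?thesis by (simp add: algebra_simps)
    qed
    moreover have "s * \<bar>s\<bar> powr (p - 2) = sgn s * \<bar>s\<bar> powr (p - 1)"
    proof -
      have "\<bar>s\<bar> powr (p - 1) = \<bar>s\<bar> * \<bar>s\<bar> powr (p - 2)"
        using False powr_add[of "\<bar>s\<bar>" 1 "p - 2"] by simp
      then show ?thesis by (simp add: sgn_if abs_if)
    qed
    ultimately show ?thesis by (simp add: mult.assoc)
  qed
  obtain B where B: "0 < B" "\<And>x. \<bar>\<phi> x\<bar> \<le> B" "\<And>x. norm (grad \<phi> x) \<le> B"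
    using test_function_bounded[OF \<phi>] by metis
  have C: "0 \<le> C" using b(1)[of 0] by linarith
  define K where "K = (B\<^sup>2 + 1) powr (p/2) + p * (B\<^sup>2 + 1) powr ((p - 1)/2)"
  have sB: "s\<^sup>2 + (\<kappa> n)\<^sup>2 \<le> B\<^sup>2 + 1" if "\<bar>s\<bar> \<le> B" for s n
    using that \<kappa>[of n] B(1) by (intro add_mono) (auto simp: abs_le_square_iff[symmetric] power_le_one)
  have Eb: "\<bar>E n s\<bar> \<le> K" if s: "\<bar>s\<bar> \<le> B" for n s
  proof -
    have "((\<kappa> n)\<^sup>2) powr (p/2) \<le> (s\<^sup>2 + (\<kappa> n)\<^sup>2) powr (p/2)"
      using p_gt_1 by (intro powr_mono2) auto
    moreover have "(s\<^sup>2 + (\<kappa> n)\<^sup>2) powr (p/2) \<le> (B\<^sup>2 + 1) powr (p/2)"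
      using p_gt_1 by (intro powr_mono2 sB[OF s]) auto
    moreover have "0 \<le> p * (B\<^sup>2 + 1) powr ((p - 1)/2)" using p_gt_1 by simp
    moreover have "0 \<le> ((\<kappa> n)\<^sup>2) powr (p/2)" by simp
    ultimately show ?thesis unfolding E_def K_def by linarith
  qed
  have E'b: "\<bar>E' n s\<bar> \<le> K" if s: "\<bar>s\<bar> \<le> B" for n s
  proof -
    let ?q = "s\<^sup>2 + (\<kappa> n)\<^sup>2"
    have q: "?q > 0" using quadratic_pos[of "\<kappa> n" s] \<kappa>[of n] by simp
    have "\<bar>s\<bar> = (s\<^sup>2) powr (1/2)" by (simp add: powr_half_sqrt)
    also have "\<dots> \<le> ?q powr (1/2)" by (intro powr_mono2) auto
    finally have "\<bar>E' n s\<bar> \<le> p * (?q powr (1/2) * ?q powr (p/2 - 1))"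
      unfolding E'_def using p_gt_1 by (simp add: abs_mult mult_right_mono mult.assoc)
    also have "?q powr (1/2) * ?q powr (p/2 - 1) = ?q powr ((p - 1)/2)"
      by (simp add: diff_divide_distrib flip: powr_add)
    also have "p * ?q powr ((p - 1)/2) \<le> p * (B\<^sup>2 + 1) powr ((p - 1)/2)"
      using p_gt_1 q by (intro mult_left_mono powr_mono2 sB[OF s]) auto
    also have "\<dots> \<le> K" by (simp add: K_def)
    finally show ?thesis .
  qed
  have K: "0 \<le> K" using Eb[of 0 0] B(1) by simp
  note GL = sob0_Lp(2)[OF u]
  show ?thesis
  proof (rule sob0_closed[OF S])
    show "dom_conv (\<lambda>n x. E n (\<phi> x) * F (u x)) (\<lambda>x. \<bar>\<phi> x\<bar> powr p * F (u x))"
    proof (rule dom_convI[where g = "\<lambda>x. K * C", OF _ Lp_const])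
      show "(\<lambda>x. E n (\<phi> x) * F (u x)) \<in> borel_measurable M" for n using sob0_Lp(1)[OF S] Lp_D(1) by blast
      show "AE x in M. norm (E n (\<phi> x) * F (u x)) \<le> K * C" for n
      proof (rule AE_I2)
        fix x
        have "\<bar>E n (\<phi> x)\<bar> * \<bar>F (u x)\<bar> \<le> K * C" using K by (intro mult_mono b B Eb) auto
        then show "norm (E n (\<phi> x) * F (u x)) \<le> K * C" by (simp add: abs_mult)
      qed
      show "AE x in M. (\<lambda>n. E n (\<phi> x) * F (u x)) \<longlonglongrightarrow> \<bar>\<phi> x\<bar> powr p * F (u x)"
        by (intro AE_I2 tendsto_intros Elim)
    qed
    show "dom_conv (\<lambda>n x. F (u x) *\<^sub>R (E' n (\<phi> x) *\<^sub>R grad \<phi> x) + (E n (\<phi> x) * F' (u x)) *\<^sub>R G x)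
      (\<lambda>x. (F (u x) * (p * sgn (\<phi> x) * \<bar>\<phi> x\<bar> powr (p - 1))) *\<^sub>R grad \<phi> x + (\<bar>\<phi> x\<bar> powr p * F' (u x)) *\<^sub>R G x)"
    proof (rule dom_convI[where g = "\<lambda>x. C * (K * B) + (K * C) *\<^sub>R norm (G x)", OF _ Lp_add[OF Lp_const Lp_cmult[OF Lp_norm[OF GL]]]])
      show "(\<lambda>x. F (u x) *\<^sub>R (E' n (\<phi> x) *\<^sub>R grad \<phi> x) + (E n (\<phi> x) * F' (u x)) *\<^sub>R G x) \<in> borel_measurable M" for n
        using sob0_Lp(2)[OF S] Lp_D(1) by blast
      show "AE x in M. norm (F (u x) *\<^sub>R (E' n (\<phi> x) *\<^sub>R grad \<phi> x) + (E n (\<phi> x) * F' (u x)) *\<^sub>R G x)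
          \<le> C * (K * B) + (K * C) *\<^sub>R norm (G x)" for n
      proof (rule AE_I2)
        fix x
        have "\<bar>F (u x)\<bar> * (\<bar>E' n (\<phi> x)\<bar> * norm (grad \<phi> x)) \<le> C * (K * B)"
          using C K by (intro mult_mono b B E'b) (auto intro: B)
        moreover have "(\<bar>E n (\<phi> x)\<bar> * \<bar>F' (u x)\<bar>) * norm (G x) \<le> (K * C) * norm (G x)"
          using C K by (intro mult_mono b B Eb) auto
        ultimately show "norm (F (u x) *\<^sub>R (E' n (\<phi> x) *\<^sub>R grad \<phi> x) + (E n (\<phi> x) * F' (u x)) *\<^sub>R G x)
          \<le> C * (K * B) + (K * C) *\<^sub>R norm (G x)"
          by (intro norm_triangle_mono) (auto simp: abs_mult)
      qed
      show "AE x in M. (\<lambda>n. F (u x) *\<^sub>R (E' n (\<phi> x) *\<^sub>R grad \<phi> x) + (E n (\<phi> x) * F' (u x)) *\<^sub>R G x)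
          \<longlonglongrightarrow> (F (u x) * (p * sgn (\<phi> x) * \<bar>\<phi> x\<bar> powr (p - 1))) *\<^sub>R grad \<phi> x + (\<bar>\<phi> x\<bar> powr p * F' (u x)) *\<^sub>R G x"
      proof (rule AE_I2)
        fix x
        have "(\<lambda>n. F (u x) *\<^sub>R (E' n (\<phi> x) *\<^sub>R grad \<phi> x) + (E n (\<phi> x) * F' (u x)) *\<^sub>R G x)
          \<longlonglongrightarrow> F (u x) *\<^sub>R ((p * sgn (\<phi> x) * \<bar>\<phi> x\<bar> powr (p - 1)) *\<^sub>R grad \<phi> x) + (\<bar>\<phi> x\<bar> powr p * F' (u x)) *\<^sub>R G x"
          by (intro tendsto_intros Elim E'lim)
        then show "(\<lambda>n. F (u x) *\<^sub>R (E' n (\<phi> x) *\<^sub>R grad \<phi> x) + (E n (\<phi> x) * F' (u x)) *\<^sub>R G x)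
          \<longlonglongrightarrow> (F (u x) * (p * sgn (\<phi> x) * \<bar>\<phi> x\<bar> powr (p - 1))) *\<^sub>R grad \<phi> x + (\<bar>\<phi> x\<bar> powr p * F' (u x)) *\<^sub>R G x"
          by simp
      qed
    qed
  qed
qed

end

section \<open>Poincare inequality on convex sets\<close>

text \<open>The graph of \<open>t\<^sup>p\<close> lies above its tangent at \<open>c\<close>.\<close>

lemma weighted_Young:
  fixes c t :: real
  assumes "1 < p" "0 \<le> c" "0 \<le> t"
  shows "p * (c powr (p - 1) * t) \<le> t powr p + (p - 1) * c powr p"
proof -
  have "t * c powr (p - 1) \<le> t powr p / p + (c powr (p - 1)) powr (p / (p - 1)) / (p / (p - 1))"
    by (rule Youngs_inequality) (use assms in \<open>auto simp: field_simps\<close>)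
  also have "(c powr (p - 1)) powr (p / (p - 1)) = c powr p"
    using assms by (simp add: powr_powr)
  finally have "p * (t * c powr (p - 1)) \<le> p * (t powr p / p + c powr p / (p / (p - 1)))"
    using assms by (intro mult_left_mono) auto
  also have "\<dots> = t powr p + (p - 1) * c powr p" using assms by (simp add: field_simps)
  finally show ?thesis by (simp add: mult_ac)
qed

text \<open>The tangent inequality at the mean value of \<open>s\<close> is integrated.\<close>

lemma Jensen_powr:
  fixes s :: "'b \<Rightarrow> real"
  assumes "finite_measure N" "1 < p" "\<And>x. 0 \<le> s x" "integrable N s" "integrable N (\<lambda>x. s x powr p)"
  shows "(\<integral>x. s x \<partial>N) powr p \<le> measure N (space N) powr (p - 1) * (\<integral>x. s x powr p \<partial>N)"
proof -
  interpret finite_measure N by fact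
  let ?m = "measure N (space N)"
  have I: "0 \<le> (\<integral>x. s x \<partial>N)" using assms(3) by simp
  show ?thesis
  proof (cases "?m = 0")
    case True
    then have "AE x in N. s x = 0"
      by (intro AE_I[where N = "space N"]) (auto simp: emeasure_eq_measure)
    then have "(\<integral>x. s x \<partial>N) = 0" by (intro integral_eq_zero_AE)
    then show ?thesis using True assms(2) by simp
  next
    case False
    then have m: "0 < ?m" using measure_nonneg[of N "space N"] by linarith
    define c where "c = (\<integral>x. s x \<partial>N) / ?m"
    have c: "0 \<le> c" using I m by (simp add: c_def)
    have "(\<integral>x. p * (c powr (p - 1) * s x) \<partial>N) \<le> (\<integral>x. s x powr p + (p - 1) * c powr p \<partial>N)"
      by (rule integral_mono) (use assms c weighted_Young in auto)
    then have "p * (c powr (p - 1) * (\<integral>x. s x \<partial>N)) \<le> (\<integral>x. s x powr p \<partial>N) + (p - 1) * c powr p * ?m"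
      using assms by (simp add: mult_ac)
    moreover have "c powr (p - 1) * (\<integral>x. s x \<partial>N) = c powr p * ?m"
    proof -
      have "(\<integral>x. s x \<partial>N) = c * ?m" using m by (simp add: c_def)
      moreover have "c powr (p - 1) * c = c powr p"
        using c powr_add[of c "p - 1" 1] by (cases "c = 0") auto
      ultimately show ?thesis by (simp add: mult_ac)
    qed
    ultimately have "c powr p * ?m \<le> (\<integral>x. s x powr p \<partial>N)" by (simp add: algebra_simps)
    then have "?m powr (p - 1) * (c powr p * ?m) \<le> ?m powr (p - 1) * (\<integral>x. s x powr p \<partial>N)"
      by (intro mult_left_mono) auto
    moreover have "?m powr (p - 1) * (c powr p * ?m) = (\<integral>x. s x \<partial>N) powr p"
    proof -
      have "?m powr (p - 1) * ?m = ?m powr p" using m powr_add[of ?m "p - 1" 1] by simp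
      then have "?m powr (p - 1) * (c powr p * ?m) = (c * ?m) powr p"
        using c m by (simp add: powr_mult mult_ac)
      then show ?thesis using m by (simp add: c_def)
    qed
    ultimately show ?thesis by simp
  qed
qed

text \<open>The fundamental theorem of calculus along the segment, followed by Jensen's inequality.\<close>

lemma line_difference_bound:
  fixes f :: "'a::euclidean_space \<Rightarrow> real"
  assumes d: "\<And>x. GDERIV f x :> g x" and g: "continuous_on UNIV g" and p: "1 < p"
  shows "ennreal (\<bar>f (y + h) - f y\<bar> powr p) \<le>
    (\<integral>\<^sup>+t. indicator {0..1} t * ennreal (norm h powr p * norm (g (y + t *\<^sub>R h)) powr p) \<partial>lborel)"
proof -
  define \<gamma> where "\<gamma> t = f (y + t *\<^sub>R h)" for t
  have l: "continuous_on S (\<lambda>t. g (y + t *\<^sub>R h))" for S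
    by (rule continuous_on_compose2[OF g]) (auto intro!: continuous_intros)
  have der: "(\<gamma> has_vector_derivative h \<bullet> g (y + t *\<^sub>R h)) (at t within S)" for t S
  proof -
    have "(\<gamma> has_derivative (\<lambda>s. (s *\<^sub>R h) \<bullet> g (y + t *\<^sub>R h))) (at t within S)"
      unfolding \<gamma>_def
      by (rule has_derivative_compose[of "\<lambda>t. y + t *\<^sub>R h" "\<lambda>s. s *\<^sub>R h"])
         (use d[of "y + t *\<^sub>R h"] in \<open>auto intro!: derivative_eq_intros simp: gderiv_def\<close>)
    then show ?thesis by (simp add: has_vector_derivative_def)
  qed
  have cg: "continuous_on {0..1} (\<lambda>t. h \<bullet> g (y + t *\<^sub>R h))" by (intro continuous_intros l)
  let ?s = "\<lambda>t. norm h * norm (g (y + t *\<^sub>R h))"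
  have cs: "continuous_on {0..1} ?s" "continuous_on {0..1} (\<lambda>t. ?s t powr p)"
    using p by (auto intro!: continuous_intros l continuous_on_powr')
  let ?N = "restrict_space lborel {0..1::real}"
  interpret N: finite_measure ?N by (rule finite_measureI) (simp add: emeasure_restrict_space space_restrict_space)
  have iN: "integrable ?N k \<longleftrightarrow> set_integrable lborel {0..1} k" for k :: "real \<Rightarrow> real"
    by (simp add: integrable_restrict_space set_integrable_def)
  have i: "integrable ?N (\<lambda>t. h \<bullet> g (y + t *\<^sub>R h))" "integrable ?N ?s" "integrable ?N (\<lambda>t. ?s t powr p)"
    unfolding iN by (intro borel_integrable_atLeastAtMost' cg cs)+
  have "\<gamma> 1 - \<gamma> 0 = (\<integral>t. indicator {0..1} t *\<^sub>R (h \<bullet> g (y + t *\<^sub>R h)) \<partial>lborel)"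
    by (rule integral_FTC_atLeastAtMost[symmetric]) (use der cg in auto)
  also have "\<dots> = (\<integral>t. h \<bullet> g (y + t *\<^sub>R h) \<partial>?N)" by (subst integral_restrict_space) auto
  finally have "\<bar>f (y + h) - f y\<bar> = \<bar>\<integral>t. h \<bullet> g (y + t *\<^sub>R h) \<partial>?N\<bar>" by (simp add: \<gamma>_def)
  also have "\<dots> \<le> (\<integral>t. ?s t \<partial>?N)"
    by (rule order_trans[OF integral_abs_bound integral_mono]) (use i in \<open>auto intro: Cauchy_Schwarz_ineq2\<close>)
  finally have "\<bar>f (y + h) - f y\<bar> powr p \<le> (\<integral>t. ?s t \<partial>?N) powr p"
    using p by (intro powr_mono2) auto
  also have "\<dots> \<le> measure ?N (space ?N) powr (p - 1) * (\<integral>t. ?s t powr p \<partial>?N)"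
    by (rule Jensen_powr[OF N.finite_measure_axioms p _ i(2,3)]) auto
  also have "measure ?N (space ?N) = 1" by (simp add: measure_restrict_space space_restrict_space)
  finally have "ennreal (\<bar>f (y + h) - f y\<bar> powr p) \<le> ennreal (\<integral>t. ?s t powr p \<partial>?N)"
    by (simp add: ennreal_leI)
  also have "\<dots> = (\<integral>\<^sup>+t. ennreal (?s t powr p) \<partial>?N)"
    by (rule nn_integral_eq_integral[symmetric, OF i(3)]) auto
  also have "\<dots> = (\<integral>\<^sup>+t. ennreal (?s t powr p) * indicator {0..1} t \<partial>lborel)"
    by (rule nn_integral_restrict_space) auto
  also have "\<dots> = (\<integral>\<^sup>+t. indicator {0..1} t * ennreal (norm h powr p * norm (g (y + t *\<^sub>R h)) powr p) \<partial>lborel)"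
    by (simp add: powr_mult mult.commute)
  finally show ?thesis .
qed

lemma nn_integral_lborel_shift:
  fixes k :: "'a::euclidean_space \<Rightarrow> ennreal"
  assumes [measurable]: "k \<in> borel_measurable borel"
  shows "(\<integral>\<^sup>+x. k (a + x) \<partial>lborel) = (\<integral>\<^sup>+x. k x \<partial>lborel)"
proof -
  have "(\<integral>\<^sup>+x. k x \<partial>lborel) = (\<integral>\<^sup>+x. k x \<partial>distr lborel borel ((+) a))"
    by (simp add: lborel_distr_plus)
  also have "\<dots> = (\<integral>\<^sup>+x. k (a + x) \<partial>lborel)" by (subst nn_integral_distr) auto
  finally show ?thesis by simp
qed

text \<open>Convexity keeps the segment from \<open>y\<close> to \<open>x = y + h\<close> inside \<open>Q\<close>, so that \<open>\<bar>f x - f y\<bar>\<^sup>p\<close> is controlled by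
  the gradient at the points \<open>y + t h\<close> of \<open>Q\<close>. For fixed \<open>h\<close> and \<open>t\<close> the map \<open>y \<mapsto> y + t h\<close> preserves the
  measure, and the \<open>h\<close> that occur lie in \<open>D\<close>. The double integral on the left replaces the deviation
  from a mean value; it is stable under Fatou's lemma.\<close>

theorem Poincare_convex:
  fixes f :: "'a::euclidean_space \<Rightarrow> real"
  assumes d: "\<And>x. GDERIV f x :> g x" and gc: "continuous_on UNIV g" and p: "1 < p"
    and Q: "Q \<in> sets borel" "convex Q" and D: "D \<in> sets borel"
    and diff: "\<And>x y. x \<in> Q \<Longrightarrow> y \<in> Q \<Longrightarrow> x - y \<in> D \<and> norm (x - y) \<le> r"
  shows "(\<integral>\<^sup>+y. \<integral>\<^sup>+x. indicator Q y * indicator Q x * ennreal (\<bar>f x - f y\<bar> powr p) \<partial>lborel \<partial>lborel)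
    \<le> emeasure lborel D * ennreal (r powr p) * (\<integral>\<^sup>+x. indicator Q x * ennreal (norm (g x) powr p) \<partial>lborel)"
proof -
  have fc: "continuous_on UNIV f"
    using d by (intro continuous_at_imp_continuous_on) (auto simp: gderiv_def intro: has_derivative_continuous)
  note [measurable] = Q(1) D borel_measurable_continuous_onI[OF gc] borel_measurable_continuous_onI[OF fc]
  define k where "k z = indicator Q z * ennreal (norm (g z) powr p)" for z
  have [measurable]: "k \<in> borel_measurable borel" unfolding k_def[abs_def] by measurable
  define H where "H y h t = indicator {0..1::real} t * (indicator D h * (ennreal (r powr p) * k (y + t *\<^sub>R h)))" for y h t
  have "(\<integral>\<^sup>+y. \<integral>\<^sup>+x. indicator Q y * indicator Q x * ennreal (\<bar>f x - f y\<bar> powr p) \<partial>lborel \<partial>lborel)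
      = (\<integral>\<^sup>+y. \<integral>\<^sup>+h. indicator Q y * indicator Q (y + h) * ennreal (\<bar>f (y + h) - f y\<bar> powr p) \<partial>lborel \<partial>lborel)"
    by (intro nn_integral_cong nn_integral_lborel_shift[symmetric]) measurable
  also have "\<dots> \<le> (\<integral>\<^sup>+y. \<integral>\<^sup>+h. \<integral>\<^sup>+t. H y h t \<partial>lborel \<partial>lborel \<partial>lborel)"
  proof (intro nn_integral_mono)
    fix y h :: 'a
    show "indicator Q y * indicator Q (y + h) * ennreal (\<bar>f (y + h) - f y\<bar> powr p) \<le> (\<integral>\<^sup>+t. H y h t \<partial>lborel)"
    proof (cases "y \<in> Q \<and> y + h \<in> Q")
      case True
      then have h: "h \<in> D" "norm h \<le> r" using diff[of "y + h" y] by auto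
      have inQ: "y + t *\<^sub>R h \<in> Q" if "t \<in> {0..1}" for t
        using convexD_alt[OF Q(2), of y "y + h" t] True that by (auto simp: algebra_simps)
      have "ennreal (\<bar>f (y + h) - f y\<bar> powr p) \<le>
        (\<integral>\<^sup>+t. indicator {0..1} t * ennreal (norm h powr p * norm (g (y + t *\<^sub>R h)) powr p) \<partial>lborel)"
        by (rule line_difference_bound[OF d gc p])
      also have "\<dots> \<le> (\<integral>\<^sup>+t. H y h t \<partial>lborel)"
      proof (intro nn_integral_mono)
        fix t :: real
        have "norm h powr p * norm (g (y + t *\<^sub>R h)) powr p \<le> r powr p * norm (g (y + t *\<^sub>R h)) powr p"
          using h(2) p by (intro mult_right_mono powr_mono2) auto
        then have "ennreal (norm h powr p * norm (g (y + t *\<^sub>R h)) powr p) \<le>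
            ennreal (r powr p) * ennreal (norm (g (y + t *\<^sub>R h)) powr p)"
          by (simp add: ennreal_leI flip: ennreal_mult)
        then show "indicator {0..1} t * ennreal (norm h powr p * norm (g (y + t *\<^sub>R h)) powr p) \<le> H y h t"
          using h(1) inQ[of t] by (auto simp: H_def k_def indicator_def)
      qed
      finally show ?thesis using True by simp
    qed auto
  qed
  also have "\<dots> = (\<integral>\<^sup>+h. \<integral>\<^sup>+y. \<integral>\<^sup>+t. H y h t \<partial>lborel \<partial>lborel \<partial>lborel)"
    unfolding H_def by (rule lborel_pair.Fubini') measurable
  also have "\<dots> = (\<integral>\<^sup>+h. \<integral>\<^sup>+t. \<integral>\<^sup>+y. H y h t \<partial>lborel \<partial>lborel \<partial>lborel)"
    unfolding H_def by (intro nn_integral_cong lborel_pair.Fubini') measurable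
  also have "\<dots> = (\<integral>\<^sup>+h. \<integral>\<^sup>+t. indicator {0..1::real} t * (indicator D h * (ennreal (r powr p) * (\<integral>\<^sup>+y. k y \<partial>lborel))) \<partial>lborel \<partial>lborel)"
  proof (intro nn_integral_cong)
    fix h :: 'a and t :: real
    have "(\<integral>\<^sup>+y. k (y + t *\<^sub>R h) \<partial>lborel) = (\<integral>\<^sup>+y. k y \<partial>lborel)"
      using nn_integral_lborel_shift[of k "t *\<^sub>R h"] by (simp add: add.commute)
    then show "(\<integral>\<^sup>+y. H y h t \<partial>lborel) = indicator {0..1::real} t * (indicator D h * (ennreal (r powr p) * (\<integral>\<^sup>+y. k y \<partial>lborel)))"
      unfolding H_def by (simp add: nn_integral_cmult)
  qed
  also have "\<dots> = (\<integral>\<^sup>+h. indicator D h * (ennreal (r powr p) * (\<integral>\<^sup>+y. k y \<partial>lborel)) \<partial>lborel)"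
    by (simp add: nn_integral_multc)
  also have "\<dots> = emeasure lborel D * (ennreal (r powr p) * (\<integral>\<^sup>+y. k y \<partial>lborel))"
    by (subst nn_integral_multc) auto
  finally show ?thesis by (simp add: k_def mult.assoc)
qed

section \<open>Rellich compactness\<close>

text \<open>The cube of side \<open>\<delta>\<close> that contains \<open>z\<close> in the grid \<open>\<delta> \<int>\<^sup>N\<close>. As fibres of one map the cells are a
  partition by construction.\<close>

definition cell :: "real \<Rightarrow> 'a::euclidean_space \<Rightarrow> 'a set" where
  "cell \<delta> z = {x. \<forall>b\<in>Basis. \<lfloor>x \<bullet> b / \<delta>\<rfloor> = \<lfloor>z \<bullet> b / \<delta>\<rfloor>}"

lemma mem_cell_self: "z \<in> cell \<delta> z"
  by (simp add: cell_def)

lemma cell_eq: "x \<in> cell \<delta> z \<Longrightarrow> cell \<delta> x = cell \<delta> z"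
  by (simp add: cell_def)

lemma mem_cell_iff:
  assumes "0 < \<delta>"
  shows "x \<in> cell \<delta> z \<longleftrightarrow> (\<forall>b\<in>Basis. \<delta> * \<lfloor>z \<bullet> b / \<delta>\<rfloor> \<le> x \<bullet> b \<and> x \<bullet> b < \<delta> * (\<lfloor>z \<bullet> b / \<delta>\<rfloor> + 1))"
  using assms by (simp add: cell_def floor_eq_iff field_simps)

lemma cell_borel: "0 < \<delta> \<Longrightarrow> cell \<delta> z \<in> sets borel"
  unfolding cell_def by measurable

lemma cell_convex:
  assumes "0 < \<delta>" shows "convex (cell \<delta> z)"
proof -
  have h: "convex {x. c \<le> x \<bullet> b}" "convex {x. x \<bullet> b < c}" for c and b :: 'a
    using convex_halfspace_ge[of c b] convex_halfspace_lt[of b c] by (simp_all add: inner_commute)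
  have "cell \<delta> z = (\<Inter>b\<in>Basis. {x. \<delta> * \<lfloor>z \<bullet> b / \<delta>\<rfloor> \<le> x \<bullet> b} \<inter> {x. x \<bullet> b < \<delta> * (\<lfloor>z \<bullet> b / \<delta>\<rfloor> + 1)})"
    by (auto simp: mem_cell_iff[OF assms])
  also have "convex \<dots>"
    by (intro convex_INT convex_Int h)
  finally show ?thesis .
qed

lemma cell_emeasure:
  fixes z :: "'a::euclidean_space"
  assumes "0 < \<delta>" shows "emeasure lborel (cell \<delta> z) = ennreal (\<delta> ^ DIM('a))"
proof -
  define l where "l = (\<Sum>b\<in>Basis. (\<delta> * \<lfloor>z \<bullet> b / \<delta>\<rfloor>) *\<^sub>R b)"
  define u where "u = (\<Sum>b\<in>Basis. (\<delta> * (\<lfloor>z \<bullet> b / \<delta>\<rfloor> + 1)) *\<^sub>R b)"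
  have lb: "l \<bullet> b = \<delta> * \<lfloor>z \<bullet> b / \<delta>\<rfloor>" and ub: "u \<bullet> b = \<delta> * (\<lfloor>z \<bullet> b / \<delta>\<rfloor> + 1)" if "b \<in> Basis" for b
    using that by (auto simp: l_def u_def)
  have sub: "box l u \<subseteq> cell \<delta> z" "cell \<delta> z \<subseteq> cbox l u"
    using lb ub by (auto simp: mem_cell_iff[OF assms] mem_box less_imp_le)
  have le: "l \<bullet> b \<le> u \<bullet> b" if "b \<in> Basis" for b using that assms by (simp add: lb ub)
  have "(\<Prod>b\<in>Basis. (u - l) \<bullet> b) = (\<Prod>b\<in>(Basis::'a set). \<delta>)"
    by (rule prod.cong) (auto simp: inner_diff_left lb ub algebra_simps)
  then have e: "(\<Prod>b\<in>Basis. (u - l) \<bullet> b) = \<delta> ^ DIM('a)" by simp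
  have "emeasure lborel (box l u) \<le> emeasure lborel (cell \<delta> z)"
    by (rule emeasure_mono[OF sub(1)]) (use cell_borel[OF assms] in simp)
  moreover have "emeasure lborel (cell \<delta> z) \<le> emeasure lborel (cbox l u)"
    by (rule emeasure_mono[OF sub(2)]) simp
  ultimately show ?thesis
    using emeasure_lborel_box[OF le] emeasure_lborel_cbox[OF le] e by (simp add: antisym)
qed

lemma cell_diff:
  fixes x y z :: "'a::euclidean_space" and \<delta> :: real
  assumes "0 < \<delta>" "x \<in> cell \<delta> z" "y \<in> cell \<delta> z"
  shows "x - y \<in> cbox (- \<delta> *\<^sub>R One) (\<delta> *\<^sub>R One) \<and> norm (x - y) \<le> DIM('a) * \<delta>"
proof -
  have c: "\<bar>(x - y) \<bullet> b\<bar> \<le> \<delta>" if "b \<in> Basis" for b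
  proof -
    have "\<delta> * \<lfloor>z \<bullet> b / \<delta>\<rfloor> \<le> x \<bullet> b" "x \<bullet> b < \<delta> * (\<lfloor>z \<bullet> b / \<delta>\<rfloor> + 1)"
      "\<delta> * \<lfloor>z \<bullet> b / \<delta>\<rfloor> \<le> y \<bullet> b" "y \<bullet> b < \<delta> * (\<lfloor>z \<bullet> b / \<delta>\<rfloor> + 1)"
      using assms(2,3) that by (auto simp: mem_cell_iff[OF assms(1)])
    then show ?thesis by (simp add: inner_diff_left distrib_left abs_le_iff)
  qed
  have "norm (x - y) \<le> (\<Sum>b\<in>Basis. \<bar>(x - y) \<bullet> b\<bar>)" by (rule norm_le_l1)
  also have "\<dots> \<le> (\<Sum>b\<in>(Basis::'a set). \<delta>)" by (intro sum_mono c)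
  finally have "norm (x - y) \<le> DIM('a) * \<delta>" by simp
  moreover have "x - y \<in> cbox (- \<delta> *\<^sub>R One) (\<delta> *\<^sub>R One)"
    unfolding mem_box
  proof
    fix b :: 'a assume "b \<in> Basis"
    then show "- \<delta> *\<^sub>R One \<bullet> b \<le> (x - y) \<bullet> b \<and> (x - y) \<bullet> b \<le> \<delta> *\<^sub>R One \<bullet> b"
      using c[of b] by (simp add: abs_le_iff)
  qed
  ultimately show ?thesis by simp
qed

lemma finite_cells:
  fixes S :: "'a::euclidean_space set"
  assumes "bounded S" "0 < \<delta>" shows "finite (cell \<delta> ` S)"
proof -
  obtain R where R: "\<And>x. x \<in> S \<Longrightarrow> norm x \<le> R" using assms(1) by (auto simp: bounded_iff)
  define K where "K z = (\<lambda>b\<in>(Basis::'a set). \<lfloor>z \<bullet> b / \<delta>\<rfloor>)" for z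
  have "K z \<in> PiE Basis (\<lambda>_. {\<lfloor>- R / \<delta>\<rfloor>..\<lfloor>R / \<delta>\<rfloor>})" if "z \<in> S" for z
  proof -
    have "- R \<le> z \<bullet> b \<and> z \<bullet> b \<le> R" if "b \<in> Basis" for b
      using Basis_le_norm[OF that, of z] R[OF \<open>z \<in> S\<close>] by (simp add: abs_le_iff)
    then have "- R / \<delta> \<le> z \<bullet> b / \<delta> \<and> z \<bullet> b / \<delta> \<le> R / \<delta>" if "b \<in> Basis" for b
      using assms(2) that by (intro conjI divide_right_mono) auto
    then show ?thesis unfolding K_def by (intro restrict_PiE_iff[THEN iffD2] ballI) (simp add: floor_mono)
  qed
  then have "finite (K ` S)"
    by (intro finite_subset[OF _ finite_PiE[of Basis "\<lambda>_. {\<lfloor>- R / \<delta>\<rfloor>..\<lfloor>R / \<delta>\<rfloor>}"]]) auto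
  moreover have "cell \<delta> ` S \<subseteq> (\<lambda>k. {x. \<forall>b\<in>Basis. \<lfloor>x \<bullet> b / \<delta>\<rfloor> = k b}) ` (K ` S)"
    by (auto simp: cell_def K_def image_iff intro!: bexI)
  ultimately show ?thesis by (meson finite_imageI finite_subset)
qed

text \<open>On a cell of measure \<open>m\<close>, the value \<open>m f(x)\<close> is \<open>\<integral> f - \<integral> (f(y) - f(x)) dy\<close>. The second integral is
  controlled by the Poincare inequality.\<close>

lemma cell_estimate:
  fixes f :: "'a::euclidean_space \<Rightarrow> real" and \<delta> :: real and z :: 'a
  assumes d: "\<And>x. GDERIV f x :> g x" and gc: "continuous_on UNIV g" and p: "1 < p" and \<delta>: "0 < \<delta>"
    and bd: "\<And>x. \<bar>f x\<bar> \<le> B"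
  defines "m \<equiv> \<delta> ^ DIM('a)" and "Q \<equiv> cell \<delta> z"
  shows "(\<integral>\<^sup>+x. indicator Q x * ennreal (\<bar>f x\<bar> powr p) \<partial>lborel) \<le>
    ennreal (2 powr p * m powr (1 - p) * \<bar>\<integral>x. indicator Q x * f x \<partial>lborel\<bar> powr p) +
    ennreal (2 powr p * (2 ^ DIM('a) * (DIM('a) * \<delta>) powr p)) * (\<integral>\<^sup>+x. indicator Q x * ennreal (norm (g x) powr p) \<partial>lborel)"
proof -
  have fc: "continuous_on UNIV f"
    using d by (intro continuous_at_imp_continuous_on) (auto simp: gderiv_def intro: has_derivative_continuous)
  have m: "0 < m" using \<delta> by (simp add: m_def)
  have Q [measurable]: "Q \<in> sets borel" unfolding Q_def by (rule cell_borel[OF \<delta>])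
  note [measurable] = borel_measurable_continuous_onI[OF gc] borel_measurable_continuous_onI[OF fc]
  have emQ: "emeasure lborel Q = ennreal m" unfolding Q_def m_def by (rule cell_emeasure[OF \<delta>])
  let ?N = "restrict_space lborel Q"
  interpret N: finite_measure ?N
    by (rule finite_measureI) (simp add: emeasure_restrict_space space_restrict_space emQ)
  have "measure ?N (space ?N) = measure lborel Q"
    by (simp add: measure_restrict_space space_restrict_space)
  then have mN: "measure ?N (space ?N) = m"
    using emQ m by (simp add: measure_def)
  have fN: "k \<in> borel_measurable borel \<Longrightarrow> k \<in> borel_measurable ?N" for k :: "'a \<Rightarrow> real"
    by (simp add: measurable_restrict_space1)
  have bint: "integrable ?N k" if "k \<in> borel_measurable borel" "\<And>x. \<bar>k x\<bar> \<le> C" for k :: "'a \<Rightarrow> real" and C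
    using that by (intro N.integrable_const_bound[where B = C] fN) auto
  define I where "I = (\<integral>x. f x \<partial>?N)"
  have I_eq: "I = (\<integral>x. indicator Q x * f x \<partial>lborel)"
    unfolding I_def by (subst integral_restrict_space) auto
  define J where "J x = (\<integral>\<^sup>+y. indicator Q y * ennreal (\<bar>f y - f x\<bar> powr p) \<partial>lborel)" for x
  have [measurable]: "J \<in> borel_measurable borel" unfolding J_def[abs_def] by measurable
  have pt: "ennreal (\<bar>f x\<bar> powr p) \<le> ennreal (2 powr p * m powr (- p) * \<bar>I\<bar> powr p) + ennreal (2 powr p / m) * J x" for x
  proof -
    have fb: "\<bar>f y - f x\<bar> \<le> 2 * B" for y using bd[of x] bd[of y] by linarith
    have i1: "integrable ?N f" by (rule bint[OF _ bd]) simp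
    have i2: "integrable ?N (\<lambda>y. \<bar>f y - f x\<bar>)" by (rule bint[where C = "2 * B"]) (use fb in auto)
    have i3: "integrable ?N (\<lambda>y. \<bar>f y - f x\<bar> powr p)"
      by (rule bint[where C = "(2 * B) powr p"]) (use fb p in \<open>auto intro: powr_mono2\<close>)
    have "m * f x = I - (\<integral>y. f y - f x \<partial>?N)" using i1 mN by (simp add: I_def)
    then have "m * \<bar>f x\<bar> \<le> \<bar>I\<bar> + \<bar>\<integral>y. f y - f x \<partial>?N\<bar>"
      using m by (simp add: abs_mult[symmetric, of m] abs_mult_pos mult.commute) 
    also have "\<bar>\<integral>y. f y - f x \<partial>?N\<bar> \<le> (\<integral>y. \<bar>f y - f x\<bar> \<partial>?N)" by (rule integral_abs_bound)
    finally have "(m * \<bar>f x\<bar>) powr p \<le> (\<bar>I\<bar> + (\<integral>y. \<bar>f y - f x\<bar> \<partial>?N)) powr p"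
      using m p by (intro powr_mono2) auto
    also have "\<dots> \<le> 2 powr p * (\<bar>I\<bar> powr p + (\<integral>y. \<bar>f y - f x\<bar> \<partial>?N) powr p)"
      using norm_add_powr_le[of p "\<bar>I\<bar>" "\<integral>y. \<bar>f y - f x\<bar> \<partial>?N"] p by simp
    also have "\<dots> \<le> 2 powr p * (\<bar>I\<bar> powr p + m powr (p - 1) * (\<integral>y. \<bar>f y - f x\<bar> powr p \<partial>?N))"
      using Jensen_powr[OF N.finite_measure_axioms p _ i2 i3] mN by (intro mult_left_mono add_left_mono) auto
    finally have "m powr p * \<bar>f x\<bar> powr p \<le> 2 powr p * (\<bar>I\<bar> powr p + m powr (p - 1) * (\<integral>y. \<bar>f y - f x\<bar> powr p \<partial>?N))"
      using m by (simp add: powr_mult)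
    then have "m powr (-p) * (m powr p * \<bar>f x\<bar> powr p) \<le> m powr (-p) * (2 powr p * (\<bar>I\<bar> powr p + m powr (p - 1) * (\<integral>y. \<bar>f y - f x\<bar> powr p \<partial>?N)))"
      by (intro mult_left_mono) auto
    also have "m powr (-p) * (m powr p * \<bar>f x\<bar> powr p) = \<bar>f x\<bar> powr p"
      using m by (simp flip: mult.assoc powr_add)
    also have "m powr (-p) * (2 powr p * (\<bar>I\<bar> powr p + m powr (p - 1) * (\<integral>y. \<bar>f y - f x\<bar> powr p \<partial>?N))) =
       2 powr p * m powr (- p) * \<bar>I\<bar> powr p + 2 powr p * (m powr (-p) * m powr (p - 1)) * (\<integral>y. \<bar>f y - f x\<bar> powr p \<partial>?N)"
      by (simp add: algebra_simps)
    also have "m powr (-p) * m powr (p - 1) = 1 / m"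
      using powr_add[of m "-p" "p - 1"] powr_neg_one[OF m] by simp
    finally have "ennreal (\<bar>f x\<bar> powr p) \<le> ennreal (2 powr p * m powr (- p) * \<bar>I\<bar> powr p + 2 powr p / m * (\<integral>y. \<bar>f y - f x\<bar> powr p \<partial>?N))"
      by (intro ennreal_leI) simp
    also have "\<dots> = ennreal (2 powr p * m powr (- p) * \<bar>I\<bar> powr p) + ennreal (2 powr p / m * (\<integral>y. \<bar>f y - f x\<bar> powr p \<partial>?N))"
      by (rule ennreal_plus) (use m in auto)
    also have "ennreal (2 powr p / m * (\<integral>y. \<bar>f y - f x\<bar> powr p \<partial>?N)) = ennreal (2 powr p / m) * ennreal (\<integral>y. \<bar>f y - f x\<bar> powr p \<partial>?N)"
      by (rule ennreal_mult) (use m in auto)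
    also have "ennreal (\<integral>y. \<bar>f y - f x\<bar> powr p \<partial>?N) = J x"
    proof -
      have "ennreal (\<integral>y. \<bar>f y - f x\<bar> powr p \<partial>?N) = (\<integral>\<^sup>+y. ennreal (\<bar>f y - f x\<bar> powr p) \<partial>?N)"
        by (rule nn_integral_eq_integral[symmetric, OF i3]) auto
      also have "\<dots> = J x" unfolding J_def by (subst nn_integral_restrict_space) (auto simp: mult.commute)
      finally show ?thesis .
    qed
    finally show ?thesis .
  qed
  have PQ: "(\<integral>\<^sup>+x. indicator Q x * J x \<partial>lborel) \<le> ennreal (2 ^ DIM('a) * m * (DIM('a) * \<delta>) powr p) * (\<integral>\<^sup>+x. indicator Q x * ennreal (norm (g x) powr p) \<partial>lborel)"
  proof -
    have "(\<integral>\<^sup>+x. indicator Q x * J x \<partial>lborel) = (\<integral>\<^sup>+y. \<integral>\<^sup>+x. indicator Q y * indicator Q x * ennreal (\<bar>f x - f y\<bar> powr p) \<partial>lborel \<partial>lborel)"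
      unfolding J_def by (intro nn_integral_cong) (simp add: nn_integral_cmult[symmetric] mult.assoc)
    also have "\<dots> \<le> emeasure lborel (cbox (- \<delta> *\<^sub>R One) (\<delta> *\<^sub>R One) :: 'a set) * ennreal ((DIM('a) * \<delta>) powr p) * (\<integral>\<^sup>+x. indicator Q x * ennreal (norm (g x) powr p) \<partial>lborel)"
      by (rule Poincare_convex[OF d gc p Q]) (use cell_convex[OF \<delta>] cell_diff[OF \<delta>] in \<open>auto simp: Q_def\<close>)
    also have "emeasure lborel (cbox (- \<delta> *\<^sub>R One) (\<delta> *\<^sub>R One) :: 'a set) = ennreal (2 ^ DIM('a) * m)"
    proof -
      have "emeasure lborel (cbox (- \<delta> *\<^sub>R One) (\<delta> *\<^sub>R One) :: 'a set) = (\<Prod>b\<in>(Basis::'a set). (\<delta> *\<^sub>R One - (- \<delta> *\<^sub>R One)) \<bullet> b)"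
        using \<delta> by (intro emeasure_lborel_cbox) auto
      also have "(\<Prod>b\<in>(Basis::'a set). (\<delta> *\<^sub>R One - (- \<delta> *\<^sub>R One)) \<bullet> b) = (\<Prod>b\<in>(Basis::'a set). 2 * \<delta>)"
        by (rule prod.cong) (auto simp: inner_diff_left inner_add_left)
      finally show ?thesis by (simp add: power_mult_distrib m_def)
    qed
    also have "ennreal (2 ^ DIM('a) * m) * ennreal ((DIM('a) * \<delta>) powr p) = ennreal (2 ^ DIM('a) * m * (DIM('a) * \<delta>) powr p)"
      using m by (simp add: ennreal_mult)
    finally show ?thesis .
  qed
  have "(\<integral>\<^sup>+x. indicator Q x * ennreal (\<bar>f x\<bar> powr p) \<partial>lborel) \<le>
    (\<integral>\<^sup>+x. ennreal (2 powr p * m powr (- p) * \<bar>I\<bar> powr p) * indicator Q x + ennreal (2 powr p / m) * (indicator Q x * J x) \<partial>lborel)"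
    by (intro nn_integral_mono) (use pt in \<open>auto simp: indicator_def\<close>)
  also have "\<dots> = ennreal (2 powr p * m powr (- p) * \<bar>I\<bar> powr p) * ennreal m + ennreal (2 powr p / m) * (\<integral>\<^sup>+x. indicator Q x * J x \<partial>lborel)"
    by (subst nn_integral_add) (auto simp: nn_integral_cmult emQ)
  also have "\<dots> \<le> ennreal (2 powr p * m powr (- p) * \<bar>I\<bar> powr p) * ennreal m +
     ennreal (2 powr p / m) * (ennreal (2 ^ DIM('a) * m * (DIM('a) * \<delta>) powr p) * (\<integral>\<^sup>+x. indicator Q x * ennreal (norm (g x) powr p) \<partial>lborel))"
    by (intro add_left_mono mult_left_mono PQ) auto
  also have "ennreal (2 powr p * m powr (- p) * \<bar>I\<bar> powr p) * ennreal m = ennreal (2 powr p * m powr (1 - p) * \<bar>I\<bar> powr p)"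
  proof -
    have "m powr (1 - p) = m powr (- p) * m" using m powr_add[of m "-p" 1] by simp
    then show ?thesis using m by (simp add: ennreal_mult[symmetric] mult_ac)
  qed
  also have "ennreal (2 powr p / m) * (ennreal (2 ^ DIM('a) * m * (DIM('a) * \<delta>) powr p) * (\<integral>\<^sup>+x. indicator Q x * ennreal (norm (g x) powr p) \<partial>lborel))
     = ennreal (2 powr p * (2 ^ DIM('a) * (DIM('a) * \<delta>) powr p)) * (\<integral>\<^sup>+x. indicator Q x * ennreal (norm (g x) powr p) \<partial>lborel)"
    using m by (simp add: mult.assoc[symmetric] ennreal_mult[symmetric])
  finally show ?thesis unfolding I_eq .
qed

context bounded_domain
begin

lemma nn_integral_test_function:
  fixes h :: "'a \<Rightarrow> 'b::euclidean_space"
  assumes "h \<in> borel_measurable borel" "\<And>x. x \<notin> \<Omega> \<Longrightarrow> h x = 0" "h \<in> Lp \<Omega> p"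
  shows "(\<integral>\<^sup>+x. ennreal (norm (h x) powr p) \<partial>lborel) = ennreal (\<integral>x. norm (h x) powr p \<partial>M)"
proof -
  have "ennreal (\<integral>x. norm (h x) powr p \<partial>M) = (\<integral>\<^sup>+x. ennreal (norm (h x) powr p) \<partial>M)"
    by (rule nn_integral_eq_integral[symmetric, OF Lp_D(2)[OF assms(3)]]) auto
  also have "\<dots> = (\<integral>\<^sup>+x. ennreal (norm (h x) powr p) * indicator \<Omega> x \<partial>lebesgue)"
    by (rule nn_integral_restrict_space) simp
  also have "\<dots> = (\<integral>\<^sup>+x. ennreal (norm (h x) powr p) \<partial>lebesgue)"
    by (rule nn_integral_cong) (use assms(2) p_gt_1 in \<open>auto simp: indicator_def\<close>)
  also have "\<dots> = (\<integral>\<^sup>+x. ennreal (norm (h x) powr p) \<partial>lborel)" by (rule nn_integral_completion)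
  finally show ?thesis by simp
qed

text \<open>The side of the cells is chosen such that the gradient term receives the factor \<open>\<epsilon>\<close>; finitely many
  cells meet the bounded set \<open>\<Omega>\<close>. Cells may stick out of \<open>\<Omega>\<close>, because test functions are defined,
  and smooth, on the whole space.\<close>

lemma Rellich_estimate:
  assumes "0 < \<epsilon>"
  shows "\<exists>\<Q> K. finite \<Q> \<and> \<Q> \<subseteq> sets borel \<and> 0 \<le> K \<and> (\<forall>f\<in>test_functions \<Omega>.
    (\<integral>x. \<bar>f x\<bar> powr p \<partial>M) \<le> \<epsilon> * (\<integral>x. norm (grad f x) powr p \<partial>M)
      + K * (\<Sum>Q\<in>\<Q>. \<bar>\<integral>x. indicator Q x * f x \<partial>M\<bar> powr p))"
proof -
  define c where "c = 2 powr p * 2 ^ DIM('a) * DIM('a) powr p"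
  have c: "0 < c" by (simp add: c_def)
  define \<delta> where "\<delta> = (\<epsilon> / c) powr (1 / p)"
  have \<delta>: "0 < \<delta>" using assms c by (simp add: \<delta>_def)
  have \<delta>p: "2 powr p * (2 ^ DIM('a) * (DIM('a) * \<delta>) powr p) = \<epsilon>"
  proof -
    have "\<delta> powr p = \<epsilon> / c" using assms c p_gt_1 by (simp add: \<delta>_def powr_powr)
    then have "2 powr p * (2 ^ DIM('a) * (DIM('a) * \<delta>) powr p) = c * (\<epsilon> / c)"
      using \<delta> by (simp add: powr_mult c_def)
    then show ?thesis using c by simp
  qed
  let ?Q = "cell \<delta> ` \<Omega>"
  define K where "K = 2 powr p * (\<delta> ^ DIM('a)) powr (1 - p)"
  have K: "0 \<le> K" by (simp add: K_def)
  have fin: "finite ?Q" by (rule finite_cells[OF bounded_dom \<delta>])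
  have "(\<integral>x. \<bar>f x\<bar> powr p \<partial>M) \<le> \<epsilon> * (\<integral>x. norm (grad f x) powr p \<partial>M) + K * (\<Sum>Q\<in>?Q. \<bar>\<integral>x. indicator Q x * f x \<partial>M\<bar> powr p)"
    if f: "f \<in> test_functions \<Omega>" for f
  proof -
    have s: "smooth f" by (rule test_functions_smooth[OF f])
    note [measurable] = smooth_borel[OF s]
    obtain B where B: "\<And>x. \<bar>f x\<bar> \<le> B" using test_function_bounded[OF f] by metis
    have [measurable]: "Q \<in> sets borel" if "Q \<in> ?Q" for Q using that cell_borel[OF \<delta>] by auto
    define F where "F = (\<integral>x. \<bar>f x\<bar> powr p \<partial>M)"
    define G where "G = (\<integral>x. norm (grad f x) powr p \<partial>M)"
    define A where "A Q = \<bar>\<integral>x. indicator Q x * f x \<partial>M\<bar> powr p" for Q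
    have FG: "0 \<le> F" "0 \<le> G" "\<And>Q. 0 \<le> A Q" by (auto simp: F_def G_def A_def)
    have F: "ennreal F = (\<integral>\<^sup>+x. ennreal (\<bar>f x\<bar> powr p) \<partial>lborel)"
      unfolding F_def using nn_integral_test_function[of f] test_function_zero_off_domain(1)[OF f] test_Lp(1)[OF f] by simp
    have G: "ennreal G = (\<integral>\<^sup>+x. ennreal (norm (grad f x) powr p) \<partial>lborel)"
      unfolding G_def using nn_integral_test_function[of "grad f"] test_function_zero_off_domain(2)[OF f] test_Lp(2)[OF f] by simp
    have part: "(\<Sum>Q\<in>?Q. indicator Q x) = (1::ennreal)" if x: "x \<in> \<Omega>" for x
    proof -
      have "(\<Sum>Q\<in>?Q. indicator Q x) = (\<Sum>Q\<in>?Q. if Q = cell \<delta> x then 1 else (0::ennreal))"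
      proof (rule sum.cong)
        fix Q assume "Q \<in> ?Q"
        then obtain z where Q: "Q = cell \<delta> z" by auto
        have "x \<in> Q \<longleftrightarrow> Q = cell \<delta> x"
          using cell_eq[of x \<delta> z] mem_cell_self[of x \<delta>] by (metis Q)
        then show "indicator Q x = (if Q = cell \<delta> x then 1 else (0::ennreal))"
          by (simp only: indicator_def of_bool_def)
      qed simp
      also have "\<dots> = 1" using fin x by simp
      finally show ?thesis .
    qed
    have "ennreal F = (\<integral>\<^sup>+x. (\<Sum>Q\<in>?Q. indicator Q x * ennreal (\<bar>f x\<bar> powr p)) \<partial>lborel)"
      unfolding F
    proof (rule nn_integral_cong)
      fix x show "ennreal (\<bar>f x\<bar> powr p) = (\<Sum>Q\<in>?Q. indicator Q x * ennreal (\<bar>f x\<bar> powr p))"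
        using part[of x] test_function_zero_off_domain(1)[OF f, of x] p_gt_1
        by (cases "x \<in> \<Omega>") (auto simp flip: sum_distrib_right)
    qed
    also have "\<dots> = (\<Sum>Q\<in>?Q. \<integral>\<^sup>+x. indicator Q x * ennreal (\<bar>f x\<bar> powr p) \<partial>lborel)"
      by (rule nn_integral_sum) measurable
    also have "\<dots> \<le> (\<Sum>Q\<in>?Q. ennreal (K * A Q) + ennreal \<epsilon> * (\<integral>\<^sup>+x. indicator Q x * ennreal (norm (grad f x) powr p) \<partial>lborel))"
    proof (rule sum_mono)
      fix Q assume "Q \<in> ?Q"
      then obtain z where Q: "Q = cell \<delta> z" by auto
      have Qb [measurable]: "Q \<in> sets borel" unfolding Q by (rule cell_borel[OF \<delta>])
      have "(\<integral>x. indicator Q x * f x \<partial>lborel) = (\<integral>x. indicator Q x * f x \<partial>M)"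
        using test_function_zero_off_domain(1)[OF f] by (intro integral_M_eq_lborel[symmetric]) auto
      then show "(\<integral>\<^sup>+x. indicator Q x * ennreal (\<bar>f x\<bar> powr p) \<partial>lborel) \<le>
          ennreal (K * A Q) + ennreal \<epsilon> * (\<integral>\<^sup>+x. indicator Q x * ennreal (norm (grad f x) powr p) \<partial>lborel)"
        using cell_estimate[OF smooth_GDERIV[OF s] smooth_continuous_grad[OF s] p_gt_1 \<delta> B, of z]
        unfolding \<delta>p K_def A_def Q by simp
    qed
    also have "\<dots> = ennreal (K * (\<Sum>Q\<in>?Q. A Q)) + ennreal \<epsilon> * (\<Sum>Q\<in>?Q. \<integral>\<^sup>+x. indicator Q x * ennreal (norm (grad f x) powr p) \<partial>lborel)"
      using K FG by (simp add: sum.distrib sum_distrib_left sum_ennreal)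
    also have "(\<Sum>Q\<in>?Q. \<integral>\<^sup>+x. indicator Q x * ennreal (norm (grad f x) powr p) \<partial>lborel) =
        (\<integral>\<^sup>+x. (\<Sum>Q\<in>?Q. indicator Q x * ennreal (norm (grad f x) powr p)) \<partial>lborel)"
      by (rule nn_integral_sum[symmetric]) measurable
    also have "\<dots> = ennreal G"
      unfolding G
    proof (rule nn_integral_cong)
      fix x show "(\<Sum>Q\<in>?Q. indicator Q x * ennreal (norm (grad f x) powr p)) = ennreal (norm (grad f x) powr p)"
        using part[of x] test_function_zero_off_domain(2)[OF f, of x] p_gt_1
        by (cases "x \<in> \<Omega>") (auto simp flip: sum_distrib_right)
    qed
    also have "ennreal (K * (\<Sum>Q\<in>?Q. A Q)) + ennreal \<epsilon> * ennreal G = ennreal (K * (\<Sum>Q\<in>?Q. A Q) + \<epsilon> * G)"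
      using K FG assms by (simp add: ennreal_mult sum_nonneg)
    finally have "F \<le> K * (\<Sum>Q\<in>?Q. A Q) + \<epsilon> * G"
      using K FG assms by (subst (asm) ennreal_le_iff) (auto intro!: add_nonneg_nonneg mult_nonneg_nonneg sum_nonneg)
    then show ?thesis by (simp add: F_def G_def A_def add.commute)
  qed
  then show ?thesis using fin K cell_borel[OF \<delta>] by (intro exI[of _ ?Q] exI[of _ K]) auto
qed

text \<open>The functions are replaced by test functions that are close in norm. The estimate above, for
  \<open>\<epsilon> = 1/(k + 1)\<close>, involves only countably many functionals \<open>f \<mapsto> \<integral>\<^sub>Q f\<close>. By a diagonal argument all of
  them converge along one subsequence, which is therefore Cauchy in \<open>L\<^sup>p\<close>.\<close>

theorem Rellich:
  fixes u :: "nat \<Rightarrow> 'a \<Rightarrow> real"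
  assumes s: "\<And>n. sob0 (u n) (G n)"
    and b: "\<And>n. (\<integral>x. \<bar>u n x\<bar> powr p \<partial>M) \<le> C" "\<And>n. (\<integral>x. norm (G n x) powr p \<partial>M) \<le> C"
  obtains r U where "strict_mono r" "dom_conv (\<lambda>n. u (r n)) U"
proof -
  define e where "e n = inverse (real (Suc n))" for n
  have e: "e n > 0" "e n \<le> 1" for n by (auto simp: e_def inverse_le_1_iff)
  have e0: "e \<longlonglongrightarrow> 0" unfolding e_def[abs_def] by (rule LIMSEQ_inverse_real_of_nat)
  have "\<forall>k. \<exists>\<phi>. \<phi> \<in> test_functions \<Omega> \<and> (\<integral>x. norm (\<phi> x - u k x) powr p \<partial>M) < e k \<and> (\<integral>x. norm (grad \<phi> x - G k x) powr p \<partial>M) < e k"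
    by (intro allI sob0_approx[unfolded Bex_def] s e(1))
  from choice[OF this] obtain f where f: "\<And>k. f k \<in> test_functions \<Omega>"
    and f1: "\<And>k. (\<integral>x. norm (f k x - u k x) powr p \<partial>M) < e k"
    and f2: "\<And>k. (\<integral>x. norm (grad (f k) x - G k x) powr p \<partial>M) < e k"
    by auto
  note uL = sob0_Lp(1)[OF s] and GL = sob0_Lp(2)[OF s]
  have zL: "(\<lambda>x. 0) \<in> Lp \<Omega> p" "(\<lambda>x. 0::'a) \<in> Lp \<Omega> p" by (rule Lp_const)+
  define C' where "C' = 2 powr p * (1 + C)"
  have fC: "(\<integral>x. \<bar>f n x\<bar> powr p \<partial>M) \<le> C'" for n
  proof -
    have "(\<integral>x. norm (f n x - 0) powr p \<partial>M) \<le> 2 powr p * ((\<integral>x. norm (f n x - u n x) powr p \<partial>M) + (\<integral>x. norm (u n x - 0) powr p \<partial>M))"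
      by (rule Lp_dist_triangle[OF test_Lp(1)[OF f] uL zL(1)])
    also have "\<dots> \<le> C'" unfolding C'_def using f1[of n] e(2)[of n] b(1)[of n] by (intro mult_left_mono add_mono) auto
    finally show ?thesis by simp
  qed
  have gC: "(\<integral>x. norm (grad (f n) x) powr p \<partial>M) \<le> C'" for n
  proof -
    have "(\<integral>x. norm (grad (f n) x - 0) powr p \<partial>M) \<le> 2 powr p * ((\<integral>x. norm (grad (f n) x - G n x) powr p \<partial>M) + (\<integral>x. norm (G n x - 0) powr p \<partial>M))"
      by (rule Lp_dist_triangle[OF test_Lp(2)[OF f] GL zL(2)])
    also have "\<dots> \<le> C'" unfolding C'_def using f2[of n] e(2)[of n] b(2)[of n] by (intro mult_left_mono add_mono) auto
    finally show ?thesis by simp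
  qed
  have C': "0 \<le> C'" using fC[of 0] by (rule order_trans[rotated]) simp
  have "\<forall>k::nat. \<exists>\<Q>. finite \<Q> \<and> \<Q> \<subseteq> sets borel \<and> (\<exists>K\<ge>0. \<forall>h\<in>test_functions \<Omega>.
    (\<integral>x. \<bar>h x\<bar> powr p \<partial>M) \<le> e k * (\<integral>x. norm (grad h x) powr p \<partial>M) + K * (\<Sum>Q\<in>\<Q>. \<bar>\<integral>x. indicator Q x * h x \<partial>M\<bar> powr p))"
    using Rellich_estimate e(1) by meson
  from choice[OF this] obtain \<Q> where \<Q>all: "\<forall>k. finite (\<Q> k) \<and> \<Q> k \<subseteq> sets borel \<and> (\<exists>K\<ge>0. \<forall>h\<in>test_functions \<Omega>.
    (\<integral>x. \<bar>h x\<bar> powr p \<partial>M) \<le> e k * (\<integral>x. norm (grad h x) powr p \<partial>M) + K * (\<Sum>Q\<in>\<Q> k. \<bar>\<integral>x. indicator Q x * h x \<partial>M\<bar> powr p))"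
    by (rule exE)
  note \<Q> = conjunct1[OF spec[OF \<Q>all]] conjunct1[OF conjunct2[OF spec[OF \<Q>all]]]
  define S where "S = (\<Union>k. \<Q> k)"
  have "countable S" unfolding S_def by (rule countable_UN) (auto intro: countable_finite \<Q>(1))
  have indm: "(\<lambda>x. indicat_real Q x) \<in> borel_measurable M" if "Q \<in> S" for Q
    using that \<Q>(2) unfolding S_def
    by (intro measurable_restrict_space1 measurable_completion borel_measurable_indicator) auto
  have ind_int: "integrable M (\<lambda>x. indicat_real Q x * h x)" if "Q \<in> S" "h \<in> test_functions \<Omega>" for Q h
    using bounded_mult_integrable[OF Lp_integrable[OF test_Lp(1)[OF that(2)]] indm[OF that(1)], of 1] by simp
  define A where "A n Q = (\<integral>x. indicator Q x * f n x \<partial>M)" for n Q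
  have Abd: "norm (A n Q) \<le> measure M \<Omega> + C'" if "Q \<in> S" for n Q
  proof -
    have "\<bar>A n Q\<bar> \<le> (\<integral>x. \<bar>indicator Q x * f n x\<bar> \<partial>M)" unfolding A_def by (rule integral_abs_bound)
    also have "\<dots> \<le> (\<integral>x. 1 + \<bar>f n x\<bar> powr p \<partial>M)"
    proof (rule integral_mono)
      show "integrable M (\<lambda>x. \<bar>indicat_real Q x * f n x\<bar>)" using ind_int[OF that f] by (rule integrable_abs)
      show "integrable M (\<lambda>x. 1 + \<bar>f n x\<bar> powr p)" using Lp_D(2)[OF test_Lp(1)[OF f]] by simp
      fix x
      have "\<bar>f n x\<bar> \<le> 1 + \<bar>f n x\<bar> powr p" by (rule le_one_add_powr[OF p_gt_1]) simp
      then show "\<bar>indicator Q x * f n x\<bar> \<le> 1 + \<bar>f n x\<bar> powr p" by (simp add: indicator_def add_increasing)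
    qed
    also have "\<dots> = measure M \<Omega> + (\<integral>x. \<bar>f n x\<bar> powr p \<partial>M)"
      using Lp_D(2)[OF test_Lp(1)[OF f]] by simp
    finally show ?thesis using fC[of n] by simp
  qed
  have "\<exists>r. strict_mono r \<and> (\<forall>Q\<in>S. \<exists>l. (\<lambda>n. A (r n) Q) \<longlonglongrightarrow> l)"
    by (rule function_convergent_subsequence[OF \<open>countable S\<close>, of A, OF Abd]) auto
  then obtain r where "strict_mono r \<and> (\<forall>Q\<in>S. \<exists>l. (\<lambda>n. A (r n) Q) \<longlonglongrightarrow> l)" by (rule exE)
  then have r: "strict_mono r" and rl: "\<And>Q. Q \<in> S \<Longrightarrow> \<exists>l. (\<lambda>n. A (r n) Q) \<longlonglongrightarrow> l" by simp_all
  define h where "h n = f (r n)" for n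
  have hL: "h n \<in> Lp \<Omega> p" for n unfolding h_def by (rule test_Lp(1)[OF f])
  have "\<exists>N. \<forall>m\<ge>N. \<forall>n\<ge>N. (\<integral>x. norm (h m x - h n x) powr p \<partial>M) < \<eta>" if \<eta>: "\<eta> > 0" for \<eta>
  proof -
    define D where "D = 2 powr p * (C' + C') + 1"
    have D: "0 < D" using C' by (simp add: D_def add_nonneg_pos)
    have "\<eta> / (2 * D) > 0" using \<eta> D by simp
    from order_tendstoD(2)[OF e0 this] obtain k where k: "e k < \<eta> / (2 * D)"
      by (auto simp: eventually_sequentially)
    obtain K where K: "0 \<le> K" and est: "\<And>h. h \<in> test_functions \<Omega> \<Longrightarrow>
      (\<integral>x. \<bar>h x\<bar> powr p \<partial>M) \<le> e k * (\<integral>x. norm (grad h x) powr p \<partial>M) + K * (\<Sum>Q\<in>\<Q> k. \<bar>\<integral>x. indicator Q x * h x \<partial>M\<bar> powr p)"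
      using \<Q>all by blast
    \<comment> \<open>a tolerance for the single cells which keeps their weighted sum below \<open>\<eta> / 2\<close>\<close>
    define \<theta> where "\<theta> = \<eta> / (2 * (K + 1) * (card (\<Q> k) + 1))"
    have \<theta>: "0 < \<theta>" using \<eta> K by (simp add: \<theta>_def)
    have "\<exists>N. \<forall>m\<ge>N. \<forall>n\<ge>N. \<bar>A (r m) Q - A (r n) Q\<bar> powr p \<le> \<theta>" if "Q \<in> \<Q> k" for Q
    proof -
      have "Q \<in> S" using that by (auto simp: S_def)
      then have "Cauchy (\<lambda>n. A (r n) Q)" using rl LIMSEQ_imp_Cauchy by blast
      moreover have "0 < \<theta> powr (1 / p)" using \<theta> by simp
      ultimately obtain N where N: "\<And>m n. m \<ge> N \<Longrightarrow> n \<ge> N \<Longrightarrow> \<bar>A (r m) Q - A (r n) Q\<bar> < \<theta> powr (1 / p)"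
        unfolding Cauchy_def dist_real_def by blast
      have "\<bar>A (r m) Q - A (r n) Q\<bar> powr p \<le> \<theta>" if "m \<ge> N" "n \<ge> N" for m n
      proof -
        have "\<bar>A (r m) Q - A (r n) Q\<bar> powr p \<le> (\<theta> powr (1 / p)) powr p"
          using N[OF that] p_gt_1 by (intro powr_mono2) auto
        then show ?thesis using \<theta> p_gt_1 by (simp add: powr_powr)
      qed
      then show ?thesis by blast
    qed
    then obtain N where N: "\<And>Q m n. Q \<in> \<Q> k \<Longrightarrow> m \<ge> N Q \<Longrightarrow> n \<ge> N Q \<Longrightarrow> \<bar>A (r m) Q - A (r n) Q\<bar> powr p \<le> \<theta>"
      by metis
    define N0 where "N0 = (\<Sum>Q\<in>\<Q> k. N Q)"
    have N0: "N Q \<le> N0" if "Q \<in> \<Q> k" for Q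
      unfolding N0_def using \<Q>(1)[of k] that by (intro member_le_sum) auto
    have "(\<integral>x. norm (h m x - h n x) powr p \<partial>M) < \<eta>" if mn: "m \<ge> N0" "n \<ge> N0" for m n
    proof -
      have t: "(\<lambda>x. h m x - h n x) \<in> test_functions \<Omega>" unfolding h_def by (intro test_functions_diff f)
      have gr: "grad (\<lambda>x. h m x - h n x) x = grad (f (r m)) x - grad (f (r n)) x" for x
        unfolding h_def by (rule test_functions_diff(2)[OF f f])
      have "(\<integral>x. norm (grad (\<lambda>x. h m x - h n x) x) powr p \<partial>M) \<le> 2 powr p * (C' + C')"
      proof -
        have "(\<integral>x. norm (grad (f (r m)) x - grad (f (r n)) x) powr p \<partial>M) \<le>
          2 powr p * ((\<integral>x. norm (grad (f (r m)) x - 0) powr p \<partial>M) + (\<integral>x. norm (0 - grad (f (r n)) x) powr p \<partial>M))"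
          by (rule Lp_dist_triangle[OF test_Lp(2)[OF f] zL(2) test_Lp(2)[OF f]])
        also have "\<dots> \<le> 2 powr p * (C' + C')" using gC by (intro mult_left_mono add_mono) auto
        finally show ?thesis unfolding gr .
      qed
      also have "\<dots> \<le> D" by (simp add: D_def)
      finally have "e k * (\<integral>x. norm (grad (\<lambda>x. h m x - h n x) x) powr p \<partial>M) \<le> e k * D"
        using e(1)[of k] by (intro mult_left_mono) auto
      also have "\<dots> < \<eta> / 2" using k D by (simp add: field_simps)
      finally have 1: "e k * (\<integral>x. norm (grad (\<lambda>x. h m x - h n x) x) powr p \<partial>M) < \<eta> / 2" .
      have "(\<integral>x. indicator Q x * (h m x - h n x) \<partial>M) = A (r m) Q - A (r n) Q" if "Q \<in> \<Q> k" for Q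
      proof -
        have "Q \<in> S" using that by (auto simp: S_def)
        then show ?thesis using ind_int[OF _ f] by (simp add: A_def h_def right_diff_distrib)
      qed
      then have "(\<Sum>Q\<in>\<Q> k. \<bar>\<integral>x. indicator Q x * (h m x - h n x) \<partial>M\<bar> powr p) = (\<Sum>Q\<in>\<Q> k. \<bar>A (r m) Q - A (r n) Q\<bar> powr p)"
        by (intro sum.cong) auto
      also have "\<dots> \<le> (\<Sum>Q\<in>\<Q> k. \<theta>)" using N N0 mn by (intro sum_mono) (meson order_trans)
      also have "\<dots> = card (\<Q> k) * \<theta>" by simp
      finally have "K * (\<Sum>Q\<in>\<Q> k. \<bar>\<integral>x. indicator Q x * (h m x - h n x) \<partial>M\<bar> powr p) \<le> K * (card (\<Q> k) * \<theta>)"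
        using K by (intro mult_left_mono) auto
      also have "\<dots> \<le> (K + 1) * ((card (\<Q> k) + 1) * \<theta>)"
        using K \<theta> by (intro mult_mono) auto
      also have "\<dots> = \<eta> / 2"
      proof -
        have "a * (b * (\<eta> / (2 * a * b))) = \<eta> / 2" if "a \<noteq> 0" "b \<noteq> 0" for a b
          using that by (simp add: divide_simps)
        from this[of "K + 1" "real (card (\<Q> k) + 1)"] show ?thesis
          using K unfolding \<theta>_def by (simp only: mult.assoc)
      qed
      finally have "K * (\<Sum>Q\<in>\<Q> k. \<bar>\<integral>x. indicator Q x * (h m x - h n x) \<partial>M\<bar> powr p) \<le> \<eta> / 2" .
      with est[OF t] 1 show ?thesis by simp
    qed
    then show ?thesis by blast
  qed
  from Lp_Cauchy_subseq[OF hL this] obtain s' U where s': "strict_mono s'" and U: "dom_conv (\<lambda>n. h (s' n)) U"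
    by metis
  define q where "q n = r (s' n)" for n
  have q: "strict_mono q" unfolding q_def using r s' by (auto simp: strict_mono_def)
  have UL: "U \<in> Lp \<Omega> p" by (rule dom_conv_Lp(2)[OF U])
  have eq0: "(\<lambda>n. e (q n)) \<longlonglongrightarrow> 0" using LIMSEQ_subseq_LIMSEQ[OF e0 q] by (simp add: o_def)
  have "(\<lambda>n. \<integral>x. norm (u (q n) x - U x) powr p \<partial>M) \<longlonglongrightarrow> 0"
  proof (rule tendsto_sandwich[OF _ _ tendsto_const])
    let ?R = "\<lambda>n. 2 powr p * (e (q n) + (\<integral>x. norm (h (s' n) x - U x) powr p \<partial>M))"
    have "?R \<longlonglongrightarrow> 2 powr p * (0 + 0)" by (intro tendsto_intros eq0 dom_conv_norm[OF U])
    then show "?R \<longlonglongrightarrow> 0" by simp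
    have "(\<integral>x. norm (u (q n) x - U x) powr p \<partial>M) \<le> ?R n" for n
    proof -
      have "(\<integral>x. norm (u (q n) x - U x) powr p \<partial>M) \<le> 2 powr p * ((\<integral>x. norm (u (q n) x - h (s' n) x) powr p \<partial>M) + (\<integral>x. norm (h (s' n) x - U x) powr p \<partial>M))"
        by (rule Lp_dist_triangle[OF uL hL UL])
      also have "\<dots> \<le> ?R n"
        using f1[of "q n"] by (intro mult_left_mono add_right_mono) (auto simp: h_def q_def abs_minus_commute)
      finally show ?thesis .
    qed
    then show "\<forall>\<^sub>F n in sequentially. (\<integral>x. norm (u (q n) x - U x) powr p \<partial>M) \<le> ?R n" by simp
  qed simp
  from Lp_conv_subseq[OF uL UL this] obtain t where t: "strict_mono t" "dom_conv (\<lambda>n. u (q (t n))) U"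
    by metis
  have "strict_mono (\<lambda>n. q (t n))" using q t(1) by (auto simp: strict_mono_def)
  then show ?thesis using t(2) by (rule that)
qed

end

section \<open>The potential\<close>

text \<open>All pointwise arguments concern the vector field \<open>a(x, \<cdot>)\<close> at a fixed point \<open>x\<close>.\<close>

definition admissible :: "real \<Rightarrow> real \<Rightarrow> real \<Rightarrow> ('a::euclidean_space \<Rightarrow> 'a) \<Rightarrow> bool" where
  "admissible p \<alpha> \<beta> A \<longleftrightarrow> continuous_on UNIV A \<and>
    (\<forall>\<xi>. \<alpha> * norm \<xi> powr p \<le> A \<xi> \<bullet> \<xi>) \<and>
    (\<forall>\<xi>. norm (A \<xi>) \<le> \<beta> * norm \<xi> powr (p - 1)) \<and>
    (\<forall>\<xi>. \<forall>t>0. A (t *\<^sub>R \<xi>) = t powr (p - 1) *\<^sub>R A \<xi>) \<and>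
    (\<forall>\<xi>. A (- \<xi>) = - A \<xi>) \<and>
    (\<forall>\<xi> \<eta>. \<xi> \<noteq> \<eta> \<longrightarrow> 0 < (A \<xi> - A \<eta>) \<bullet> (\<xi> - \<eta>)) \<and>
    (\<forall>k\<ge>1. \<forall>\<xi> :: nat \<Rightarrow> 'a. \<xi> (k + 1) = \<xi> 1 \<longrightarrow> (\<Sum>i=1..k. A (\<xi> i) \<bullet> (\<xi> (i + 1) - \<xi> i)) \<le> 0)"

locale admissible_field =
  fixes p \<alpha> \<beta> :: real and A :: "'a::euclidean_space \<Rightarrow> 'a"
  assumes p: "1 < p" and \<alpha>: "0 < \<alpha>" and adm: "admissible p \<alpha> \<beta> A"
begin

lemma A_cont: "continuous_on UNIV A"
  and A_coercive: "\<alpha> * norm \<xi> powr p \<le> A \<xi> \<bullet> \<xi>"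
  and A_bound: "norm (A \<xi>) \<le> \<beta> * norm \<xi> powr (p - 1)"
  and A_hom: "0 < t \<Longrightarrow> A (t *\<^sub>R \<xi>) = t powr (p - 1) *\<^sub>R A \<xi>"
  and A_odd: "A (- \<xi>) = - A \<xi>"
  and A_strict: "\<xi> \<noteq> \<eta> \<Longrightarrow> 0 < (A \<xi> - A \<eta>) \<bullet> (\<xi> - \<eta>)"
  using adm by (auto simp: admissible_def)

lemma A_cyclic:
  assumes "1 \<le> k" "\<xi> (k + 1) = \<xi> (1::nat)"
  shows "(\<Sum>i=1..k. A (\<xi> i) \<bullet> (\<xi> (i + 1) - \<xi> i)) \<le> 0"
  using adm assms unfolding admissible_def by blast

lemma A_0: "A 0 = 0"
  using A_odd[of 0] by (simp add: eq_neg_iff_add_eq_0 flip: scaleR_2)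

definition \<Phi> :: "'a \<Rightarrow> real" where "\<Phi> \<xi> = A \<xi> \<bullet> \<xi>"

lemma \<Phi>_lower: "\<alpha> * norm \<xi> powr p \<le> \<Phi> \<xi>"
  unfolding \<Phi>_def by (rule A_coercive)

lemma \<Phi>_nonneg: "0 \<le> \<Phi> \<xi>"
  using \<Phi>_lower[of \<xi>] \<alpha> by (smt (verit) mult_nonneg_nonneg powr_ge_zero)

lemma \<Phi>_upper: "\<Phi> \<xi> \<le> \<beta> * norm \<xi> powr p"
proof -
  have "\<Phi> \<xi> \<le> norm (A \<xi>) * norm \<xi>" unfolding \<Phi>_def by (rule norm_cauchy_schwarz)
  also have "\<dots> \<le> \<beta> * norm \<xi> powr (p - 1) * norm \<xi>" by (intro mult_right_mono A_bound) auto
  also have "\<beta> * norm \<xi> powr (p - 1) * norm \<xi> = \<beta> * norm \<xi> powr p"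
    using powr_add[of "norm \<xi>" "p - 1" 1] by (cases "\<xi> = 0") auto
  finally show ?thesis .
qed

lemma \<Phi>_0: "\<Phi> 0 = 0" by (simp add: \<Phi>_def)

lemma \<Phi>_even: "\<Phi> (- \<xi>) = \<Phi> \<xi>" by (simp add: \<Phi>_def A_odd)

lemma \<Phi>_hom_pos:
  assumes "0 < t" shows "\<Phi> (t *\<^sub>R \<xi>) = t powr p * \<Phi> \<xi>"
proof -
  have "t powr (p - 1) * t = t powr p" using assms powr_add[of t "p - 1" 1] by simp
  then show ?thesis by (simp add: \<Phi>_def A_hom[OF assms] mult_ac)
qed

lemma \<Phi>_hom: "\<Phi> (t *\<^sub>R \<xi>) = \<bar>t\<bar> powr p * \<Phi> \<xi>"
proof -
  consider "t = 0" | "0 < t" | "t < 0" by linarith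
  then show ?thesis
  proof cases
    case 3
    have "\<Phi> (t *\<^sub>R \<xi>) = \<Phi> (\<bar>t\<bar> *\<^sub>R \<xi>)" using 3 \<Phi>_even[of "t *\<^sub>R \<xi>"] by simp
    then show ?thesis using 3 \<Phi>_hom_pos[of "\<bar>t\<bar>" \<xi>] by simp
  qed (use p in \<open>auto simp: \<Phi>_0 \<Phi>_hom_pos\<close>)
qed

text \<open>The cycle runs from \<open>0\<close> along a ray to \<open>\<xi>\<close>, jumps to \<open>\<eta>\<close> and returns along a ray.
  By homogeneity the radial parts are Riemann sums of \<open>\<integral>\<^sub>0\<^sup>1 t\<^sup>p\<^sup>-\<^sup>1 dt = 1/p\<close>.\<close>

lemma \<Phi>_gradient_ineq: "\<Phi> \<xi> + p * (A \<xi> \<bullet> (\<eta> - \<xi>)) \<le> \<Phi> \<eta>"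
proof -
  have main: "(1/p - 1/n) * \<Phi> \<xi> + A \<xi> \<bullet> (\<eta> - \<xi>) - (1/p + 1/n) * \<Phi> \<eta> \<le> 0" if n: "0 < n" for n :: nat
  proof -
    \<comment> \<open>lower and upper Riemann sums of \<open>1/p\<close> that differ by \<open>1/n\<close>\<close>
    define L where "L = (\<Sum>i<n. (real i / n) powr (p - 1) * (1/n))"
    define U where "U = (\<Sum>i<n. (real (Suc i) / n) powr (p - 1) * (1/n))"
    have tel: "(\<Sum>i<n. (real (Suc i) / n) powr p - (real i / n) powr p) = 1"
      using sum_lessThan_telescope[of "\<lambda>i. (real i / n) powr p" n] n p by simp
    have pp: "c powr (p - 1) * c = c powr p" if "0 \<le> c" for c :: real
      using that powr_add[of c "p - 1" 1] by (cases "c = 0") auto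
    have Y: "p * (c powr (p - 1) * (t - c)) \<le> t powr p - c powr p" if "0 \<le> c" "0 \<le> t" for c t
      using weighted_Young[OF p that] pp[OF that(1)] by (simp add: algebra_simps)
    have L1: "p * L \<le> 1"
    proof -
      have "p * L \<le> (\<Sum>i<n. (real (Suc i) / n) powr p - (real i / n) powr p)"
        unfolding L_def sum_distrib_left
      proof (rule sum_mono)
        fix i
        have "real (Suc i) / n - real i / n = 1 / n" by (simp add: diff_divide_distrib[symmetric])
        then show "p * ((real i / n) powr (p - 1) * (1/n)) \<le> (real (Suc i) / n) powr p - (real i / n) powr p"
          using Y[of "real i / n" "real (Suc i) / n"] by simp
      qed
      then show ?thesis using tel by simp
    qed
    have U1: "1 \<le> p * U"
    proof -
      have "(\<Sum>i<n. (real (Suc i) / n) powr p - (real i / n) powr p) \<le> p * U"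
        unfolding U_def sum_distrib_left
      proof (rule sum_mono)
        fix i
        have e: "real i / n - real (Suc i) / n = - (1 / n)" by (simp add: diff_divide_distrib[symmetric])
        show "(real (Suc i) / n) powr p - (real i / n) powr p \<le> p * ((real (Suc i) / n) powr (p - 1) * (1/n))"
          using Y[of "real (Suc i) / n" "real i / n"] unfolding e by simp
      qed
      then show ?thesis using tel by simp
    qed
    have UL: "U = L + 1/n"
    proof -
      have "U - L = (\<Sum>i<n. (real (Suc i) / n) powr (p - 1) * (1/n) - (real i / n) powr (p - 1) * (1/n))"
        by (simp add: U_def L_def sum_subtractf)
      also have "\<dots> = 1/n"
        using sum_lessThan_telescope[of "\<lambda>i. (real i / n) powr (p - 1) * (1/n)" n] n p by simp
      finally show ?thesis by simp
    qed
    \<comment> \<open>\<open>z\<close> runs through \<open>0, \<xi>/n, \<dots>, \<xi>\<close> for the indices up to \<open>n\<close> and through \<open>\<eta>, \<dots>, \<eta>/n, 0\<close> for the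
      indices from \<open>n + 1\<close> to \<open>2 n + 1\<close>; \<open>w\<close> is the same cycle counted from \<open>1\<close>\<close>
    define z where "z i = (if i \<le> n then (real i / n) *\<^sub>R \<xi> else ((2 * real n + 1 - real i) / n) *\<^sub>R \<eta>)" for i :: nat
    define w where "w i = z (i - 1)" for i :: nat
    define h where "h i = A (z i) \<bullet> (z (Suc i) - z i)" for i
    have "(\<Sum>i=1..2 * n + 1. A (w i) \<bullet> (w (i + 1) - w i)) \<le> 0"
      by (rule A_cyclic) (use n in \<open>auto simp: w_def z_def\<close>)
    also have "(\<Sum>i=1..2 * n + 1. A (w i) \<bullet> (w (i + 1) - w i)) = (\<Sum>i<2 * n + 1. h i)"
      by (rule sum.reindex_bij_witness[of _ "\<lambda>i. i + 1" "\<lambda>i. i - 1"]) (auto simp: w_def h_def)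
    also have "\<dots> = (\<Sum>i<n. h i) + (h n + (\<Sum>j<n. h (n + 1 + j)))"
    proof -
      have e: "{..<2 * n + 1} = {..<n} \<union> ({n} \<union> {n + 1..<2 * n + 1})" by auto
      have "sum h ({..<n} \<union> ({n} \<union> {n + 1..<2 * n + 1})) = sum h {..<n} + sum h ({n} \<union> {n + 1..<2 * n + 1})"
        by (rule sum.union_disjoint) auto
      also have "sum h ({n} \<union> {n + 1..<2 * n + 1}) = sum h {n} + sum h {n + 1..<2 * n + 1}"
        by (rule sum.union_disjoint) auto
      finally have "(\<Sum>i<2 * n + 1. h i) = (\<Sum>i<n. h i) + (h n + (\<Sum>i=n + 1..<2 * n + 1. h i))"
        unfolding e by simp
      also have "(\<Sum>i=n + 1..<2 * n + 1. h i) = (\<Sum>j<n. h (n + 1 + j))"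
        by (rule sum.reindex_bij_witness[of _ "\<lambda>j. n + 1 + j" "\<lambda>i. i - (n + 1)"]) auto
      finally show ?thesis .
    qed
    also have "(\<Sum>i<n. h i) = L * \<Phi> \<xi>"
    proof -
      have "h i = (real i / n) powr (p - 1) * (1/n) * \<Phi> \<xi>" if "i < n" for i
      proof -
        have "z (Suc i) - z i = (1 / n) *\<^sub>R \<xi>"
          using that by (simp add: z_def diff_divide_distrib[symmetric] flip: scaleR_diff_left)
        moreover have "A (z i) = (real i / n) powr (p - 1) *\<^sub>R A \<xi>"
          using that n p A_hom[of "real i / n" \<xi>] A_0 by (cases "i = 0") (auto simp: z_def)
        ultimately show ?thesis by (simp add: h_def \<Phi>_def)
      qed
      then show ?thesis by (simp add: L_def sum_distrib_right)
    qed
    also have "h n = A \<xi> \<bullet> (\<eta> - \<xi>)" using n by (simp add: h_def z_def)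
    also have "(\<Sum>j<n. h (n + 1 + j)) = - U * \<Phi> \<eta>"
    proof -
      have "h (n + 1 + j) = - ((real (n - j) / n) powr (p - 1) * (1/n) * \<Phi> \<eta>)" if "j < n" for j
      proof -
        have 1: "z (n + 1 + j) = (real (n - j) / n) *\<^sub>R \<eta>" "z (Suc (n + 1 + j)) = (real (n - j) / n - 1 / n) *\<^sub>R \<eta>"
          using that by (auto simp: z_def of_nat_diff diff_divide_distrib[symmetric] algebra_simps)
        have "A (z (n + 1 + j)) = (real (n - j) / n) powr (p - 1) *\<^sub>R A \<eta>"
          unfolding 1 using that by (intro A_hom) auto
        moreover have "z (Suc (n + 1 + j)) - z (n + 1 + j) = - ((1 / n) *\<^sub>R \<eta>)"
          unfolding 1 by (simp add: scaleR_diff_left)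
        ultimately show ?thesis by (simp add: h_def \<Phi>_def)
      qed
      then have "(\<Sum>j<n. h (n + 1 + j)) = (\<Sum>j<n. - ((real (n - j) / n) powr (p - 1) * (1/n) * \<Phi> \<eta>))"
        by (intro sum.cong) auto
      also have "\<dots> = (\<Sum>i<n. - ((real (Suc i) / n) powr (p - 1) * (1/n) * \<Phi> \<eta>))"
        by (rule sum.reindex_bij_witness[of _ "\<lambda>i. n - Suc i" "\<lambda>j. n - Suc j"]) auto
      finally show ?thesis by (simp add: U_def sum_distrib_right sum_negf)
    qed
    finally have "L * \<Phi> \<xi> + (A \<xi> \<bullet> (\<eta> - \<xi>) + - U * \<Phi> \<eta>) \<le> 0" .
    moreover have "(1/p - 1/n) * \<Phi> \<xi> \<le> L * \<Phi> \<xi>"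
      using U1 UL p \<Phi>_nonneg by (intro mult_right_mono) (auto simp: field_simps)
    moreover have "U * \<Phi> \<eta> \<le> (1/p + 1/n) * \<Phi> \<eta>"
      using L1 UL p \<Phi>_nonneg by (intro mult_right_mono) (auto simp: field_simps)
    ultimately show ?thesis by linarith
  qed
  define e where "e n = inverse (real (Suc n))" for n
  have e0: "e \<longlonglongrightarrow> 0" unfolding e_def[abs_def] by (rule LIMSEQ_inverse_real_of_nat)
  have "(\<lambda>n. (1/p - e n) * \<Phi> \<xi> + A \<xi> \<bullet> (\<eta> - \<xi>) - (1/p + e n) * \<Phi> \<eta>) \<longlonglongrightarrow>
    (1/p - 0) * \<Phi> \<xi> + A \<xi> \<bullet> (\<eta> - \<xi>) - (1/p + 0) * \<Phi> \<eta>"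
    by (intro tendsto_intros e0)
  then have "(1/p - 0) * \<Phi> \<xi> + A \<xi> \<bullet> (\<eta> - \<xi>) - (1/p + 0) * \<Phi> \<eta> \<le> 0"
    by (rule LIMSEQ_le_const2) (use main[of "Suc n" for n] in \<open>auto simp: e_def inverse_eq_divide\<close>)
  then have "p * ((1/p) * \<Phi> \<xi> + A \<xi> \<bullet> (\<eta> - \<xi>) - (1/p) * \<Phi> \<eta>) \<le> 0"
    using p by (simp add: mult_nonneg_nonpos)
  then show ?thesis using p by (simp add: algebra_simps)
qed

text \<open>The gradient inequality is used from \<open>\<xi>\<close> to the midpoint and from there to \<open>\<eta>\<close>; strict monotonicity
  compares the two slopes.\<close>

lemma \<Phi>_gradient_strict:
  assumes "\<xi> \<noteq> \<eta>" shows "\<Phi> \<xi> + p * (A \<xi> \<bullet> (\<eta> - \<xi>)) < \<Phi> \<eta>"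
proof -
  define m where "m = (1/2) *\<^sub>R (\<xi> + \<eta>)"
  have d: "\<eta> - m = m - \<xi>" "\<eta> - \<xi> = (m - \<xi>) + (m - \<xi>)"
    by (simp_all add: m_def algebra_simps flip: scaleR_2 scaleR_left.add)
  have "m \<noteq> \<xi>" using d assms by auto
  then have "0 < p * ((A m - A \<xi>) \<bullet> (m - \<xi>))" using A_strict p by simp
  moreover have "\<Phi> \<xi> + p * (A \<xi> \<bullet> (m - \<xi>)) \<le> \<Phi> m" "\<Phi> m + p * (A m \<bullet> (m - \<xi>)) \<le> \<Phi> \<eta>"
    using \<Phi>_gradient_ineq[of \<xi> m] \<Phi>_gradient_ineq[of m \<eta>] d by auto
  ultimately show ?thesis unfolding d(2) by (simp add: inner_add_right inner_diff_left algebra_simps)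
qed

lemma \<Phi>_strictly_convex: "strictly_convex \<Phi>"
  unfolding strictly_convex_def
proof (intro allI impI)
  fix \<xi> \<eta> :: 'a and t :: real
  assume t: "\<xi> \<noteq> \<eta> \<and> 0 < t \<and> t < 1"
  define m where "m = (1 - t) *\<^sub>R \<xi> + t *\<^sub>R \<eta>"
  have 1: "\<xi> - m = (- t) *\<^sub>R (\<eta> - \<xi>)" "\<eta> - m = (1 - t) *\<^sub>R (\<eta> - \<xi>)"
    by (simp_all add: m_def algebra_simps)
  have ne: "m \<noteq> \<xi>" "m \<noteq> \<eta>" using 1 t by auto
  have "\<Phi> m + p * (A m \<bullet> (\<xi> - m)) < \<Phi> \<xi>" "\<Phi> m + p * (A m \<bullet> (\<eta> - m)) < \<Phi> \<eta>"
    using \<Phi>_gradient_strict ne by auto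
  then have "(1 - t) * (\<Phi> m + p * (A m \<bullet> (\<xi> - m))) + t * (\<Phi> m + p * (A m \<bullet> (\<eta> - m))) < (1 - t) * \<Phi> \<xi> + t * \<Phi> \<eta>"
    using t by (intro add_strict_mono mult_strict_left_mono) auto
  moreover have "(1 - t) * (\<Phi> m + p * (A m \<bullet> (\<xi> - m))) + t * (\<Phi> m + p * (A m \<bullet> (\<eta> - m))) = \<Phi> m"
    unfolding 1 inner_scaleR_right by (simp add: algebra_simps)
  ultimately show "\<Phi> ((1 - t) *\<^sub>R \<xi> + t *\<^sub>R \<eta>) < (1 - t) * \<Phi> \<xi> + t * \<Phi> \<eta>" by (simp add: m_def)
qed

lemma \<Phi>_convex:
  assumes "0 \<le> t" "t \<le> 1" shows "\<Phi> ((1 - t) *\<^sub>R \<xi> + t *\<^sub>R \<eta>) \<le> (1 - t) * \<Phi> \<xi> + t * \<Phi> \<eta>"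
proof (cases "\<xi> = \<eta> \<or> t = 0 \<or> t = 1")
  case True
  then show ?thesis by (auto simp: algebra_simps simp flip: scaleR_add_left)
next
  case False
  then show ?thesis using \<Phi>_strictly_convex assms unfolding strictly_convex_def by (force intro: less_imp_le)
qed

text \<open>The gradient inequalities at \<open>\<xi>\<close> and at \<open>\<xi> + h\<close> enclose the remainder between \<open>0\<close> and
  \<open>p \<bar>A (\<xi> + h) - A \<xi>\<bar> \<bar>h\<bar>\<close>, and \<open>A\<close> is continuous.\<close>

lemma \<Phi>_GDERIV: "GDERIV \<Phi> \<xi> :> p *\<^sub>R A \<xi>"
  unfolding gderiv_def has_derivative_at
proof (intro conjI)
  show "bounded_linear (\<lambda>h. h \<bullet> (p *\<^sub>R A \<xi>))" by (rule bounded_linear_inner_left)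
  have "((\<lambda>h. p * norm (A (\<xi> + h) - A \<xi>)) \<longlongrightarrow> p * norm (A (\<xi> + 0) - A \<xi>)) (at 0)"
  proof -
    have "isCont A \<xi>" using A_cont by (simp add: continuous_on_eq_continuous_at)
    then have "(\<lambda>h. A (\<xi> + h)) \<midarrow>0\<rightarrow> A (\<xi> + 0)" by (simp add: isCont_iff)
    then show ?thesis by (intro tendsto_intros)
  qed
  then have lim: "((\<lambda>h. p * norm (A (\<xi> + h) - A \<xi>)) \<longlongrightarrow> 0) (at 0)" by simp
  show "(\<lambda>h. norm (\<Phi> (\<xi> + h) - \<Phi> \<xi> - h \<bullet> (p *\<^sub>R A \<xi>)) / norm h) \<midarrow>0\<rightarrow> 0"
  proof (rule tendsto_sandwich[OF _ _ tendsto_const lim])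
    show "\<forall>\<^sub>F h in at 0. norm (\<Phi> (\<xi> + h) - \<Phi> \<xi> - h \<bullet> (p *\<^sub>R A \<xi>)) / norm h \<le> p * norm (A (\<xi> + h) - A \<xi>)"
      unfolding eventually_at_filter
    proof (rule always_eventually, intro allI impI)
      fix h :: 'a assume h: "h \<noteq> 0"
      have 1: "0 \<le> \<Phi> (\<xi> + h) - \<Phi> \<xi> - h \<bullet> (p *\<^sub>R A \<xi>)"
        using \<Phi>_gradient_ineq[of \<xi> "\<xi> + h"] by (simp add: inner_commute)
      have "\<Phi> (\<xi> + h) - \<Phi> \<xi> - h \<bullet> (p *\<^sub>R A \<xi>) \<le> p * ((A (\<xi> + h) - A \<xi>) \<bullet> h)"
        using \<Phi>_gradient_ineq[of "\<xi> + h" \<xi>] by (simp add: inner_commute[of h] inner_diff_left algebra_simps)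
      also have "\<dots> \<le> p * (norm (A (\<xi> + h) - A \<xi>) * norm h)"
        using p by (intro mult_left_mono norm_cauchy_schwarz) auto
      finally show "norm (\<Phi> (\<xi> + h) - \<Phi> \<xi> - h \<bullet> (p *\<^sub>R A \<xi>)) / norm h \<le> p * norm (A (\<xi> + h) - A \<xi>)"
        using 1 h by (simp add: divide_le_eq mult.assoc)
    qed
  qed (simp add: always_eventually)
qed

text \<open>Euler's identity: both expressions for the derivative of \<open>t \<mapsto> f (t \<xi>)\<close> at \<open>t = 1\<close> agree.\<close>

lemma potential_unique:
  assumes "GDERIV f \<xi> :> p *\<^sub>R A \<xi>" "\<And>t. 0 < t \<Longrightarrow> f (t *\<^sub>R \<xi>) = t powr p * f \<xi>"
  shows "f \<xi> = \<Phi> \<xi>"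
proof -
  have "((\<lambda>t. f (t *\<^sub>R \<xi>)) has_derivative (\<lambda>t. (t *\<^sub>R \<xi>) \<bullet> (p *\<^sub>R A \<xi>))) (at 1)"
    by (rule has_derivative_compose[of "\<lambda>t. t *\<^sub>R \<xi>" "\<lambda>t. t *\<^sub>R \<xi>"])
       (use assms(1) in \<open>auto intro!: derivative_eq_intros simp: gderiv_def\<close>)
  moreover have "(\<lambda>t. (t *\<^sub>R \<xi>) \<bullet> (p *\<^sub>R A \<xi>)) = (*) (p * \<Phi> \<xi>)"
    by (auto simp: fun_eq_iff \<Phi>_def inner_commute)
  ultimately have 1: "((\<lambda>t. f (t *\<^sub>R \<xi>)) has_real_derivative p * \<Phi> \<xi>) (at 1)"
    by (simp add: has_field_derivative_def)
  have "((\<lambda>t. t powr p * f \<xi>) has_real_derivative (p * 1 powr (p - 1)) * f \<xi>) (at 1)"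
    by (intro DERIV_cmult_right has_real_derivative_powr) simp
  then have "((\<lambda>t. f (t *\<^sub>R \<xi>)) has_real_derivative (p * 1 powr (p - 1)) * f \<xi>) (at 1)"
    by (rule has_field_derivative_transform_within_open[of _ _ _ "{0<..}"]) (use assms(2) in auto)
  from DERIV_unique[OF 1 this] show ?thesis using p by simp
qed

section \<open>Pointwise inequalities for the test field\<close>

lemma A_Young: "p * (A \<xi> \<bullet> \<eta>) \<le> \<Phi> \<eta> + (p - 1) * \<Phi> \<xi>"
  using \<Phi>_gradient_ineq[of \<xi> \<eta>] by (simp add: inner_diff_right \<Phi>_def algebra_simps)

text \<open>With \<open>H = h(v)\<close>, \<open>m = h'(v)\<close>, \<open>\<xi> = \<nabla>v\<close>, \<open>y = \<phi>\<close> and \<open>\<eta> = \<nabla>\<phi>\<close> the vector on the left is the gradient of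
  \<open>\<bar>\<phi>\<bar>\<^sup>p h(v)\<^sup>1\<^sup>-\<^sup>p\<close>. The inequality \<open>A_Young\<close> is applied to multiples of \<open>\<xi>\<close> and \<open>\<eta>\<close> that are scaled such
  that the terms with \<open>\<Phi> \<xi>\<close> cancel.\<close>

lemma Picone_pointwise:
  fixes y H m :: real
  assumes H: "0 < H" and m: "0 < m"
  shows "A \<xi> \<bullet> ((H powr (1 - p) * (p * sgn y * \<bar>y\<bar> powr (p - 1))) *\<^sub>R \<eta> + (\<bar>y\<bar> powr p * (- (p - 1) * m * H powr (- p))) *\<^sub>R \<xi>)
    \<le> m powr (1 - p) * \<Phi> \<eta>"
proof (cases "y = 0")
  case True
  then show ?thesis using \<Phi>_nonneg p by simp
next
  case y: False
  define \<sigma> where "\<sigma> = \<bar>y\<bar> * m powr (1 / p) / H"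
  have \<sigma>: "0 < \<sigma>" using y H m by (simp add: \<sigma>_def)
  have s1: "\<sigma> powr (p - 1) = \<bar>y\<bar> powr (p - 1) * m powr ((p - 1) / p) * H powr (1 - p)"
  proof -
    have "\<sigma> powr (p - 1) = \<bar>y\<bar> powr (p - 1) * (m powr (1 / p)) powr (p - 1) / H powr (p - 1)"
      using H m by (simp add: \<sigma>_def powr_mult powr_divide)
    also have "(m powr (1 / p)) powr (p - 1) = m powr ((p - 1) / p)" by (simp add: powr_powr)
    finally show ?thesis using powr_minus_divide[of H "p - 1"] by simp
  qed
  have s2: "\<sigma> powr p = \<bar>y\<bar> powr p * m * H powr (- p)"
  proof -
    have "\<sigma> powr p = \<bar>y\<bar> powr p * (m powr (1 / p)) powr p / H powr p"
      using H m by (simp add: \<sigma>_def powr_mult powr_divide)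
    also have "(m powr (1 / p)) powr p = m" using m p by (simp add: powr_powr)
    finally show ?thesis using powr_minus_divide[of H p] by simp
  qed
  have k: "\<bar>sgn y * m powr (- (p - 1) / p)\<bar> powr p = m powr (1 - p)"
    using y m p by (simp add: abs_mult powr_powr)
  have mm: "m powr ((p - 1) / p) * m powr (- (p - 1) / p) = 1"
    using m by (simp flip: powr_add) (simp add: add_divide_distrib[symmetric])
  have "p * (A (\<sigma> *\<^sub>R \<xi>) \<bullet> ((sgn y * m powr (- (p - 1) / p)) *\<^sub>R \<eta>)) \<le>
     \<Phi> ((sgn y * m powr (- (p - 1) / p)) *\<^sub>R \<eta>) + (p - 1) * \<Phi> (\<sigma> *\<^sub>R \<xi>)"
    by (rule A_Young)
  also have "\<dots> = m powr (1 - p) * \<Phi> \<eta> + (p - 1) * (\<bar>y\<bar> powr p * m * H powr (- p)) * \<Phi> \<xi>"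
    using \<sigma> unfolding \<Phi>_hom k by (simp add: s2)
  finally have 1: "p * (A (\<sigma> *\<^sub>R \<xi>) \<bullet> ((sgn y * m powr (- (p - 1) / p)) *\<^sub>R \<eta>)) \<le>
     m powr (1 - p) * \<Phi> \<eta> + (p - 1) * (\<bar>y\<bar> powr p * m * H powr (- p)) * \<Phi> \<xi>" .
  have 2: "p * (A (\<sigma> *\<^sub>R \<xi>) \<bullet> ((sgn y * m powr (- (p - 1) / p)) *\<^sub>R \<eta>)) =
    H powr (1 - p) * (p * sgn y * \<bar>y\<bar> powr (p - 1)) * (A \<xi> \<bullet> \<eta>)"
  proof -
    have "p * (A (\<sigma> *\<^sub>R \<xi>) \<bullet> ((sgn y * m powr (- (p - 1) / p)) *\<^sub>R \<eta>)) =
    (m powr ((p - 1) / p) * m powr (- (p - 1) / p)) * (H powr (1 - p) * (p * sgn y * \<bar>y\<bar> powr (p - 1)) * (A \<xi> \<bullet> \<eta>))"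
    unfolding A_hom[OF \<sigma>] s1 by simp
    then show ?thesis unfolding mm by simp
  qed
  show ?thesis using 1 unfolding 2 by (simp add: inner_add_right \<Phi>_def algebra_simps)
qed

text \<open>The same vector, added with a small factor \<open>t\<close>. The sum is a convex combination of \<open>\<xi>\<close> and a multiple
  of \<open>\<eta>\<close>, so convexity of \<open>\<Phi>\<close> yields a decrease proportional to \<open>\<Phi> \<xi> H\<^sup>-\<^sup>p\<close>, the energy density of
  \<open>log h(v)\<close>.\<close>

lemma log_pointwise:
  fixes y H m t :: real
  assumes H: "0 < H" and m: "0 < m" and t: "0 < t" and small: "t * ((p - 1) * \<bar>y\<bar> powr p * m * H powr (- p)) \<le> 1"
  shows "\<Phi> (\<xi> + t *\<^sub>R ((H powr (1 - p) * (p * sgn y * \<bar>y\<bar> powr (p - 1))) *\<^sub>R \<eta> + (\<bar>y\<bar> powr p * (- (p - 1) * m * H powr (- p))) *\<^sub>R \<xi>))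
    \<le> \<Phi> \<xi> - t * ((p - 1) * \<bar>y\<bar> powr p * m * H powr (- p) * \<Phi> \<xi>) + t * (p powr p * (p - 1) powr (1 - p) * m powr (1 - p) * \<Phi> \<eta>)"
proof (cases "y = 0")
  case True
  then show ?thesis using \<Phi>_nonneg p t by simp
next
  case y: False
  define k where "k = (p - 1) * \<bar>y\<bar> powr p * m * H powr (- p)"
  have k: "0 < k" using p y m H by (simp add: k_def)
  define b where "b = H powr (1 - p) * (p * sgn y * \<bar>y\<bar> powr (p - 1))"
  have eq: "\<xi> + t *\<^sub>R (b *\<^sub>R \<eta> + (\<bar>y\<bar> powr p * (- (p - 1) * m * H powr (- p))) *\<^sub>R \<xi>) =
     (1 - t * k) *\<^sub>R \<xi> + (t * k) *\<^sub>R ((b / k) *\<^sub>R \<eta>)"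
  proof -
    have c: "\<bar>y\<bar> powr p * (- (p - 1) * m * H powr (- p)) = - k" by (simp add: k_def algebra_simps)
    show ?thesis unfolding c using k by (simp add: algebra_simps)
  qed
  have "\<Phi> ((1 - t * k) *\<^sub>R \<xi> + (t * k) *\<^sub>R ((b / k) *\<^sub>R \<eta>)) \<le> (1 - t * k) * \<Phi> \<xi> + (t * k) * \<Phi> ((b / k) *\<^sub>R \<eta>)"
    using t k small by (intro \<Phi>_convex) (auto simp: k_def)
  also have "(t * k) * \<Phi> ((b / k) *\<^sub>R \<eta>) = t * (p powr p * (p - 1) powr (1 - p) * m powr (1 - p) * \<Phi> \<eta>)"
  proof -
    have ab: "\<bar>b / k\<bar> = H powr (1 - p) * p * \<bar>y\<bar> powr (p - 1) / k"
      using p k y by (simp add: b_def abs_mult)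
    have 1: "\<bar>b / k\<bar> powr p = H powr ((1 - p) * p) * p powr p * \<bar>y\<bar> powr ((p - 1) * p) / k powr p"
      unfolding ab using p k by (simp add: powr_mult powr_divide powr_powr)
    have 2: "k powr (1 - p) = (p - 1) powr (1 - p) * \<bar>y\<bar> powr (p * (1 - p)) * m powr (1 - p) * H powr (- p * (1 - p))"
      unfolding k_def using p m by (simp add: powr_mult powr_powr)
    have 3: "k / k powr p = k powr (1 - p)" using k by (simp add: powr_diff)
    have "k * \<bar>b / k\<bar> powr p = (k / k powr p) * (H powr ((1 - p) * p) * p powr p * \<bar>y\<bar> powr ((p - 1) * p))"
      unfolding 1 by simp
    also have "\<dots> = p powr p * (p - 1) powr (1 - p) * m powr (1 - p) * (H powr ((1 - p) * p) * H powr (- p * (1 - p))) *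
       (\<bar>y\<bar> powr ((p - 1) * p) * \<bar>y\<bar> powr (p * (1 - p)))"
      unfolding 3 2 by (simp only: mult_ac)
    also have "H powr ((1 - p) * p) * H powr (- p * (1 - p)) = 1"
      using H by (simp flip: powr_add)
    also have "\<bar>y\<bar> powr ((p - 1) * p) * \<bar>y\<bar> powr (p * (1 - p)) = 1"
    proof -
      have e: "(p - 1) * p + p * (1 - p) = 0" by algebra
      show ?thesis using y unfolding powr_add[symmetric] e by simp
    qed
    finally show ?thesis unfolding \<Phi>_hom by (simp add: mult.assoc)
  qed
  finally have "\<Phi> ((1 - t * k) *\<^sub>R \<xi> + (t * k) *\<^sub>R ((b / k) *\<^sub>R \<eta>)) \<le> \<Phi> \<xi> - t * (k * \<Phi> \<xi>) + t * (p powr p * (p - 1) powr (1 - p) * m powr (1 - p) * \<Phi> \<eta>)"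
    by (simp add: algebra_simps)
  then show ?thesis unfolding eq[symmetric] unfolding k_def b_def .
qed

end

section \<open>The eigenvalue problem\<close>

locale eigenproblem = bounded_domain \<Omega> p
  for \<Omega> :: "'a::euclidean_space set" and p :: real +
  fixes \<alpha> \<beta> \<rho>m \<rho>p :: real and \<rho> :: "'a \<Rightarrow> real" and a :: "'a \<Rightarrow> 'a \<Rightarrow> 'a"
  assumes \<alpha>_pos: "0 < \<alpha>" and \<beta>_pos: "0 < \<beta>" and \<rho>m_pos: "0 < \<rho>m"
    and \<rho>_meas: "\<rho> \<in> borel_measurable M"
    and \<rho>_bounds: "AE x in M. \<rho>m \<le> \<rho> x \<and> \<rho> x \<le> \<rho>p"
    and a_meas: "\<And>\<xi>. (\<lambda>x. a x \<xi>) \<in> borel_measurable M"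
    and a_adm: "AE x in M. admissible p \<alpha> \<beta> (a x)"
begin

lemma a_field: "AE x in M. admissible_field p \<alpha> \<beta> (a x)"
  using a_adm by eventually_elim (simp add: admissible_field_def p_gt_1 \<alpha>_pos)

text \<open>For simple \<open>u\<close> this is the measurability in the first argument; continuity in the second argument
  passes to the limit.\<close>

lemma Caratheodory_measurable:
  assumes "u \<in> borel_measurable M" shows "(\<lambda>x. a x (u x)) \<in> borel_measurable M"
proof -
  obtain s where s: "\<And>i. simple_function M (s i)" "\<And>x. x \<in> space M \<Longrightarrow> (\<lambda>i. s i x) \<longlonglongrightarrow> u x"
    using borel_measurable_implies_sequence_metric[OF assms, of 0] by blast
  have "(\<lambda>x. a x (s i x)) \<in> borel_measurable M" for i
  proof (rule measurable_compose_countable'[where f = "\<lambda>\<xi> x. a x \<xi>"])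
    show "s i \<in> measurable M (count_space (s i ` space M))"
      using simple_functionD[OF s(1)[of i]] by (subst measurable_count_space_eq2) auto
    show "countable (s i ` space M)" using simple_functionD(1)[OF s(1)[of i]] by (rule countable_finite)
  qed (rule a_meas)
  moreover have "AE x in M. (\<lambda>i. a x (s i x)) \<longlonglongrightarrow> a x (u x)"
    using a_field AE_space
  proof eventually_elim
    case (elim x)
    then show ?case
      using continuous_on_tendsto_compose[OF admissible_field.A_cont[OF elim(1)] s(2)[OF elim(2)]] by simp
  qed
  ultimately show ?thesis by (rule measurable_AE_limit)
qed

lemma powr_product_bound:
  assumes "0 \<le> c" "0 \<le> t" shows "c powr (p - 1) * t \<le> t powr p + c powr p"
proof -
  have "p * (c powr (p - 1) * t) \<le> t powr p + (p - 1) * c powr p" by (rule weighted_Young[OF p_gt_1 assms])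
  also have "\<dots> \<le> p * (t powr p + c powr p)"
    using p_gt_1 by (simp add: algebra_simps) (smt (verit) mult_le_cancel_right1 powr_ge_zero)
  finally show ?thesis using p_gt_1 by simp
qed

lemma integrable_a_inner:
  assumes "G \<in> Lp \<Omega> p" "H \<in> Lp \<Omega> p" shows "integrable M (\<lambda>x. a x (G x) \<bullet> H x)"
proof (rule Bochner_Integration.integrable_bound)
  show "integrable M (\<lambda>x. \<beta> * (norm (H x) powr p + norm (G x) powr p))"
    using Lp_D(2)[OF assms(1)] Lp_D(2)[OF assms(2)] by simp
  show "(\<lambda>x. a x (G x) \<bullet> H x) \<in> borel_measurable M"
    using Caratheodory_measurable[OF Lp_D(1)[OF assms(1)]] Lp_D(1)[OF assms(2)] by (rule borel_measurable_inner)
  show "AE x in M. norm (a x (G x) \<bullet> H x) \<le> norm (\<beta> * (norm (H x) powr p + norm (G x) powr p))"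
    using a_field
  proof eventually_elim
    case (elim x)
    interpret F: admissible_field p \<alpha> \<beta> "a x" by fact
    have "norm (a x (G x) \<bullet> H x) \<le> norm (a x (G x)) * norm (H x)" by (simp add: Cauchy_Schwarz_ineq2)
    also have "\<dots> \<le> \<beta> * norm (G x) powr (p - 1) * norm (H x)" by (intro mult_right_mono F.A_bound) auto
    also have "\<dots> \<le> \<beta> * (norm (H x) powr p + norm (G x) powr p)"
      using powr_product_bound[of "norm (G x)" "norm (H x)"] \<beta>_pos by (simp add: mult.assoc)
    finally show ?case using \<beta>_pos by simp
  qed
qed

lemma integrable_\<rho>_mult:
  assumes "integrable M f" shows "integrable M (\<lambda>x. \<rho> x * f x)"
proof (rule Bochner_Integration.integrable_bound)
  show "integrable M (\<lambda>x. \<rho>p * f x)" using assms by simp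
  show "(\<lambda>x. \<rho> x * f x) \<in> borel_measurable M" using \<rho>_meas assms by (intro borel_measurable_times) auto
  show "AE x in M. norm (\<rho> x * f x) \<le> norm (\<rho>p * f x)"
    using \<rho>_bounds by eventually_elim (use \<rho>m_pos in \<open>auto simp: abs_mult intro!: mult_right_mono\<close>)
qed

text \<open>By Euler's identity \<open>E\<close> is the integral of the potential, see \<open>integral_potential\<close> below.\<close>

definition E :: "('a \<Rightarrow> 'a) \<Rightarrow> real" where "E G = (\<integral>x. a x (G x) \<bullet> G x \<partial>M)"
definition B :: "('a \<Rightarrow> real) \<Rightarrow> real" where "B v = (\<integral>x. \<rho> x * \<bar>v x\<bar> powr p \<partial>M)"

lemma integrable_\<rho>_powr: "v \<in> Lpr \<Longrightarrow> integrable M (\<lambda>x. \<rho> x * \<bar>v x\<bar> powr p)"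
  by (rule integrable_\<rho>_mult) (use Lp_D(2)[of v] in simp)

lemma B_nonneg: "0 \<le> B v"
  unfolding B_def
  by (rule integral_nonneg_AE) (use \<rho>_bounds \<rho>m_pos in \<open>auto elim!: eventually_mono\<close>)

lemma B_zero_iff:
  assumes "v \<in> Lpr" shows "B v = 0 \<longleftrightarrow> (AE x in M. v x = 0)"
proof -
  have "B v = 0 \<longleftrightarrow> (AE x in M. \<rho> x * \<bar>v x\<bar> powr p = 0)"
    unfolding B_def
    by (rule integral_nonneg_eq_0_iff_AE[OF integrable_\<rho>_powr[OF assms]])
       (use \<rho>_bounds \<rho>m_pos in \<open>auto elim!: eventually_mono\<close>)
  also have "\<dots> \<longleftrightarrow> (AE x in M. v x = 0)"
  proof
    assume "AE x in M. \<rho> x * \<bar>v x\<bar> powr p = 0"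
    then show "AE x in M. v x = 0" using \<rho>_bounds by eventually_elim (use \<rho>m_pos in auto)
  next
    assume "AE x in M. v x = 0"
    then show "AE x in M. \<rho> x * \<bar>v x\<bar> powr p = 0" by eventually_elim simp
  qed
  finally show ?thesis .
qed

lemma B_lower:
  assumes "v \<in> Lpr" shows "\<rho>m * (\<integral>x. \<bar>v x\<bar> powr p \<partial>M) \<le> B v"
proof -
  have "(\<integral>x. \<rho>m * \<bar>v x\<bar> powr p \<partial>M) \<le> (\<integral>x. \<rho> x * \<bar>v x\<bar> powr p \<partial>M)"
    by (rule integral_mono_AE) (use Lp_D(2)[OF assms] integrable_\<rho>_powr[OF assms] \<rho>_bounds in
      \<open>auto elim!: eventually_mono intro!: mult_right_mono\<close>)
  then show ?thesis by (simp add: B_def)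
qed

lemma B_cmult: "B (\<lambda>x. c * v x) = \<bar>c\<bar> powr p * B v"
proof -
  have "B (\<lambda>x. c * v x) = (\<integral>x. \<bar>c\<bar> powr p * (\<rho> x * \<bar>v x\<bar> powr p) \<partial>M)"
    unfolding B_def by (simp add: abs_mult powr_mult mult_ac)
  then show ?thesis by (simp add: B_def)
qed

lemma E_cmult: "E (\<lambda>x. c *\<^sub>R G x) = \<bar>c\<bar> powr p * E G"
proof -
  have "AE x in M. a x (c *\<^sub>R G x) \<bullet> (c *\<^sub>R G x) = \<bar>c\<bar> powr p * (a x (G x) \<bullet> G x)"
    using a_field
  proof eventually_elim
    case (elim x)
    interpret F: admissible_field p \<alpha> \<beta> "a x" by fact
    show ?case using F.\<Phi>_hom[of c "G x"] by (simp only: F.\<Phi>_def)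
  qed
  from integral_eq_AE(1)[OF this] show ?thesis by (simp add: E_def)
qed

lemma E_AE_eq: "AE x in M. G x = H x \<Longrightarrow> E G = E H"
  unfolding E_def by (rule integral_eq_AE(1)) (auto elim!: eventually_mono)

lemma E_lower:
  assumes "G \<in> Lp \<Omega> p" shows "\<alpha> * (\<integral>x. norm (G x) powr p \<partial>M) \<le> E G"
proof -
  have "(\<integral>x. \<alpha> * norm (G x) powr p \<partial>M) \<le> (\<integral>x. a x (G x) \<bullet> G x \<partial>M)"
  proof (rule integral_mono_AE)
    show "AE x in M. \<alpha> * norm (G x) powr p \<le> a x (G x) \<bullet> G x"
      using a_field by eventually_elim (rule admissible_field.A_coercive)
  qed (use Lp_D(2)[OF assms] integrable_a_inner[OF assms assms] in auto)
  then show ?thesis by (simp add: E_def)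
qed

lemma E_nonneg: "G \<in> Lp \<Omega> p \<Longrightarrow> 0 \<le> E G"
  by (rule order_trans[OF _ E_lower]) (use \<alpha>_pos in auto)

lemma E_continuous:
  assumes "dom_conv f G" shows "(\<lambda>n. E (f n)) \<longlonglongrightarrow> E G"
proof -
  obtain g where g: "g \<in> Lpr" "\<forall>x. 0 \<le> g x" "AE x in M. \<forall>n. norm (f n x) \<le> g x" "AE x in M. (\<lambda>n. f n x) \<longlonglongrightarrow> G x"
    using dom_convE[OF assms] by blast
  note fm = dom_conv_measurable(1)[OF assms]
  show ?thesis unfolding E_def
  proof (rule integral_dom_conv(1)[OF g(1), where C = \<beta>])
    show "(\<lambda>x. a x (f n x) \<bullet> f n x) \<in> borel_measurable M" for n
      by (intro borel_measurable_inner Caratheodory_measurable fm)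
    show "AE x in M. \<forall>n. norm (a x (f n x) \<bullet> f n x) \<le> \<beta> * (1 + \<bar>g x\<bar> powr p)"
      using g(3) a_field
    proof eventually_elim
      case (elim x)
      interpret F: admissible_field p \<alpha> \<beta> "a x" by fact
      show ?case
      proof
        fix n
        have "norm (a x (f n x) \<bullet> f n x) = F.\<Phi> (f n x)" using F.\<Phi>_nonneg by (simp add: F.\<Phi>_def)
        also have "\<dots> \<le> \<beta> * norm (f n x) powr p" by (rule F.\<Phi>_upper)
        also have "\<dots> \<le> \<beta> * (1 + \<bar>g x\<bar> powr p)"
          using elim(1) \<beta>_pos p_gt_1 g(2) by (intro mult_left_mono add_increasing powr_mono2) auto
        finally show "norm (a x (f n x) \<bullet> f n x) \<le> \<beta> * (1 + \<bar>g x\<bar> powr p)" .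
      qed
    qed
    show "AE x in M. (\<lambda>n. a x (f n x) \<bullet> f n x) \<longlonglongrightarrow> a x (G x) \<bullet> G x"
      using g(4) a_field
    proof eventually_elim
      case (elim x)
      interpret F: admissible_field p \<alpha> \<beta> "a x" by fact
      show ?case using continuous_on_tendsto_compose[OF F.A_cont elim(1)] elim(1) by (intro tendsto_inner) auto
    qed
  qed
qed

lemma B_continuous:
  assumes "dom_conv f v" shows "(\<lambda>n. B (f n)) \<longlonglongrightarrow> B v"
proof -
  obtain g where g: "g \<in> Lpr" "\<forall>x. 0 \<le> g x" "AE x in M. \<forall>n. norm (f n x) \<le> g x" "AE x in M. (\<lambda>n. f n x) \<longlonglongrightarrow> v x"
    using dom_convE[OF assms] by blast
  note fm [measurable] = dom_conv_measurable(1)[OF assms]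
  note [measurable] = \<rho>_meas
  show ?thesis unfolding B_def
  proof (rule integral_dom_conv(1)[OF g(1), where C = \<rho>p])
    show "AE x in M. \<forall>n. norm (\<rho> x * \<bar>f n x\<bar> powr p) \<le> \<rho>p * (1 + \<bar>g x\<bar> powr p)"
      using g(3) \<rho>_bounds
    proof eventually_elim
      case (elim x)
      show ?case
      proof
        fix n
        have "\<rho> x * \<bar>f n x\<bar> powr p \<le> \<rho>p * (1 + \<bar>g x\<bar> powr p)"
          using elim \<rho>m_pos p_gt_1 g(2) by (intro mult_mono add_increasing powr_mono2) auto
        then show "norm (\<rho> x * \<bar>f n x\<bar> powr p) \<le> \<rho>p * (1 + \<bar>g x\<bar> powr p)" using elim \<rho>m_pos by (simp add: abs_mult)
      qed
    qed
    show "AE x in M. (\<lambda>n. \<rho> x * \<bar>f n x\<bar> powr p) \<longlonglongrightarrow> \<rho> x * \<bar>v x\<bar> powr p"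
      using g(4)
    proof eventually_elim
      case (elim x)
      then show ?case using p_gt_1 by (intro tendsto_intros tendsto_powr') auto
    qed
  qed measurable
qed

definition lambda1 where "lambda1 = first_eigenvalue \<Omega> p (potential \<Omega> p \<alpha> \<beta> a) \<rho>"

lemma is_potential_a: "is_potential \<Omega> p \<alpha> \<beta> a (\<lambda>x \<xi>. a x \<xi> \<bullet> \<xi>)"
  unfolding is_potential_def
proof (intro conjI allI)
  show "(\<lambda>x. a x \<xi> \<bullet> \<xi>) \<in> borel_measurable M" for \<xi>
    by (intro borel_measurable_inner a_meas) auto
  show "AE x in M.
        continuous_on UNIV (\<lambda>\<xi>. a x \<xi> \<bullet> \<xi>) \<and>
        (\<forall>\<xi>. a x (- \<xi>) \<bullet> (- \<xi>) = a x \<xi> \<bullet> \<xi>) \<and>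
        (\<forall>t>0. \<forall>\<xi>. a x (t *\<^sub>R \<xi>) \<bullet> (t *\<^sub>R \<xi>) = t powr p * (a x \<xi> \<bullet> \<xi>)) \<and>
        strictly_convex (\<lambda>\<xi>. a x \<xi> \<bullet> \<xi>) \<and>
        (\<forall>\<xi>. GDERIV (\<lambda>\<xi>. a x \<xi> \<bullet> \<xi>) \<xi> :> p *\<^sub>R a x \<xi>) \<and>
        a x 0 \<bullet> 0 = 0 \<and>
        (\<forall>\<xi>. \<alpha> * norm \<xi> powr p \<le> a x \<xi> \<bullet> \<xi> \<and> a x \<xi> \<bullet> \<xi> \<le> \<beta> * norm \<xi> powr p)"
    using a_field
  proof eventually_elim
    case (elim x)
    interpret F: admissible_field p \<alpha> \<beta> "a x" by fact
    have eq: "(\<lambda>\<xi>. a x \<xi> \<bullet> \<xi>) = F.\<Phi>" by (simp add: F.\<Phi>_def fun_eq_iff)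
    have eq': "a x \<xi> \<bullet> \<xi> = F.\<Phi> \<xi>" for \<xi> by (simp add: F.\<Phi>_def)
    have "continuous_on UNIV F.\<Phi>" unfolding eq[symmetric] by (intro continuous_intros F.A_cont)
    then show ?case
      unfolding eq eq'
      using F.\<Phi>_even F.\<Phi>_hom_pos F.\<Phi>_strictly_convex F.\<Phi>_GDERIV F.\<Phi>_0 F.\<Phi>_lower F.\<Phi>_upper by blast
  qed
qed

text \<open>Every potential is homogeneous with the prescribed gradient, so Euler's identity determines it.\<close>

lemma potential_AE: "AE x in M. \<forall>\<xi>. potential \<Omega> p \<alpha> \<beta> a x \<xi> = a x \<xi> \<bullet> \<xi>"
proof -
  have "is_potential \<Omega> p \<alpha> \<beta> a (potential \<Omega> p \<alpha> \<beta> a)"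
    unfolding potential_def by (rule someI[where P = "is_potential \<Omega> p \<alpha> \<beta> a"]) (rule is_potential_a)
  then have "AE x in M. (\<forall>t>0. \<forall>\<xi>. potential \<Omega> p \<alpha> \<beta> a x (t *\<^sub>R \<xi>) = t powr p * potential \<Omega> p \<alpha> \<beta> a x \<xi>) \<and>
     (\<forall>\<xi>. GDERIV (potential \<Omega> p \<alpha> \<beta> a x) \<xi> :> p *\<^sub>R a x \<xi>)"
    unfolding is_potential_def by (auto elim!: eventually_mono)
  then show ?thesis using a_field
  proof eventually_elim
    case (elim x)
    interpret F: admissible_field p \<alpha> \<beta> "a x" by fact
    show ?case using F.potential_unique[of "potential \<Omega> p \<alpha> \<beta> a x"] elim(1) by (simp add: F.\<Phi>_def)
  qed
qed

lemma integral_potential: "(\<integral>x. potential \<Omega> p \<alpha> \<beta> a x (G x) \<partial>M) = E G"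
  unfolding E_def by (rule integral_eq_AE(1)) (use potential_AE in \<open>auto elim!: eventually_mono\<close>)

definition quotients where
  "quotients = {E (wgrad \<Omega> v) / B v | v. v \<in> W1p0 \<Omega> p \<and> nontrivial_on \<Omega> v}"

lemma lambda1_eq: "lambda1 = Inf quotients"
  unfolding lambda1_def first_eigenvalue_def quotients_def integral_potential B_def ..

lemma quotient_nonneg: "r \<in> quotients \<Longrightarrow> 0 \<le> r"
  unfolding quotients_def using E_nonneg sob0_Lp(2)[OF W1p0_imp_sob0] B_nonneg by (auto intro!: divide_nonneg_nonneg)

lemma lambda1_le:
  assumes "sob0 v G" shows "lambda1 * B v \<le> E G"
proof (cases "AE x in M. v x = 0")
  case True
  then have "B v = 0" using B_zero_iff sob0_Lp(1)[OF assms] by blast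
  then show ?thesis using E_nonneg[OF sob0_Lp(2)[OF assms]] by simp
next
  case False
  then have Bp: "0 < B v" using B_zero_iff[OF sob0_Lp(1)[OF assms]] B_nonneg[of v] by linarith
  have "E (wgrad \<Omega> v) / B v \<in> quotients"
    unfolding quotients_def using sob0_imp_W1p0(1)[OF assms] False by (auto simp: nontrivial_on_def)
  then have "lambda1 \<le> E (wgrad \<Omega> v) / B v"
    unfolding lambda1_eq by (intro cInf_lower bdd_belowI[of _ 0]) (auto simp: quotient_nonneg)
  also have "E (wgrad \<Omega> v) = E G" by (rule E_AE_eq[OF sob0_imp_W1p0(2)[OF assms]])
  finally show ?thesis using Bp by (simp add: field_simps)
qed

lemma lambda1_nonneg:
  assumes "sob0 v G" "\<not> (AE x in M. v x = 0)" shows "0 \<le> lambda1"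
proof -
  have "E (wgrad \<Omega> v) / B v \<in> quotients"
    unfolding quotients_def using sob0_imp_W1p0(1)[OF assms(1)] assms(2) by (auto simp: nontrivial_on_def)
  then show ?thesis unfolding lambda1_eq by (intro cInf_greatest) (auto simp: quotient_nonneg)
qed

lemma lambda1_greatest:
  assumes "sob0 v G" "\<not> (AE x in M. v x = 0)" "\<And>w H. sob0 w H \<Longrightarrow> \<mu> * B w \<le> E H"
  shows "\<mu> \<le> lambda1"
  unfolding lambda1_eq
proof (rule cInf_greatest)
  have "E (wgrad \<Omega> v) / B v \<in> quotients"
    unfolding quotients_def using sob0_imp_W1p0(1)[OF assms(1)] assms(2) by (auto simp: nontrivial_on_def)
  then show "quotients \<noteq> {}" by blast
  fix r assume "r \<in> quotients"
  then obtain w where w: "r = E (wgrad \<Omega> w) / B w" "w \<in> W1p0 \<Omega> p" "nontrivial_on \<Omega> w"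
    by (auto simp: quotients_def)
  note s = W1p0_imp_sob0[OF w(2)]
  have "0 < B w" using B_zero_iff[OF sob0_Lp(1)[OF s]] B_nonneg[of w] w(3) by (auto simp: nontrivial_on_def less_le)
  then show "\<mu> \<le> r" using assms(3)[OF s] by (simp add: w(1) field_simps)
qed

lemma sob0_density:
  assumes "\<And>\<phi>. \<phi> \<in> test_functions \<Omega> \<Longrightarrow> \<mu> * B \<phi> \<le> E (grad \<phi>)" and w: "sob0 w H"
  shows "\<mu> * B w \<le> E H"
proof -
  obtain f where f: "\<And>n. f n \<in> test_functions \<Omega>" "dom_conv f w" "dom_conv (\<lambda>n. grad (f n)) H"
    using w unfolding sob0_def by blast
  show ?thesis
    by (rule LIMSEQ_le[OF tendsto_mult_left[OF B_continuous[OF f(2)]] E_continuous[OF f(3)]])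
       (use assms(1) f(1) in blast)
qed

text \<open>Any representatives of the gradients are admitted, so that parts and multiples of solutions can be
  inserted with the gradients given by the chain rules.\<close>

definition weak_eq :: "real \<Rightarrow> ('a \<Rightarrow> real) \<Rightarrow> ('a \<Rightarrow> 'a) \<Rightarrow> bool" where
  "weak_eq \<mu> u G \<longleftrightarrow> sob0 u G \<and> (\<forall>v H. sob0 v H \<longrightarrow>
     (\<integral>x. a x (G x) \<bullet> H x \<partial>M) = \<mu> * (\<integral>x. \<rho> x * (\<bar>u x\<bar> powr (p - 2) * u x) * v x \<partial>M))"

lemma weak_solution_imp_weak_eq:
  assumes "weak_solution \<Omega> p a \<rho> \<mu> u" shows "weak_eq \<mu> u (wgrad \<Omega> u)"
  unfolding weak_eq_def
proof (intro conjI allI impI)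
  show "sob0 u (wgrad \<Omega> u)" using assms by (intro W1p0_imp_sob0) (simp add: weak_solution_def)
  fix v H assume v: "sob0 v H"
  have "AE x in M. a x (wgrad \<Omega> u x) \<bullet> H x = a x (wgrad \<Omega> u x) \<bullet> wgrad \<Omega> v x"
    using sob0_imp_W1p0(2)[OF v] by eventually_elim simp
  from integral_eq_AE(1)[OF this]
  show "(\<integral>x. a x (wgrad \<Omega> u x) \<bullet> H x \<partial>M) = \<mu> * (\<integral>x. \<rho> x * (\<bar>u x\<bar> powr (p - 2) * u x) * v x \<partial>M)"
    using assms sob0_imp_W1p0(1)[OF v] by (simp add: weak_solution_def)
qed

lemma weak_eq_uminus:
  assumes "weak_eq \<mu> u G" shows "weak_eq \<mu> (\<lambda>x. - u x) (\<lambda>x. - G x)"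
  unfolding weak_eq_def
proof (intro conjI allI impI)
  have s: "sob0 u G" using assms by (simp add: weak_eq_def)
  show "sob0 (\<lambda>x. - u x) (\<lambda>x. - G x)" using sob0_cmult[OF s, of "-1"] by simp
  fix v H assume v: "sob0 v H"
  have "AE x in M. a x (- G x) \<bullet> H x = - (a x (G x) \<bullet> H x)"
    using a_field by eventually_elim (simp add: admissible_field.A_odd)
  from integral_eq_AE(1)[OF this]
  show "(\<integral>x. a x (- G x) \<bullet> H x \<partial>M) = \<mu> * (\<integral>x. \<rho> x * (\<bar>- u x\<bar> powr (p - 2) * (- u x)) * v x \<partial>M)"
    using assms v by (simp add: weak_eq_def)
qed

text \<open>The gradient of the positive part agrees with the gradient of \<open>u\<close> where \<open>u > 0\<close> and vanishes
  elsewhere. Tested with its positive part, the equation therefore computes the energy of this part.\<close>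

lemma weak_eq_pos_part:
  assumes "weak_eq \<mu> u G"
  shows "E (\<lambda>x. if 0 < u x then G x else 0) = \<mu> * B (\<lambda>x. max 0 (u x))"
proof -
  have s: "sob0 u G" using assms by (simp add: weak_eq_def)
  have 1: "AE x in M. a x (if 0 < u x then G x else 0) \<bullet> (if 0 < u x then G x else 0) =
      a x (G x) \<bullet> (if 0 < u x then G x else 0)"
    by (rule AE_I2) simp
  have 2: "\<bar>u x\<bar> powr (p - 2) * u x * max 0 (u x) = \<bar>max 0 (u x)\<bar> powr p" for x
  proof (cases "0 < u x")
    case True
    have "u x powr p = u x powr (p - 2) * u x powr 2" using powr_add[of "u x" "p - 2" 2] by simp
    then show ?thesis using True by (simp add: power2_eq_square mult.assoc)
  qed (use p_gt_1 in \<open>simp add: max_def\<close>)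
  have "E (\<lambda>x. if 0 < u x then G x else 0) = (\<integral>x. a x (G x) \<bullet> (if 0 < u x then G x else 0) \<partial>M)"
    unfolding E_def by (rule integral_eq_AE(1)[OF 1])
  also have "\<dots> = \<mu> * (\<integral>x. \<rho> x * (\<bar>u x\<bar> powr (p - 2) * u x) * max 0 (u x) \<partial>M)"
    using assms sob0_pos_part[OF s] by (simp add: weak_eq_def)
  also have "(\<integral>x. \<rho> x * (\<bar>u x\<bar> powr (p - 2) * u x) * max 0 (u x) \<partial>M) = B (\<lambda>x. max 0 (u x))"
    unfolding B_def by (simp add: mult.assoc 2[unfolded mult.assoc])
  finally show ?thesis .
qed

lemma E_convex_below:
  assumes "G \<in> Lp \<Omega> p" "Z \<in> Lp \<Omega> p"
  shows "E G + p * (\<integral>x. a x (G x) \<bullet> Z x \<partial>M) \<le> E (\<lambda>x. G x + Z x)"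
proof -
  note i = integrable_a_inner[OF assms(1,1)] integrable_a_inner[OF assms] integrable_a_inner[OF Lp_add[OF assms] Lp_add[OF assms]]
  have "(\<integral>x. a x (G x) \<bullet> G x + p * (a x (G x) \<bullet> Z x) \<partial>M) \<le> (\<integral>x. a x (G x + Z x) \<bullet> (G x + Z x) \<partial>M)"
  proof (rule integral_mono_AE)
    show "AE x in M. a x (G x) \<bullet> G x + p * (a x (G x) \<bullet> Z x) \<le> a x (G x + Z x) \<bullet> (G x + Z x)"
      using a_field
    proof eventually_elim
      case (elim x)
      interpret F: admissible_field p \<alpha> \<beta> "a x" by fact
      show ?case using F.\<Phi>_gradient_ineq[of "G x" "G x + Z x"] by (simp add: F.\<Phi>_def)
    qed
  qed (use i in auto)
  then show ?thesis using i by (simp add: E_def)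
qed

end

section \<open>Strong maximum principle\<close>

text \<open>The function \<open>h\<^sub>\<tau>(s) = sqrt (qf \<tau> s)\<close> is a smooth positive substitute for \<open>s + \<tau>\<close> on the whole line,
  as approximating test functions may be negative. Since \<open>\<tau>\<^sup>4\<close> is small compared with \<open>\<tau>\<^sup>2\<close>, the
  derivative of \<open>h\<^sub>\<tau>\<close> is close to \<open>1\<close>, uniformly in \<open>s \<ge> 0\<close>, when \<open>\<tau>\<close> is small; \<open>log_qf \<tau>\<close> is the logarithm of \<open>h\<^sub>\<tau>\<close>.\<close>

definition qf :: "real \<Rightarrow> real \<Rightarrow> real" where "qf \<tau> s = (s + \<tau>)\<^sup>2 + (\<tau>\<^sup>2)\<^sup>2"

definition log_qf :: "real \<Rightarrow> real \<Rightarrow> real" where "log_qf \<tau> s = ln (qf \<tau> s) / 2"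

lemma qf_pos: "\<tau> \<noteq> 0 \<Longrightarrow> 0 < qf \<tau> s"
  unfolding qf_def by (intro quadratic_pos) simp

lemma continuous_qf: "continuous_on S (qf \<tau>)"
  unfolding qf_def[abs_def] by (intro continuous_intros)

lemma log_qf_has_derivative:
  assumes "\<tau> \<noteq> 0" shows "(log_qf \<tau> has_real_derivative (s + \<tau>) / qf \<tau> s) (at s)"
proof -
  have 1: "(qf \<tau> has_real_derivative 2 * (s + \<tau>)) (at s)"
    unfolding qf_def[abs_def] by (auto intro!: derivative_eq_intros)
  have "((\<lambda>s. ln (qf \<tau> s)) has_real_derivative 1 / qf \<tau> s * (2 * (s + \<tau>))) (at s)"
    by (rule DERIV_chain2[where f = ln and g = "qf \<tau>"]) (rule DERIV_ln_divide[OF qf_pos[OF assms]], rule 1)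
  from DERIV_cdivide[OF this, of 2]
  have "((\<lambda>s. ln (qf \<tau> s) / 2) has_real_derivative 1 / qf \<tau> s * (2 * (s + \<tau>)) / 2) (at s)" .
  moreover have "1 / qf \<tau> s * (2 * (s + \<tau>)) / 2 = (s + \<tau>) / qf \<tau> s"
    using qf_pos[OF assms, of s] by (simp add: field_simps)
  ultimately show ?thesis unfolding log_qf_def[abs_def] by (simp only:)
qed

lemma continuous_log_qf_deriv: "\<tau> \<noteq> 0 \<Longrightarrow> continuous_on S (\<lambda>s. (s + \<tau>) / qf \<tau> s)"
  using qf_pos[of \<tau>] by (intro continuous_intros continuous_qf) (auto simp: less_imp_neq[symmetric])

lemma abs_shift_le: "\<bar>s + \<tau>\<bar> \<le> qf \<tau> s powr (1/2)"
proof -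
  have "\<bar>s + \<tau>\<bar> = ((s + \<tau>)\<^sup>2) powr (1/2)" by (simp add: powr_half_sqrt)
  also have "\<dots> \<le> qf \<tau> s powr (1/2)" by (intro powr_mono2) (auto simp: qf_def)
  finally show ?thesis .
qed

lemma log_qf_deriv_bound:
  assumes "\<tau> \<noteq> 0" shows "\<bar>(s + \<tau>) / qf \<tau> s\<bar> \<le> qf \<tau> s powr (- 1/2)"
proof -
  have q: "0 < qf \<tau> s" by (rule qf_pos[OF assms])
  have "\<bar>(s + \<tau>) / qf \<tau> s\<bar> \<le> qf \<tau> s powr (1/2) / qf \<tau> s"
    using abs_shift_le[of s \<tau>] q by (simp add: divide_right_mono)
  also have "\<dots> = qf \<tau> s powr (1/2) / qf \<tau> s powr 1" using q by simp
  also have "\<dots> = qf \<tau> s powr (1/2 - 1)" by (rule powr_diff[symmetric])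
  also have "1/2 - 1 = - 1/(2::real)" by simp
  finally show ?thesis .
qed

lemma log_qf_mono:
  assumes "0 < \<tau>" "0 \<le> s" "s \<le> t" shows "log_qf \<tau> s \<le> log_qf \<tau> t"
proof -
  have "qf \<tau> s \<le> qf \<tau> t" unfolding qf_def using assms by (intro add_right_mono power_mono) auto
  then show ?thesis unfolding log_qf_def using qf_pos[of \<tau> s] assms(1) by simp
qed

text \<open>The logarithm separates \<open>0\<close> from any \<open>\<eta> > 0\<close> by an arbitrarily large gap.\<close>

lemma log_qf_gap:
  assumes "0 < \<eta>" obtains \<tau> where "0 < \<tau>" "\<tau> \<le> 1" "R \<le> log_qf \<tau> \<eta> - log_qf \<tau> 0"
proof -
  define \<tau> where "\<tau> = min 1 (\<eta> * exp (- R) / sqrt 2)"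
  have \<tau>: "0 < \<tau>" "\<tau> \<le> 1" "\<tau> \<le> \<eta> * exp (- R) / sqrt 2" using assms by (auto simp: \<tau>_def)
  have "log_qf \<tau> 0 \<le> ln (2 * \<tau>\<^sup>2) / 2"
  proof -
    have "(\<tau>\<^sup>2)\<^sup>2 \<le> \<tau>\<^sup>2" using \<tau> by (simp add: power2_eq_square mult_left_le mult_le_one)
    then have "qf \<tau> 0 \<le> 2 * \<tau>\<^sup>2" by (simp add: qf_def)
    then show ?thesis unfolding log_qf_def using qf_pos[of \<tau> 0] \<tau>(1) by simp
  qed
  also have "\<dots> \<le> ln ((\<eta> * exp (- R))\<^sup>2) / 2"
  proof -
    have "2 * \<tau>\<^sup>2 \<le> 2 * (\<eta> * exp (- R) / sqrt 2)\<^sup>2"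
      using \<tau> by (intro mult_left_mono power_mono) auto
    then have "2 * \<tau>\<^sup>2 \<le> (\<eta> * exp (- R))\<^sup>2" by (simp add: power_divide)
    then show ?thesis using \<tau>(1) by (intro divide_right_mono ln_mono) auto
  qed
  also have "\<dots> = ln \<eta> - R" using assms by (simp add: ln_powr ln_realpow ln_mult)
  also have "ln \<eta> \<le> log_qf \<tau> \<eta>"
  proof -
    have "ln (\<eta>\<^sup>2) \<le> ln (qf \<tau> \<eta>)"
    proof (rule ln_mono)
      have "\<eta>\<^sup>2 \<le> (\<eta> + \<tau>)\<^sup>2" using assms \<tau> by (intro power_mono) auto
      then show "\<eta>\<^sup>2 \<le> qf \<tau> \<eta>" unfolding qf_def by (simp add: add_increasing2)
    qed (use assms in auto)
    then show ?thesis using assms by (simp add: log_qf_def ln_realpow)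
  qed
  finally have "R \<le> log_qf \<tau> \<eta> - log_qf \<tau> 0" by simp
  with \<tau>(1,2) show ?thesis by (rule that)
qed

context bounded_domain
begin

definition osc :: "'a set \<Rightarrow> ('a \<Rightarrow> real) \<Rightarrow> ennreal" where
  "osc Q h = (\<integral>\<^sup>+y. \<integral>\<^sup>+x. indicator Q y * indicator Q x * ennreal (\<bar>h x - h y\<bar> powr p) \<partial>M \<partial>M)"

lemma indicator_measurable_M:
  "Q \<in> sets borel \<Longrightarrow> (indicator Q :: 'a \<Rightarrow> ennreal) \<in> borel_measurable M"
  by (intro measurable_restrict_space1 measurable_completion borel_measurable_indicator) auto

text \<open>Fatou's lemma in both variables. The oscillation is a double integral of values of the function, so
  it passes to limits almost everywhere, where an energy would require weak convergence of gradients.\<close>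

lemma osc_Fatou:
  assumes Q: "Q \<in> sets borel" and h: "\<And>n. h n \<in> borel_measurable M"
    and lim: "AE x in M. (\<lambda>n. h n x) \<longlonglongrightarrow> k x"
    and b: "\<And>n. osc Q (h n) \<le> ennreal (c n)" and c: "c \<longlonglongrightarrow> C"
  shows "osc Q k \<le> ennreal C"
proof -
  note [measurable] = h indicator_measurable_M[OF Q]
  define F where "F n y x = indicator Q y * indicator Q x * ennreal (\<bar>h n x - h n y\<bar> powr p)" for n y x
  have Fl: "(\<lambda>n. F n y x) \<longlonglongrightarrow> indicator Q y * indicator Q x * ennreal (\<bar>k x - k y\<bar> powr p)"
    if "(\<lambda>n. h n x) \<longlonglongrightarrow> k x" "(\<lambda>n. h n y) \<longlonglongrightarrow> k y" for x y
  proof -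
    have "(\<lambda>n. \<bar>h n x - h n y\<bar> powr p) \<longlonglongrightarrow> \<bar>k x - k y\<bar> powr p"
      using that p_gt_1 by (intro tendsto_powr' tendsto_intros) auto
    then have "(\<lambda>n. ennreal (\<bar>h n x - h n y\<bar> powr p)) \<longlonglongrightarrow> ennreal (\<bar>k x - k y\<bar> powr p)"
      by (rule tendsto_ennrealI)
    then show ?thesis unfolding F_def by (cases "x \<in> Q"; cases "y \<in> Q") auto
  qed
  have "osc Q k \<le> (\<integral>\<^sup>+y. liminf (\<lambda>n. \<integral>\<^sup>+x. F n y x \<partial>M) \<partial>M)"
    unfolding osc_def
  proof (rule nn_integral_mono_AE)
    show "AE y in M. (\<integral>\<^sup>+x. indicator Q y * indicator Q x * ennreal (\<bar>k x - k y\<bar> powr p) \<partial>M) \<le> liminf (\<lambda>n. \<integral>\<^sup>+x. F n y x \<partial>M)"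
      using lim
    proof eventually_elim
      case (elim y)
      have "(\<integral>\<^sup>+x. indicator Q y * indicator Q x * ennreal (\<bar>k x - k y\<bar> powr p) \<partial>M) \<le> (\<integral>\<^sup>+x. liminf (\<lambda>n. F n y x) \<partial>M)"
      proof (rule nn_integral_mono_AE)
        show "AE x in M. indicator Q y * indicator Q x * ennreal (\<bar>k x - k y\<bar> powr p) \<le> liminf (\<lambda>n. F n y x)"
          using lim
        proof eventually_elim
          case (elim x)
          show ?case
            using lim_imp_Liminf[OF trivial_limit_sequentially Fl[OF elim \<open>(\<lambda>n. h n y) \<longlonglongrightarrow> k y\<close>]] by simp
        qed
      qed
      also have "\<dots> \<le> liminf (\<lambda>n. \<integral>\<^sup>+x. F n y x \<partial>M)"
        by (rule nn_integral_liminf) (unfold F_def, measurable)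
      finally show ?case .
    qed
  qed
  also have "\<dots> \<le> liminf (\<lambda>n. \<integral>\<^sup>+y. \<integral>\<^sup>+x. F n y x \<partial>M \<partial>M)"
    by (rule nn_integral_liminf) (unfold F_def, measurable)
  also have "\<dots> \<le> liminf (\<lambda>n. ennreal (c n))"
    by (rule Liminf_mono) (use b in \<open>simp add: osc_def F_def\<close>)
  also have "\<dots> = ennreal C"
    by (rule lim_imp_Liminf) (auto intro: tendsto_ennrealI c)
  finally show ?thesis .
qed

lemma nn_integral_indicator_M:
  assumes "Q \<subseteq> \<Omega>"
  shows "(\<integral>\<^sup>+x. indicator Q x * k x \<partial>M) = (\<integral>\<^sup>+x. indicator Q x * k x \<partial>lborel)"
proof -
  have "(\<integral>\<^sup>+x. indicator Q x * k x \<partial>M) = (\<integral>\<^sup>+x. indicator Q x * k x * indicator \<Omega> x \<partial>lebesgue)"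
    by (rule nn_integral_restrict_space) simp
  also have "\<dots> = (\<integral>\<^sup>+x. indicator Q x * k x \<partial>lebesgue)"
    by (rule nn_integral_cong) (use assms in \<open>auto simp: indicator_def\<close>)
  also have "\<dots> = (\<integral>\<^sup>+x. indicator Q x * k x \<partial>lborel)" by (rule nn_integral_completion)
  finally show ?thesis .
qed

lemma osc_smooth:
  assumes d: "\<And>x. GDERIV f x :> g x" and gc: "continuous_on UNIV g"
    and Q: "Q \<in> sets borel" "convex Q" "Q \<subseteq> \<Omega>" and D: "D \<in> sets borel"
    and diff: "\<And>x y. x \<in> Q \<Longrightarrow> y \<in> Q \<Longrightarrow> x - y \<in> D \<and> norm (x - y) \<le> r"
  shows "osc Q f \<le> emeasure lborel D * ennreal (r powr p) * (\<integral>\<^sup>+x. indicator Q x * ennreal (norm (g x) powr p) \<partial>M)"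
proof -
  have fc: "continuous_on UNIV f"
    using d by (intro continuous_at_imp_continuous_on) (auto simp: gderiv_def intro: has_derivative_continuous)
  note fb [measurable] = borel_measurable_continuous_onI[OF fc]
  note [measurable] = Q(1)
  have in1: "(\<integral>\<^sup>+x. indicator Q y * indicator Q x * ennreal (\<bar>f x - f y\<bar> powr p) \<partial>M) =
     indicator Q y * (\<integral>\<^sup>+x. indicator Q x * ennreal (\<bar>f x - f y\<bar> powr p) \<partial>lborel)" for y
  proof -
    have "f \<in> borel_measurable M" using fb by (auto intro!: measurable_restrict_space1 measurable_completion)
    note [measurable] = this indicator_measurable_M[OF Q(1)]
    have "(\<integral>\<^sup>+x. indicator Q y * indicator Q x * ennreal (\<bar>f x - f y\<bar> powr p) \<partial>M) =
      indicator Q y * (\<integral>\<^sup>+x. indicator Q x * ennreal (\<bar>f x - f y\<bar> powr p) \<partial>M)"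
      unfolding mult.assoc by (rule nn_integral_cmult) measurable
    then show ?thesis by (simp add: nn_integral_indicator_M[OF Q(3)])
  qed
  have in2: "(\<integral>\<^sup>+x. indicator Q y * indicator Q x * ennreal (\<bar>f x - f y\<bar> powr p) \<partial>lborel) =
     indicator Q y * (\<integral>\<^sup>+x. indicator Q x * ennreal (\<bar>f x - f y\<bar> powr p) \<partial>lborel)" for y
    unfolding mult.assoc by (rule nn_integral_cmult) measurable
  have "osc Q f = (\<integral>\<^sup>+y. \<integral>\<^sup>+x. indicator Q y * indicator Q x * ennreal (\<bar>f x - f y\<bar> powr p) \<partial>lborel \<partial>lborel)"
    unfolding osc_def in1 in2 by (rule nn_integral_indicator_M[OF Q(3)])
  also have "\<dots> \<le> emeasure lborel D * ennreal (r powr p) * (\<integral>\<^sup>+x. indicator Q x * ennreal (norm (g x) powr p) \<partial>lborel)"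
    by (rule Poincare_convex[OF d gc p_gt_1 Q(1,2) D diff])
  finally show ?thesis by (simp add: nn_integral_indicator_M[OF Q(3)])
qed

text \<open>For test functions this is the Poincare inequality for \<open>log h\<^sub>\<tau>(v)\<close>. The right-hand side converges along
  an approximating sequence by dominated convergence and the left-hand side by Fatou's lemma.\<close>

lemma osc_log_sob0:
  assumes Q: "Q \<in> sets borel" "convex Q" "Q \<subseteq> \<Omega>"
  shows "\<exists>K\<ge>0. \<forall>v G \<tau>. sob0 v G \<longrightarrow> \<tau> \<noteq> 0 \<longrightarrow> osc Q (\<lambda>x. log_qf \<tau> (v x)) \<le>
    ennreal (K * (\<integral>x. indicator Q x * (\<bar>(v x + \<tau>) / qf \<tau> (v x)\<bar> powr p * norm (G x) powr p) \<partial>M))"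
proof -
  obtain R where R: "\<Omega> \<subseteq> cball 0 R" using bounded_dom by (metis bounded_iff mem_cball_0 subsetI)
  \<comment> \<open>the ball \<open>D\<close> contains all differences of points of \<open>Q\<close>\<close>
  define D where "D = cball (0::'a) (2 * R)"
  define K where "K = measure lborel D * (2 * R) powr p"
  have K: "0 \<le> K" by (simp add: K_def)
  have diff: "x - y \<in> D \<and> norm (x - y) \<le> 2 * R" if "x \<in> Q" "y \<in> Q" for x y
  proof -
    have "norm x \<le> R" "norm y \<le> R" using that Q(3) R by (auto simp: subset_iff)
    then have "norm (x - y) \<le> 2 * R" using norm_triangle_ineq4[of x y] by linarith
    then show ?thesis by (simp add: D_def)
  qed
  have emD: "emeasure lborel D = ennreal (measure lborel D)"
    using emeasure_lborel_cball_finite[of "0::'a" "2 * R"] unfolding D_def by (intro emeasure_eq_ennreal_measure) auto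
  have "osc Q (\<lambda>x. log_qf \<tau> (v x)) \<le> ennreal (K * (\<integral>x. indicator Q x * (\<bar>(v x + \<tau>) / qf \<tau> (v x)\<bar> powr p * norm (G x) powr p) \<partial>M))"
    if v: "sob0 v G" and \<tau>: "\<tau> \<noteq> 0" for v G \<tau>
  proof -
    define L' where "L' s = (s + \<tau>) / qf \<tau> s" for s
    have L'c: "continuous_on UNIV L'" unfolding L'_def[abs_def] by (rule continuous_log_qf_deriv[OF \<tau>])
    have Lc: "continuous_on UNIV (log_qf \<tau>)"
      using log_qf_has_derivative[OF \<tau>] by (intro continuous_at_imp_continuous_on) (auto intro: DERIV_isCont)
    define C where "C = ((\<tau>\<^sup>2)\<^sup>2) powr (- 1/2)"
    have L'b: "\<bar>L' s\<bar> \<le> C" for s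
    proof -
      have "\<bar>L' s\<bar> \<le> qf \<tau> s powr (- 1/2)" unfolding L'_def by (rule log_qf_deriv_bound[OF \<tau>])
      also have "\<dots> \<le> C" unfolding C_def using \<tau> by (intro powr_mono2') (auto simp: qf_def)
      finally show ?thesis .
    qed
    have C: "0 \<le> C" by (simp add: C_def)
    obtain f where f: "\<And>n. f n \<in> test_functions \<Omega>" "dom_conv f v" "dom_conv (\<lambda>n. grad (f n)) G"
      using v unfolding sob0_def by blast
    have sf: "smooth (f n)" for n by (rule test_functions_smooth[OF f(1)])
    obtain g where g: "g \<in> Lpr" "\<forall>x. 0 \<le> g x" "AE x in M. \<forall>n. norm (grad (f n) x) \<le> g x" "AE x in M. (\<lambda>n. grad (f n) x) \<longlonglongrightarrow> G x"
      using dom_convE[OF f(3)] by blast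
    define I where "I n = (\<integral>x. indicator Q x * (\<bar>L' (f n x)\<bar> powr p * norm (grad (f n) x) powr p) \<partial>M)" for n
    define J where "J = (\<integral>x. indicator Q x * (\<bar>L' (v x)\<bar> powr p * norm (G x) powr p) \<partial>M)"
    have Qm: "(indicator Q :: 'a \<Rightarrow> real) \<in> borel_measurable M"
      using Q(1) by (intro measurable_restrict_space1 measurable_completion borel_measurable_indicator) auto
    have im: "(\<lambda>x. indicator Q x * (\<bar>L' (f n x)\<bar> powr p * norm (grad (f n) x) powr p)) \<in> borel_measurable M" for n
    proof -
      note [measurable] = Qm dom_conv_compose_bounded(2)[OF f(2) L'c, of n] test_measurable(2)[OF f(1), of n]
      show ?thesis by measurable
    qed
    have ib: "AE x in M. \<forall>n. norm (indicat_real Q x * (\<bar>L' (f n x)\<bar> powr p * norm (grad (f n) x) powr p)) \<le> C powr p * (1 + \<bar>g x\<bar> powr p)"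
      using g(3)
    proof eventually_elim
      case (elim x)
      show ?case
      proof
        fix n
        have "\<bar>L' (f n x)\<bar> powr p * norm (grad (f n) x) powr p \<le> C powr p * (1 + \<bar>g x\<bar> powr p)"
          using elim g(2) L'b p_gt_1 by (intro mult_mono add_increasing powr_mono2) auto
        then show "norm (indicat_real Q x * (\<bar>L' (f n x)\<bar> powr p * norm (grad (f n) x) powr p)) \<le> C powr p * (1 + \<bar>g x\<bar> powr p)"
          by (cases "x \<in> Q") (auto simp: add_nonneg_nonneg)
      qed
    qed
    have il: "AE x in M. (\<lambda>n. indicator Q x * (\<bar>L' (f n x)\<bar> powr p * norm (grad (f n) x) powr p)) \<longlonglongrightarrow>
        indicator Q x * (\<bar>L' (v x)\<bar> powr p * norm (G x) powr p)"
      using dom_conv_compose_bounded(3)[OF f(2) L'c] g(4)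
    proof eventually_elim
      case (elim x)
      then show ?case using p_gt_1 by (intro tendsto_intros tendsto_powr') auto
    qed
    have IJ: "I \<longlonglongrightarrow> J" unfolding I_def[abs_def] J_def by (rule integral_dom_conv(1)[OF g(1) im ib il])
    have ii: "integrable M (\<lambda>x. indicator Q x * (\<bar>L' (f n x)\<bar> powr p * norm (grad (f n) x) powr p))" for n
      by (rule integral_dom_conv(3)[OF g(1) im ib il])
    have "osc Q (\<lambda>x. log_qf \<tau> (v x)) \<le> ennreal (K * J)"
    proof (rule osc_Fatou[OF Q(1)])
      show "(\<lambda>x. log_qf \<tau> (f n x)) \<in> borel_measurable M" for n by (rule dom_conv_compose_bounded(2)[OF f(2) Lc])
      show "AE x in M. (\<lambda>n. log_qf \<tau> (f n x)) \<longlonglongrightarrow> log_qf \<tau> (v x)" by (rule dom_conv_compose_bounded(3)[OF f(2) Lc])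
      show "(\<lambda>n. K * I n) \<longlonglongrightarrow> K * J" by (intro tendsto_intros IJ)
      fix n
      have "osc Q (\<lambda>x. log_qf \<tau> (f n x)) \<le> emeasure lborel D * ennreal ((2 * R) powr p) *
          (\<integral>\<^sup>+x. indicator Q x * ennreal (norm (L' (f n x) *\<^sub>R grad (f n) x) powr p) \<partial>M)"
      proof (rule osc_smooth[OF _ _ Q _ diff])
        show "GDERIV (\<lambda>x. log_qf \<tau> (f n x)) x :> L' (f n x) *\<^sub>R grad (f n) x" for x
          unfolding L'_def by (intro GDERIV_DERIV_compose log_qf_has_derivative \<tau> smooth_GDERIV sf)
        show "continuous_on UNIV (\<lambda>x. L' (f n x) *\<^sub>R grad (f n) x)"
          by (intro continuous_intros smooth_continuous_grad sf continuous_on_compose2[OF L'c smooth_continuous[OF sf]]) auto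
      qed (auto simp: D_def)
      also have "(\<integral>\<^sup>+x. indicator Q x * ennreal (norm (L' (f n x) *\<^sub>R grad (f n) x) powr p) \<partial>M) =
          (\<integral>\<^sup>+x. ennreal (indicator Q x * (\<bar>L' (f n x)\<bar> powr p * norm (grad (f n) x) powr p)) \<partial>M)"
        by (rule nn_integral_cong) (auto simp: indicator_def powr_mult)
      also have "\<dots> = ennreal (I n)" unfolding I_def by (rule nn_integral_eq_integral[OF ii]) auto
      also have "emeasure lborel D * ennreal ((2 * R) powr p) * ennreal (I n) = ennreal (K * I n)"
      proof -
        have "0 \<le> I n" unfolding I_def by (rule Bochner_Integration.integral_nonneg) auto
        then show ?thesis unfolding emD K_def by (simp add: ennreal_mult)
      qed
      finally show "osc Q (\<lambda>x. log_qf \<tau> (f n x)) \<le> ennreal (K * I n)" .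
    qed
    then show ?thesis unfolding J_def L'_def .
  qed
  then show ?thesis using K by (intro exI[of _ K]) auto
qed

text \<open>If \<open>U\<close> vanished on a set \<open>Z\<close> of positive measure and exceeded some \<open>\<eta> > 0\<close> on another one, the oscillation
  of the logarithm over the product of both sets would be arbitrarily large for small \<open>\<tau>\<close>.\<close>

lemma zero_or_positive_on:
  assumes U: "U \<in> borel_measurable M" "AE x in M. 0 \<le> U x" and Q: "Q \<in> sets borel" "Q \<subseteq> \<Omega>"
    and b: "\<And>\<tau>. 0 < \<tau> \<Longrightarrow> \<tau> \<le> 1 \<Longrightarrow> osc Q (\<lambda>x. log_qf \<tau> (U x)) \<le> ennreal C"
  shows "(AE x in M. x \<in> Q \<longrightarrow> U x = 0) \<or> (AE x in M. x \<in> Q \<longrightarrow> 0 < U x)"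
proof (rule ccontr)
  assume neg: "\<not> ?thesis"
  note [measurable] = U(1)
  have QM [measurable]: "Q \<in> sets M" using Q by (auto simp: sets_restrict_space_iff)
  define Z where "Z = {x\<in>\<Omega>. x \<in> Q \<and> U x \<le> 0}"
  define P where "P n = {x\<in>\<Omega>. x \<in> Q \<and> inverse (real (Suc n)) \<le> U x}" for n
  have Zm [measurable]: "Z \<in> sets M"
  proof -
    have "{x \<in> space M. x \<in> Q \<and> U x \<le> 0} \<in> sets M" by measurable
    then show ?thesis by (simp add: Z_def)
  qed
  have Pm [measurable]: "P n \<in> sets M" for n
  proof -
    have "{x \<in> space M. x \<in> Q \<and> inverse (real (Suc n)) \<le> U x} \<in> sets M" by measurable
    then show ?thesis by (simp add: P_def)
  qed
  have Z: "emeasure M Z \<noteq> 0"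
  proof
    assume "emeasure M Z = 0"
    then have "AE x in M. x \<notin> Z" using Zm by (intro AE_not_in) (simp add: null_setsI)
    then have "AE x in M. x \<in> Q \<longrightarrow> 0 < U x" by eventually_elim (use Q(2) in \<open>auto simp: Z_def not_le\<close>)
    then show False using neg by simp
  qed
  have "\<exists>n. emeasure M (P n) \<noteq> 0"
  proof (rule ccontr)
    assume "\<not> (\<exists>n. emeasure M (P n) \<noteq> 0)"
    then have "AE x in M. x \<notin> P n" for n using Pm by (intro AE_not_in) (auto intro: null_setsI)
    then have "AE x in M. \<forall>n. x \<notin> P n" by (simp add: AE_all_countable)
    then have "AE x in M. x \<in> Q \<longrightarrow> U x = 0" using U(2)
    proof eventually_elim
      case (elim x)
      show ?case
      proof
        assume x: "x \<in> Q"
        show "U x = 0"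
        proof (rule ccontr)
          assume "U x \<noteq> 0"
          then have "0 < U x" using elim(2) by simp
          then obtain n where "inverse (real (Suc n)) < U x" using reals_Archimedean by blast
          then show False using elim(1) x Q(2) by (auto simp: P_def dest!: spec[of _ n])
        qed
      qed
    qed
    then show False using neg by simp
  qed
  then obtain n where Pn: "emeasure M (P n) \<noteq> 0" by blast
  define \<eta> where "\<eta> = inverse (real (Suc n))"
  have \<eta>: "0 < \<eta>" by (simp add: \<eta>_def)
  define \<mu> where "\<mu> = measure M (P n) * measure M Z"
  have \<mu>: "0 < \<mu>" using Z Pn by (simp add: \<mu>_def emeasure_eq_measure zero_less_measure_iff)
  \<comment> \<open>a gap of size \<open>R\<close> contributes \<open>R\<^sup>p \<mu> = \<bar>C\<bar> + 1\<close> to the oscillation\<close>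
  define R where "R = ((\<bar>C\<bar> + 1) / \<mu>) powr (1 / p)"
  obtain \<tau> where \<tau>: "0 < \<tau>" "\<tau> \<le> 1" "R \<le> log_qf \<tau> \<eta> - log_qf \<tau> 0" by (rule log_qf_gap[OF \<eta>])
  have "ennreal (\<bar>C\<bar> + 1) = ennreal (R powr p * \<mu>)"
    using \<mu> p_gt_1 by (simp add: R_def powr_powr)
  also have "\<dots> = emeasure M (P n) * (ennreal (R powr p) * emeasure M Z)"
    by (simp add: emeasure_eq_measure \<mu>_def ennreal_mult mult_ac)
  also have "\<dots> = (\<integral>\<^sup>+y. indicator (P n) y * (ennreal (R powr p) * emeasure M Z) \<partial>M)"
    by (subst nn_integral_multc) auto
  also have "\<dots> = (\<integral>\<^sup>+y. indicator (P n) y * (\<integral>\<^sup>+x. ennreal (R powr p) * indicator Z x \<partial>M) \<partial>M)"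
    by (simp add: nn_integral_cmult)
  also have "\<dots> \<le> osc Q (\<lambda>x. log_qf \<tau> (U x))"
    unfolding osc_def
  proof (intro nn_integral_mono_AE)
    show "AE y in M. indicator (P n) y * (\<integral>\<^sup>+x. ennreal (R powr p) * indicator Z x \<partial>M) \<le>
      (\<integral>\<^sup>+x. indicator Q y * indicator Q x * ennreal (\<bar>log_qf \<tau> (U x) - log_qf \<tau> (U y)\<bar> powr p) \<partial>M)"
    proof (rule AE_I2)
      fix y assume "y \<in> space M"
      show "indicator (P n) y * (\<integral>\<^sup>+x. ennreal (R powr p) * indicator Z x \<partial>M) \<le>
        (\<integral>\<^sup>+x. indicator Q y * indicator Q x * ennreal (\<bar>log_qf \<tau> (U x) - log_qf \<tau> (U y)\<bar> powr p) \<partial>M)"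
      proof (cases "y \<in> P n")
        case True
        have "(\<integral>\<^sup>+x. ennreal (R powr p) * indicator Z x \<partial>M) \<le>
          (\<integral>\<^sup>+x. indicator Q y * indicator Q x * ennreal (\<bar>log_qf \<tau> (U x) - log_qf \<tau> (U y)\<bar> powr p) \<partial>M)"
        proof (rule nn_integral_mono_AE)
          show "AE x in M. ennreal (R powr p) * indicator Z x \<le>
            indicator Q y * indicator Q x * ennreal (\<bar>log_qf \<tau> (U x) - log_qf \<tau> (U y)\<bar> powr p)"
            using U(2)
          proof eventually_elim
            case (elim x)
            show ?case
            proof (cases "x \<in> Z")
              case xZ: True
              then have "U x = 0" using elim by (simp add: Z_def)
              moreover have "log_qf \<tau> \<eta> \<le> log_qf \<tau> (U y)"
                using True \<eta> \<tau>(1) by (intro log_qf_mono) (auto simp: P_def \<eta>_def)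
              ultimately have "R \<le> \<bar>log_qf \<tau> (U x) - log_qf \<tau> (U y)\<bar>" using \<tau>(3) by simp
              then have "R powr p \<le> \<bar>log_qf \<tau> (U x) - log_qf \<tau> (U y)\<bar> powr p"
                using p_gt_1 by (intro powr_mono2) (auto simp: R_def)
              then show ?thesis using xZ True by (simp add: Z_def P_def ennreal_leI)
            qed simp
          qed
        qed
        then show ?thesis using True by simp
      qed simp
    qed
  qed
  also have "\<dots> \<le> ennreal C" by (rule b[OF \<tau>(1,2)])
  finally have "ennreal (\<bar>C\<bar> + 1) \<le> ennreal C" .
  then show False unfolding ennreal_le_iff2 by auto
qed

end

context eigenproblem
begin

text \<open>Adding a nonnegative function of \<open>W\<^sub>0\<^sup>1\<^sup>,\<^sup>p\<close> lowers the energy by at most \<open>e\<close>. For \<open>e = 0\<close> this is the variational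
  form of a supersolution. Allowing \<open>e > 0\<close> covers minimising sequences, which satisfy no equation.\<close>

definition near_min :: "real \<Rightarrow> ('a \<Rightarrow> real) \<Rightarrow> ('a \<Rightarrow> 'a) \<Rightarrow> bool" where
  "near_min e v G \<longleftrightarrow> sob0 v G \<and> (AE x in M. 0 \<le> v x) \<and>
    (\<forall>\<psi> Z. sob0 \<psi> Z \<longrightarrow> (AE x in M. 0 \<le> \<psi> x) \<longrightarrow> E G \<le> E (\<lambda>x. G x + Z x) + e)"

text \<open>The right-hand side of the equation is nonnegative on nonnegative test functions, and the energy is
  convex.\<close>

lemma near_min_weak_eq:
  assumes w: "weak_eq \<mu> v G" and "0 \<le> \<mu>" and pos: "AE x in M. 0 \<le> v x"
  shows "near_min 0 v G"
  unfolding near_min_def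
proof (intro conjI allI impI)
  show s: "sob0 v G" using w by (simp add: weak_eq_def)
  show "AE x in M. 0 \<le> v x" by fact
  fix \<psi> Z assume \<psi>: "sob0 \<psi> Z" "AE x in M. 0 \<le> \<psi> x"
  have "0 \<le> (\<integral>x. \<rho> x * (\<bar>v x\<bar> powr (p - 2) * v x) * \<psi> x \<partial>M)"
  proof (rule integral_nonneg_AE)
    show "AE x in M. 0 \<le> \<rho> x * (\<bar>v x\<bar> powr (p - 2) * v x) * \<psi> x"
      using pos \<psi>(2) \<rho>_bounds by eventually_elim (use \<rho>m_pos in auto)
  qed
  then have "0 \<le> (\<integral>x. a x (G x) \<bullet> Z x \<partial>M)"
    using w \<psi>(1) \<open>0 \<le> \<mu>\<close> by (simp add: weak_eq_def)
  then have "0 \<le> p * (\<integral>x. a x (G x) \<bullet> Z x \<partial>M)" using p_gt_1 by simp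
  with E_convex_below[OF sob0_Lp(2)[OF s] sob0_Lp(2)[OF \<psi>(1)]] show "E G \<le> E (\<lambda>x. G x + Z x) + 0" by linarith
qed

text \<open>Adding a nonnegative function increases the mass \<open>B\<close> beyond \<open>1\<close>, so the new energy is at least \<open>\<lambda>\<^sub>1\<close>.\<close>

lemma near_min_quotient:
  assumes s: "sob0 v G" and pos: "AE x in M. 0 \<le> v x" and B1: "B v = 1"
  shows "near_min (E G - lambda1) v G"
  unfolding near_min_def
proof (intro conjI allI impI)
  have "\<not> (AE x in M. v x = 0)" using B_zero_iff[OF sob0_Lp(1)[OF s]] B1 by simp
  then have l: "0 \<le> lambda1" by (rule lambda1_nonneg[OF s])
  fix \<psi> Z assume \<psi>: "sob0 \<psi> Z" "AE x in M. 0 \<le> \<psi> x"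
  note sum = sob0_add[OF s \<psi>(1)]
  have "B v \<le> B (\<lambda>x. v x + \<psi> x)"
    unfolding B_def
  proof (rule integral_mono_AE)
    show "AE x in M. \<rho> x * \<bar>v x\<bar> powr p \<le> \<rho> x * \<bar>v x + \<psi> x\<bar> powr p"
      using pos \<psi>(2) \<rho>_bounds
      by eventually_elim (use \<rho>m_pos p_gt_1 in \<open>auto intro!: mult_left_mono powr_mono2\<close>)
  qed (intro integrable_\<rho>_powr sob0_Lp(1)[OF s] sob0_Lp(1)[OF sum])+
  then have "lambda1 * 1 \<le> lambda1 * B (\<lambda>x. v x + \<psi> x)" using l B1 by (intro mult_left_mono) auto
  also have "\<dots> \<le> E (\<lambda>x. G x + Z x)" by (rule lambda1_le[OF sum])
  finally show "E G \<le> E (\<lambda>x. G x + Z x) + (E G - lambda1)" by simp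
qed (use assms in auto)

text \<open>The derivative of \<open>h\<^sub>\<tau>\<close> at \<open>s\<close>.\<close>

definition qf_ratio :: "real \<Rightarrow> real \<Rightarrow> real" where
  "qf_ratio \<tau> s = (s + \<tau>) / qf \<tau> s powr (1/2)"

lemma qf_ratio_pos: "0 < \<tau> \<Longrightarrow> 0 \<le> s \<Longrightarrow> 0 < qf_ratio \<tau> s"
  unfolding qf_ratio_def using qf_pos[of \<tau> s] by simp

lemma qf_ratio_lower:
  assumes "0 < \<tau>" "0 \<le> s" shows "(1 + \<tau>\<^sup>2) powr (- 1/2) \<le> qf_ratio \<tau> s"
proof -
  have q: "0 < qf \<tau> s" using assms by (intro qf_pos) simp
  have "\<tau>\<^sup>2 \<le> (s + \<tau>)\<^sup>2" using assms by (intro power_mono) auto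
  then have "(\<tau>\<^sup>2)\<^sup>2 \<le> \<tau>\<^sup>2 * (s + \<tau>)\<^sup>2" unfolding power2_eq_square[of "\<tau>\<^sup>2"] by (intro mult_left_mono) auto
  then have "qf \<tau> s \<le> (1 + \<tau>\<^sup>2) * (s + \<tau>)\<^sup>2" by (simp add: qf_def algebra_simps)
  then have "qf \<tau> s powr (1/2) \<le> ((1 + \<tau>\<^sup>2) * (s + \<tau>)\<^sup>2) powr (1/2)" using q by (intro powr_mono2) auto
  also have "\<dots> = (1 + \<tau>\<^sup>2) powr (1/2) * (s + \<tau>)"
    using assms by (simp add: powr_mult powr_half_sqrt)
  finally have "(1 + \<tau>\<^sup>2) powr (- 1/2) * qf \<tau> s powr (1/2) \<le> (1 + \<tau>\<^sup>2) powr (- 1/2) * ((1 + \<tau>\<^sup>2) powr (1/2) * (s + \<tau>))"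
    by (intro mult_left_mono) auto
  also have "\<dots> = ((1 + \<tau>\<^sup>2) powr (- 1/2) * (1 + \<tau>\<^sup>2) powr (1/2)) * (s + \<tau>)" by (simp only: mult.assoc)
  also have "(1 + \<tau>\<^sup>2) powr (- 1/2) * (1 + \<tau>\<^sup>2) powr (1/2) = 1"
  proof -
    have "1 + \<tau>\<^sup>2 \<noteq> 0" by (smt (verit) zero_le_power2)
    then show ?thesis by (simp flip: powr_add)
  qed
  finally show ?thesis unfolding qf_ratio_def using q by (simp add: le_divide_eq)
qed

lemma qf_ratio_powr:
  assumes "0 < \<tau>" "0 \<le> s" shows "qf_ratio \<tau> s powr (1 - p) \<le> (1 + \<tau>\<^sup>2) powr ((p - 1) / 2)"
proof -
  have "0 < 1 + \<tau>\<^sup>2" by (smt (verit) zero_le_power2)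
  then have "qf_ratio \<tau> s powr (1 - p) \<le> ((1 + \<tau>\<^sup>2) powr (- 1/2)) powr (1 - p)"
    using qf_ratio_lower[OF assms] p_gt_1 by (intro powr_mono2') auto
  also have "\<dots> = (1 + \<tau>\<^sup>2) powr ((p - 1) / 2)" by (simp add: powr_powr diff_divide_distrib)
  finally show ?thesis .
qed

lemma qf_powr_weight:
  assumes "\<tau> \<noteq> 0"
  shows "qf \<tau> s powr ((1 - p) / 2) = (qf \<tau> s powr (1/2)) powr (1 - p)"
    and "(1 - p) * (s + \<tau>) * qf \<tau> s powr ((1 - p) / 2 - 1) = - (p - 1) * qf_ratio \<tau> s * (qf \<tau> s powr (1/2)) powr (- p)"
proof -
  have q: "0 < qf \<tau> s" by (rule qf_pos[OF assms])
  show "qf \<tau> s powr ((1 - p) / 2) = (qf \<tau> s powr (1/2)) powr (1 - p)" by (simp add: powr_powr)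
  have e: "(1 - p) / 2 - 1 = - p / 2 - 1 / 2" by (simp add: diff_divide_distrib)
  have "qf \<tau> s powr ((1 - p) / 2 - 1) = qf \<tau> s powr (- p / 2 - 1 / 2)" unfolding e ..
  also have "\<dots> = qf \<tau> s powr (- p / 2) / qf \<tau> s powr (1/2)" by (rule powr_diff)
  finally show "(1 - p) * (s + \<tau>) * qf \<tau> s powr ((1 - p) / 2 - 1) = - (p - 1) * qf_ratio \<tau> s * (qf \<tau> s powr (1/2)) powr (- p)"
    by (simp add: qf_ratio_def powr_powr)
qed

text \<open>The gradient of \<open>\<bar>\<phi>\<bar>\<^sup>p h\<^sub>\<tau>(v)\<^sup>1\<^sup>-\<^sup>p\<close>, in the form of the pointwise inequalities above.\<close>

definition test_grad :: "real \<Rightarrow> ('a \<Rightarrow> real) \<Rightarrow> ('a \<Rightarrow> real) \<Rightarrow> ('a \<Rightarrow> 'a) \<Rightarrow> 'a \<Rightarrow> 'a" where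
  "test_grad \<tau> \<phi> v G x =
    ((qf \<tau> (v x) powr (1/2)) powr (1 - p) * (p * sgn (\<phi> x) * \<bar>\<phi> x\<bar> powr (p - 1))) *\<^sub>R grad \<phi> x +
    (\<bar>\<phi> x\<bar> powr p * (- (p - 1) * qf_ratio \<tau> (v x) * (qf \<tau> (v x) powr (1/2)) powr (- p))) *\<^sub>R G x"

lemma sob0_test_grad:
  assumes v: "sob0 v G" and \<phi>: "\<phi> \<in> test_functions \<Omega>" and \<tau>: "\<tau> \<noteq> 0"
  shows "sob0 (\<lambda>x. \<bar>\<phi> x\<bar> powr p * qf \<tau> (v x) powr ((1 - p) / 2)) (test_grad \<tau> \<phi> v G)"
proof -
  let ?F = "\<lambda>s. qf \<tau> s powr ((1 - p) / 2)" and ?F' = "\<lambda>s. (1 - p) * (s + \<tau>) * qf \<tau> s powr ((1 - p) / 2 - 1)"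
  define C where "C = ((\<tau>\<^sup>2)\<^sup>2) powr ((1 - p) / 2) + (p - 1) * ((\<tau>\<^sup>2)\<^sup>2) powr (- p / 2)"
  have t4: "0 < (\<tau>\<^sup>2)\<^sup>2" "(\<tau>\<^sup>2)\<^sup>2 \<le> qf \<tau> s" for s using \<tau> by (auto simp: qf_def)
  have "sob0 (\<lambda>x. \<bar>\<phi> x\<bar> powr p * ?F (v x))
    (\<lambda>x. (?F (v x) * (p * sgn (\<phi> x) * \<bar>\<phi> x\<bar> powr (p - 1))) *\<^sub>R grad \<phi> x + (\<bar>\<phi> x\<bar> powr p * ?F' (v x)) *\<^sub>R G x)"
  proof (rule sob0_abs_powr_mult_chain[OF \<phi> v, where C = C])
    show "(?F has_real_derivative ?F' s) (at s)" for s
      unfolding qf_def by (rule DERIV_cong[OF quadratic_powr_has_derivative]) (use \<tau> in \<open>auto simp: field_simps\<close>)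
    show "continuous_on UNIV ?F'"
      using qf_pos[OF \<tau>] by (intro continuous_intros continuous_qf) (auto simp: less_imp_neq[symmetric])
    show "\<bar>?F s\<bar> \<le> C" for s
    proof -
      have "?F s \<le> ((\<tau>\<^sup>2)\<^sup>2) powr ((1 - p) / 2)" using t4 p_gt_1 by (intro powr_mono2') auto
      moreover have "0 \<le> (p - 1) * ((\<tau>\<^sup>2)\<^sup>2) powr (- p / 2)" using p_gt_1 by simp
      ultimately show ?thesis by (simp add: C_def)
    qed
    show "\<bar>?F' s\<bar> \<le> C" for s
    proof -
      have "\<bar>?F' s\<bar> = (p - 1) * (\<bar>s + \<tau>\<bar> * qf \<tau> s powr ((1 - p) / 2 - 1))" using p_gt_1 by (simp add: abs_mult)
      also have "\<dots> \<le> (p - 1) * (qf \<tau> s powr (1/2) * qf \<tau> s powr ((1 - p) / 2 - 1))"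
        using p_gt_1 by (intro mult_left_mono mult_right_mono abs_shift_le) auto
      also have "qf \<tau> s powr (1/2) * qf \<tau> s powr ((1 - p) / 2 - 1) = qf \<tau> s powr (1/2 + ((1 - p) / 2 - 1))"
        by (rule powr_add[symmetric])
      also have "1/2 + ((1 - p) / 2 - 1) = - p / 2" by (simp add: field_simps)
      also have "(p - 1) * qf \<tau> s powr (- p / 2) \<le> (p - 1) * ((\<tau>\<^sup>2)\<^sup>2) powr (- p / 2)"
        using t4 p_gt_1 by (intro mult_left_mono powr_mono2') auto
      also have "\<dots> \<le> C" by (simp add: C_def)
      finally show ?thesis .
    qed
    show "smooth (\<lambda>x. ?F (\<psi> x))" if "smooth \<psi>" for \<psi> :: "'a \<Rightarrow> real"
      unfolding qf_def by (rule smooth_quadratic_powr[OF that]) (use \<tau> in simp)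
  qed
  then show ?thesis
    by (rule sob0_AE_eq) (auto simp: test_grad_def qf_powr_weight[OF \<tau>])
qed

text \<open>An almost minimiser \<open>v\<close> is compared with \<open>v + t \<bar>\<phi>\<bar>\<^sup>p h\<^sub>\<tau>(v)\<^sup>1\<^sup>-\<^sup>p\<close>. By \<open>log_pointwise\<close> the energy drops by \<open>t\<close>
  times the energy of \<open>log h\<^sub>\<tau>(v)\<close>, weighted with \<open>\<bar>\<phi>\<bar>\<^sup>p\<close>, up to a multiple of \<open>t E (\<nabla>\<phi>)\<close>. The admissible
  \<open>t\<close>, and with it the factor \<open>D\<close> of the error \<open>e\<close>, depends on \<open>\<tau>\<close>; what matters is that \<open>C\<close> does not.\<close>

lemma log_energy:
  assumes \<phi>: "\<phi> \<in> test_functions \<Omega>" and c: "0 < c" "\<And>x. x \<in> Q \<Longrightarrow> c \<le> \<bar>\<phi> x\<bar>"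
  shows "\<exists>C. \<forall>\<tau>. 0 < \<tau> \<longrightarrow> \<tau> \<le> 1 \<longrightarrow> (\<exists>D. \<forall>e v G. near_min e v G \<longrightarrow>
    (\<integral>x. indicator Q x * (\<bar>(v x + \<tau>) / qf \<tau> (v x)\<bar> powr p * norm (G x) powr p) \<partial>M) \<le> C + D * e)"
proof -
  obtain b where b: "0 < b" "\<And>x. \<bar>\<phi> x\<bar> \<le> b" using test_function_bounded[OF \<phi>] by metis
  define K where "K = p powr p * (p - 1) powr (1 - p) * 2 powr ((p - 1) / 2)"
  \<comment> \<open>\<open>\<kappa>\<close> inverts the lower bound of the weight \<open>w\<close> on \<open>Q\<close> and the coercivity of \<open>\<Phi>\<close>\<close>
  define \<kappa> where "\<kappa> = 2 powr (1/2) / ((p - 1) * \<alpha> * c powr p)"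
  have \<kappa>: "0 < \<kappa>" using p_gt_1 \<alpha>_pos c by (simp add: \<kappa>_def)
  have main: "\<exists>D. \<forall>e v G. near_min e v G \<longrightarrow>
    (\<integral>x. indicator Q x * (\<bar>(v x + \<tau>) / qf \<tau> (v x)\<bar> powr p * norm (G x) powr p) \<partial>M) \<le> \<kappa> * (K * E (grad \<phi>)) + D * e"
    if \<tau>: "0 < \<tau>" "\<tau> \<le> 1" for \<tau>
  proof -
    \<comment> \<open>\<open>k\<close> bounds the weight \<open>w\<close> below, and \<open>t k \<le> 1\<close> is what makes the sum in \<open>log_pointwise\<close> a convex
      combination\<close>
    define k where "k = (p - 1) * b powr p * \<tau> powr (- p)"
    have k: "0 \<le> k" using p_gt_1 by (simp add: k_def)
    define t where "t = 1 / (k + 1)"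
    have t: "0 < t" "t * k \<le> 1" using k by (auto simp: t_def)
    have "(\<integral>x. indicator Q x * (\<bar>(v x + \<tau>) / qf \<tau> (v x)\<bar> powr p * norm (G x) powr p) \<partial>M) \<le> \<kappa> * (K * E (grad \<phi>)) + (\<kappa> / t) * e"
      if nm: "near_min e v G" for e v G
    proof -
      have v: "sob0 v G" and pos: "AE x in M. 0 \<le> v x"
        and min: "\<And>\<psi> Z. sob0 \<psi> Z \<Longrightarrow> AE x in M. 0 \<le> \<psi> x \<Longrightarrow> E G \<le> E (\<lambda>x. G x + Z x) + e"
        using nm by (auto simp: near_min_def)
      let ?H = "\<lambda>x. qf \<tau> (v x) powr (1/2)" and ?m = "\<lambda>x. qf_ratio \<tau> (v x)"
      have H: "0 < ?H x" for x using qf_pos[of \<tau> "v x"] \<tau> by simp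
      define w where "w x = (p - 1) * \<bar>\<phi> x\<bar> powr p * ?m x * ?H x powr (- p)" for x
      note S = sob0_test_grad[OF v \<phi>, of \<tau>]
      have S': "sob0 (\<lambda>x. t * (\<bar>\<phi> x\<bar> powr p * qf \<tau> (v x) powr ((1 - p) / 2))) (\<lambda>x. t *\<^sub>R test_grad \<tau> \<phi> v G x)"
        by (rule sob0_cmult[OF S]) (use \<tau> in simp)
      have EZ: "E G \<le> E (\<lambda>x. G x + t *\<^sub>R test_grad \<tau> \<phi> v G x) + e"
        by (rule min[OF S']) (use t in simp)
      note GL = sob0_Lp(2)[OF v] and ZL = sob0_Lp(2)[OF S']
      note gL = test_Lp(2)[OF \<phi>]
      have wb: "AE x in M. 0 \<le> w x \<and> w x \<le> k"
        using pos
      proof eventually_elim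
        case (elim x)
        have m0: "0 < ?m x" using qf_ratio_pos[OF \<tau>(1) elim] .
        have sh: "v x + \<tau> \<le> ?H x" using abs_shift_le[of "v x" \<tau>] by simp
        have "?m x \<le> 1" unfolding qf_ratio_def using sh H[of x] by simp
        moreover have "?H x powr (- p) \<le> \<tau> powr (- p)"
          using sh elim \<tau> p_gt_1 by (intro powr_mono2') auto
        moreover have "\<bar>\<phi> x\<bar> powr p \<le> b powr p" using b p_gt_1 by (intro powr_mono2) auto
        ultimately have "(p - 1) * \<bar>\<phi> x\<bar> powr p * ?m x * ?H x powr (- p) \<le> (p - 1) * b powr p * 1 * \<tau> powr (- p)"
          using p_gt_1 m0 by (intro mult_mono) auto
        then show ?case using p_gt_1 m0 by (simp add: w_def k_def)
      qed
      have wm: "w \<in> borel_measurable M"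
      proof -
        note [measurable] = Lp_D(1)[OF sob0_Lp(1)[OF v]] test_measurable(1)[OF \<phi>] borel_measurable_continuous_onI[OF continuous_qf[of UNIV \<tau>]]
        show ?thesis unfolding w_def[abs_def] qf_ratio_def by measurable
      qed
      have iw: "integrable M (\<lambda>x. w x * (a x (G x) \<bullet> G x))"
      proof (rule Bochner_Integration.integrable_bound)
        show "integrable M (\<lambda>x. k * (a x (G x) \<bullet> G x))" using integrable_a_inner[OF GL GL] by simp
        show "(\<lambda>x. w x * (a x (G x) \<bullet> G x)) \<in> borel_measurable M"
          using wm integrable_a_inner[OF GL GL] by (intro borel_measurable_times) auto
        show "AE x in M. norm (w x * (a x (G x) \<bullet> G x)) \<le> norm (k * (a x (G x) \<bullet> G x))"
          using wb by eventually_elim (auto simp: abs_mult intro!: mult_right_mono)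
      qed
      have "E (\<lambda>x. G x + t *\<^sub>R test_grad \<tau> \<phi> v G x) \<le>
        (\<integral>x. a x (G x) \<bullet> G x - t * (w x * (a x (G x) \<bullet> G x)) + t * (K * (a x (grad \<phi> x) \<bullet> grad \<phi> x)) \<partial>M)"
        unfolding E_def
      proof (rule integral_mono_AE)
        show "integrable M (\<lambda>x. a x (G x + t *\<^sub>R test_grad \<tau> \<phi> v G x) \<bullet> (G x + t *\<^sub>R test_grad \<tau> \<phi> v G x))"
          by (rule integrable_a_inner[OF Lp_add[OF GL ZL] Lp_add[OF GL ZL]])
        show "integrable M (\<lambda>x. a x (G x) \<bullet> G x - t * (w x * (a x (G x) \<bullet> G x)) + t * (K * (a x (grad \<phi> x) \<bullet> grad \<phi> x)))"
          using integrable_a_inner[OF GL GL] iw integrable_a_inner[OF gL gL] by simp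
        show "AE x in M. a x (G x + t *\<^sub>R test_grad \<tau> \<phi> v G x) \<bullet> (G x + t *\<^sub>R test_grad \<tau> \<phi> v G x) \<le>
            a x (G x) \<bullet> G x - t * (w x * (a x (G x) \<bullet> G x)) + t * (K * (a x (grad \<phi> x) \<bullet> grad \<phi> x))"
          using a_field pos wb
        proof eventually_elim
          case (elim x)
          interpret F: admissible_field p \<alpha> \<beta> "a x" by fact
          have m0: "0 < ?m x" using qf_ratio_pos[OF \<tau>(1) elim(2)] .
          have "t * w x \<le> 1" using elim(3) t by (smt (verit) mult_left_mono)
          then have "F.\<Phi> (G x + t *\<^sub>R test_grad \<tau> \<phi> v G x) \<le> F.\<Phi> (G x) - t * (w x * F.\<Phi> (G x)) +
              t * (p powr p * (p - 1) powr (1 - p) * ?m x powr (1 - p) * F.\<Phi> (grad \<phi> x))"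
            using F.log_pointwise[OF H[of x] m0 t(1), where y = "\<phi> x" and \<xi> = "G x" and \<eta> = "grad \<phi> x"]
            unfolding test_grad_def w_def by simp
          also have "p powr p * (p - 1) powr (1 - p) * ?m x powr (1 - p) * F.\<Phi> (grad \<phi> x) \<le> K * F.\<Phi> (grad \<phi> x)"
          proof -
            have "?m x powr (1 - p) \<le> (1 + \<tau>\<^sup>2) powr ((p - 1) / 2)" by (rule qf_ratio_powr[OF \<tau>(1) elim(2)])
            also have "\<dots> \<le> 2 powr ((p - 1) / 2)"
              using \<tau> p_gt_1 by (intro powr_mono2) (auto simp: power_le_one)
            finally show ?thesis unfolding K_def
              using F.\<Phi>_nonneg by (intro mult_right_mono mult_left_mono) auto
          qed
          finally show ?case using t(1) by (simp add: F.\<Phi>_def mult_left_mono)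
        qed
      qed
      also have "\<dots> = E G - t * (\<integral>x. w x * (a x (G x) \<bullet> G x) \<partial>M) + t * (K * E (grad \<phi>))"
        using integrable_a_inner[OF GL GL] iw integrable_a_inner[OF gL gL] by (simp add: E_def)
      finally have "t * (\<integral>x. w x * (a x (G x) \<bullet> G x) \<partial>M) \<le> t * (K * E (grad \<phi>)) + e" using EZ by linarith
      then have W: "(\<integral>x. w x * (a x (G x) \<bullet> G x) \<partial>M) \<le> K * E (grad \<phi>) + e / t"
        using t(1) by (simp add: field_simps)
      have "(\<integral>x. indicator Q x * (\<bar>(v x + \<tau>) / qf \<tau> (v x)\<bar> powr p * norm (G x) powr p) \<partial>M) \<le> (\<integral>x. \<kappa> * (w x * (a x (G x) \<bullet> G x)) \<partial>M)"
      proof (rule integral_mono_AE')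
        show "integrable M (\<lambda>x. \<kappa> * (w x * (a x (G x) \<bullet> G x)))" using iw by simp
        show "AE x in M. indicator Q x * (\<bar>(v x + \<tau>) / qf \<tau> (v x)\<bar> powr p * norm (G x) powr p) \<le> \<kappa> * (w x * (a x (G x) \<bullet> G x))"
          using a_field pos wb
        proof eventually_elim
          case (elim x)
          interpret F: admissible_field p \<alpha> \<beta> "a x" by fact
          have \<Phi>: "a x (G x) \<bullet> G x = F.\<Phi> (G x)" by (simp add: F.\<Phi>_def)
          show ?case
          proof (cases "x \<in> Q")
            case True
            have "\<bar>(v x + \<tau>) / qf \<tau> (v x)\<bar> powr p \<le> (qf \<tau> (v x) powr (- 1/2)) powr p"
              using log_qf_deriv_bound[of \<tau> "v x"] \<tau> p_gt_1 by (intro powr_mono2) auto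
            also have "\<dots> = ?H x powr (- p)" by (simp add: powr_powr)
            finally have 1: "\<bar>(v x + \<tau>) / qf \<tau> (v x)\<bar> powr p \<le> ?H x powr (- p)" .
            have "(2::real) powr (- 1/2) \<le> (1 + \<tau>\<^sup>2) powr (- 1/2)"
            proof -
              have "0 < 1 + \<tau>\<^sup>2" by (smt (verit) zero_le_power2)
              then show ?thesis using \<tau> by (intro powr_mono2') (auto simp: power_le_one)
            qed
            also have "\<dots> \<le> ?m x" by (rule qf_ratio_lower[OF \<tau>(1) elim(2)])
            finally have m2: "(2::real) powr (- 1/2) \<le> ?m x" .
            have cp: "c powr p \<le> \<bar>\<phi> x\<bar> powr p" using c(2)[OF True] c(1) p_gt_1 by (intro powr_mono2) auto
            have m0: "0 < ?m x" using qf_ratio_pos[OF \<tau>(1) elim(2)] .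
            have "(p - 1) * c powr p * 2 powr (- 1/2) * ?H x powr (- p) \<le> w x"
              unfolding w_def using cp m2 m0 p_gt_1 by (intro mult_mono) auto
            then have "\<kappa> * ((p - 1) * c powr p * 2 powr (- 1/2) * ?H x powr (- p) * (\<alpha> * norm (G x) powr p)) \<le> \<kappa> * (w x * F.\<Phi> (G x))"
              using \<kappa> \<alpha>_pos elim(3) F.\<Phi>_lower[of "G x"] by (intro mult_left_mono mult_mono) auto
            moreover have "\<kappa> * ((p - 1) * c powr p * 2 powr (- 1/2) * ?H x powr (- p) * (\<alpha> * norm (G x) powr p)) =
              ?H x powr (- p) * norm (G x) powr p"
            proof -
              have "\<kappa> * ((p - 1) * c powr p * 2 powr (- 1/2) * \<alpha>) = 1"
              proof -
                have "(2::real) powr (1/2) * 2 powr (- 1/2) = 1" by (simp flip: powr_add)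
                then show ?thesis unfolding \<kappa>_def using p_gt_1 c(1) \<alpha>_pos by (simp add: field_simps)
              qed
              then have "\<kappa> * ((p - 1) * c powr p * 2 powr (- 1/2) * \<alpha>) * (?H x powr (- p) * norm (G x) powr p) = ?H x powr (- p) * norm (G x) powr p"
                by simp
              then show ?thesis by (simp only: mult_ac)
            qed
            moreover have "\<bar>(v x + \<tau>) / qf \<tau> (v x)\<bar> powr p * norm (G x) powr p \<le> ?H x powr (- p) * norm (G x) powr p"
              using 1 by (intro mult_right_mono) auto
            ultimately have "\<bar>(v x + \<tau>) / qf \<tau> (v x)\<bar> powr p * norm (G x) powr p \<le> \<kappa> * (w x * F.\<Phi> (G x))"
              by linarith
            then show ?thesis using True unfolding \<Phi> by simp
          next
            case False
            then show ?thesis unfolding \<Phi> using \<kappa> elim(3) F.\<Phi>_nonneg by simp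
          qed
        qed
        show "AE x in M. 0 \<le> \<kappa> * (w x * (a x (G x) \<bullet> G x))"
          using a_field wb
        proof eventually_elim
          case (elim x)
          interpret F: admissible_field p \<alpha> \<beta> "a x" by fact
          show ?case using \<kappa> elim(2) F.\<Phi>_nonneg[of "G x"] by (simp add: F.\<Phi>_def)
        qed
      qed
      also have "\<dots> = \<kappa> * (\<integral>x. w x * (a x (G x) \<bullet> G x) \<partial>M)" by simp
      also have "\<dots> \<le> \<kappa> * (K * E (grad \<phi>) + e / t)" using W \<kappa> by (intro mult_left_mono) auto
      finally show ?thesis by (simp add: algebra_simps)
    qed
    then show ?thesis by blast
  qed
  then show ?thesis by (intro exI[of _ "\<kappa> * (K * E (grad \<phi>))"]) auto
qed

text \<open>For fixed \<open>\<tau>\<close> the limit \<open>n \<rightarrow> \<infinity>\<close> removes the error term; the remaining bound on the oscillation is uniform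
  in \<open>\<tau>\<close>.\<close>

lemma zero_or_positive_locally:
  assumes nm: "\<And>n. near_min (e n) (v n) (G n)" and e: "e \<longlonglongrightarrow> 0"
    and lim: "AE x in M. (\<lambda>n. v n x) \<longlonglongrightarrow> U x"
    and Q: "Q \<in> sets borel" "convex Q" "Q \<subseteq> \<Omega>"
    and \<phi>: "\<phi> \<in> test_functions \<Omega>" and c: "0 < c" "\<And>x. x \<in> Q \<Longrightarrow> c \<le> \<bar>\<phi> x\<bar>"
  shows "(AE x in M. x \<in> Q \<longrightarrow> U x = 0) \<or> (AE x in M. x \<in> Q \<longrightarrow> 0 < U x)"
proof -
  have s: "sob0 (v n) (G n)" and pos: "AE x in M. 0 \<le> v n x" for n
    using nm[of n] by (auto simp: near_min_def)
  have vm: "v n \<in> borel_measurable M" for n using Lp_D(1)[OF sob0_Lp(1)[OF s]] .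
  have Um: "U \<in> borel_measurable M" by (rule measurable_AE_limit[OF vm lim])
  have "AE x in M. \<forall>n. 0 \<le> v n x" using pos by (simp add: AE_all_countable)
  then have U0: "AE x in M. 0 \<le> U x"
    using lim by eventually_elim (auto intro: LIMSEQ_le_const)
  obtain K where K: "0 \<le> K" and osc: "\<And>v G \<tau>. sob0 v G \<Longrightarrow> \<tau> \<noteq> 0 \<Longrightarrow> osc Q (\<lambda>x. log_qf \<tau> (v x)) \<le>
    ennreal (K * (\<integral>x. indicator Q x * (\<bar>(v x + \<tau>) / qf \<tau> (v x)\<bar> powr p * norm (G x) powr p) \<partial>M))"
    using osc_log_sob0[OF Q] by blast
  obtain C where C: "\<And>\<tau>. 0 < \<tau> \<Longrightarrow> \<tau> \<le> 1 \<Longrightarrow> \<exists>D. \<forall>e v G. near_min e v G \<longrightarrow>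
    (\<integral>x. indicator Q x * (\<bar>(v x + \<tau>) / qf \<tau> (v x)\<bar> powr p * norm (G x) powr p) \<partial>M) \<le> C + D * e"
    using log_energy[OF \<phi> c] by blast
  have "osc Q (\<lambda>x. log_qf \<tau> (U x)) \<le> ennreal (K * C)" if \<tau>: "0 < \<tau>" "\<tau> \<le> 1" for \<tau>
  proof -
    obtain D where D: "\<And>e v G. near_min e v G \<Longrightarrow>
      (\<integral>x. indicator Q x * (\<bar>(v x + \<tau>) / qf \<tau> (v x)\<bar> powr p * norm (G x) powr p) \<partial>M) \<le> C + D * e"
      using C[OF \<tau>] by blast
    have Lc: "continuous_on UNIV (log_qf \<tau>)"
      using log_qf_has_derivative[of \<tau>] \<tau>(1) by (intro continuous_at_imp_continuous_on) (auto intro: DERIV_isCont)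
    show ?thesis
    proof (rule osc_Fatou[OF Q(1)])
      show "(\<lambda>x. log_qf \<tau> (v n x)) \<in> borel_measurable M" for n
        by (rule measurable_compose[OF vm borel_measurable_continuous_onI[OF Lc]])
      show "AE x in M. (\<lambda>n. log_qf \<tau> (v n x)) \<longlonglongrightarrow> log_qf \<tau> (U x)"
        using lim by eventually_elim (rule continuous_on_tendsto_compose[OF Lc], auto)
      show "osc Q (\<lambda>x. log_qf \<tau> (v n x)) \<le> ennreal (K * (C + D * e n))" for n
        by (rule order_trans[OF osc[OF s]]) (use \<tau> K D[OF nm[of n]] in \<open>auto intro!: ennreal_leI mult_left_mono\<close>)
      have "(\<lambda>n. K * (C + D * e n)) \<longlonglongrightarrow> K * (C + D * 0)" by (intro tendsto_intros e)
      then show "(\<lambda>n. K * (C + D * e n)) \<longlonglongrightarrow> K * C" by simp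
    qed
  qed
  then show ?thesis by (rule zero_or_positive_on[OF Um U0 Q(1,3)])
qed

lemma not_AE_False_open:
  assumes "open S" "S \<subseteq> \<Omega>" "S \<noteq> {}" shows "\<not> (AE x in M. x \<notin> S)"
proof
  assume "AE x in M. x \<notin> S"
  then have "AE x in lebesgue. x \<notin> S" unfolding AE_M by eventually_elim (use assms(2) in auto)
  then have "negligible S"
    using assms(1) by (simp add: negligible_iff_null_sets completion.null_sets_iff_AE)
  then show False using open_not_negligible[OF assms(1,3)] by simp
qed

text \<open>The local alternative makes the largest open set where \<open>U\<close> vanishes almost everywhere and the largest
  open set where \<open>U\<close> is positive almost everywhere cover \<open>\<Omega>\<close>. They are disjoint, so one of them is empty.\<close>

theorem strong_maximum_principle:
  assumes conn: "connected \<Omega>"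
    and nm: "\<And>n. near_min (e n) (v n) (G n)" and e: "e \<longlonglongrightarrow> 0"
    and lim: "AE x in M. (\<lambda>n. v n x) \<longlonglongrightarrow> U x"
  shows "(AE x in M. U x = 0) \<or> (AE x in M. 0 < U x)"
proof -
  define Z where "Z = \<Union>{S. open S \<and> S \<subseteq> \<Omega> \<and> (AE x in M. x \<in> S \<longrightarrow> U x = 0)}"
  define P where "P = \<Union>{S. open S \<and> S \<subseteq> \<Omega> \<and> (AE x in M. x \<in> S \<longrightarrow> 0 < U x)}"
  have op: "open Z" "open P" unfolding Z_def P_def by (auto intro: open_Union)
  have sub: "Z \<subseteq> \<Omega>" "P \<subseteq> \<Omega>" by (auto simp: Z_def P_def)
  have cover: "\<Omega> \<subseteq> Z \<union> P"
  proof
    fix x assume x: "x \<in> \<Omega>"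
    obtain a' b' where ab': "cbox a' b' \<subseteq> \<Omega>" "x \<in> box a' b'"
      using open_contains_cbox[OF open_dom x] by metis
    obtain a b where ab: "cbox a b \<subseteq> box a' b'" "x \<in> box a b"
      using open_contains_cbox[OF open_box ab'(2)] by metis
    have ne: "box a' b' \<noteq> {}" using ab' by blast
    \<comment> \<open>the minimum over the smaller box of a bump function of the larger one serves as the lower bound \<open>c\<close>\<close>
    have "\<exists>y\<in>cbox a b. \<forall>z\<in>cbox a b. bump 0 a' b' y \<le> bump 0 a' b' z"
    proof (rule continuous_attains_inf)
      show "cbox a b \<noteq> {}" using ab(2) box_subset_cbox[of a b] by blast
      show "continuous_on (cbox a b) (bump 0 a' b')"
        by (rule continuous_on_subset[OF smooth_continuous[OF smooth_bump]]) simp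
    qed simp
    then obtain y where y: "y \<in> cbox a b" "\<And>z. z \<in> cbox a b \<Longrightarrow> bump 0 a' b' y \<le> bump 0 a' b' z" by blast
    have c: "0 < bump 0 a' b' y" using y(1) ab(1) bump_pos_iff[OF ne] by blast
    have boxsub: "box a b \<subseteq> \<Omega>"
      using ab(1) ab'(1) box_subset_cbox[of a b] box_subset_cbox[of a' b'] by blast
    have "(AE x in M. x \<in> box a b \<longrightarrow> U x = 0) \<or> (AE x in M. x \<in> box a b \<longrightarrow> 0 < U x)"
    proof (rule zero_or_positive_locally[OF nm e lim _ convex_box(2) boxsub bump_test_function[OF ne ab'(1)] c])
      fix z assume "z \<in> box a b"
      then have "z \<in> cbox a b" using box_subset_cbox by blast
      then show "bump 0 a' b' y \<le> \<bar>bump 0 a' b' z\<bar>" using y(2) by fastforce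
    qed simp
    then show "x \<in> Z \<union> P"
    proof
      assume "AE x in M. x \<in> box a b \<longrightarrow> U x = 0"
      then have "x \<in> Z" unfolding Z_def using ab(2) boxsub open_box by (intro UnionI[of "box a b"]) simp_all
      then show ?thesis ..
    next
      assume "AE x in M. x \<in> box a b \<longrightarrow> 0 < U x"
      then have "x \<in> P" unfolding P_def using ab(2) boxsub open_box by (intro UnionI[of "box a b"]) simp_all
      then show ?thesis ..
    qed
  qed
  have disj: "Z \<inter> P = {}"
  proof (rule ccontr)
    assume "Z \<inter> P \<noteq> {}"
    then obtain x S T where S: "x \<in> S" "open S" "S \<subseteq> \<Omega>" "AE x in M. x \<in> S \<longrightarrow> U x = 0"
      and T: "x \<in> T" "open T" "T \<subseteq> \<Omega>" "AE x in M. x \<in> T \<longrightarrow> 0 < U x"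
      by (auto simp: Z_def P_def)
    have "AE x in M. x \<notin> S \<inter> T" using S(4) T(4) by eventually_elim auto
    moreover have "open (S \<inter> T)" "S \<inter> T \<subseteq> \<Omega>" "S \<inter> T \<noteq> {}" using S T by auto
    ultimately show False using not_AE_False_open by blast
  qed
  have glob: "AE x in M. R x" if R: "\<Omega> \<subseteq> \<Union>{S. open S \<and> S \<subseteq> \<Omega> \<and> (AE x in M. x \<in> S \<longrightarrow> R x)}" for R :: "'a \<Rightarrow> bool"
  proof -
    let ?\<S> = "{S. open S \<and> S \<subseteq> \<Omega> \<and> (AE x in M. x \<in> S \<longrightarrow> R x)}"
    obtain \<T> where \<T>: "\<T> \<subseteq> ?\<S>" "countable \<T>" "\<Union>\<T> = \<Union>?\<S>"
      using Lindelof[of ?\<S>] by auto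
    have "AE x in M. \<forall>S\<in>\<T>. x \<in> S \<longrightarrow> R x"
      by (subst AE_ball_countable[OF \<T>(2)]) (use \<T>(1) in blast)
    then show ?thesis using AE_space
    proof eventually_elim
      case (elim x)
      then have "x \<in> \<Union>\<T>" using R \<T>(3) by auto
      then show ?case using elim(1) by blast
    qed
  qed
  have "Z = {} \<or> P = {}"
    using connectedD[OF conn op _ cover] disj sub by blast
  then show ?thesis
  proof
    assume "Z = {}"
    then have "\<Omega> \<subseteq> P" using cover by blast
    then show ?thesis using glob[of "\<lambda>x. 0 < U x"] unfolding P_def by blast
  next
    assume "P = {}"
    then have "\<Omega> \<subseteq> Z" using cover by blast
    then show ?thesis using glob[of "\<lambda>x. U x = 0"] unfolding Z_def by blast
  qed
qed

section \<open>Picone's inequality and isolation of the first eigenvalue\<close>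

text \<open>The equation is tested with \<open>\<bar>\<phi>\<bar>\<^sup>p h\<^sub>\<tau>(v)\<^sup>1\<^sup>-\<^sup>p\<close>. By \<open>Picone_pointwise\<close> the left-hand side is at most \<open>E (\<nabla>\<phi>)\<close>
  up to a factor that tends to \<open>1\<close>. On the right-hand side \<open>v\<^sup>p\<^sup>-\<^sup>1 h\<^sub>\<tau>(v)\<^sup>1\<^sup>-\<^sup>p\<close> is bounded by \<open>1\<close> and tends
  to \<open>1\<close> as \<open>\<tau> \<rightarrow> 0\<close>, because \<open>v > 0\<close>.\<close>

lemma Picone_bound:
  assumes w: "weak_eq \<mu> v G" and \<mu>: "0 \<le> \<mu>" and pos: "AE x in M. 0 < v x" and \<phi>: "\<phi> \<in> test_functions \<Omega>"
  shows "\<mu> * B \<phi> \<le> E (grad \<phi>)"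
proof -
  have v: "sob0 v G" using w by (simp add: weak_eq_def)
  note vm = Lp_D(1)[OF sob0_Lp(1)[OF v]] and gL = test_Lp(2)[OF \<phi>]
  obtain b where b: "0 < b" "\<And>x. \<bar>\<phi> x\<bar> \<le> b" using test_function_bounded[OF \<phi>] by metis
  define \<tau> where "\<tau> n = inverse (real (Suc n))" for n
  have \<tau>: "0 < \<tau> n" for n by (simp add: \<tau>_def)
  have \<tau>0: "\<tau> \<longlonglongrightarrow> 0" unfolding \<tau>_def[abs_def] by (rule LIMSEQ_inverse_real_of_nat)
  define h where "h n x = \<rho> x * (\<bar>v x\<bar> powr (p - 2) * v x) * (\<bar>\<phi> x\<bar> powr p * qf (\<tau> n) (v x) powr ((1 - p) / 2))" for n x
  have le: "\<mu> * (\<integral>x. h n x \<partial>M) \<le> (1 + (\<tau> n)\<^sup>2) powr ((p - 1) / 2) * E (grad \<phi>)" for n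
  proof -
    have \<tau>n: "\<tau> n \<noteq> 0" using \<tau>[of n] by simp
    note S = sob0_test_grad[OF v \<phi> \<tau>n]
    have "\<mu> * (\<integral>x. h n x \<partial>M) = (\<integral>x. a x (G x) \<bullet> test_grad (\<tau> n) \<phi> v G x \<partial>M)"
      using w S by (simp add: weak_eq_def h_def)
    also have "\<dots> \<le> (\<integral>x. (1 + (\<tau> n)\<^sup>2) powr ((p - 1) / 2) * (a x (grad \<phi> x) \<bullet> grad \<phi> x) \<partial>M)"
    proof (rule integral_mono_AE)
      show "AE x in M. a x (G x) \<bullet> test_grad (\<tau> n) \<phi> v G x \<le> (1 + (\<tau> n)\<^sup>2) powr ((p - 1) / 2) * (a x (grad \<phi> x) \<bullet> grad \<phi> x)"
        using a_field pos
      proof eventually_elim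
        case (elim x)
        interpret F: admissible_field p \<alpha> \<beta> "a x" by fact
        have H: "0 < qf (\<tau> n) (v x) powr (1/2)" using qf_pos[OF \<tau>n, of "v x"] by simp
        have m: "0 < qf_ratio (\<tau> n) (v x)" using qf_ratio_pos[OF \<tau>] elim(2) by simp
        have "a x (G x) \<bullet> test_grad (\<tau> n) \<phi> v G x \<le> qf_ratio (\<tau> n) (v x) powr (1 - p) * F.\<Phi> (grad \<phi> x)"
          unfolding test_grad_def by (rule F.Picone_pointwise[OF H m])
        also have "\<dots> \<le> (1 + (\<tau> n)\<^sup>2) powr ((p - 1) / 2) * F.\<Phi> (grad \<phi> x)"
          using elim(2) F.\<Phi>_nonneg by (intro mult_right_mono qf_ratio_powr \<tau>) auto
        finally show ?case by (simp add: F.\<Phi>_def)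
      qed
    qed (use integrable_a_inner[OF sob0_Lp(2)[OF v] sob0_Lp(2)[OF S]] integrable_a_inner[OF gL gL] in auto)
    also have "\<dots> = (1 + (\<tau> n)\<^sup>2) powr ((p - 1) / 2) * E (grad \<phi>)" by (simp add: E_def)
    finally show ?thesis .
  qed
  have vv: "\<bar>s\<bar> powr (p - 2) * s = s powr (p - 1)" if "0 < s" for s :: real
    using that powr_add[of s "p - 2" 1] by simp
  have "(\<lambda>n. \<integral>x. h n x \<partial>M) \<longlonglongrightarrow> (\<integral>x. \<rho> x * \<bar>\<phi> x\<bar> powr p \<partial>M)"
  proof (rule integral_dom_conv(1)[where g = "\<lambda>x. 0" and C = "\<rho>p * b powr p"])
    show "(\<lambda>x. 0) \<in> Lpr" by (rule Lp_const)
    show "h n \<in> borel_measurable M" for n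
    proof -
      note [measurable] = vm \<rho>_meas test_measurable(1)[OF \<phi>] borel_measurable_continuous_onI[OF continuous_qf[of UNIV "\<tau> n"]]
      show ?thesis unfolding h_def[abs_def] by measurable
    qed
    show "AE x in M. \<forall>n. norm (h n x) \<le> \<rho>p * b powr p * (1 + \<bar>0\<bar> powr p)"
      using pos \<rho>_bounds
    proof eventually_elim
      case (elim x)
      show ?case
      proof
        fix n
        have "v x \<le> qf (\<tau> n) (v x) powr (1/2)" using abs_shift_le[of "v x" "\<tau> n"] elim(1) \<tau>[of n] by simp
        then have "(qf (\<tau> n) (v x) powr (1/2)) powr (1 - p) \<le> v x powr (1 - p)"
          using elim(1) p_gt_1 by (intro powr_mono2') auto
        then have "v x powr (p - 1) * qf (\<tau> n) (v x) powr ((1 - p) / 2) \<le> v x powr (p - 1) * v x powr (1 - p)"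
          by (intro mult_left_mono) (auto simp: powr_powr)
        also have "\<dots> = 1" using elim(1) by (simp flip: powr_add)
        finally have 1: "v x powr (p - 1) * qf (\<tau> n) (v x) powr ((1 - p) / 2) \<le> 1" .
        have "h n x = \<rho> x * \<bar>\<phi> x\<bar> powr p * (v x powr (p - 1) * qf (\<tau> n) (v x) powr ((1 - p) / 2))"
          unfolding h_def vv[OF elim(1)] by simp
        moreover have "\<rho> x * \<bar>\<phi> x\<bar> powr p * (v x powr (p - 1) * qf (\<tau> n) (v x) powr ((1 - p) / 2)) \<le> \<rho>p * b powr p * 1"
          using 1 elim(2) \<rho>m_pos b p_gt_1 by (intro mult_mono powr_mono2) auto
        moreover have "0 \<le> \<rho> x * \<bar>\<phi> x\<bar> powr p * (v x powr (p - 1) * qf (\<tau> n) (v x) powr ((1 - p) / 2))"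
          using elim(2) \<rho>m_pos by simp
        ultimately show "norm (h n x) \<le> \<rho>p * b powr p * (1 + \<bar>0\<bar> powr p)" by simp
      qed
    qed
    show "AE x in M. (\<lambda>n. h n x) \<longlonglongrightarrow> \<rho> x * \<bar>\<phi> x\<bar> powr p"
      using pos
    proof eventually_elim
      case (elim x)
      have "(\<lambda>n. qf (\<tau> n) (v x) powr ((1 - p) / 2)) \<longlonglongrightarrow> ((v x + 0)\<^sup>2 + (0\<^sup>2)\<^sup>2) powr ((1 - p) / 2)"
        unfolding qf_def using elim by (intro tendsto_intros \<tau>0) auto
      moreover have "((v x + 0)\<^sup>2 + (0\<^sup>2)\<^sup>2) powr ((1 - p) / 2) = v x powr (1 - p)"
      proof -
        have "(v x powr 2) powr ((1 - p) / 2) = v x powr (2 * ((1 - p) / 2))" by (rule powr_powr)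
        also have "2 * ((1 - p) / 2) = 1 - p" by simp
        finally have "(v x powr 2) powr ((1 - p) / 2) = v x powr (1 - p)" .
        moreover have "v x powr 2 = (v x)\<^sup>2" using elim by simp
        ultimately show ?thesis by simp
      qed
      ultimately have q: "(\<lambda>n. qf (\<tau> n) (v x) powr ((1 - p) / 2)) \<longlonglongrightarrow> v x powr (1 - p)" by (simp only:)
      have "(\<lambda>n. h n x) \<longlonglongrightarrow> \<rho> x * v x powr (p - 1) * (\<bar>\<phi> x\<bar> powr p * v x powr (1 - p))"
        unfolding h_def vv[OF elim] by (intro tendsto_mult tendsto_const q)
      moreover have "v x powr (p - 1) * v x powr (1 - p) = 1" using elim by (simp flip: powr_add)
      then have "\<rho> x * v x powr (p - 1) * (\<bar>\<phi> x\<bar> powr p * v x powr (1 - p)) = \<rho> x * \<bar>\<phi> x\<bar> powr p"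
        by (simp add: mult_ac)
      ultimately show ?case by simp
    qed
  qed
  then have 1: "(\<lambda>n. \<mu> * (\<integral>x. h n x \<partial>M)) \<longlonglongrightarrow> \<mu> * B \<phi>" unfolding B_def by (intro tendsto_intros)
  have "(\<lambda>n. (1 + (\<tau> n)\<^sup>2) powr ((p - 1) / 2) * E (grad \<phi>)) \<longlonglongrightarrow> (1 + 0\<^sup>2) powr ((p - 1) / 2) * E (grad \<phi>)"
    by (intro tendsto_intros \<tau>0) auto
  then have 2: "(\<lambda>n. (1 + (\<tau> n)\<^sup>2) powr ((p - 1) / 2) * E (grad \<phi>)) \<longlonglongrightarrow> E (grad \<phi>)" by simp
  show ?thesis by (rule LIMSEQ_le[OF 1 2]) (use le in blast)
qed

theorem nonneg_eigenfunction:
  assumes conn: "connected \<Omega>" and w: "weak_eq \<mu> v G" and nz: "\<not> (AE x in M. v x = 0)"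
    and pos: "AE x in M. 0 \<le> v x"
  shows "\<mu> \<le> lambda1"
proof (rule ccontr)
  assume "\<not> \<mu> \<le> lambda1"
  have v: "sob0 v G" using w by (simp add: weak_eq_def)
  have "0 \<le> lambda1" by (rule lambda1_nonneg[OF v nz])
  then have \<mu>: "0 \<le> \<mu>" using \<open>\<not> \<mu> \<le> lambda1\<close> by simp
  have "(AE x in M. v x = 0) \<or> (AE x in M. 0 < v x)"
    using strong_maximum_principle[OF conn, of "\<lambda>n. 0" "\<lambda>n. v" "\<lambda>n. G" v] near_min_weak_eq[OF w \<mu> pos] by simp
  then have "AE x in M. 0 < v x" using nz by simp
  then have "\<mu> * B u \<le> E H" if "sob0 u H" for u H
    using sob0_density[OF Picone_bound[OF w \<mu>] that] by blast
  then have "\<mu> \<le> lambda1" by (rule lambda1_greatest[OF v nz])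
  then show False using \<open>\<not> \<mu> \<le> lambda1\<close> by simp
qed

lemma normalized_pos_part:
  assumes w: "weak_eq \<mu> u G" and nz: "\<not> (AE x in M. max 0 (u x) = 0)"
  shows "\<exists>c>0. sob0 (\<lambda>x. c * max 0 (u x)) (\<lambda>x. c *\<^sub>R (if 0 < u x then G x else 0)) \<and>
    B (\<lambda>x. c * max 0 (u x)) = 1 \<and> E (\<lambda>x. c *\<^sub>R (if 0 < u x then G x else 0)) = \<mu>"
proof -
  have s: "sob0 u G" using w by (simp add: weak_eq_def)
  note P = sob0_pos_part[OF s]
  let ?b = "B (\<lambda>x. max 0 (u x))"
  have b: "0 < ?b" using B_zero_iff[OF sob0_Lp(1)[OF P]] nz B_nonneg[of "\<lambda>x. max 0 (u x)"] by (auto simp: less_le)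
  define c where "c = (1 / ?b) powr (1 / p)"
  have c: "0 < c" using b by (simp add: c_def)
  have cp: "\<bar>c\<bar> powr p = 1 / ?b" using c b p_gt_1 by (simp add: c_def powr_powr)
  have "B (\<lambda>x. c * max 0 (u x)) = 1" unfolding B_cmult cp using b by simp
  moreover have "E (\<lambda>x. c *\<^sub>R (if 0 < u x then G x else 0)) = \<mu>"
    unfolding E_cmult cp weak_eq_pos_part[OF w] using b by simp
  ultimately show ?thesis using c sob0_cmult[OF P, of c] by blast
qed

text \<open>Rellich's theorem provides a limit, whose mass is one because \<open>B\<close> is continuous. The strong maximum
  principle excludes the zeros.\<close>

lemma minimizing_sequence_positive:
  fixes U :: "nat \<Rightarrow> 'a \<Rightarrow> real"
  assumes conn: "connected \<Omega>" and s: "\<And>n. sob0 (U n) (H n)" and pos: "\<And>n x. 0 \<le> U n x"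
    and B1: "\<And>n. B (U n) = 1" and Eb: "\<And>n. E (H n) \<le> C" and El: "(\<lambda>n. E (H n)) \<longlonglongrightarrow> lambda1"
  shows "\<exists>r V. strict_mono r \<and> dom_conv (\<lambda>n. U (r n)) V \<and> (AE x in M. 0 < V x)"
proof -
  define C' where "C' = 1 / \<rho>m + C / \<alpha>"
  have C: "0 \<le> C" using E_nonneg[OF sob0_Lp(2)[OF s[of 0]]] Eb[of 0] by linarith
  have 1: "(\<integral>x. \<bar>U n x\<bar> powr p \<partial>M) \<le> C'" for n
  proof -
    have "(\<integral>x. \<bar>U n x\<bar> powr p \<partial>M) \<le> 1 / \<rho>m"
      using B_lower[OF sob0_Lp(1)[OF s[of n]]] B1[of n] \<rho>m_pos by (simp add: field_simps)
    also have "\<dots> \<le> C'" using C \<alpha>_pos by (simp add: C'_def)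
    finally show ?thesis .
  qed
  have 2: "(\<integral>x. norm (H n x) powr p \<partial>M) \<le> C'" for n
  proof -
    have "\<alpha> * (\<integral>x. norm (H n x) powr p \<partial>M) \<le> C"
      using E_lower[OF sob0_Lp(2)[OF s[of n]]] Eb[of n] by linarith
    then have "(\<integral>x. norm (H n x) powr p \<partial>M) \<le> C / \<alpha>" using \<alpha>_pos by (simp add: field_simps)
    also have "\<dots> \<le> C'" using \<rho>m_pos by (simp add: C'_def)
    finally show ?thesis .
  qed
  obtain r V where r: "strict_mono r" and V: "dom_conv (\<lambda>n. U (r n)) V" by (rule Rellich[OF s 1 2])
  have "B V = 1" using LIMSEQ_unique[OF B_continuous[OF V]] B1 by simp
  then have nz: "\<not> (AE x in M. V x = 0)" using B_zero_iff[OF dom_conv_Lp(2)[OF V]] by simp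
  have "(\<lambda>n. E (H (r n))) \<longlonglongrightarrow> lambda1" using LIMSEQ_subseq_LIMSEQ[OF El r] by (simp add: o_def)
  then have e: "(\<lambda>n. E (H (r n)) - lambda1) \<longlonglongrightarrow> 0" by (simp add: LIM_zero)
  have "(AE x in M. V x = 0) \<or> (AE x in M. 0 < V x)"
    by (rule strong_maximum_principle[OF conn near_min_quotient[OF s _ B1] e])
       (use pos V in \<open>auto simp: dom_conv_def\<close>)
  then show ?thesis using r V nz by blast
qed

text \<open>Otherwise the normalised positive and negative parts of a sequence of eigenfunctions have positive
  limits, although their product vanishes.\<close>

theorem first_eigenvalue_isolated:
  assumes conn: "connected \<Omega>"
  shows "\<exists>\<delta>>0. {lambda1<..<lambda1 + \<delta>} \<inter> Spectrum \<Omega> p a \<rho> = {}"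
proof (rule ccontr)
  assume neg: "\<not> ?thesis"
  define \<epsilon> where "\<epsilon> n = inverse (real (Suc n))" for n
  have \<epsilon>: "0 < \<epsilon> n" "\<epsilon> n \<le> 1" for n by (auto simp: \<epsilon>_def inverse_le_1_iff)
  have \<epsilon>0: "\<epsilon> \<longlonglongrightarrow> 0" unfolding \<epsilon>_def[abs_def] by (rule LIMSEQ_inverse_real_of_nat)
  have "\<exists>\<mu> u G. lambda1 < \<mu> \<and> \<mu> < lambda1 + \<epsilon> n \<and> weak_eq \<mu> u G \<and> \<not> (AE x in M. u x = 0)" for n
  proof -
    have "{lambda1<..<lambda1 + \<epsilon> n} \<inter> Spectrum \<Omega> p a \<rho> \<noteq> {}" using neg \<epsilon>(1)[of n] by blast
    then obtain \<mu> u where "lambda1 < \<mu>" "\<mu> < lambda1 + \<epsilon> n" "nontrivial_on \<Omega> u" "weak_solution \<Omega> p a \<rho> \<mu> u"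
      by (auto simp: Spectrum_def)
    then show ?thesis using weak_solution_imp_weak_eq
      by (intro exI[of _ \<mu>] exI[of _ u] exI[of _ "wgrad \<Omega> u"]) (simp add: nontrivial_on_def)
  qed
  then obtain \<mu> u G where \<mu>: "\<And>n. lambda1 < \<mu> n" "\<And>n. \<mu> n < lambda1 + \<epsilon> n"
    and w: "\<And>n. weak_eq (\<mu> n) (u n) (G n)" and nz: "\<And>n. \<not> (AE x in M. u n x = 0)"
    by metis
  have \<mu>l: "\<mu> \<longlonglongrightarrow> lambda1"
  proof (rule tendsto_sandwich[OF _ _ tendsto_const])
    have "(\<lambda>n. lambda1 + \<epsilon> n) \<longlonglongrightarrow> lambda1 + 0" by (intro tendsto_intros \<epsilon>0)
    then show "(\<lambda>n. lambda1 + \<epsilon> n) \<longlonglongrightarrow> lambda1" by simp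
    show "\<forall>\<^sub>F n in sequentially. lambda1 \<le> \<mu> n" "\<forall>\<^sub>F n in sequentially. \<mu> n \<le> lambda1 + \<epsilon> n"
      using \<mu> by (auto intro!: always_eventually less_imp_le)
  qed
  have \<mu>b: "\<mu> n \<le> lambda1 + 1" for n using \<mu>(2)[of n] \<epsilon>(2)[of n] by simp
  \<comment> \<open>an eigenvalue above \<open>\<lambda>\<^sub>1\<close> has no eigenfunction of one sign\<close>
  have onesign: False if w': "weak_eq (\<mu> n) u' G'" and z: "AE x in M. max 0 (- u' x) = 0" and nz': "\<not> (AE x in M. u' x = 0)" for n u' G'
  proof -
    have "AE x in M. 0 \<le> u' x" using z by eventually_elim (auto simp: max_def split: if_splits)
    then have "\<mu> n \<le> lambda1" by (rule nonneg_eigenfunction[OF conn w' nz'])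
    then show False using \<mu>(1)[of n] by simp
  qed
  have w2: "weak_eq (\<mu> n) (\<lambda>x. - u n x) (\<lambda>x. - G n x)" for n by (rule weak_eq_uminus[OF w])
  have neg_part: "\<not> (AE x in M. max 0 (- u n x) = 0)" for n using onesign[OF w _ nz] by blast
  have pos_part: "\<not> (AE x in M. max 0 (u n x) = 0)" for n
    using onesign[OF w2, of n] nz[of n] by auto
  define U where "U c n x = c * max 0 (u n x)" for c n x
  define U' where "U' c n x = c *\<^sub>R (if 0 < u n x then G n x else 0)" for c n x
  define N where "N c n x = c * max 0 (- u n x)" for c n x
  define N' where "N' c n x = c *\<^sub>R (if 0 < - u n x then - G n x else 0)" for c n x
  have "\<forall>n. \<exists>c. 0 < c \<and> sob0 (U c n) (U' c n) \<and> B (U c n) = 1 \<and> E (U' c n) = \<mu> n"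
    unfolding U_def[abs_def] U'_def[abs_def] by (intro allI normalized_pos_part[OF w pos_part])
  from choice[OF this] obtain c where call: "\<forall>n. 0 < c n \<and> sob0 (U (c n) n) (U' (c n) n) \<and> B (U (c n) n) = 1 \<and> E (U' (c n) n) = \<mu> n"
    by (rule exE)
  then have c: "0 < c n" and S: "sob0 (U (c n) n) (U' (c n) n)" and B1: "B (U (c n) n) = 1" and E1: "E (U' (c n) n) = \<mu> n" for n
    by simp_all
  have "\<forall>n. \<exists>c. 0 < c \<and> sob0 (N c n) (N' c n) \<and> B (N c n) = 1 \<and> E (N' c n) = \<mu> n"
    unfolding N_def[abs_def] N'_def[abs_def] by (intro allI normalized_pos_part[OF w2 neg_part])
  from choice[OF this] obtain d where dall: "\<forall>n. 0 < d n \<and> sob0 (N (d n) n) (N' (d n) n) \<and> B (N (d n) n) = 1 \<and> E (N' (d n) n) = \<mu> n"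
    by (rule exE)
  then have d: "0 < d n" and S': "sob0 (N (d n) n) (N' (d n) n)" and B1': "B (N (d n) n) = 1" and E1': "E (N' (d n) n) = \<mu> n" for n
    by simp_all
  have U0: "0 \<le> U (c n) n x" and N0: "0 \<le> N (d n) n x" for n x
    using c[of n] d[of n] by (simp_all add: U_def N_def)
  have "\<exists>r V. strict_mono r \<and> dom_conv (\<lambda>n. U (c (r n)) (r n)) V \<and> (AE x in M. 0 < V x)"
    by (rule minimizing_sequence_positive[OF conn S U0 B1, where C = "lambda1 + 1"])
       (use \<mu>l \<mu>b in \<open>simp_all add: E1\<close>)
  then obtain r V where r: "strict_mono r" and V: "dom_conv (\<lambda>n. U (c (r n)) (r n)) V" and V0: "AE x in M. 0 < V x"
    by blast
  have \<mu>r: "(\<lambda>n. \<mu> (r n)) \<longlonglongrightarrow> lambda1" using LIMSEQ_subseq_LIMSEQ[OF \<mu>l r] by (simp add: o_def)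
  have "\<exists>s W. strict_mono s \<and> dom_conv (\<lambda>n. N (d (r (s n))) (r (s n))) W \<and> (AE x in M. 0 < W x)"
    by (rule minimizing_sequence_positive[OF conn S' N0 B1', where C = "lambda1 + 1"])
       (use \<mu>r \<mu>b in \<open>simp_all add: E1'\<close>)
  then obtain s W where s: "strict_mono s" and W: "dom_conv (\<lambda>n. N (d (r (s n))) (r (s n))) W" and W0: "AE x in M. 0 < W x"
    by blast
  have "AE x in M. (\<lambda>n. U (c (r (s n))) (r (s n)) x) \<longlonglongrightarrow> V x"
    using dom_conv_subseq[OF V s] by (simp add: dom_conv_def)
  moreover have "AE x in M. (\<lambda>n. N (d (r (s n))) (r (s n)) x) \<longlonglongrightarrow> W x"
    using W by (simp add: dom_conv_def)
  ultimately have "AE x in M. V x = 0" using V0 W0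
  proof eventually_elim
    case (elim x)
    have "(\<lambda>n. U (c (r (s n))) (r (s n)) x * N (d (r (s n))) (r (s n)) x) \<longlonglongrightarrow> V x * W x"
      by (intro tendsto_mult elim)
    moreover have "U (c (r (s n))) (r (s n)) x * N (d (r (s n))) (r (s n)) x = 0" for n
      by (simp add: U_def N_def max_def)
    ultimately have "V x * W x = 0" by (simp add: LIMSEQ_const_iff)
    then show ?case using elim by simp
  qed
  moreover have "B V = 1" using LIMSEQ_unique[OF B_continuous[OF V]] B1 by simp
  ultimately show False using B_zero_iff[OF dom_conv_Lp(2)[OF V]] by simp
qed

end

theorem theorem4p10:
  fixes p \<alpha> \<beta> c \<rho>m \<rho>p :: real
    and \<Omega> :: "'a::euclidean_space set"
    and \<rho> :: "'a \<Rightarrow> real"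
    and a :: "'a \<Rightarrow> 'a \<Rightarrow> 'a"
  assumes p: "1 < p"
    and \<Omega>: "open \<Omega>" "connected \<Omega>" "bounded \<Omega>" "\<Omega> \<noteq> {}"
    and \<rho>: "\<rho> \<in> borel_measurable (lebesgue_on \<Omega>)"
      "0 < \<rho>m" "AE x in lebesgue_on \<Omega>. \<rho>m \<le> \<rho> x \<and> \<rho> x \<le> \<rho>p"
    and pos: "0 < \<alpha>" "0 < \<beta>" "0 < c"
    and H0: "AE x in lebesgue_on \<Omega>. continuous_on UNIV (a x)"
      "\<And>\<xi>. (\<lambda>x. a x \<xi>) \<in> borel_measurable (lebesgue_on \<Omega>)"
    and H1: "AE x in lebesgue_on \<Omega>. \<forall>\<xi>\<^sub>1 \<xi>\<^sub>2. 0 \<le> (a x \<xi>\<^sub>1 - a x \<xi>\<^sub>2) \<bullet> (\<xi>\<^sub>1 - \<xi>\<^sub>2)"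
    and H2: "AE x in lebesgue_on \<Omega>. \<forall>\<xi>. \<alpha> * norm \<xi> powr p \<le> a x \<xi> \<bullet> \<xi>"
    and H3: "AE x in lebesgue_on \<Omega>. \<forall>\<xi>. norm (a x \<xi>) \<le> \<beta> * norm \<xi> powr (p - 1)"
    and H4: "AE x in lebesgue_on \<Omega>. \<forall>\<xi>. \<forall>t>0. a x (t *\<^sub>R \<xi>) = t powr (p - 1) *\<^sub>R a x \<xi>"
    and H5: "AE x in lebesgue_on \<Omega>. \<forall>\<xi>. a x (- \<xi>) = - a x \<xi>"
    and H6: "AE x in lebesgue_on \<Omega>. \<forall>\<xi>\<^sub>1 \<xi>\<^sub>2. let \<delta>\<^sub>p = min (p / 2) (p - 1) in
      norm (a x \<xi>\<^sub>1 - a x \<xi>\<^sub>2) \<le> c * Psi a x \<xi>\<^sub>1 \<xi>\<^sub>2 powr ((p - 1 - \<delta>\<^sub>p) / p)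
        * ((a x \<xi>\<^sub>1 - a x \<xi>\<^sub>2) \<bullet> (\<xi>\<^sub>1 - \<xi>\<^sub>2)) powr (\<delta>\<^sub>p / p)"
    and H7: "AE x in lebesgue_on \<Omega>. \<forall>k\<ge>1. \<forall>\<xi> :: nat \<Rightarrow> 'a. \<xi> (k + 1) = \<xi> 1 \<longrightarrow>
      (\<Sum>i=1..k. a x (\<xi> i) \<bullet> (\<xi> (i + 1) - \<xi> i)) \<le> 0"
    and H8: "AE x in lebesgue_on \<Omega>. \<forall>\<xi>\<^sub>1 \<xi>\<^sub>2. (\<xi>\<^sub>1, \<xi>\<^sub>2) \<noteq> (0, 0) \<longrightarrow> (let \<gamma> = max 2 p in
      \<alpha> * norm (\<xi>\<^sub>1 - \<xi>\<^sub>2) powr \<gamma> * Psi a x \<xi>\<^sub>1 \<xi>\<^sub>2 powr (1 - \<gamma> / p)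
        \<le> (a x \<xi>\<^sub>1 - a x \<xi>\<^sub>2) \<bullet> (\<xi>\<^sub>1 - \<xi>\<^sub>2))"
  shows "let lambda1 = first_eigenvalue \<Omega> p (potential \<Omega> p \<alpha> \<beta> a) \<rho> in
    \<exists>\<delta>>0. {lambda1<..<lambda1 + \<delta>} \<inter> Spectrum \<Omega> p a \<rho> = {}"
proof -
  have adm: "AE x in lebesgue_on \<Omega>. admissible p \<alpha> \<beta> (a x)"
    using H0(1) H2 H3 H4 H5 H7 H8
  proof eventually_elim
    case (elim x)
    \<comment> \<open>for \<open>\<xi> \<noteq> \<eta>\<close> one of the two vectors is nonzero, so \<open>Psi\<close> is positive by coercivity and its power in the
      lower bound, whatever the sign of the exponent, does not vanish\<close>
    have strict: "0 < (a x \<xi> - a x \<eta>) \<bullet> (\<xi> - \<eta>)" if ne: "\<xi> \<noteq> \<eta>" for \<xi> \<eta>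
    proof -
      have nn: "0 \<le> a x \<zeta> \<bullet> \<zeta>" "\<zeta> \<noteq> 0 \<Longrightarrow> 0 < a x \<zeta> \<bullet> \<zeta>" for \<zeta> :: 'a
      proof -
        have le: "\<alpha> * norm \<zeta> powr p \<le> a x \<zeta> \<bullet> \<zeta>" using elim(2) by blast
        show "0 \<le> a x \<zeta> \<bullet> \<zeta>" by (rule order_trans[OF _ le]) (use pos(1) in simp)
        show "0 < a x \<zeta> \<bullet> \<zeta>" if "\<zeta> \<noteq> 0" by (rule less_le_trans[OF _ le]) (use pos(1) that in simp)
      qed
      have "0 < Psi a x \<xi> \<eta>"
      proof (cases "\<xi> = 0")
        case True
        then show ?thesis unfolding Psi_def using nn(1)[of \<xi>] nn(2)[of \<eta>] ne by (intro add_nonneg_pos) auto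
      next
        case False
        then show ?thesis unfolding Psi_def using nn(2)[of \<xi>] nn(1)[of \<eta>] by (intro add_pos_nonneg) auto
      qed
      then have "0 < \<alpha> * norm (\<xi> - \<eta>) powr (max 2 p) * Psi a x \<xi> \<eta> powr (1 - max 2 p / p)"
        using ne pos(1) by simp
      also have "\<dots> \<le> (a x \<xi> - a x \<eta>) \<bullet> (\<xi> - \<eta>)"
        by (rule elim(7)[unfolded Let_def, rule_format]) (use ne in auto)
      finally show ?thesis .
    qed
    show ?case unfolding admissible_def using elim(1-6) strict by blast
  qed
  interpret eigenproblem \<Omega> p \<alpha> \<beta> \<rho>m \<rho>p \<rho> a
    by unfold_locales (use p \<Omega> \<rho> pos H0(2) adm in auto)
  show ?thesis
    using first_eigenvalue_isolated[OF \<Omega>(2)] unfolding lambda1_def Let_def .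
qed

end
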